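(* Consider the problem $\min_{x\in\mathbb{R}^d} P(x)=\frac1N\sum_{\tau=1}^n\sum_{i=1}^m\phi_{i\tau}(A_{i\tau}^\top x)+g(x)$, $N=mn$, $A_{i\tau}\in\mathbb{R}^{d\times t}$, where each $\phi_{i\tau}:\mathbb{R}^t\to\mathbb{R}$ is convex and $\frac1\gamma$-smooth and $g:\mathbb{R}^d\to\mathbb{R}$ is $\lambda$-strongly convex ($\gamma,\lambda>0$). Let $Q$ and $Q_1$ be contraction compressors with parameters $\delta,\delta_1\in(0,1]$ respectively. Run the algorithm ECSPDC (described in the context) with $$\sigma=\tfrac{1}{2\mathcal{R}_1}\sqrt{\tfrac{m\lambda}{\gamma}},\qquad \eta=\tfrac{1}{2\mathcal{R}_1}\sqrt{\tfrac{\gamma}{m\lambda}},\qquad \theta=1-\min\left\{\tfrac{1}{m+4\mathcal{R}_1\sqrt{m/(\lambda\gamma)}},\tfrac{\delta}{6},\tfrac{\delta_1}{6}\right\},$$ where $\mathcal{R}_1>0$ is chosen in each of the two cases (i) and (ii) of this statement. Let $\Phi_2^k,\Psi_2^k$ be the Lyapunov functions defined in the context. (i) Let $\mathcal{R}_1=\mathcal{R}_2$, where $$\mathcal{R}_2^2=2R^2+\tfrac{2R_m^2}{n}+\tfrac{3(1-\delta)}{4}\left(\tfrac{14\bar R^2}{\delta^2}+\tfrac{7R_m^2}{2\delta}+\tfrac{84(1-\delta_1)\bar R^2}{\delta^2\delta_1^2m^2}+\tfrac{42R_m^2}{\delta^2\delta_1m^2}\right),$$ and assume $\mathcal{R}_2^2/(\lambda\gamma)\ge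 1$. Then for every $\epsilon\in(0,1)$, $$\mathbb{E}[\Phi_2^k]\le\epsilon\left(\Phi_2^0+\tfrac{1}{4\sigma n}\sum_{\tau=1}^n\sum_{i=1}^m\|y_{i\tau}^0-y_{i\tau}^*\|^2\right)$$ as long as $$k\ge\mathcal{O}\left(\left(\tfrac1\delta+\tfrac1{\delta_1}+m+\mathcal{R}_2\sqrt{\tfrac{m}{\lambda\gamma}}\right)\log\tfrac1\epsilon\right).$$ In particular, if $\frac1m\le\mathcal{O}(\delta_1)$, then it suffices that $$k\ge\mathcal{O}\left(\left(\left(R+\tfrac{R_m}{\sqrt n}+\tfrac{\sqrt{1-\delta}\,\bar R}{\delta}+\tfrac{\sqrt{1-\delta}\,R_m}{\sqrt\delta}\right)\sqrt{\tfrac{m}{\lambda\gamma}}+\tfrac1\delta+m\right)\log\tfrac1\epsilon\right).$$ (ii) Let $\mathcal{R}_1=\mathcal{R}_3$, where $$\mathcal{R}_3^2=2R^2+\tfrac{2R_m^2}{n}+\tfrac{21(1-\delta)}{4}\left(\tfrac{2R^2}{\delta^2}+\tfrac{11R_m^2}{2\delta n}+\tfrac{12(1-\delta)\bar R^2}{\delta^2n}+\tfrac{12R^2}{5\delta^2\delta_1^2m^2}+\tfrac{228R_m^2}{5\delta^2\delta_1m^2n}+\tfrac{432(1-\delta_1)\bar R^2}{5\delta^2\delta_1^2m^2n}\right).$$ Assume in addition that $\mathbb{E}[Q(x)]=\delta x$ and $\mathbb{E}[Q_1(x)]=\delta_1x$ for all $x\in\mathbb{R}^d$, and that $\mathcal{R}_3^2/(\lambda\gamma)\ge1$.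 Then for every $\epsilon\in(0,1)$, $$\mathbb{E}[\Psi_2^k]\le\epsilon\left(\Psi_2^0+\tfrac{1}{4\sigma n}\sum_{\tau=1}^n\sum_{i=1}^m\|y_{i\tau}^0-y_{i\tau}^*\|^2\right)$$ as long as $k\ge\mathcal{O}\left(\left(\frac1\delta+\frac1{\delta_1}+m+\mathcal{R}_3\sqrt{\frac{m}{\lambda\gamma}}\right)\log\frac1\epsilon\right)$. If $\frac1m\le\mathcal{O}(\delta_1)$, then it suffices that $$k\ge\mathcal{O}\left(\left(\left(R+\tfrac{R_m}{\sqrt n}+\tfrac{\sqrt{1-\delta}\,R}{\delta}+\tfrac{\sqrt{1-\delta}\,R_m}{\sqrt{\delta n}}\right)\sqrt{\tfrac{m}{\lambda\gamma}}+\tfrac1\delta+m\right)\log\tfrac1\epsilon\right).$$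
   Context: Here $\mathcal{O}(\cdot)$ hides universal constants (and, under the hypothesis $\frac1m\le\mathcal{O}(\delta_1)$, i.e. $\frac1m\le c\,\delta_1$, a constant depending only on $c$). A contraction compressor with parameter $\delta\in(0,1]$ is a randomized map $Q:\mathbb{R}^d\to\mathbb{R}^d$ with $\mathbb{E}\|x-Q(x)\|^2\le(1-\delta)\|x\|^2$ for all $x$. The randomness of all compressor calls is independent across nodes, iterations and calls, and independent of the index sampling. Constants: $R_m=\max_{i,\tau}\|A_{i\tau}\|$; $\bar R^2=\max_{\tau\in[n]}\frac1m\lambda_{\max}(\sum_{i=1}^mA_{i\tau}A_{i\tau}^\top)$; $R^2=\frac1N\lambda_{\max}(\sum_{\tau=1}^n\sum_{i=1}^mA_{i\tau}A_{i\tau}^\top)$. Saddle function: with $Y=(y_{i\tau})_{i\in[m],\tau\in[n]}\in\mathbb{R}^{tN}$, $y_{i\tau}\in\mathbb{R}^t$, and $\phi_{i\tau}^*$ the convex conjugate of $\phi_{i\tau}$, $$f(x,Y)=g(x)+\frac1N\sum_{\tau=1}^n\sum_{i=1}^m\left(\langle y_{i\tau},A_{i\tau}^\top x\rangle-\phi_{i\tau}^*(y_{i\tau})\right),$$ and $(x^*,Y^* )$, $Y^*=(y^*_{i\tau})$, is the solution of $\min_x\max_Yf(x,Y)$. Algorithm ECSPDC (stepsize parameters $\sigma,\eta>0$, $\theta\in(0,1)$). Initialization: $x^0=z^0\in\mathbb{R}^d$; $e^0_\tau=0\in\mathbb{R}^d$; $y^0_{i\tau}\in\mathbb{R}^t$;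 $u^0_\tau=\frac1m\sum_{i=1}^mA_{i\tau}y^0_{i\tau}$; $h^0_\tau\in\mathbb{R}^d$; $h^0=\frac1n\sum_\tau h^0_\tau$. For $k=0,1,2,\dots$: on each node $\tau\in[n]$ sample $i_k^\tau$ uniformly from $[m]$, independently across nodes and iterations; set $y^{k+1}_{i\tau}=\arg\max_{y\in\mathbb{R}^t}\{\langle y,A_{i\tau}^\top z^k\rangle-\phi^*_{i\tau}(y)-\frac1{2\sigma}\|y-y^k_{i\tau}\|^2\}$ if $i=i_k^\tau$, and $y^{k+1}_{i\tau}=y^k_{i\tau}$ otherwise; $\Delta^k_\tau=Q\big(A_{i_k^\tau\tau}(y^{k+1}_{i_k^\tau\tau}-y^k_{i_k^\tau\tau})+u^k_\tau-h^k_\tau+e^k_\tau\big)$; $u^{k+1}_\tau=u^k_\tau+\frac1mA_{i_k^\tau\tau}(y^{k+1}_{i_k^\tau\tau}-y^k_{i_k^\tau\tau})$; $h^{k+1}_\tau=h^k_\tau+Q_1(u^k_\tau-h^k_\tau)$; $e^{k+1}_\tau=e^k_\tau+A_{i_k^\tau\tau}(y^{k+1}_{i_k^\tau\tau}-y^k_{i_k^\tau\tau})+u^k_\tau-h^k_\tau-\Delta^k_\tau$. Then $\Delta^k=\frac1n\sum_\tau\Delta^k_\tau$; $x^{k+1}=\arg\min_{x}\{g(x)+\langle h^k+\Delta^k,x\rangle+\frac1{2\eta}\|x-x^k\|^2\}$; $h^{k+1}=h^k+\frac1n\sum_\tau Q_1(u^k_\tau-h^k_\tau)$ (where, for each $\tau$,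 $Q_1(u^k_\tau-h^k_\tau)$ is the same realization that is used in the update $h^{k+1}_\tau=h^k_\tau+Q_1(u^k_\tau-h^k_\tau)$ on node $\tau$, so $h^{k+1}=\frac1n\sum_\tau h_\tau^{k+1}$); $z^{k+1}=x^{k+1}+\theta(x^{k+1}-x^k)$. Put $e^k=\frac1n\sum_\tau e^k_\tau$, $u^k=\frac1n\sum_\tau u^k_\tau$, $\tilde x^k=x^k-\eta e^k$, $Y^k=(y^k_{i\tau})$. Lyapunov functions: $$\Phi_2^k=\left(\tfrac1{2\eta}+\tfrac\lambda4\right)\|\tilde x^k-x^*\|^2+\left(\tfrac1{4\sigma}+\tfrac\gamma2\right)\tfrac1n\sum_{\tau,i}\|y^k_{i\tau}-y^*_{i\tau}\|^2+\tfrac{3(\eta+\lambda\eta^2)}{\delta n}\sum_\tau\|e^k_\tau\|^2+f(x^k,Y^* )-f(x^*,Y^* )+m\left(f(x^*,Y^* )-f(x^*,Y^k)\right)+\tfrac{42(1-\delta)(\eta+\lambda\eta^2)}{\delta^2\delta_1n}\sum_\tau\|h^k_\tau-u^k_\tau\|^2,$$ $$\Psi_2^k=\left(\tfrac1{2\eta}+\tfrac\lambda4\right)\|\tilde x^k-x^*\|^2+\left(\tfrac1{4\sigma}+\tfrac\gamma2\right)\tfrac1n\sum_{\tau,i}\|y^k_{i\tau}-y^*_{i\tau}\|^2+f(x^k,Y^* )-f(x^*,Y^* )+m\left(f(x^*,Y^* )-f(x^*,Y^k)\right)+\tfrac{3(\eta+\lambda\eta^2)}{\delta}\|e^k\|^2+\tfrac{21(1-\delta)(\eta+\lambda\eta^2)}{\delta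 n^2}\sum_\tau\|e^k_\tau\|^2+\tfrac{84(1-\delta)(\eta+\lambda\eta^2)}{5\delta^2\delta_1}\|h^k-u^k\|^2+\tfrac{1512(1-\delta)(\eta+\lambda\eta^2)}{5\delta^2\delta_1n^2}\sum_\tau\|h^k_\tau-u^k_\tau\|^2.$$ *)

theory Defs
  imports "HOL-Probability.Probability"
begin

text \<open>
  Indices are zero-based: data points \<open>i < m\<close> on each of the nodes \<open>\<tau> < n\<close>.  The conjugate of a
  real-valued function may be \<open>\<infinity>\<close>, so the conjugate, the saddle function and the Lyapunov functions
  are \<^typ>\<open>ereal\<close>-valued; since a conjugate is never \<open>-\<infinity>\<close>, no sum below mixes the two infinities.
\<close>

definition strongly_convex :: "real \<Rightarrow> ('a::real_normed_vector \<Rightarrow> real) \<Rightarrow> bool" where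
  "strongly_convex lam g \<longleftrightarrow>
     (\<forall>x y. \<forall>a\<in>{0..1}. g (a *\<^sub>R x + (1 - a) *\<^sub>R y)
        \<le> a * g x + (1 - a) * g y - lam / 2 * a * (1 - a) * (norm (x - y))\<^sup>2)"

definition L_smooth :: "real \<Rightarrow> ('a::real_inner \<Rightarrow> real) \<Rightarrow> bool" where
  "L_smooth L f \<longleftrightarrow> (\<exists>G. (\<forall>x. GDERIV f x :> G x) \<and> L-lipschitz_on UNIV G)"

definition conjugate :: "('a::real_inner \<Rightarrow> real) \<Rightarrow> 'a \<Rightarrow> ereal" where
  "conjugate f y = (SUP u. ereal (y \<bullet> u - f u))"

definition lambda_max :: "real^'d^'d \<Rightarrow> real" where
  "lambda_max B = Max {l. \<exists>v. v \<noteq> 0 \<and> B *v v = l *\<^sub>R v}"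

text \<open>
  Matrix norms are spectral, hence \<^const>\<open>onorm\<close>: the library's \<^const>\<open>norm\<close> on
  \<^typ>\<open>real^'t^'d\<close> is the Frobenius norm.
\<close>

definition Rm_const :: "nat \<Rightarrow> nat \<Rightarrow> (nat \<Rightarrow> nat \<Rightarrow> real^'t^'d) \<Rightarrow> real" where
  "Rm_const m n A = Max ((\<lambda>(i, \<tau>). onorm (\<lambda>v. A i \<tau> *v v)) ` ({..<m} \<times> {..<n}))"

definition Rbar_const :: "nat \<Rightarrow> nat \<Rightarrow> (nat \<Rightarrow> nat \<Rightarrow> real^'t^'d) \<Rightarrow> real" where
  "Rbar_const m n A =
     sqrt (Max ((\<lambda>\<tau>. 1 / real m * lambda_max (\<Sum>i<m. A i \<tau> ** transpose (A i \<tau>))) ` {..<n}))"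

definition R_const :: "nat \<Rightarrow> nat \<Rightarrow> (nat \<Rightarrow> nat \<Rightarrow> real^'t^'d) \<Rightarrow> real" where
  "R_const m n A =
     sqrt (1 / real (m * n) * lambda_max (\<Sum>\<tau><n. \<Sum>i<m. A i \<tau> ** transpose (A i \<tau>)))"

definition R2_const :: "nat \<Rightarrow> nat \<Rightarrow> (nat \<Rightarrow> nat \<Rightarrow> real^'t^'d) \<Rightarrow> real \<Rightarrow> real \<Rightarrow> real" where
  "R2_const m n A \<delta> \<delta>1 =
     (let R = R_const m n A; Rb = Rbar_const m n A; Rm = Rm_const m n A in
      sqrt (2 * R\<^sup>2 + 2 * Rm\<^sup>2 / n
        + 3 * (1 - \<delta>) / 4 *
          (14 * Rb\<^sup>2 / \<delta>\<^sup>2 + 7 * Rm\<^sup>2 / (2 * \<delta>)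
           + 84 * (1 - \<delta>1) * Rb\<^sup>2 / (\<delta>\<^sup>2 * \<delta>1\<^sup>2 * (real m)\<^sup>2)
           + 42 * Rm\<^sup>2 / (\<delta>\<^sup>2 * \<delta>1 * (real m)\<^sup>2))))"

definition R3_const :: "nat \<Rightarrow> nat \<Rightarrow> (nat \<Rightarrow> nat \<Rightarrow> real^'t^'d) \<Rightarrow> real \<Rightarrow> real \<Rightarrow> real" where
  "R3_const m n A \<delta> \<delta>1 =
     (let R = R_const m n A; Rb = Rbar_const m n A; Rm = Rm_const m n A in
      sqrt (2 * R\<^sup>2 + 2 * Rm\<^sup>2 / n
        + 21 * (1 - \<delta>) / 4 *
          (2 * R\<^sup>2 / \<delta>\<^sup>2 + 11 * Rm\<^sup>2 / (2 * \<delta> * n) + 12 * (1 - \<delta>) * Rb\<^sup>2 / (\<delta>\<^sup>2 * n)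
           + 12 * R\<^sup>2 / (5 * \<delta>\<^sup>2 * \<delta>1\<^sup>2 * (real m)\<^sup>2)
           + 228 * Rm\<^sup>2 / (5 * \<delta>\<^sup>2 * \<delta>1 * (real m)\<^sup>2 * n)
           + 432 * (1 - \<delta>1) * Rb\<^sup>2 / (5 * \<delta>\<^sup>2 * \<delta>1\<^sup>2 * (real m)\<^sup>2 * n))))"

text \<open>
  The constants hidden by the order notation are given numerically.  An existential quantifier in a
  theorem would be instantiated after the index types of \<^typ>\<open>real^'d\<close> and \<^typ>\<open>real^'t\<close> and so
  could not express independence of the dimensions.  The values are deliberately not sharp;
  \<open>bigO_const_given c\<close> is used under the hypothesis \<open>1 / m \<le> c * \<delta>1\<close>.
\<close>

definition bigO_const :: real where
  "bigO_const = 100"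

definition bigO_const_given :: "real \<Rightarrow> real" where
  "bigO_const_given c = 1000 * (1 + c)"

definition saddle_fun ::
  "nat \<Rightarrow> nat \<Rightarrow> (nat \<Rightarrow> nat \<Rightarrow> real^'t^'d) \<Rightarrow> (nat \<Rightarrow> nat \<Rightarrow> real^'t \<Rightarrow> real) \<Rightarrow> (real^'d \<Rightarrow> real)
   \<Rightarrow> real^'d \<Rightarrow> (nat \<Rightarrow> nat \<Rightarrow> real^'t) \<Rightarrow> ereal" where
  "saddle_fun m n A \<phi> g x Y =
     ereal (g x) + ereal (1 / real (m * n)) *
       (\<Sum>\<tau><n. \<Sum>i<m. ereal (Y i \<tau> \<bullet> (transpose (A i \<tau>) *v x)) - conjugate (\<phi> i \<tau>) (Y i \<tau>))"

definition minmax_solution :: "('x \<Rightarrow> 'y \<Rightarrow> ereal) \<Rightarrow> 'x \<Rightarrow> 'y \<Rightarrow> bool" where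
  "minmax_solution F xs Ys \<longleftrightarrow>
     is_arg_min (\<lambda>x. SUP Y. F x Y) (\<lambda>_. True) xs \<and> is_arg_max (F xs) (\<lambda>_. True) Ys"

text \<open>
  A randomized map is a jointly measurable \<open>Q s x\<close> whose seed \<open>s\<close> has law \<open>S\<close>; every call draws
  a fresh seed.
\<close>

definition contraction_compressor ::
  "'s measure \<Rightarrow> ('s \<Rightarrow> real^'d \<Rightarrow> real^'d) \<Rightarrow> real \<Rightarrow> bool" where
  "contraction_compressor S Q \<delta> \<longleftrightarrow>
     prob_space S \<and> (\<lambda>(s, x). Q s x) \<in> borel_measurable (S \<Otimes>\<^sub>M borel) \<and>
     (\<forall>x. integrable S (\<lambda>s. (norm (x - Q s x))\<^sup>2) \<and>
          (\<integral>s. (norm (x - Q s x))\<^sup>2 \<partial>S) \<le> (1 - \<delta>) * (norm x)\<^sup>2)"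

text \<open>
  \<open>I k \<tau>\<close> is the index sampled by node \<open>\<tau>\<close> in iteration \<open>k\<close>; \<open>\<xi> k \<tau>\<close> and \<open>\<xi>1 k \<tau>\<close> are the seeds
  of its two compressor calls.  Independence of the triples together with their product law makes
  all of these variables mutually independent.
\<close>

definition ecspdc_randomness ::
  "'w measure \<Rightarrow> nat \<Rightarrow> nat \<Rightarrow> 's measure \<Rightarrow> 's1 measure
   \<Rightarrow> (nat \<Rightarrow> nat \<Rightarrow> 'w \<Rightarrow> nat) \<Rightarrow> (nat \<Rightarrow> nat \<Rightarrow> 'w \<Rightarrow> 's) \<Rightarrow> (nat \<Rightarrow> nat \<Rightarrow> 'w \<Rightarrow> 's1) \<Rightarrow> bool" where
  "ecspdc_randomness M m n S S1 I \<xi> \<xi>1 \<longleftrightarrow>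
     (let law = uniform_count_measure {..<m} \<Otimes>\<^sub>M (S \<Otimes>\<^sub>M S1) in
      prob_space M \<and>
      prob_space.indep_vars M (\<lambda>_. law) (\<lambda>(k, \<tau>) \<omega>. (I k \<tau> \<omega>, \<xi> k \<tau> \<omega>, \<xi>1 k \<tau> \<omega>)) (UNIV \<times> {..<n}) \<and>
      (\<forall>k. \<forall>\<tau><n. distr M law (\<lambda>\<omega>. (I k \<tau> \<omega>, \<xi> k \<tau> \<omega>, \<xi>1 k \<tau> \<omega>)) = law))"

text \<open>
  Unlike the Bochner integral, which is \<open>0\<close> where it does not exist, this gives \<open>\<infinity>\<close> for a
  nonnegative variable that is not integrable.
\<close>

definition ereal_expectation :: "'w measure \<Rightarrow> ('w \<Rightarrow> ereal) \<Rightarrow> ereal" where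
  "ereal_expectation M X =
     enn2ereal (\<integral>\<^sup>+\<omega>. e2ennreal (X \<omega>) \<partial>M) - enn2ereal (\<integral>\<^sup>+\<omega>. e2ennreal (- X \<omega>) \<partial>M)"

text \<open>\<open>st_h\<close> holds the node vectors \<open>h\<^sub>\<tau>\<close>, \<open>st_hs\<close> the server vector \<open>h\<close> without node index.\<close>

record ('x, 'y) ecspdc_state =
  st_x :: 'x
  st_z :: 'x
  st_y :: "nat \<Rightarrow> nat \<Rightarrow> 'y"
  st_e :: "nat \<Rightarrow> 'x"
  st_u :: "nat \<Rightarrow> 'x"
  st_h :: "nat \<Rightarrow> 'x"
  st_hs :: 'x

definition node_mean :: "nat \<Rightarrow> (nat \<Rightarrow> 'x::real_vector) \<Rightarrow> 'x" where
  "node_mean n v = (1 / real n) *\<^sub>R (\<Sum>\<tau><n. v \<tau>)"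

definition ecspdc_init ::
  "nat \<Rightarrow> nat \<Rightarrow> (nat \<Rightarrow> nat \<Rightarrow> real^'t^'d) \<Rightarrow> real^'d \<Rightarrow> (nat \<Rightarrow> nat \<Rightarrow> real^'t) \<Rightarrow> (nat \<Rightarrow> real^'d)
   \<Rightarrow> (real^'d, real^'t) ecspdc_state" where
  "ecspdc_init m n A x0 y0 h0 =
     \<lparr>st_x = x0, st_z = x0, st_y = y0, st_e = (\<lambda>_. 0),
      st_u = (\<lambda>\<tau>. (1 / real m) *\<^sub>R (\<Sum>i<m. A i \<tau> *v y0 i \<tau>)),
      st_h = h0, st_hs = node_mean n h0\<rparr>"

text \<open>
  \<open>i \<tau>\<close> is the sampled index and \<open>q \<tau>\<close>, \<open>q1 \<tau>\<close> are the realizations of the two compressors on node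
  \<open>\<tau>\<close>; the vector \<open>c\<close> makes the node and server updates of \<open>h\<close> share one realization of \<open>q1\<close>.
\<close>

definition ecspdc_step ::
  "nat \<Rightarrow> nat \<Rightarrow> (nat \<Rightarrow> nat \<Rightarrow> real^'t^'d) \<Rightarrow> (nat \<Rightarrow> nat \<Rightarrow> real^'t \<Rightarrow> real) \<Rightarrow> (real^'d \<Rightarrow> real)
   \<Rightarrow> real \<Rightarrow> real \<Rightarrow> real
   \<Rightarrow> (nat \<Rightarrow> nat) \<Rightarrow> (nat \<Rightarrow> real^'d \<Rightarrow> real^'d) \<Rightarrow> (nat \<Rightarrow> real^'d \<Rightarrow> real^'d)
   \<Rightarrow> (real^'d, real^'t) ecspdc_state \<Rightarrow> (real^'d, real^'t) ecspdc_state" where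
  "ecspdc_step m n A \<phi> g \<sigma> \<eta> \<theta> i q q1 s =
     (let x = st_x s; z = st_z s; y = st_y s; e = st_e s; u = st_u s; h = st_h s; hs = st_hs s;
          y' = (\<lambda>j \<tau>. if j = i \<tau>
                  then arg_max (\<lambda>v. ereal (v \<bullet> (transpose (A j \<tau>) *v z)) - conjugate (\<phi> j \<tau>) v
                                      - ereal (1 / (2 * \<sigma>) * (norm (v - y j \<tau>))\<^sup>2)) (\<lambda>_. True)
                  else y j \<tau>);
          a = (\<lambda>\<tau>. A (i \<tau>) \<tau> *v (y' (i \<tau>) \<tau> - y (i \<tau>) \<tau>));
          D = (\<lambda>\<tau>. q \<tau> (a \<tau> + u \<tau> - h \<tau> + e \<tau>));
          c = (\<lambda>\<tau>. q1 \<tau> (u \<tau> - h \<tau>));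
          x' = arg_min (\<lambda>v. g v + (hs + node_mean n D) \<bullet> v + 1 / (2 * \<eta>) * (norm (v - x))\<^sup>2)
                 (\<lambda>_. True)
      in \<lparr>st_x = x', st_z = x' + \<theta> *\<^sub>R (x' - x), st_y = y',
          st_e = (\<lambda>\<tau>. e \<tau> + a \<tau> + u \<tau> - h \<tau> - D \<tau>),
          st_u = (\<lambda>\<tau>. u \<tau> + (1 / real m) *\<^sub>R a \<tau>),
          st_h = (\<lambda>\<tau>. h \<tau> + c \<tau>), st_hs = hs + node_mean n c\<rparr>)"

primrec ecspdc ::
  "nat \<Rightarrow> nat \<Rightarrow> (nat \<Rightarrow> nat \<Rightarrow> real^'t^'d) \<Rightarrow> (nat \<Rightarrow> nat \<Rightarrow> real^'t \<Rightarrow> real) \<Rightarrow> (real^'d \<Rightarrow> real)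
   \<Rightarrow> real \<Rightarrow> real \<Rightarrow> real
   \<Rightarrow> ('s \<Rightarrow> real^'d \<Rightarrow> real^'d) \<Rightarrow> ('s1 \<Rightarrow> real^'d \<Rightarrow> real^'d)
   \<Rightarrow> (nat \<Rightarrow> nat \<Rightarrow> 'w \<Rightarrow> nat) \<Rightarrow> (nat \<Rightarrow> nat \<Rightarrow> 'w \<Rightarrow> 's) \<Rightarrow> (nat \<Rightarrow> nat \<Rightarrow> 'w \<Rightarrow> 's1)
   \<Rightarrow> (real^'d, real^'t) ecspdc_state \<Rightarrow> nat \<Rightarrow> 'w \<Rightarrow> (real^'d, real^'t) ecspdc_state" where
  "ecspdc m n A \<phi> g \<sigma> \<eta> \<theta> Q Q1 I \<xi> \<xi>1 s0 0 \<omega> = s0"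
| "ecspdc m n A \<phi> g \<sigma> \<eta> \<theta> Q Q1 I \<xi> \<xi>1 s0 (Suc k) \<omega> =
     ecspdc_step m n A \<phi> g \<sigma> \<eta> \<theta>
       (\<lambda>\<tau>. I k \<tau> \<omega>) (\<lambda>\<tau>. Q (\<xi> k \<tau> \<omega>)) (\<lambda>\<tau>. Q1 (\<xi>1 k \<tau> \<omega>))
       (ecspdc m n A \<phi> g \<sigma> \<eta> \<theta> Q Q1 I \<xi> \<xi>1 s0 k \<omega>)"

definition dual_dist_sq ::
  "nat \<Rightarrow> nat \<Rightarrow> (nat \<Rightarrow> nat \<Rightarrow> 'y::real_normed_vector) \<Rightarrow> (nat \<Rightarrow> nat \<Rightarrow> 'y) \<Rightarrow> real" where
  "dual_dist_sq m n Y Ys = (\<Sum>\<tau><n. \<Sum>i<m. (norm (Y i \<tau> - Ys i \<tau>))\<^sup>2)"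

definition Phi2 ::
  "nat \<Rightarrow> nat \<Rightarrow> (nat \<Rightarrow> nat \<Rightarrow> real^'t^'d) \<Rightarrow> (nat \<Rightarrow> nat \<Rightarrow> real^'t \<Rightarrow> real) \<Rightarrow> (real^'d \<Rightarrow> real)
   \<Rightarrow> real \<Rightarrow> real \<Rightarrow> real \<Rightarrow> real \<Rightarrow> real \<Rightarrow> real \<Rightarrow> real^'d \<Rightarrow> (nat \<Rightarrow> nat \<Rightarrow> real^'t)
   \<Rightarrow> (real^'d, real^'t) ecspdc_state \<Rightarrow> ereal" where
  "Phi2 m n A \<phi> g lam \<gamma> \<delta> \<delta>1 \<sigma> \<eta> xs Ys s =
     (let f = saddle_fun m n A \<phi> g; e = node_mean n (st_e s); xt = st_x s - \<eta> *\<^sub>R e in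
      ereal ((1 / (2 * \<eta>) + lam / 4) * (norm (xt - xs))\<^sup>2
             + (1 / (4 * \<sigma>) + \<gamma> / 2) * (1 / n) * dual_dist_sq m n (st_y s) Ys
             + 3 * (\<eta> + lam * \<eta>\<^sup>2) / (\<delta> * n) * (\<Sum>\<tau><n. (norm (st_e s \<tau>))\<^sup>2))
      + (f (st_x s) Ys - f xs Ys) + ereal m * (f xs Ys - f xs (st_y s))
      + ereal (42 * (1 - \<delta>) * (\<eta> + lam * \<eta>\<^sup>2) / (\<delta>\<^sup>2 * \<delta>1 * n)
               * (\<Sum>\<tau><n. (norm (st_h s \<tau> - st_u s \<tau>))\<^sup>2)))"

definition Psi2 ::
  "nat \<Rightarrow> nat \<Rightarrow> (nat \<Rightarrow> nat \<Rightarrow> real^'t^'d) \<Rightarrow> (nat \<Rightarrow> nat \<Rightarrow> real^'t \<Rightarrow> real) \<Rightarrow> (real^'d \<Rightarrow> real)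
   \<Rightarrow> real \<Rightarrow> real \<Rightarrow> real \<Rightarrow> real \<Rightarrow> real \<Rightarrow> real \<Rightarrow> real^'d \<Rightarrow> (nat \<Rightarrow> nat \<Rightarrow> real^'t)
   \<Rightarrow> (real^'d, real^'t) ecspdc_state \<Rightarrow> ereal" where
  "Psi2 m n A \<phi> g lam \<gamma> \<delta> \<delta>1 \<sigma> \<eta> xs Ys s =
     (let f = saddle_fun m n A \<phi> g; e = node_mean n (st_e s); u = node_mean n (st_u s);
          xt = st_x s - \<eta> *\<^sub>R e in
      ereal ((1 / (2 * \<eta>) + lam / 4) * (norm (xt - xs))\<^sup>2
             + (1 / (4 * \<sigma>) + \<gamma> / 2) * (1 / n) * dual_dist_sq m n (st_y s) Ys)
      + (f (st_x s) Ys - f xs Ys) + ereal m * (f xs Ys - f xs (st_y s))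
      + ereal (3 * (\<eta> + lam * \<eta>\<^sup>2) / \<delta> * (norm e)\<^sup>2
               + 21 * (1 - \<delta>) * (\<eta> + lam * \<eta>\<^sup>2) / (\<delta> * (real n)\<^sup>2) * (\<Sum>\<tau><n. (norm (st_e s \<tau>))\<^sup>2)
               + 84 * (1 - \<delta>) * (\<eta> + lam * \<eta>\<^sup>2) / (5 * \<delta>\<^sup>2 * \<delta>1) * (norm (st_hs s - u))\<^sup>2
               + 1512 * (1 - \<delta>) * (\<eta> + lam * \<eta>\<^sup>2) / (5 * \<delta>\<^sup>2 * \<delta>1 * (real n)\<^sup>2)
                 * (\<Sum>\<tau><n. (norm (st_h s \<tau> - st_u s \<tau>))\<^sup>2)))"

end

theory Submission
  imports Defs
begin

text \<open>
  The error feedback makes the virtual iterate \<open>x - \<eta> e\<close> follow an uncompressed proximal step with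
  the gradient estimator \<open>u + (1/n) \<Sum> a\<^sub>\<tau>\<close>, so the primal progress is that of SPDC up to multiples of
  \<open>\<parallel>e\<parallel>\<^sup>2\<close>.  Adding the cross term \<open>\<langle>u - u\<^sup>*, x\<^sup>k - x\<^sup>k\<^sup>-\<^sup>1\<rangle> + \<parallel>x\<^sup>k - x\<^sup>k\<^sup>-\<^sup>1\<parallel>\<^sup>2 / (8 \<eta>)\<close> and
  \<open>\<parallel>Y - Y\<^sup>*\<parallel>\<^sup>2 / (4 \<sigma> n)\<close> to the Lyapunov function of the theorem gives a function that contracts by \<open>\<theta>\<close>
  in one step: the dual prox step yields the decrease \<open>\<parallel>y' - y\<parallel>\<^sup>2 / (2 \<sigma>)\<close>, and because
  \<open>1 / (2 \<sigma>) = 2 \<eta> R\<^sub>1\<^sup>2\<close> the choice of \<open>R\<^sub>1\<close> is exactly what pays for the growth of the two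
  error sequences \<open>e\<close> and \<open>u - h\<close>, whose own contraction factors are \<open>1 - \<delta>/2\<close> and \<open>1 - \<delta>\<^sub>1/2\<close>.
  The added terms are nonnegative together and reduce to the extra dual distance at time \<open>0\<close>.
\<close>

section \<open>Convex analysis and spectral bounds\<close>

text \<open>The new dual variable maximizes an extended-real function, so its existence, uniqueness
  and measurability are not evident. Moreau's decomposition settles all three: it is the gradient of
  \<open>\<phi>\<close> at a proximal point of \<open>\<phi>\<close>, a Lipschitz function of the
  data whose conjugate is finite. A start outside the domain of some conjugate makes the claimed
  bound infinite; otherwise every Lyapunov function stays real.

  The 6 in \<open>\<theta>\<close> is what remains of the contraction: the coupling between the
  sequences consumes \<open>\<delta> / 3\<close> of \<open>\<delta> / 2\<close>, and the weights of
  the Lyapunov functions are solved from this requirement; similarly for \<open>\<delta>1\<close>.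
  In the unbiased case the error averaged over the nodes has its own recursion, into which
  independent nodes feed their variances divided by \<open>n\<close>; these are bounded by the
  unaveraged errors, which is why both kinds occur in \<open>Psi2\<close>.

  One step is estimated pathwise by a majorant whose mean can be computed, and the induction over
  the iterations uses nonnegative integrals only, so that integrability comes out as a
  by-product.\<close>

lemma strongly_convexD:
  assumes "strongly_convex \<mu> g" "0 \<le> a" "a \<le> 1"
  shows "g (a *\<^sub>R x + (1 - a) *\<^sub>R y)
        \<le> a * g x + (1 - a) * g y - \<mu> / 2 * a * (1 - a) * (norm (x - y))\<^sup>2"
  using assms unfolding strongly_convex_def by auto

lemma strongly_convex_convex_on:
  assumes "strongly_convex \<mu> g" "0 \<le> \<mu>"
  shows "convex_on UNIV g"
proof (rule convex_onI)
  fix t x y assume t: "0 < t" "t < (1::real)"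
  have "g ((1 - t) *\<^sub>R x + (1 - (1 - t)) *\<^sub>R y)
        \<le> (1 - t) * g x + (1 - (1 - t)) * g y - \<mu> / 2 * (1 - t) * (1 - (1 - t)) * (norm (x - y))\<^sup>2"
    by (rule strongly_convexD[OF assms(1)]) (use t in auto)
  moreover have "0 \<le> \<mu> / 2 * (1 - t) * (1 - (1 - t)) * (norm (x - y))\<^sup>2"
    using assms(2) t by simp
  ultimately show "g ((1 - t) *\<^sub>R x + t *\<^sub>R y) \<le> (1 - t) * g x + t * g y"
    by simp
qed auto

lemma convex_on_strongly_convex_0:
  assumes "convex_on UNIV g"
  shows "strongly_convex 0 g"
  using assms by (auto simp: strongly_convex_def convex_on_def)

text \<open>Continuity bounds \<open>g\<close> below by some \<open>c\<close> on the unit ball;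
  writing a far point as a multiple of a unit vector, strong convexity between it and 0 then forces
  quadratic growth, so a minimum over a large enough ball is global.\<close>

lemma strongly_convex_attains_min:
  fixes g :: "'a::euclidean_space \<Rightarrow> real"
  assumes sc: "strongly_convex \<mu> g" and "0 < \<mu>"
  shows "\<exists>x. \<forall>v. g x \<le> g v"
proof -
  have cont: "continuous_on UNIV g"
    using strongly_convex_convex_on[OF sc] assms(2) by (intro convex_on_continuous) auto
  have "\<exists>c. \<forall>v\<in>cball 0 1. c \<le> g v"
    using continuous_attains_inf[OF compact_cball _ continuous_on_subset[OF cont subset_UNIV], of 0 1]
    by auto
  then obtain c where c: "\<And>v. norm v \<le> 1 \<Longrightarrow> c \<le> g v" unfolding mem_cball_0 Ball_def by blast
  \<comment> \<open>Chosen so that \<open>\<mu> / 2 * (s - 1)\<close> is at least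
    \<open>\<bar>g 0 - c\<bar>\<close> as soon as \<open>s > r\<close>.\<close>
  define r where "r = 1 + 2 * \<bar>g 0 - c\<bar> / \<mu>"
  have r1: "r \<ge> 1" using \<open>0 < \<mu>\<close> by (simp add: r_def)
  obtain x where x: "norm x \<le> r" and xmin: "\<And>v. norm v \<le> r \<Longrightarrow> g x \<le> g v"
    using continuous_attains_inf[OF compact_cball _ continuous_on_subset[OF cont subset_UNIV], of 0 r] r1
    by auto
  have "g x \<le> g v" for v
  proof (cases "norm v \<le> r")
    case True then show ?thesis by (rule xmin)
  next
    case False
    define s where "s = norm v"
    have s: "s > r" "s > 1" using False r1 by (auto simp: s_def)
    have "c \<le> g ((1 / s) *\<^sub>R v + (1 - 1 / s) *\<^sub>R 0)"
      using s by (intro c) (auto simp: s_def)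
    also have "\<dots> \<le> 1 / s * g v + (1 - 1 / s) * g 0 - \<mu> / 2 * (1 / s) * (1 - 1 / s) * (norm (v - 0))\<^sup>2"
      using s by (intro strongly_convexD[OF sc]) auto
    also have "\<dots> = 1 / s * g v + (1 - 1 / s) * g 0 - \<mu> / 2 * (s - 1)"
      using s by (simp add: s_def[symmetric] field_simps power2_eq_square)
    finally have "s * c \<le> s * (1 / s * g v + (1 - 1 / s) * g 0 - \<mu> / 2 * (s - 1))"
      using s by (intro mult_left_mono) auto
    also have "\<dots> = g v + (s - 1) * g 0 - \<mu> / 2 * (s - 1) * s"
      using s by (simp add: field_simps)
    finally have 1: "g v \<ge> g 0 + s * (c - g 0 + \<mu> / 2 * (s - 1))"
      by (simp add: algebra_simps)
    have "\<bar>g 0 - c\<bar> \<le> \<mu> / 2 * (s - 1)"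
      using s \<open>0 < \<mu>\<close> by (simp add: r_def field_simps)
    then have "0 \<le> s * (c - g 0 + \<mu> / 2 * (s - 1))"
      using s by (intro mult_nonneg_nonneg) linarith+
    moreover have "g x \<le> g 0" using r1 by (intro xmin) auto
    ultimately show ?thesis using 1 by linarith
  qed
  then show ?thesis by blast
qed

text \<open>Compare the minimum with the value at
  \<open>a *\<^sub>R v + (1 - a) *\<^sub>R x\<close>, divide by \<open>a\<close> and let
  \<open>a\<close> tend to 0; the limit is taken in the form \<open>z = 1 - a\<close> by
  \<open>field_le_mult_one_interval\<close>.\<close>

lemma strongly_convex_min_growth:
  assumes sc: "strongly_convex \<mu> g" and min: "\<And>v. g x \<le> g v"
  shows "g x + \<mu> / 2 * (norm (v - x))\<^sup>2 \<le> g v"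
proof -
  have "z * (\<mu> / 2 * (norm (v - x))\<^sup>2) \<le> g v - g x" if z: "0 < z" "z < 1" for z
  proof -
    define a where "a = 1 - z"
    have a: "0 < a" "a < 1" using z by (auto simp: a_def)
    have "g x \<le> g (a *\<^sub>R v + (1 - a) *\<^sub>R x)" by (rule min)
    also have "\<dots> \<le> a * g v + (1 - a) * g x - \<mu> / 2 * a * (1 - a) * (norm (v - x))\<^sup>2"
      using a by (intro strongly_convexD[OF sc]) auto
    finally have "a * (z * (\<mu> / 2 * (norm (v - x))\<^sup>2)) \<le> a * (g v - g x)"
      by (simp add: a_def algebra_simps)
    then show ?thesis using a by simp
  qed
  then have "\<mu> / 2 * (norm (v - x))\<^sup>2 \<le> g v - g x"
    by (rule field_le_mult_one_interval)
  then show ?thesis by simp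
qed

text \<open>The strong convexity inequality of the squared distance, with equality: this is why
  adding \<open>b * (norm (v - q))\<^sup>2\<close> raises the modulus by exactly
  \<open>2 * b\<close>.\<close>

lemma norm_sq_combination:
  fixes x y p :: "'a::real_inner"
  shows "(norm (a *\<^sub>R x + (1 - a) *\<^sub>R y - p))\<^sup>2
    = a * (norm (x - p))\<^sup>2 + (1 - a) * (norm (y - p))\<^sup>2 - a * (1 - a) * (norm (x - y))\<^sup>2"
  unfolding power2_norm_eq_inner
  by (simp add: inner_simps inner_commute algebra_simps power2_eq_square)

lemma strongly_convex_add_linear_quadratic:
  fixes g :: "'a::real_inner \<Rightarrow> real"
  assumes sc: "strongly_convex \<mu> g"
  shows "strongly_convex (\<mu> + 2 * b) (\<lambda>v. g v + c \<bullet> v + b * (norm (v - q))\<^sup>2)"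
  unfolding strongly_convex_def
proof (intro allI ballI)
  fix x y :: 'a and a :: real assume a: "a \<in> {0..1}"
  have "g (a *\<^sub>R x + (1 - a) *\<^sub>R y)
        \<le> a * g x + (1 - a) * g y - \<mu> / 2 * a * (1 - a) * (norm (x - y))\<^sup>2"
    using a by (intro strongly_convexD[OF sc]) auto
  then show "g (a *\<^sub>R x + (1 - a) *\<^sub>R y) + c \<bullet> (a *\<^sub>R x + (1 - a) *\<^sub>R y)
      + b * (norm (a *\<^sub>R x + (1 - a) *\<^sub>R y - q))\<^sup>2
    \<le> a * (g x + c \<bullet> x + b * (norm (x - q))\<^sup>2) + (1 - a) * (g y + c \<bullet> y + b * (norm (y - q))\<^sup>2)
      - (\<mu> + 2 * b) / 2 * a * (1 - a) * (norm (x - y))\<^sup>2"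
    unfolding norm_sq_combination inner_add_right inner_scaleR_right
    by (simp add: field_simps)
qed

text \<open>\<open>arg_min\<close> is a choice among minimizers, so its value is known only once the
  minimizer is shown to be unique; the same holds for \<open>arg_max\<close> below.\<close>

lemma arg_min_unique:
  fixes f :: "'a \<Rightarrow> 'b::linorder"
  assumes "\<And>v. f p \<le> f v" "\<And>v. f v \<le> f p \<Longrightarrow> v = p"
  shows "arg_min f (\<lambda>_. True) = p"
  unfolding arg_min_def is_arg_min_linorder
  using assms by (intro some_equality) auto

lemma arg_max_unique:
  fixes f :: "'a \<Rightarrow> 'b::linorder"
  assumes "\<And>v. f v \<le> f p" "\<And>v. f p \<le> f v \<Longrightarrow> v = p"
  shows "arg_max f (\<lambda>_. True) = p"
  unfolding arg_max_def is_arg_max_def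
  using assms by (intro some_equality) (auto simp: not_less)

text \<open>Moreau's proximal operator of \<open>\<eta> * g\<close>, kept separate from the
  \<open>arg_min\<close> of the algorithm because it serves twice: for \<open>g\<close> in the
  primal step and, with parameter \<open>1 / \<sigma>\<close>, for each \<open>\<phi>\<close> in the
  dual step.\<close>

definition proximal :: "real \<Rightarrow> ('a::real_inner \<Rightarrow> real) \<Rightarrow> 'a \<Rightarrow> 'a" where
  "proximal \<eta> g q = (SOME p. \<forall>v. g p + 1 / (2 * \<eta>) * (norm (p - q))\<^sup>2 \<le> g v + 1 / (2 * \<eta>) * (norm (v - q))\<^sup>2)"

lemma proximal_growth:
  fixes g :: "'a::euclidean_space \<Rightarrow> real"
  assumes sc: "strongly_convex \<mu> g" and "0 \<le> \<mu>" "0 < \<eta>"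
  shows "g (proximal \<eta> g q) + 1 / (2 * \<eta>) * (norm (proximal \<eta> g q - q))\<^sup>2
      + (\<mu> / 2 + 1 / (2 * \<eta>)) * (norm (v - proximal \<eta> g q))\<^sup>2
    \<le> g v + 1 / (2 * \<eta>) * (norm (v - q))\<^sup>2"
proof -
  define F where "F = (\<lambda>v. g v + 1 / (2 * \<eta>) * (norm (v - q))\<^sup>2)"
  have "strongly_convex (\<mu> + 2 * (1 / (2 * \<eta>))) (\<lambda>v. g v + 0 \<bullet> v + 1 / (2 * \<eta>) * (norm (v - q))\<^sup>2)"
    by (rule strongly_convex_add_linear_quadratic[OF sc])
  then have F: "strongly_convex (\<mu> + 1 / \<eta>) F" by (simp add: F_def)
  have "\<exists>p. \<forall>v. F p \<le> F v"
    by (rule strongly_convex_attains_min[OF F]) (use assms in \<open>simp add: add_nonneg_pos\<close>)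
  then have "\<forall>v. F (proximal \<eta> g q) \<le> F v"
    unfolding proximal_def F_def by (rule someI_ex)
  then have "F (proximal \<eta> g q) + (\<mu> + 1 / \<eta>) / 2 * (norm (v - proximal \<eta> g q))\<^sup>2 \<le> F v"
    by (intro strongly_convex_min_growth[OF F]) auto
  then show ?thesis by (simp add: F_def add_divide_distrib mult.commute)
qed

text \<open>Add the growth inequalities of the two proximal points, each tested at the other one,
  and apply Cauchy-Schwarz. Continuity of the proximal map is what later makes the iterates
  measurable.\<close>

lemma proximal_nonexpansive:
  fixes g :: "'a::euclidean_space \<Rightarrow> real"
  assumes sc: "convex_on UNIV g" and "0 < \<eta>"
  shows "norm (proximal \<eta> g q - proximal \<eta> g q') \<le> norm (q - q')"
proof -
  define p p' where "p = proximal \<eta> g q" and "p' = proximal \<eta> g q'"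
  note gr = proximal_growth[OF convex_on_strongly_convex_0[OF sc] order_refl \<open>0 < \<eta>\<close>]
  have "1 / (2 * \<eta>) * (2 * ((norm (p' - p))\<^sup>2))
    \<le> 1 / (2 * \<eta>) * ((norm (p' - q))\<^sup>2 - (norm (p - q))\<^sup>2 + (norm (p - q'))\<^sup>2 - (norm (p' - q'))\<^sup>2)"
    using gr[of q p'] gr[of q' p] unfolding p_def[symmetric] p'_def[symmetric] norm_minus_commute[of p p']
    by (simp add: algebra_simps)
  then have "2 * ((norm (p' - p))\<^sup>2)
    \<le> (norm (p' - q))\<^sup>2 - (norm (p - q))\<^sup>2 + (norm (p - q'))\<^sup>2 - (norm (p' - q'))\<^sup>2"
    using \<open>0 < \<eta>\<close> by (simp only: mult_le_cancel_left_pos zero_less_divide_1_iff zero_less_mult_iff zero_less_numeral simp_thms)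
  also have "\<dots> = 2 * ((p - p') \<bullet> (q - q'))"
    unfolding power2_norm_eq_inner by (simp add: inner_simps inner_commute algebra_simps)
  finally have "(norm (p - p'))\<^sup>2 \<le> norm (p - p') * norm (q - q')"
    using norm_cauchy_schwarz[of "p - p'" "q - q'"] by (simp add: norm_minus_commute)
  then show ?thesis
    unfolding p_def[symmetric] p'_def[symmetric]
    by (cases "norm (p - p') = 0") (auto simp: power2_eq_square)
qed

lemma borel_measurable_proximal:
  fixes g :: "'a::euclidean_space \<Rightarrow> real"
  assumes "convex_on UNIV g" "0 < \<eta>"
  shows "proximal \<eta> g \<in> borel_measurable borel"
proof (rule borel_measurable_continuous_onI)
  have "1-lipschitz_on UNIV (proximal \<eta> g)"
    using proximal_nonexpansive[OF assms] by (auto simp: lipschitz_on_def dist_norm)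
  then show "continuous_on UNIV (proximal \<eta> g)" by (rule lipschitz_on_continuous_on)
qed

text \<open>Completing the square absorbs the linear term into the centre
  \<open>x - \<eta> *\<^sub>R c\<close>, at the price of a constant independent of
  \<open>v\<close>.\<close>

lemma arg_min_eq_proximal:
  fixes g :: "'a::euclidean_space \<Rightarrow> real"
  assumes sc: "strongly_convex \<mu> g" and "0 \<le> \<mu>" "0 < \<eta>"
  shows "arg_min (\<lambda>v. g v + c \<bullet> v + 1 / (2 * \<eta>) * (norm (v - x))\<^sup>2) (\<lambda>_. True)
    = proximal \<eta> g (x - \<eta> *\<^sub>R c)"
proof -
  define p where "p = proximal \<eta> g (x - \<eta> *\<^sub>R c)"
  have eq: "g v + c \<bullet> v + 1 / (2 * \<eta>) * (norm (v - x))\<^sup>2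
    = g v + 1 / (2 * \<eta>) * (norm (v - (x - \<eta> *\<^sub>R c)))\<^sup>2 + (c \<bullet> x - \<eta> / 2 * (c \<bullet> c))" for v
    unfolding power2_norm_eq_inner using \<open>0 < \<eta>\<close>
    by (simp add: inner_simps inner_commute field_simps)
  have gr: "g p + 1 / (2 * \<eta>) * (norm (p - (x - \<eta> *\<^sub>R c)))\<^sup>2 + 1 / (2 * \<eta>) * (norm (v - p))\<^sup>2
    \<le> g v + 1 / (2 * \<eta>) * (norm (v - (x - \<eta> *\<^sub>R c)))\<^sup>2" for v
  proof -
    have "0 \<le> \<mu> / 2 * (norm (v - p))\<^sup>2" using assms(2) by simp
    then show ?thesis
      using proximal_growth[OF assms, of "x - \<eta> *\<^sub>R c" v] unfolding p_def[symmetric] distrib_right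
      by linarith
  qed
  show ?thesis unfolding p_def[symmetric] eq
  proof (rule arg_min_unique)
    fix v
    have "0 \<le> 1 / (2 * \<eta>) * (norm (v - p))\<^sup>2" using \<open>0 < \<eta>\<close> by simp
    then show "g p + 1 / (2 * \<eta>) * (norm (p - (x - \<eta> *\<^sub>R c)))\<^sup>2 + (c \<bullet> x - \<eta> / 2 * (c \<bullet> c))
      \<le> g v + 1 / (2 * \<eta>) * (norm (v - (x - \<eta> *\<^sub>R c)))\<^sup>2 + (c \<bullet> x - \<eta> / 2 * (c \<bullet> c))"
      using gr[of v] by linarith
  next
    fix v
    assume "g v + 1 / (2 * \<eta>) * (norm (v - (x - \<eta> *\<^sub>R c)))\<^sup>2 + (c \<bullet> x - \<eta> / 2 * (c \<bullet> c))
      \<le> g p + 1 / (2 * \<eta>) * (norm (p - (x - \<eta> *\<^sub>R c)))\<^sup>2 + (c \<bullet> x - \<eta> / 2 * (c \<bullet> c))"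
    then have "1 / (2 * \<eta>) * (norm (v - p))\<^sup>2 \<le> 0" using gr[of v] by linarith
    then show "v = p" using \<open>0 < \<eta>\<close> by (simp add: divide_le_0_iff)
  qed
qed

text \<open>First-order optimality: the proximal objective is differentiable and minimal at the
  proximal point.\<close>

lemma proximal_gradient:
  fixes f :: "'a::euclidean_space \<Rightarrow> real"
  assumes cv: "convex_on UNIV f" and G: "\<And>x. GDERIV f x :> G x" and "0 < \<sigma>"
  shows "G (proximal (1 / \<sigma>) f q) = \<sigma> *\<^sub>R (q - proximal (1 / \<sigma>) f q)"
proof -
  define p where "p = proximal (1 / \<sigma>) f q"
  define F where "F = (\<lambda>v. f v + \<sigma> / 2 * ((v - q) \<bullet> (v - q)))"
  have "GDERIV F p :> G p + \<sigma> *\<^sub>R (p - q)"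
    unfolding F_def gderiv_def
    by (rule derivative_eq_intros G[unfolded gderiv_def] refl)+
      (simp add: fun_eq_iff inner_simps inner_commute algebra_simps)
  then have d: "(F has_derivative (\<lambda>h. h \<bullet> (G p + \<sigma> *\<^sub>R (p - q)))) (at p)"
    unfolding gderiv_def .
  have "F p \<le> F v" for v
  proof -
    have "0 \<le> (0 / 2 + 1 / (2 * (1 / \<sigma>))) * (norm (v - p))\<^sup>2" using \<open>0 < \<sigma>\<close> by simp
    then show ?thesis
      using proximal_growth[OF convex_on_strongly_convex_0[OF cv] order_refl, of "1 / \<sigma>" q v] \<open>0 < \<sigma>\<close>
      unfolding p_def[symmetric] F_def power2_norm_eq_inner by (simp del: inner_ge_zero zero_le_mult_iff)
  qed
  then have "(\<lambda>h. h \<bullet> (G p + \<sigma> *\<^sub>R (p - q))) = (\<lambda>h. 0)"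
    by (intro differential_zero_maxmin[OF _ open_UNIV d]) auto
  then have "(G p + \<sigma> *\<^sub>R (p - q)) \<bullet> (G p + \<sigma> *\<^sub>R (p - q)) = 0" by meson
  then have "G p + \<sigma> *\<^sub>R (p - q) = 0" by (simp only: inner_eq_zero_iff)
  then show ?thesis unfolding p_def[symmetric] by (simp add: algebra_simps)
qed

lemma convex_gradient_inequality:
  fixes f :: "'a::real_inner \<Rightarrow> real"
  assumes cv: "convex_on UNIV f" and G: "\<And>x. GDERIV f x :> G x"
  shows "f x + G x \<bullet> (u - x) \<le> f u"
proof -
  define h where "h = (\<lambda>t. f (x + t *\<^sub>R (u - x)))"
  have "convex_on UNIV h"
  proof (rule convex_onI)
    fix t a b :: real assume t: "0 < t" "t < 1"
    have eq: "x + ((1 - t) *\<^sub>R a + t *\<^sub>R b) *\<^sub>R (u - x)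
      = (1 - t) *\<^sub>R (x + a *\<^sub>R (u - x)) + t *\<^sub>R (x + b *\<^sub>R (u - x))"
      by (simp add: algebra_simps)
    show "h ((1 - t) *\<^sub>R a + t *\<^sub>R b) \<le> (1 - t) * h a + t * h b"
      unfolding h_def eq using t by (intro convex_onD[OF cv]) auto
  qed auto
  moreover have "(h has_real_derivative G x \<bullet> (u - x)) (at 0)"
  proof -
    have "((\<lambda>t. f (x + t *\<^sub>R (u - x))) has_derivative (\<lambda>t. (t *\<^sub>R (u - x)) \<bullet> G x)) (at 0)"
      by (rule has_derivative_compose[where g = f, of "\<lambda>t. x + t *\<^sub>R (u - x)" "\<lambda>t. t *\<^sub>R (u - x)" 0 UNIV])
        (auto intro!: derivative_eq_intros G[of x, unfolded gderiv_def])
    then show ?thesis unfolding h_def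
      by (rule has_derivative_imp_has_field_derivative) (simp add: inner_commute)
  qed
  ultimately have "h 1 - h 0 \<ge> (G x \<bullet> (u - x)) * (1 - 0)"
    by (intro convex_on_imp_above_tangent[where A = UNIV]) auto
  then show ?thesis by (simp add: h_def)
qed

text \<open>Along the segment from \<open>x\<close> to \<open>u\<close>, the difference
  \<open>h\<close> of the two sides has derivative at most 0 by Cauchy-Schwarz and the Lipschitz
  gradient.\<close>

lemma smooth_quadratic_upper_bound:
  fixes f :: "'a::real_inner \<Rightarrow> real"
  assumes G: "\<And>x. GDERIV f x :> G x" and L: "L-lipschitz_on UNIV G"
  shows "f u \<le> f x + G x \<bullet> (u - x) + L / 2 * (norm (u - x))\<^sup>2"
proof -
  define h where "h = (\<lambda>t. f (x + t *\<^sub>R (u - x)) - t * (G x \<bullet> (u - x)) - L / 2 * t\<^sup>2 * (norm (u - x))\<^sup>2)"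
  have d: "(h has_real_derivative (G (x + t *\<^sub>R (u - x)) - G x) \<bullet> (u - x) - L * t * (norm (u - x))\<^sup>2) (at t)" for t
  proof -
    have "((\<lambda>t. f (x + t *\<^sub>R (u - x))) has_derivative (\<lambda>s. (s *\<^sub>R (u - x)) \<bullet> G (x + t *\<^sub>R (u - x)))) (at t)"
      by (rule has_derivative_compose[where g = f, of "\<lambda>t. x + t *\<^sub>R (u - x)" "\<lambda>t. t *\<^sub>R (u - x)" t UNIV])
        (auto intro!: derivative_eq_intros G[unfolded gderiv_def])
    then have "((\<lambda>t. f (x + t *\<^sub>R (u - x))) has_real_derivative G (x + t *\<^sub>R (u - x)) \<bullet> (u - x)) (at t)"
      by (rule has_derivative_imp_has_field_derivative) (simp add: inner_commute)
    then show ?thesis unfolding h_def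
      by (auto intro!: derivative_eq_intros simp: inner_diff_left)
  qed
  have "h 1 \<le> h 0"
  proof (rule DERIV_nonpos_imp_nonincreasing[of 0 1 h])
    fix t :: real assume t: "0 \<le> t" "t \<le> 1"
    have "(G (x + t *\<^sub>R (u - x)) - G x) \<bullet> (u - x) \<le> norm (G (x + t *\<^sub>R (u - x)) - G x) * norm (u - x)"
      by (rule norm_cauchy_schwarz)
    also have "norm (G (x + t *\<^sub>R (u - x)) - G x) \<le> L * norm (t *\<^sub>R (u - x))"
      using lipschitz_onD[OF L, of "x + t *\<^sub>R (u - x)" x] by (simp add: dist_norm)
    finally have "(G (x + t *\<^sub>R (u - x)) - G x) \<bullet> (u - x) - L * t * (norm (u - x))\<^sup>2 \<le> 0"
      using t by (simp add: power2_eq_square mult_right_mono)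
    then show "\<exists>y. (h has_real_derivative y) (at t) \<and> y \<le> 0" using d by blast
  qed simp
  then show ?thesis by (simp add: h_def)
qed


section \<open>Conjugates of smooth convex functions and the dual proximal step\<close>

lemma conjugate_ge: "ereal (y \<bullet> u - f u) \<le> conjugate f y"
  unfolding conjugate_def by (rule SUP_upper) simp

lemma conjugate_not_MInfty: "conjugate f y \<noteq> - \<infinity>"
  using conjugate_ge[of y undefined f] by auto

text \<open>The equality case of Fenchel-Young: the gradient inequality says that \<open>p\<close>
  attains the supremum. Values of the form \<open>G p\<close> therefore always lie in the domain of
  the conjugate.\<close>

lemma conjugate_gradient:
  fixes f :: "'a::real_inner \<Rightarrow> real"
  assumes cv: "convex_on UNIV f" and G: "\<And>x. GDERIV f x :> G x"
  shows "conjugate f (G p) = ereal (G p \<bullet> p - f p)"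
proof (rule antisym)
  have "G p \<bullet> u - f u \<le> G p \<bullet> p - f p" for u
    using convex_gradient_inequality[OF assms, of p u] by (simp add: inner_diff_right)
  then show "conjugate f (G p) \<le> ereal (G p \<bullet> p - f p)"
    unfolding conjugate_def by (intro SUP_least) simp
qed (rule conjugate_ge)

text \<open>Smoothness of \<open>f\<close> becomes strong convexity of its conjugate. The supremum
  defining the conjugate is bounded below by a single test point, which also covers \<open>v\<close>
  outside the domain.\<close>

lemma conjugate_strong_convexity:
  fixes f :: "'a::real_inner \<Rightarrow> real"
  assumes G: "\<And>x. GDERIV f x :> G x" and L: "(1 / \<gamma>)-lipschitz_on UNIV G" and "0 < \<gamma>"
  shows "ereal (v \<bullet> p - f p + \<gamma> / 2 * (norm (v - G p))\<^sup>2) \<le> conjugate f v"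
proof -
  \<comment> \<open>The maximizer in \<open>u\<close> of \<open>v \<bullet> u\<close> minus the
    quadratic upper bound of \<open>f\<close> around \<open>p\<close>.\<close>
  define u where "u = p + \<gamma> *\<^sub>R (v - G p)"
  have "f u \<le> f p + G p \<bullet> (u - p) + (1 / \<gamma>) / 2 * (norm (u - p))\<^sup>2"
    by (rule smooth_quadratic_upper_bound[OF G L])
  also have "(1 / \<gamma>) / 2 * (norm (u - p))\<^sup>2 = \<gamma> / 2 * (norm (v - G p))\<^sup>2"
  proof -
    have "norm (u - p) = \<gamma> * norm (v - G p)" using \<open>0 < \<gamma>\<close> by (simp add: u_def)
    then show ?thesis using \<open>0 < \<gamma>\<close> by (simp add: power2_eq_square)
  qed
  also have "G p \<bullet> (u - p) = v \<bullet> (u - p) - \<gamma> * (norm (v - G p))\<^sup>2"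
    unfolding power2_norm_eq_inner by (simp add: u_def inner_simps inner_commute algebra_simps)
  finally have "v \<bullet> p - f p + \<gamma> / 2 * (norm (v - G p))\<^sup>2 \<le> v \<bullet> u - f u"
    by (simp add: inner_diff_right)
  then have "ereal (v \<bullet> p - f p + \<gamma> / 2 * (norm (v - G p))\<^sup>2) \<le> ereal (v \<bullet> u - f u)" by simp
  also have "\<dots> \<le> conjugate f v" by (rule conjugate_ge)
  finally show ?thesis .
qed

text \<open>Moreau's identity: \<open>G p\<close> maximizes the dual objective, and the gap is read
  off from the strong convexity bound of the conjugate at \<open>p\<close>. Stated in
  \<open>ereal\<close> so that \<open>v\<close> with infinite conjugate is included.\<close>

lemma dual_prox_growth:
  fixes f :: "'a::euclidean_space \<Rightarrow> real" and w y :: 'a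
  assumes cv: "convex_on UNIV f" and G: "\<And>x. GDERIV f x :> G x"
    and L: "(1 / \<gamma>)-lipschitz_on UNIV G" and "0 < \<gamma>" and "0 < \<sigma>"
  defines "p \<equiv> proximal (1 / \<sigma>) f (w + (1 / \<sigma>) *\<^sub>R y)"
  shows "ereal (v \<bullet> w) - conjugate f v - ereal (1 / (2 * \<sigma>) * (norm (v - y))\<^sup>2)
    \<le> ereal (G p \<bullet> w - (G p \<bullet> p - f p) - 1 / (2 * \<sigma>) * (norm (G p - y))\<^sup>2
        - (\<gamma> / 2 + 1 / (2 * \<sigma>)) * (norm (v - G p))\<^sup>2)"
proof -
  have "G p = \<sigma> *\<^sub>R (w + (1 / \<sigma>) *\<^sub>R y - p)"
    unfolding p_def by (rule proximal_gradient[OF cv G \<open>0 < \<sigma>\<close>])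
  then have "(1 / \<sigma>) *\<^sub>R G p = w + (1 / \<sigma>) *\<^sub>R y - p"
    using \<open>0 < \<sigma>\<close> by simp
  \<comment> \<open>With \<open>w - p\<close> parallel to \<open>G p - y\<close>, the terms linear
    in \<open>v - G p\<close> cancel below.\<close>
  then have p: "p = w - (1 / \<sigma>) *\<^sub>R (G p - y)"
    by (simp add: algebra_simps)
  have "G p \<bullet> w - (G p \<bullet> p - f p) - 1 / (2 * \<sigma>) * (norm (G p - y))\<^sup>2
        - (\<gamma> / 2 + 1 / (2 * \<sigma>)) * (norm (v - G p))\<^sup>2
    = v \<bullet> w - (v \<bullet> p - f p + \<gamma> / 2 * (norm (v - G p))\<^sup>2) - 1 / (2 * \<sigma>) * (norm (v - y))\<^sup>2
      - (v - G p) \<bullet> (w - p) + 1 / (2 * \<sigma>) * ((norm (v - y))\<^sup>2 - (norm (G p - y))\<^sup>2 - (norm (v - G p))\<^sup>2)"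
    by (simp add: inner_simps algebra_simps)
  also have "(norm (v - y))\<^sup>2 - (norm (G p - y))\<^sup>2 - (norm (v - G p))\<^sup>2 = 2 * ((v - G p) \<bullet> (G p - y))"
    unfolding power2_norm_eq_inner by (simp add: inner_simps inner_commute algebra_simps)
  also have "(v - G p) \<bullet> (w - p) = 1 / \<sigma> * ((v - G p) \<bullet> (G p - y))"
    by (subst (2) p) (simp add: inner_simps)
  finally have eq: "G p \<bullet> w - (G p \<bullet> p - f p) - 1 / (2 * \<sigma>) * (norm (G p - y))\<^sup>2
        - (\<gamma> / 2 + 1 / (2 * \<sigma>)) * (norm (v - G p))\<^sup>2
    = v \<bullet> w - (v \<bullet> p - f p + \<gamma> / 2 * (norm (v - G p))\<^sup>2) - 1 / (2 * \<sigma>) * (norm (v - y))\<^sup>2"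
    by simp
  show ?thesis
    unfolding eq
    using conjugate_strong_convexity[OF G L \<open>0 < \<gamma>\<close>, of v p] conjugate_not_MInfty[of f v]
    by (cases "conjugate f v") auto
qed

text \<open>Attainment comes without compactness: \<open>G p\<close> is an explicit maximizer with
  finite conjugate, and the quadratic gap makes it the only one.\<close>

lemma arg_max_eq_dual_prox:
  fixes f :: "'a::euclidean_space \<Rightarrow> real" and w y :: 'a
  assumes cv: "convex_on UNIV f" and G: "\<And>x. GDERIV f x :> G x"
    and L: "(1 / \<gamma>)-lipschitz_on UNIV G" and "0 < \<gamma>" and "0 < \<sigma>"
  defines "p \<equiv> proximal (1 / \<sigma>) f (w + (1 / \<sigma>) *\<^sub>R y)"
  shows "arg_max (\<lambda>v. ereal (v \<bullet> w) - conjugate f v - ereal (1 / (2 * \<sigma>) * (norm (v - y))\<^sup>2)) (\<lambda>_. True)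
    = G p"
proof (rule arg_max_unique)
  note gr = dual_prox_growth[OF assms(1-5), where w = w and y = y, folded p_def]
  have Gp: "ereal (G p \<bullet> w) - conjugate f (G p) - ereal (1 / (2 * \<sigma>) * (norm (G p - y))\<^sup>2)
    = ereal (G p \<bullet> w - (G p \<bullet> p - f p) - 1 / (2 * \<sigma>) * (norm (G p - y))\<^sup>2)"
    unfolding conjugate_gradient[OF cv G] by simp
  fix v
  have pos: "0 < \<gamma> / 2 + 1 / (2 * \<sigma>)" using assms(4,5) by (simp add: add_pos_pos)
  show "ereal (v \<bullet> w) - conjugate f v - ereal (1 / (2 * \<sigma>) * (norm (v - y))\<^sup>2)
    \<le> ereal (G p \<bullet> w) - conjugate f (G p) - ereal (1 / (2 * \<sigma>) * (norm (G p - y))\<^sup>2)"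
    unfolding Gp by (rule order_trans[OF gr]) (use pos in simp)
  assume "ereal (G p \<bullet> w) - conjugate f (G p) - ereal (1 / (2 * \<sigma>) * (norm (G p - y))\<^sup>2)
    \<le> ereal (v \<bullet> w) - conjugate f v - ereal (1 / (2 * \<sigma>) * (norm (v - y))\<^sup>2)"
  from order_trans[OF this gr]
  have "(\<gamma> / 2 + 1 / (2 * \<sigma>)) * (norm (v - G p))\<^sup>2 \<le> 0" unfolding Gp by simp
  with pos have "(norm (v - G p))\<^sup>2 \<le> 0" by (simp add: mult_le_0_iff)
  then show "v = G p" by simp
qed

section \<open>Largest eigenvalues of Gram sums and the norms of block rows\<close>

lemma inner_transpose_mult: "y \<bullet> (transpose B *v x) = (B *v y) \<bullet> (x :: real^'d)"
  for B :: "real^'t^'d"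
  using dot_lmul_matrix[of x B y] by (simp add: inner_commute transpose_matrix_vector)

text \<open>Eigenvectors of distinct eigenvalues are orthogonal, hence independent. Finiteness
  matters because \<open>lambda_max\<close> is a \<open>Max\<close>, which says nothing about
  infinite sets.\<close>

lemma finite_eigenvalues_symmetric:
  fixes B :: "real^'d^'d"
  assumes sym: "transpose B = B"
  shows "finite {l. \<exists>v. v \<noteq> 0 \<and> B *v v = l *\<^sub>R v}" (is "finite ?E")
proof -
  have symi: "x \<bullet> (B *v y) = (B *v x) \<bullet> y" for x y
    using inner_transpose_mult[of x B y] by (simp add: sym)
    define e where "e = (\<lambda>l. SOME v. v \<noteq> 0 \<and> B *v v = l *\<^sub>R v)"
    have e: "e l \<noteq> 0 \<and> B *v e l = l *\<^sub>R e l" if "l \<in> ?E" for l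
      unfolding e_def by (rule someI_ex) (use that in simp)
    have orth: "e l \<bullet> e l' = 0" if "l \<in> ?E" "l' \<in> ?E" "l \<noteq> l'" for l l'
    proof -
      have "l' * (e l \<bullet> e l') = e l \<bullet> (B *v e l')" using e[OF that(2)] by simp
      also have "\<dots> = l * (e l \<bullet> e l')" using e[OF that(1)] by (simp add: symi)
      finally show ?thesis using that(3) by simp
    qed
    have "pairwise orthogonal (e ` ?E)"
      using orth by (fastforce simp: pairwise_def orthogonal_def)
    then have "independent (e ` ?E)"
      by (rule pairwise_orthogonal_independent) (use e in force)
    then have "finite (e ` ?E)" by (rule independent_imp_finite)
    moreover have "inj_on e ?E"
      using orth e by (metis (no_types, lifting) inj_onI inner_eq_zero_iff)
    ultimately show ?thesis by (rule finite_imageD)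
qed

text \<open>The maximum of the quadratic form over the unit sphere is attained, and a maximizer
  \<open>w\<close> is an eigenvector: otherwise moving from \<open>w\<close> along the residual
  \<open>z\<close> violates the Rayleigh bound to first order.\<close>

lemma symmetric_rayleigh_max_eigenvalue:
  fixes B :: "real^'d^'d"
  assumes sym: "transpose B = B"
  shows "\<exists>l. (\<exists>v. v \<noteq> 0 \<and> B *v v = l *\<^sub>R v) \<and> (\<forall>v. v \<bullet> (B *v v) \<le> l * (v \<bullet> v))"
proof -
  have symi: "x \<bullet> (B *v y) = (B *v x) \<bullet> y" for x y
    using inner_transpose_mult[of x B y] by (simp add: sym)
  define S where "S = sphere (0 :: real^'d) 1"
  have "S \<noteq> {}" by (simp add: S_def)
  have "continuous_on S (\<lambda>v. v \<bullet> (B *v v))"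
    by (intro continuous_intros linear_continuous_on) (simp add: linear_conv_bounded_linear[symmetric])
  then obtain w where w: "w \<in> S" and wmax: "\<And>v. v \<in> S \<Longrightarrow> v \<bullet> (B *v v) \<le> w \<bullet> (B *v w)"
    using continuous_attains_sup[of S "\<lambda>v. v \<bullet> (B *v v)"] \<open>S \<noteq> {}\<close> by (auto simp: S_def)
  define l where "l = w \<bullet> (B *v w)"
  have nw: "w \<bullet> w = 1" using w by (simp add: S_def norm_eq_1)
  have ray: "v \<bullet> (B *v v) \<le> l * (v \<bullet> v)" for v
  proof (cases "v = 0")
    case False
    have "(1 / norm v) *\<^sub>R v \<bullet> (B *v ((1 / norm v) *\<^sub>R v)) \<le> l"
      unfolding l_def using False by (intro wmax) (simp add: S_def)
    then have "(v \<bullet> (B *v v)) / (norm v)\<^sup>2 \<le> l"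
      by (simp add: matrix_vector_mult_scaleR power2_eq_square)
    then show ?thesis using False by (simp add: power2_norm_eq_inner divide_le_eq)
  qed simp
  have "B *v w = l *\<^sub>R w"
  proof (rule ccontr)
    assume ne: "B *v w \<noteq> l *\<^sub>R w"
    define z where "z = B *v w - l *\<^sub>R w"
    define a where "a = z \<bullet> (B *v z) - l * (z \<bullet> z)"
    have zz: "0 < z \<bullet> z" using ne by (simp add: z_def)
    have eq: "(w + t *\<^sub>R z) \<bullet> (B *v (w + t *\<^sub>R z)) - l * ((w + t *\<^sub>R z) \<bullet> (w + t *\<^sub>R z))
      = 2 * t * (z \<bullet> z) + t\<^sup>2 * a" for t
    proof -
      have "(w + t *\<^sub>R z) \<bullet> (B *v (w + t *\<^sub>R z)) - l * ((w + t *\<^sub>R z) \<bullet> (w + t *\<^sub>R z))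
        = w \<bullet> (B *v w) - l * (w \<bullet> w) + t * (w \<bullet> (B *v z) + z \<bullet> (B *v w) - 2 * l * (w \<bullet> z)) + t\<^sup>2 * a"
        unfolding matrix_vector_right_distrib matrix_vector_mult_scaleR inner_add_left inner_add_right
          inner_scaleR_left inner_scaleR_right a_def inner_commute[of z w]
        by (simp add: power2_eq_square algebra_simps)
      also have "w \<bullet> (B *v z) = z \<bullet> (B *v w)" 
        using symi[of w z] inner_commute[of "B *v w" z] by simp
      also have "z \<bullet> (B *v w) + z \<bullet> (B *v w) - 2 * l * (w \<bullet> z) = 2 * (z \<bullet> z)"
        by (simp add: z_def inner_simps inner_commute algebra_simps)
      finally show ?thesis by (simp add: nw l_def)
    qed
    have le: "2 * t * (z \<bullet> z) + t\<^sup>2 * a \<le> 0" for t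
      using ray[of "w + t *\<^sub>R z"] eq[of t] by linarith
    \<comment> \<open>Small enough for the first-order gain \<open>2 * t * (z \<bullet> z)\<close>
      to beat \<open>t\<^sup>2 * a\<close>; the 1 in the denominator covers
      \<open>a = 0\<close>.\<close>
    define t where "t = (z \<bullet> z) / (1 + \<bar>a\<bar>)"
    have t: "0 < t" using zz by (simp add: t_def)
    have "t * \<bar>a\<bar> \<le> z \<bullet> z" using zz by (simp add: t_def field_simps)
    moreover have "t * (- a) \<le> t * \<bar>a\<bar>" using t by (intro mult_left_mono) auto
    ultimately have "- (t * a) \<le> z \<bullet> z" by simp
    then have "0 < t * (2 * (z \<bullet> z) + t * a)" using t zz by (intro mult_pos_pos) linarith+
    then show False using le[of t] by (simp add: power2_eq_square algebra_simps)
  qed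
  moreover have "w \<noteq> 0" using nw by auto
  ultimately show ?thesis using ray by blast
qed

lemma symmetric_rayleigh_le_lambda_max:
  fixes B :: "real^'d^'d"
  assumes "transpose B = B"
  shows "v \<bullet> (B *v v) \<le> lambda_max B * (norm v)\<^sup>2"
proof -
  obtain l where "\<exists>v. v \<noteq> 0 \<and> B *v v = l *\<^sub>R v" and ray: "\<And>v. v \<bullet> (B *v v) \<le> l * (v \<bullet> v)"
    using symmetric_rayleigh_max_eigenvalue[OF assms] by blast
  then have "l \<le> lambda_max B"
    unfolding lambda_max_def using finite_eigenvalues_symmetric[OF assms] by (intro Max_ge) auto
  then have "l * (v \<bullet> v) \<le> lambda_max B * (v \<bullet> v)" by (intro mult_right_mono) auto
  with ray[of v] show ?thesis by (simp add: power2_norm_eq_inner)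
qed

lemma lambda_max_le:
  fixes B :: "real^'d^'d"
  assumes "transpose B = B" and le: "\<And>v. v \<bullet> (B *v v) \<le> c * (norm v)\<^sup>2"
  shows "lambda_max B \<le> c"
proof -
  have "lambda_max B \<in> {l. \<exists>v. v \<noteq> 0 \<and> B *v v = l *\<^sub>R v}"
    unfolding lambda_max_def
    using finite_eigenvalues_symmetric[OF assms(1)] symmetric_rayleigh_max_eigenvalue[OF assms(1)]
    by (intro Max_in) auto
  then obtain v where v: "v \<noteq> 0" "B *v v = lambda_max B *\<^sub>R v" by blast
  then have "lambda_max B * (norm v)\<^sup>2 \<le> c * (norm v)\<^sup>2"
    using le[of v] by (simp add: power2_norm_eq_inner)
  then show ?thesis using v(1) by simp
qed

lemma transpose_sum: "transpose (\<Sum>j\<in>J. B j) = (\<Sum>j\<in>J. transpose (B j))"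
  for B :: "'j \<Rightarrow> real^'a^'b"
  by (induction J rule: infinite_finite_induct) (simp_all add: transpose_def vec_eq_iff)

lemma matrix_vector_mult_sum: "(\<Sum>j\<in>J. B j) *v x = (\<Sum>j\<in>J. B j *v x)"
  for B :: "'j \<Rightarrow> real^'a^'b"
  by (induction J rule: infinite_finite_induct) (simp_all add: matrix_vector_mult_add_rdistrib)

lemma inner_gram_matrix:
  fixes A :: "'j \<Rightarrow> real^'t^'d"
  shows "w \<bullet> ((\<Sum>j\<in>J. A j ** transpose (A j)) *v w) = (\<Sum>j\<in>J. (norm (transpose (A j) *v w))\<^sup>2)"
  unfolding matrix_vector_mult_sum inner_sum_right power2_norm_eq_inner inner_transpose_mult
  by (simp only: matrix_vector_mul_assoc[symmetric] inner_commute)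

lemma transpose_gram_matrix:
  fixes A :: "'j \<Rightarrow> real^'t^'d"
  shows "transpose (\<Sum>j\<in>J. A j ** transpose (A j)) = (\<Sum>j\<in>J. A j ** transpose (A j))"
  by (simp add: transpose_sum matrix_transpose_mul)

lemma sum_norm_transpose_le_lambda_max:
  fixes A :: "'j \<Rightarrow> real^'t^'d"
  shows "(\<Sum>j\<in>J. (norm (transpose (A j) *v w))\<^sup>2)
    \<le> lambda_max (\<Sum>j\<in>J. A j ** transpose (A j)) * (norm w)\<^sup>2"
proof -
  have "(\<Sum>j\<in>J. (norm (transpose (A j) *v w))\<^sup>2) = w \<bullet> ((\<Sum>j\<in>J. A j ** transpose (A j)) *v w)"
    by (rule inner_gram_matrix[symmetric])
  also have "\<dots> \<le> lambda_max (\<Sum>j\<in>J. A j ** transpose (A j)) * (norm w)\<^sup>2"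
    by (rule symmetric_rayleigh_le_lambda_max[OF transpose_gram_matrix])
  finally show ?thesis .
qed

lemma lambda_max_nonneg:
  fixes A :: "'j \<Rightarrow> real^'t^'d"
  shows "0 \<le> lambda_max (\<Sum>j\<in>J. A j ** transpose (A j))"
proof -
  have "0 \<le> (\<Sum>j\<in>J. (norm (transpose (A j) *v axis undefined 1))\<^sup>2)" by (simp add: sum_nonneg)
  also have "\<dots> \<le> lambda_max (\<Sum>j\<in>J. A j ** transpose (A j)) * (norm (axis undefined 1 :: real^'d))\<^sup>2"
    by (rule sum_norm_transpose_le_lambda_max)
  finally show ?thesis by (simp add: norm_axis_1)
qed

text \<open>The squared spectral norm of the block row of all \<open>A j\<close> is the largest
  eigenvalue of the Gram sum. Pair the vector \<open>w\<close> with itself, move the matrices to the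
  other side, apply Cauchy-Schwarz over \<open>J\<close> and cancel one factor
  \<open>norm w\<close>.\<close>

lemma norm_sum_matrix_vector_le:
  fixes A :: "'j \<Rightarrow> real^'t^'d"
  shows "(norm (\<Sum>j\<in>J. A j *v v j))\<^sup>2
    \<le> lambda_max (\<Sum>j\<in>J. A j ** transpose (A j)) * (\<Sum>j\<in>J. (norm (v j))\<^sup>2)"
proof -
  define w where "w = (\<Sum>j\<in>J. A j *v v j)"
  define S where "S = (\<Sum>j\<in>J. (norm (v j))\<^sup>2)"
  define l where "l = lambda_max (\<Sum>j\<in>J. A j ** transpose (A j))"
  have S: "0 \<le> S" by (simp add: S_def sum_nonneg)
  have "(norm w)\<^sup>2 = (\<Sum>j\<in>J. v j \<bullet> (transpose (A j) *v w))"
    unfolding inner_transpose_mult power2_norm_eq_inner inner_sum_left[symmetric] w_def[symmetric] ..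
  also have "\<dots> \<le> (\<Sum>j\<in>J. \<bar>norm (v j)\<bar> * \<bar>norm (transpose (A j) *v w)\<bar>)"
    by (intro sum_mono) (simp add: norm_cauchy_schwarz)
  also have "\<dots> \<le> L2_set (\<lambda>j. norm (v j)) J * L2_set (\<lambda>j. norm (transpose (A j) *v w)) J"
    by (rule L2_set_mult_ineq)
  also have "\<dots> = sqrt (S * (\<Sum>j\<in>J. (norm (transpose (A j) *v w))\<^sup>2))"
    by (simp add: L2_set_def S_def real_sqrt_mult)
  also have "\<dots> \<le> sqrt (S * (l * (norm w)\<^sup>2))"
    unfolding l_def
    by (intro real_sqrt_le_mono mult_left_mono sum_norm_transpose_le_lambda_max S)
  also have "\<dots> = sqrt (l * S) * norm w" by (simp add: real_sqrt_mult algebra_simps)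
  finally have "norm w \<le> sqrt (l * S)"
    by (cases "norm w = 0") (use S lambda_max_nonneg[of A J] in \<open>auto simp: power2_eq_square l_def\<close>)
  then have "(norm w)\<^sup>2 \<le> (sqrt (l * S))\<^sup>2" by (intro power_mono) auto
  also have "\<dots> = l * S" using S lambda_max_nonneg[of A J] by (simp add: l_def)
  finally have "(norm w)\<^sup>2 \<le> l * S" .
  then show ?thesis by (simp add: w_def S_def l_def)
qed

lemma lambda_max_mono:
  fixes A :: "'j \<Rightarrow> real^'t^'d"
  assumes sub: "J \<subseteq> K" "finite K"
  shows "lambda_max (\<Sum>j\<in>J. A j ** transpose (A j)) \<le> lambda_max (\<Sum>j\<in>K. A j ** transpose (A j))"
proof (rule lambda_max_le[OF transpose_gram_matrix])
  fix v :: "real^'d"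
  have "(\<Sum>j\<in>J. (norm (transpose (A j) *v v))\<^sup>2) \<le> (\<Sum>j\<in>K. (norm (transpose (A j) *v v))\<^sup>2)"
    using sub by (intro sum_mono2) auto
  also have "\<dots> \<le> lambda_max (\<Sum>j\<in>K. A j ** transpose (A j)) * (norm v)\<^sup>2"
    by (rule sum_norm_transpose_le_lambda_max)
  finally show "v \<bullet> ((\<Sum>j\<in>J. A j ** transpose (A j)) *v v)
    \<le> lambda_max (\<Sum>j\<in>K. A j ** transpose (A j)) * (norm v)\<^sup>2"
    unfolding inner_gram_matrix .
qed


section \<open>The three data constants and how they compare\<close>

lemma Rm_const_bound:
  assumes "i < m" "\<tau> < n"
  shows "norm (A i \<tau> *v v) \<le> Rm_const m n A * norm v"
proof -
  have "onorm (\<lambda>v. A i \<tau> *v v) \<le> Rm_const m n A"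
    unfolding Rm_const_def using assms by (intro Max_ge) (auto intro!: image_eqI[of _ _ "(i, \<tau>)"])
  then have "onorm (\<lambda>v. A i \<tau> *v v) * norm v \<le> Rm_const m n A * norm v"
    by (intro mult_right_mono) auto
  moreover have "norm (A i \<tau> *v v) \<le> onorm (\<lambda>v. A i \<tau> *v v) * norm v"
    by (intro onorm) (simp add: linear_conv_bounded_linear[symmetric])
  ultimately show ?thesis by linarith
qed

lemma Rm_const_nonneg:
  fixes A :: "nat \<Rightarrow> nat \<Rightarrow> real^'t^'d"
  assumes "0 < m" "0 < n"
  shows "0 \<le> Rm_const m n A"
proof -
  have "0 \<le> norm (A 0 0 *v (axis undefined 1 :: real^'t))" by simp
  also have "\<dots> \<le> Rm_const m n A * norm (axis undefined 1 :: real^'t)"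
    using assms by (intro Rm_const_bound)
  finally show ?thesis by (simp add: norm_axis_1)
qed

lemma Rbar_const_sq:
  assumes "0 < n"
  shows "(Rbar_const m n A)\<^sup>2
    = Max ((\<lambda>\<tau>. 1 / real m * lambda_max (\<Sum>i<m. A i \<tau> ** transpose (A i \<tau>))) ` {..<n})" (is "_ = Max ?X")
proof -
  have "0 \<le> 1 / real m * lambda_max (\<Sum>i<m. A i 0 ** transpose (A i 0))"
    using lambda_max_nonneg by (intro mult_nonneg_nonneg) auto
  also have "\<dots> \<le> Max ?X" using assms by (intro Max_ge) auto
  finally show ?thesis unfolding Rbar_const_def by simp
qed

lemma lambda_max_le_Rbar_const:
  assumes "0 < m" "\<tau> < n"
  shows "lambda_max (\<Sum>i<m. A i \<tau> ** transpose (A i \<tau>)) \<le> real m * (Rbar_const m n A)\<^sup>2"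
proof -
  have "1 / real m * lambda_max (\<Sum>i<m. A i \<tau> ** transpose (A i \<tau>)) \<le> (Rbar_const m n A)\<^sup>2"
    using assms by (subst Rbar_const_sq) (auto intro!: Max_ge)
  then show ?thesis using assms by (simp add: field_simps)
qed

text \<open>The double sum is flattened to an index pair, the form to which the block row bound and
  monotonicity in the index set apply.\<close>

lemma R_const_sq:
  assumes "0 < m" "0 < n"
  shows "real (m * n) * (R_const m n A)\<^sup>2
    = lambda_max (\<Sum>(\<tau>, i)\<in>{..<n} \<times> {..<m}. A i \<tau> ** transpose (A i \<tau>))"
proof -
  have "0 \<le> lambda_max (\<Sum>p\<in>{..<n} \<times> {..<m}. A (snd p) (fst p) ** transpose (A (snd p) (fst p)))"
    by (rule lambda_max_nonneg)
  then show ?thesis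
    unfolding R_const_def sum.cartesian_product using assms
    by (simp add: case_prod_unfold)
qed

lemma Rbar_const_bound:
  assumes "0 < m" "\<tau> < n"
  shows "(norm (\<Sum>i<m. A i \<tau> *v v i))\<^sup>2 \<le> real m * (Rbar_const m n A)\<^sup>2 * (\<Sum>i<m. (norm (v i))\<^sup>2)"
  by (rule order_trans[OF norm_sum_matrix_vector_le mult_right_mono[OF lambda_max_le_Rbar_const]])
    (simp_all add: assms sum_nonneg)

lemma R_const_bound:
  assumes "0 < m" "0 < n"
  shows "(norm (\<Sum>\<tau><n. \<Sum>i<m. A i \<tau> *v v i \<tau>))\<^sup>2
    \<le> real (m * n) * (R_const m n A)\<^sup>2 * (\<Sum>\<tau><n. \<Sum>i<m. (norm (v i \<tau>))\<^sup>2)"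
  unfolding R_const_sq[OF assms] sum.cartesian_product case_prod_unfold
  by (rule norm_sum_matrix_vector_le)

lemma R_const_nonneg: "0 \<le> R_const m n A"
proof -
  have "0 \<le> lambda_max (\<Sum>p\<in>{..<n} \<times> {..<m}. A (snd p) (fst p) ** transpose (A (snd p) (fst p)))"
    by (rule lambda_max_nonneg)
  then show ?thesis
    unfolding R_const_def sum.cartesian_product by (simp add: case_prod_unfold)
qed

lemma Rbar_const_nonneg:
  assumes "0 < n"
  shows "0 \<le> Rbar_const m n A"
proof -
  have "0 \<le> Max ((\<lambda>\<tau>. 1 / real m * lambda_max (\<Sum>i<m. A i \<tau> ** transpose (A i \<tau>))) ` {..<n})"
    unfolding Rbar_const_sq[OF assms, symmetric] by simp
  then show ?thesis unfolding Rbar_const_def by simp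
qed

text \<open>The Gram sum of one node is part of the Gram sum over all nodes. This lets
  \<open>R\<close> replace \<open>Rbar\<close> in the rate of the unbiased case.\<close>

lemma Rbar_const_sq_le:
  assumes "0 < m" "0 < n"
  shows "(Rbar_const m n A)\<^sup>2 \<le> real n * (R_const m n A)\<^sup>2"
proof -
  have "1 / real m * lambda_max (\<Sum>i<m. A i \<tau> ** transpose (A i \<tau>)) \<le> real n * (R_const m n A)\<^sup>2"
    if "\<tau> < n" for \<tau>
  proof -
    define B where "B = (\<lambda>p. A (snd p) (fst p))"
    have "(\<Sum>i<m. A i \<tau> ** transpose (A i \<tau>)) = (\<Sum>p\<in>{\<tau>} \<times> {..<m}. B p ** transpose (B p))"
      using sum.cartesian_product[of "\<lambda>\<tau> i. A i \<tau> ** transpose (A i \<tau>)" "{..<m}" "{\<tau>}"]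
      by (simp add: case_prod_unfold B_def)
    moreover have "lambda_max (\<Sum>p\<in>{\<tau>} \<times> {..<m}. B p ** transpose (B p))
      \<le> lambda_max (\<Sum>p\<in>{..<n} \<times> {..<m}. B p ** transpose (B p))"
      using that by (intro lambda_max_mono) auto
    ultimately have "lambda_max (\<Sum>i<m. A i \<tau> ** transpose (A i \<tau>)) \<le> real (m * n) * (R_const m n A)\<^sup>2"
      unfolding R_const_sq[OF assms] by (simp add: case_prod_unfold B_def)
    then show ?thesis using assms by (simp add: field_simps)
  qed
  then show ?thesis unfolding Rbar_const_sq[OF assms(2)] using assms(2)
    by (subst Max_le_iff) auto
qed

text \<open>A single matrix is a block row of length one, and its Gram matrix is part of the Gram
  sum of its node.\<close>

lemma Rm_const_sq_le:
  fixes A :: "nat \<Rightarrow> nat \<Rightarrow> real^'t^'d"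
  assumes "0 < m" "0 < n"
  shows "(Rm_const m n A)\<^sup>2 \<le> real m * (Rbar_const m n A)\<^sup>2"
proof -
  define c where "c = sqrt (real m * (Rbar_const m n A)\<^sup>2)"
  have "onorm (\<lambda>v. A i \<tau> *v v) \<le> c" if "i < m" "\<tau> < n" for i \<tau>
  proof (rule onorm_le)
    fix v :: "real^'t"
    have "(norm (\<Sum>j\<in>{i}. A j \<tau> *v v))\<^sup>2
      \<le> lambda_max (\<Sum>j\<in>{i}. A j \<tau> ** transpose (A j \<tau>)) * (\<Sum>j\<in>{i}. (norm v)\<^sup>2)"
      by (rule norm_sum_matrix_vector_le)
    also have "\<dots> \<le> lambda_max (\<Sum>j<m. A j \<tau> ** transpose (A j \<tau>)) * (\<Sum>j\<in>{i}. (norm v)\<^sup>2)"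
      using that by (intro mult_right_mono lambda_max_mono sum_nonneg) auto
    also have "\<dots> \<le> real m * (Rbar_const m n A)\<^sup>2 * (norm v)\<^sup>2"
      using lambda_max_le_Rbar_const[OF assms(1) that(2), of A] by (simp add: mult_right_mono)
    finally have "sqrt ((norm (A i \<tau> *v v))\<^sup>2) \<le> sqrt (real m * (Rbar_const m n A)\<^sup>2 * (norm v)\<^sup>2)"
      by (intro real_sqrt_le_mono) simp
    then show "norm (A i \<tau> *v v) \<le> c * norm v" by (simp add: real_sqrt_mult c_def)
  qed
  then have "Rm_const m n A \<le> c"
    unfolding Rm_const_def using assms by (subst Max_le_iff) auto
  then have "(Rm_const m n A)\<^sup>2 \<le> c\<^sup>2" using Rm_const_nonneg[OF assms] by (intro power_mono)
  then show ?thesis by (simp add: c_def)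
qed


section \<open>Moments of random vectors on product measures\<close>

text \<open>Fubini with the index outside: integrability over the finite uniform factor is
  automatic, so moments of the sections \<open>G i\<close> are enough.\<close>

lemma has_bochner_integral_uniform_pair:
  fixes G :: "nat \<Rightarrow> 'c \<Rightarrow> 'b::{banach,second_countable_topology}"
  assumes C: "prob_space C" and m: "0 < m"
    and G: "\<And>i. i < m \<Longrightarrow> has_bochner_integral C (G i) (v i)"
  shows "has_bochner_integral (uniform_count_measure {..<m} \<Otimes>\<^sub>M C) (\<lambda>(i, c). G i c)
    ((1 / real m) *\<^sub>R (\<Sum>i<m. v i))"
proof -
  define U where "U = uniform_count_measure {..<m}"
  interpret C: prob_space C by fact
  interpret U: prob_space U
    unfolding U_def using m by (intro prob_space_uniform_count_measure) auto
  interpret pair_sigma_finite U C ..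
  have spU: "space U = {..<m}" by (simp add: U_def space_uniform_count_measure)
  have Gi: "integrable C (G i)" "integral\<^sup>L C (G i) = v i" if "i < m" for i
    using G[OF that] by (auto simp: has_bochner_integral_iff)
  have intU: "integrable U f" for f :: "nat \<Rightarrow> 'z::{banach,second_countable_topology}"
    unfolding U_def uniform_count_measure_def by (rule integrable_point_measure_finite) simp
  \<comment> \<open>Measurability of each section suffices, since the index takes countably many
    values.\<close>
  have meas: "(\<lambda>(i, c). G i c) \<in> borel_measurable (U \<Otimes>\<^sub>M C)"
  proof -
    have "(\<lambda>x. G (fst x) (snd x)) \<in> borel_measurable (U \<Otimes>\<^sub>M C)"
    proof (rule measurable_compose_countable'[where f = "\<lambda>i x. G i (snd x)" and g = fst and I = "{..<m}"])
      show "fst \<in> U \<Otimes>\<^sub>M C \<rightarrow>\<^sub>M count_space {..<m}"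
        using measurable_fst[of U C]
        by (simp add: U_def measurable_cong_sets[OF refl sets_uniform_count_measure_count_space])
    qed (use Gi in \<open>auto intro!: measurable_compose[OF measurable_snd]\<close>)
    then show ?thesis by (simp add: case_prod_unfold)
  qed
  have int: "integrable (U \<Otimes>\<^sub>M C) (\<lambda>(i, c). G i c)"
    by (rule Fubini_integrable[OF meas]) (use Gi in \<open>auto intro!: intU AE_I2 simp: spU\<close>)
  have "integral\<^sup>L (U \<Otimes>\<^sub>M C) (\<lambda>(i, c). G i c) = (\<integral>i. (\<integral>c. G i c \<partial>C) \<partial>U)"
    by (rule integral_fst[OF int, symmetric])
  also have "\<dots> = (\<integral>i. v i \<partial>U)"
    by (rule Bochner_Integration.integral_cong) (auto simp: Gi spU)
  also have "\<dots> = (1 / real m) *\<^sub>R (\<Sum>i<m. v i)"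
    unfolding U_def uniform_count_measure_def
    by (subst lebesgue_integral_point_measure_finite) (auto simp: scaleR_sum_right)
  finally show ?thesis using int by (simp add: has_bochner_integral_iff U_def)
qed

lemma has_bochner_integral_distr_eq:
  fixes f :: "'b \<Rightarrow> 'c::{banach,second_countable_topology}"
  assumes "distr N M g = M" "g \<in> N \<rightarrow>\<^sub>M M" "has_bochner_integral M f v"
  shows "has_bochner_integral N (\<lambda>x. f (g x)) v"
  using assms integrable_distr_eq[of g N M f] integral_distr[of g N M f]
  by (auto simp: has_bochner_integral_iff)

lemma has_bochner_integral_pair_fst:
  fixes f :: "'b \<Rightarrow> 'c::{banach,second_countable_topology}"
  assumes "prob_space N" "has_bochner_integral M f v"
  shows "has_bochner_integral (M \<Otimes>\<^sub>M N) (\<lambda>x. f (fst x)) v"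
  by (rule has_bochner_integral_distr_eq[OF prob_space.distr_pair_fst[OF assms(1)] _ assms(2)]) simp

lemma has_bochner_integral_pair_snd:
  fixes f :: "'b \<Rightarrow> 'c::{banach,second_countable_topology}"
  assumes N: "prob_space N" and M: "prob_space M" and f: "has_bochner_integral M f v"
  shows "has_bochner_integral (N \<Otimes>\<^sub>M M) (\<lambda>x. f (snd x)) v"
proof -
  interpret N: prob_space N by fact
  interpret M: prob_space M by fact
  interpret pair_sigma_finite N M ..
  have "distr (N \<Otimes>\<^sub>M M) M snd = distr (distr (M \<Otimes>\<^sub>M N) (N \<Otimes>\<^sub>M M) (\<lambda>(x, y). (y, x))) M snd"
    by (simp add: distr_pair_swap[symmetric])
  also have "\<dots> = distr (M \<Otimes>\<^sub>M N) M fst"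
    by (subst distr_distr) (auto simp: comp_def case_prod_unfold)
  finally have "distr (N \<Otimes>\<^sub>M M) M snd = M" by (simp add: N.distr_pair_fst)
  then show ?thesis by (rule has_bochner_integral_distr_eq[OF _ _ f]) simp
qed

lemma has_bochner_integral_PiM_component:
  fixes f :: "'b \<Rightarrow> 'c::{banach,second_countable_topology}"
  assumes "\<And>i. i \<in> J \<Longrightarrow> prob_space (\<nu> i)" "j \<in> J" "has_bochner_integral (\<nu> j) f v"
  shows "has_bochner_integral (PiM J \<nu>) (\<lambda>r. f (r j)) v"
proof (rule has_bochner_integral_distr_eq[OF _ _ assms(3)])
  show "distr (PiM J \<nu>) (\<nu> j) (\<lambda>r. r j) = \<nu> j"
    using assms(1,2) by (rule distr_PiM_component)
qed (simp add: assms(2))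

text \<open>Independent coordinates: each component product is a product over all of
  \<open>J\<close> in which the remaining coordinates contribute the constant 1.\<close>

lemma has_bochner_integral_PiM_inner:
  fixes X :: "'i \<Rightarrow> 'b \<Rightarrow> 'c::euclidean_space"
  assumes nu: "\<And>i. prob_space (\<nu> i)" and J: "finite J" "j \<in> J" "l \<in> J" "j \<noteq> l"
    and X: "\<And>i. i \<in> J \<Longrightarrow> has_bochner_integral (\<nu> i) (X i) (\<mu> i)"
  shows "has_bochner_integral (PiM J \<nu>) (\<lambda>r. X j (r j) \<bullet> X l (r l)) (\<mu> j \<bullet> \<mu> l)"
proof -
  interpret product_sigma_finite \<nu>
    unfolding product_sigma_finite_def using nu by (auto intro: prob_space_imp_sigma_finite)
  have "has_bochner_integral (PiM J \<nu>) (\<lambda>r. (X j (r j) \<bullet> b) * (X l (r l) \<bullet> b)) ((\<mu> j \<bullet> b) * (\<mu> l \<bullet> b))"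
    for b
  proof -
    define f where "f = (\<lambda>k x. if k = j \<or> k = l then X k x \<bullet> b else 1)"
    have hb: "has_bochner_integral (\<nu> k) (f k) (if k = j \<or> k = l then \<mu> k \<bullet> b else 1)" if "k \<in> J" for k
    proof -
      interpret prob_space "\<nu> k" by (rule nu)
      show ?thesis using X[OF that] by (auto simp: f_def has_bochner_integral_iff prob_space)
    qed
    have pr: "(\<Prod>k\<in>J. (if k = j \<or> k = l then h k else 1)) = h j * h l" for h :: "'i \<Rightarrow> real"
    proof -
      have "(\<Prod>k\<in>J. (if k = j \<or> k = l then h k else 1)) = (\<Prod>k\<in>{j, l}. h k)"
        using J by (intro prod.mono_neutral_cong_right) auto
      then show ?thesis using J by simp
    qed
    have "integrable (PiM J \<nu>) (\<lambda>r. \<Prod>k\<in>J. f k (r k))"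
      using J hb by (intro product_integrable_prod) (auto simp: has_bochner_integral_iff)
    moreover have "(\<integral>r. (\<Prod>k\<in>J. f k (r k)) \<partial>PiM J \<nu>) = (\<Prod>k\<in>J. if k = j \<or> k = l then \<mu> k \<bullet> b else 1)"
      using J hb by (subst product_integral_prod) (auto simp: has_bochner_integral_iff intro!: prod.cong)
    moreover have "(\<Prod>k\<in>J. f k (r k)) = (X j (r j) \<bullet> b) * (X l (r l) \<bullet> b)" for r
      unfolding f_def using pr[of "\<lambda>k. X k (r k) \<bullet> b"] .
    ultimately show ?thesis by (simp add: has_bochner_integral_iff pr)
  qed
  then have "has_bochner_integral (PiM J \<nu>) (\<lambda>r. \<Sum>b\<in>Basis. (X j (r j) \<bullet> b) * (X l (r l) \<bullet> b))
    (\<Sum>b\<in>Basis. (\<mu> j \<bullet> b) * (\<mu> l \<bullet> b))"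
    by (intro has_bochner_integral_sum)
  then show ?thesis by (simp add: euclidean_inner[symmetric])
qed

lemma norm_sum_sq_expand:
  fixes x :: "'i \<Rightarrow> 'c::real_inner"
  assumes "finite J"
  shows "(norm (\<Sum>j\<in>J. x j))\<^sup>2 = (\<Sum>j\<in>J. (norm (x j))\<^sup>2) + (\<Sum>j\<in>J. \<Sum>l\<in>J - {j}. x j \<bullet> x l)"
proof -
  have "(norm (\<Sum>j\<in>J. x j))\<^sup>2 = (\<Sum>j\<in>J. \<Sum>l\<in>J. x j \<bullet> x l)"
    unfolding power2_norm_eq_inner inner_sum_right
    by (subst sum.swap) (simp add: inner_sum_left)
  also have "\<dots> = (\<Sum>j\<in>J. (norm (x j))\<^sup>2 + (\<Sum>l\<in>J - {j}. x j \<bullet> x l))"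
    using assms by (intro sum.cong refl) (simp add: sum.remove power2_norm_eq_inner)
  finally show ?thesis by (simp add: sum.distrib)
qed

text \<open>Variance of a sum of independent vectors: only the means enter the off-diagonal terms.
  Divided by the squared number of nodes, this is the source of the gain \<open>1 / n\<close> from
  averaging.\<close>

lemma has_bochner_integral_PiM_norm_sum_sq:
  fixes X :: "'i \<Rightarrow> 'b \<Rightarrow> 'c::euclidean_space"
  assumes nu: "\<And>i. prob_space (\<nu> i)" and J: "finite J"
    and X: "\<And>i. i \<in> J \<Longrightarrow> has_bochner_integral (\<nu> i) (X i) (\<mu> i)"
    and X2: "\<And>i. i \<in> J \<Longrightarrow> has_bochner_integral (\<nu> i) (\<lambda>x. (norm (X i x))\<^sup>2) (q i)"
  shows "has_bochner_integral (PiM J \<nu>) (\<lambda>r. (norm (\<Sum>j\<in>J. X j (r j)))\<^sup>2)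
    ((norm (\<Sum>j\<in>J. \<mu> j))\<^sup>2 + (\<Sum>j\<in>J. q j - (norm (\<mu> j))\<^sup>2))"
proof -
  have "has_bochner_integral (PiM J \<nu>)
    (\<lambda>r. (\<Sum>j\<in>J. (norm (X j (r j)))\<^sup>2) + (\<Sum>j\<in>J. \<Sum>l\<in>J - {j}. X j (r j) \<bullet> X l (r l)))
    ((\<Sum>j\<in>J. q j) + (\<Sum>j\<in>J. \<Sum>l\<in>J - {j}. \<mu> j \<bullet> \<mu> l))"
    using nu J X
    by (intro has_bochner_integral_add has_bochner_integral_sum has_bochner_integral_PiM_inner
        has_bochner_integral_PiM_component[where f = "\<lambda>x. (norm (X _ x))\<^sup>2"] X2) auto
  then show ?thesis
    unfolding norm_sum_sq_expand[OF J] by (simp add: sum_subtractf add.commute)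
qed

text \<open>Jensen's inequality for the squared norm, from the nonnegativity of the
  variance.\<close>

lemma (in prob_space) norm_expectation_sq_le:
  fixes X :: "'a \<Rightarrow> 'c::euclidean_space"
  assumes "integrable M X" "integrable M (\<lambda>x. (norm (X x))\<^sup>2)"
  shows "(norm (expectation X))\<^sup>2 \<le> (\<integral>x. (norm (X x))\<^sup>2 \<partial>M)"
proof -
  have "0 \<le> (\<integral>x. (norm (X x - expectation X))\<^sup>2 \<partial>M)" by simp
  also have "\<dots> = (\<integral>x. (norm (X x))\<^sup>2 - 2 * (X x \<bullet> expectation X) + (norm (expectation X))\<^sup>2 \<partial>M)"
    by (simp add: power2_norm_eq_inner inner_simps inner_commute algebra_simps)
  also have "\<dots> = (\<integral>x. (norm (X x))\<^sup>2 \<partial>M) - (norm (expectation X))\<^sup>2"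
    using assms by (simp add: prob_space power2_norm_eq_inner)
  finally show ?thesis by simp
qed

text \<open>The definition supplies a second moment only;
  \<open>norm v \<le> 1 + (norm v)\<^sup>2\<close> turns it into a first one.\<close>

lemma contraction_compressor_integrable:
  fixes x :: "real^'d"
  assumes "contraction_compressor S Q \<delta>"
  shows "integrable S (\<lambda>s. x - Q s x)"
proof -
  interpret prob_space S using assms by (simp add: contraction_compressor_def)
  have Q: "(\<lambda>(s, x). Q s x) \<in> borel_measurable (S \<Otimes>\<^sub>M borel)"
    and int: "integrable S (\<lambda>s. (norm (x - Q s x))\<^sup>2)"
    using assms by (auto simp: contraction_compressor_def)
  have [measurable]: "(\<lambda>s. Q s x) \<in> borel_measurable S"
    using measurable_compose[OF measurable_Pair2' Q, of x] by simp
  show ?thesis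
  proof (rule Bochner_Integration.integrable_bound)
    show "integrable S (\<lambda>s. 1 + (norm (x - Q s x))\<^sup>2)" using int by simp
    have "norm v \<le> 1 + (norm v)\<^sup>2" for v :: "real^'d"
    proof -
      have "0 \<le> (norm v - 1)\<^sup>2 + norm v" by simp
      then show ?thesis by (simp add: power2_eq_square algebra_simps)
    qed
    then show "AE s in S. norm (x - Q s x) \<le> norm (1 + (norm (x - Q s x))\<^sup>2)" by simp
  qed simp
qed


section \<open>The law of the randomness of one node in one iteration, and moments under it\<close>

definition node_law :: "nat \<Rightarrow> 's measure \<Rightarrow> 's1 measure \<Rightarrow> (nat \<times> 's \<times> 's1) measure" where
  "node_law m S S1 = uniform_count_measure {..<m} \<Otimes>\<^sub>M (S \<Otimes>\<^sub>M S1)"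

lemma prob_space_node_law:
  assumes "prob_space S" "prob_space S1" "0 < m"
  shows "prob_space (node_law m S S1)"
proof -
  interpret U: prob_space "uniform_count_measure {..<m}"
    using assms(3) by (intro prob_space_uniform_count_measure) auto
  interpret S: prob_space S by fact
  interpret S1: prob_space S1 by fact
  interpret P: pair_prob_space S S1 ..
  interpret pair_prob_space "uniform_count_measure {..<m}" "S \<Otimes>\<^sub>M S1" ..
  show ?thesis unfolding node_law_def by unfold_locales
qed

text \<open>Marginalization in the three shapes that occur: dependence on the index alone, on the
  index and the seed of \<open>Q\<close>, on the index and the seed of \<open>Q1\<close>.\<close>

lemma
  fixes G :: "nat \<Rightarrow> 's \<Rightarrow> 'b::{banach,second_countable_topology}"
    and G1 :: "nat \<Rightarrow> 's1 \<Rightarrow> 'b"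
  assumes S: "prob_space S" and S1: "prob_space S1" and m: "0 < m"
  shows node_law_integral_index:
      "has_bochner_integral (node_law m S S1) (\<lambda>(i, s, s1). v i) ((1 / real m) *\<^sub>R (\<Sum>i<m. v i :: 'b))"
    and node_law_integral_seed:
      "(\<And>i. i < m \<Longrightarrow> has_bochner_integral S (G i) (v i)) \<Longrightarrow>
        has_bochner_integral (node_law m S S1) (\<lambda>(i, s, s1). G i s) ((1 / real m) *\<^sub>R (\<Sum>i<m. v i))"
    and node_law_integral_seed1:
      "(\<And>i. i < m \<Longrightarrow> has_bochner_integral S1 (G1 i) (v i)) \<Longrightarrow>
        has_bochner_integral (node_law m S S1) (\<lambda>(i, s, s1). G1 i s1) ((1 / real m) *\<^sub>R (\<Sum>i<m. v i))"
proof -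
  interpret S: prob_space S by fact
  interpret S1: prob_space S1 by fact
  interpret P: pair_prob_space S S1 ..
  have P: "prob_space (S \<Otimes>\<^sub>M S1)" by unfold_locales
  have *: "has_bochner_integral (node_law m S S1) (\<lambda>(i, s, s1). F i (s, s1)) ((1 / real m) *\<^sub>R (\<Sum>i<m. v i))"
    if "\<And>i. i < m \<Longrightarrow> has_bochner_integral (S \<Otimes>\<^sub>M S1) (F i) (v i)" for F :: "nat \<Rightarrow> 's \<times> 's1 \<Rightarrow> 'b" and v
    using has_bochner_integral_uniform_pair[OF P m that] by (simp add: node_law_def case_prod_unfold)
  show "has_bochner_integral (node_law m S S1) (\<lambda>(i, s, s1). v i) ((1 / real m) *\<^sub>R (\<Sum>i<m. v i))"
    using *[of "\<lambda>i _. v i" v] by (simp add: has_bochner_integral_iff P.prob_space)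
  show "has_bochner_integral (node_law m S S1) (\<lambda>(i, s, s1). G i s) ((1 / real m) *\<^sub>R (\<Sum>i<m. v i))"
    if "\<And>i. i < m \<Longrightarrow> has_bochner_integral S (G i) (v i)"
    using *[of "\<lambda>i c. G i (fst c)" v] has_bochner_integral_pair_fst[OF S1 that] by simp
  show "has_bochner_integral (node_law m S S1) (\<lambda>(i, s, s1). G1 i s1) ((1 / real m) *\<^sub>R (\<Sum>i<m. v i))"
    if "\<And>i. i < m \<Longrightarrow> has_bochner_integral S1 (G1 i) (v i)"
    using *[of "\<lambda>i c. G1 i (snd c)" v] has_bochner_integral_pair_snd[OF S S1 that] by simp
qed

text \<open>The exact moment depends on the compressor, hence the existential: integrability is
  claimed together with an upper bound, a pattern kept by the later moment lemmas.\<close>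

lemma compressed_error_second_moment:
  fixes v :: "nat \<Rightarrow> real^'d"
  assumes Q: "contraction_compressor S Q \<delta>" and S1: "prob_space S1" and m: "0 < m"
  shows "\<exists>q. has_bochner_integral (node_law m S S1) (\<lambda>(i, s, s1). (norm (v i - Q s (v i)))\<^sup>2) q
    \<and> q \<le> (1 - \<delta>) * ((1 / real m) * (\<Sum>i<m. (norm (v i))\<^sup>2))"
proof -
  have S: "prob_space S" using Q by (simp add: contraction_compressor_def)
  define q where "q = (\<lambda>i. \<integral>s. (norm (v i - Q s (v i)))\<^sup>2 \<partial>S)"
  have hb: "has_bochner_integral (node_law m S S1) (\<lambda>(i, s, s1). (norm (v i - Q s (v i)))\<^sup>2)
      ((1 / real m) *\<^sub>R (\<Sum>i<m. q i))"
    using Q by (intro node_law_integral_seed[OF S S1 m])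
      (simp add: has_bochner_integral_iff q_def contraction_compressor_def)
  have "(\<Sum>i<m. q i) \<le> (\<Sum>i<m. (1 - \<delta>) * (norm (v i))\<^sup>2)"
    using Q by (intro sum_mono) (simp add: q_def contraction_compressor_def)
  then have "(1 / real m) * (\<Sum>i<m. q i) \<le> (1 / real m) * (\<Sum>i<m. (1 - \<delta>) * (norm (v i))\<^sup>2)"
    by (intro mult_left_mono) auto
  also have "\<dots> = (1 - \<delta>) * ((1 / real m) * (\<Sum>i<m. (norm (v i))\<^sup>2))"
    by (simp add: sum_distrib_left[symmetric])
  finally show ?thesis using hb by (intro exI[of _ "(1 / real m) *\<^sub>R (\<Sum>i<m. q i)"]) simp
qed

text \<open>Unbiasedness in the scaled sense makes the mean residual of \<open>Q\<close> exactly
  \<open>1 - \<delta>\<close> times its argument, and averaging over the index is linear.\<close>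

lemma compressed_error_mean:
  fixes v :: "nat \<Rightarrow> real^'d"
  assumes Q: "contraction_compressor S Q \<delta>" and S1: "prob_space S1" and m: "0 < m"
    and unb: "\<And>x. (\<integral>s. Q s x \<partial>S) = \<delta> *\<^sub>R x"
  shows "has_bochner_integral (node_law m S S1) (\<lambda>(i, s, s1). v i - Q s (v i))
    ((1 - \<delta>) *\<^sub>R ((1 / real m) *\<^sub>R (\<Sum>i<m. v i)))"
proof -
  interpret prob_space S using Q by (simp add: contraction_compressor_def)
  have int: "integrable S (\<lambda>s. x - Q s x)" for x
    by (rule contraction_compressor_integrable[OF Q])
  have int': "integrable S (\<lambda>s. Q s x)" for x
    using Bochner_Integration.integrable_diff[OF integrable_const[of x] int[of x]] by simp
  have "has_bochner_integral S (\<lambda>s. x - Q s x) ((1 - \<delta>) *\<^sub>R x)" for x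
    using int int' unb[of x] by (simp add: has_bochner_integral_iff prob_space algebra_simps)
  then have "has_bochner_integral (node_law m S S1) (\<lambda>(i, s, s1). v i - Q s (v i))
    ((1 / real m) *\<^sub>R (\<Sum>i<m. (1 - \<delta>) *\<^sub>R v i))"
    by (intro node_law_integral_seed[OF prob_space_axioms S1 m])
  then show ?thesis by (simp add: scaleR_sum_right[symmetric] mult.commute)
qed

text \<open>The index and the seed of \<open>Q1\<close> are independent, so the cross term involves
  only the mean residual \<open>\<mu>\<close> and the mean increment \<open>v'\<close>. Bounding
  \<open>\<mu>\<close> by \<open>q\<close> stands in for unbiasedness where that is not
  assumed.\<close>

lemma shift_error_moments:
  fixes p :: "real^'d" and v :: "nat \<Rightarrow> real^'d"
  assumes S: "prob_space S" and Q1: "contraction_compressor S1 Q1 \<delta>1" and m: "0 < m"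
  defines "\<mu> \<equiv> (\<integral>s. p - Q1 s p \<partial>S1)" and "q \<equiv> (\<integral>s. (norm (p - Q1 s p))\<^sup>2 \<partial>S1)"
    and "v' \<equiv> (1 / real m) *\<^sub>R (\<Sum>i<m. v i)"
  shows "has_bochner_integral (node_law m S S1) (\<lambda>(i, s, s1). p - Q1 s1 p + (1 / real m) *\<^sub>R v i)
      (\<mu> + (1 / real m) *\<^sub>R v')"
    and "has_bochner_integral (node_law m S S1) (\<lambda>(i, s, s1). (norm (p - Q1 s1 p + (1 / real m) *\<^sub>R v i))\<^sup>2)
      (q + 2 / real m * (\<mu> \<bullet> v') + 1 / (real m)\<^sup>2 * ((1 / real m) * (\<Sum>i<m. (norm (v i))\<^sup>2)))"
    and "q \<le> (1 - \<delta>1) * (norm p)\<^sup>2" and "(norm \<mu>)\<^sup>2 \<le> q"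
    and "(\<And>x. (\<integral>s. Q1 s x \<partial>S1) = \<delta>1 *\<^sub>R x) \<Longrightarrow> \<mu> = (1 - \<delta>1) *\<^sub>R p"
proof -
  interpret S1: prob_space S1 using Q1 by (simp add: contraction_compressor_def)
  have hmu: "has_bochner_integral S1 (\<lambda>s. p - Q1 s p) \<mu>"
    unfolding \<mu>_def by (rule has_bochner_integral_integrable[OF contraction_compressor_integrable[OF Q1]])
  have hq: "has_bochner_integral S1 (\<lambda>s. (norm (p - Q1 s p))\<^sup>2) q"
    using Q1 by (simp add: contraction_compressor_def q_def has_bochner_integral_integrable)
  show "q \<le> (1 - \<delta>1) * (norm p)\<^sup>2"
    using Q1 by (simp add: contraction_compressor_def q_def)
  show "(norm \<mu>)\<^sup>2 \<le> q"
    unfolding \<mu>_def q_def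
    using hmu hq by (intro S1.norm_expectation_sq_le) (simp_all add: has_bochner_integral_iff)
  have "has_bochner_integral S1 (\<lambda>s. p - Q1 s p + (1 / real m) *\<^sub>R v i) (\<mu> + (1 / real m) *\<^sub>R v i)" for i
    using hmu by (simp add: has_bochner_integral_iff S1.prob_space)
  then have "has_bochner_integral (node_law m S S1) (\<lambda>(i, s, s1). p - Q1 s1 p + (1 / real m) *\<^sub>R v i)
      ((1 / real m) *\<^sub>R (\<Sum>i<m. \<mu> + (1 / real m) *\<^sub>R v i))"
    by (intro node_law_integral_seed1[OF S S1.prob_space_axioms m])
  moreover have "(1 / real m) *\<^sub>R (\<Sum>i<m. \<mu> + (1 / real m) *\<^sub>R v i) = \<mu> + (1 / real m) *\<^sub>R v'"
    unfolding sum.distrib scaleR_sum_right[symmetric] scaleR_add_right v'_def sum_constant_scaleR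
    using m by simp
  ultimately show "has_bochner_integral (node_law m S S1) (\<lambda>(i, s, s1). p - Q1 s1 p + (1 / real m) *\<^sub>R v i)
      (\<mu> + (1 / real m) *\<^sub>R v')" by simp
  have "has_bochner_integral S1 (\<lambda>s. (norm (p - Q1 s p))\<^sup>2 + 2 / real m * ((p - Q1 s p) \<bullet> v i) + 1 / (real m)\<^sup>2 * (norm (v i))\<^sup>2)
    (q + 2 / real m * (\<mu> \<bullet> v i) + 1 / (real m)\<^sup>2 * (norm (v i))\<^sup>2)" for i
    using hmu hq by (simp add: has_bochner_integral_iff S1.prob_space)
  moreover have "(norm (p - Q1 s p + (1 / real m) *\<^sub>R v i))\<^sup>2
    = (norm (p - Q1 s p))\<^sup>2 + 2 / real m * ((p - Q1 s p) \<bullet> v i) + 1 / (real m)\<^sup>2 * (norm (v i))\<^sup>2" for i s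
  proof -
    have "(norm (x + (1 / real m) *\<^sub>R v i))\<^sup>2
      = (norm x)\<^sup>2 + 2 / real m * (x \<bullet> v i) + 1 / (real m)\<^sup>2 * (norm (v i))\<^sup>2" for x
      unfolding power2_norm_eq_inner
      by (simp add: inner_add_left inner_add_right inner_commute power2_eq_square)
    then show ?thesis .
  qed
  ultimately have "has_bochner_integral S1 (\<lambda>s. (norm (p - Q1 s p + (1 / real m) *\<^sub>R v i))\<^sup>2)
    (q + 2 / real m * (\<mu> \<bullet> v i) + 1 / (real m)\<^sup>2 * (norm (v i))\<^sup>2)" for i
    by simp
  from node_law_integral_seed1[OF S S1.prob_space_axioms m this]
  have "has_bochner_integral (node_law m S S1) (\<lambda>(i, s, s1). (norm (p - Q1 s1 p + (1 / real m) *\<^sub>R v i))\<^sup>2)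
    ((1 / real m) *\<^sub>R (\<Sum>i<m. q + 2 / real m * (\<mu> \<bullet> v i) + 1 / (real m)\<^sup>2 * (norm (v i))\<^sup>2))"
    by simp
  also have "(1 / real m) *\<^sub>R (\<Sum>i<m. q + 2 / real m * (\<mu> \<bullet> v i) + 1 / (real m)\<^sup>2 * (norm (v i))\<^sup>2)
    = q + 2 / real m * (\<mu> \<bullet> v') + 1 / (real m)\<^sup>2 * ((1 / real m) * (\<Sum>i<m. (norm (v i))\<^sup>2))"
    unfolding v'_def inner_scaleR_right inner_sum_right sum.distrib sum_distrib_left[symmetric]
    using m by (simp add: field_simps)
  finally show "has_bochner_integral (node_law m S S1) (\<lambda>(i, s, s1). (norm (p - Q1 s1 p + (1 / real m) *\<^sub>R v i))\<^sup>2)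
      (q + 2 / real m * (\<mu> \<bullet> v') + 1 / (real m)\<^sup>2 * ((1 / real m) * (\<Sum>i<m. (norm (v i))\<^sup>2)))" .
  assume unb: "\<And>x. (\<integral>s. Q1 s x \<partial>S1) = \<delta>1 *\<^sub>R x"
  have int: "integrable S1 (\<lambda>s. Q1 s p)"
    using Bochner_Integration.integrable_diff[OF S1.integrable_const[of p] contraction_compressor_integrable[OF Q1, of p]]
    by simp
  show "\<mu> = (1 - \<delta>1) *\<^sub>R p"
    unfolding \<mu>_def using int by (simp add: unb S1.prob_space algebra_simps)
qed


section \<open>The saddle problem\<close>

lemma norm_sq_add_ge: "(norm (x + y))\<^sup>2 \<ge> (norm x)\<^sup>2 / 2 - (norm y)\<^sup>2"
  for x y :: "'a::real_inner"
proof -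
  have "0 \<le> (norm (x + 2 *\<^sub>R y))\<^sup>2" by simp
  then show ?thesis
    unfolding power2_norm_eq_inner by (simp add: inner_simps inner_commute)
qed

lemma norm_sq_add_le: "(norm (x + y))\<^sup>2 \<le> 2 * (norm x)\<^sup>2 + 2 * (norm y)\<^sup>2"
  for x y :: "'a::real_inner"
proof -
  have "0 \<le> (norm (x - y))\<^sup>2" by simp
  then show ?thesis
    unfolding power2_norm_eq_inner by (simp add: inner_simps inner_commute)
qed

lemma young_inner_ge: "x \<bullet> y \<ge> - (c * (norm x)\<^sup>2) - 1 / (4 * c) * (norm y)\<^sup>2"
  if "0 < c" for x y :: "'a::real_inner"
proof -
  have "0 \<le> c * (norm (x + (1 / (2 * c)) *\<^sub>R y))\<^sup>2" using that by simp
  also have "\<dots> = c * (norm x)\<^sup>2 + x \<bullet> y + 1 / (4 * c) * (norm y)\<^sup>2"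
    using that unfolding power2_norm_eq_inner
    by (simp add: inner_simps inner_commute field_simps)
  finally show ?thesis by simp
qed

text \<open>A three-point inequality for the proximal step, rewritten for the virtual points
  \<open>t\<close> and \<open>t'\<close>. The movement \<open>d'\<close> of the true iterate comes
  with \<open>1 / (4 * \<eta>)\<close> of its square: one half is kept for the Lyapunov function,
  the other is spent on the inner product of \<open>a\<close> with what the extrapolation leaves
  over.\<close>

lemma primal_step_inequality:
  fixes g :: "'a::euclidean_space \<Rightarrow> real" and x x' z d e e' u a xs us :: 'a
  assumes sc: "strongly_convex lam g" and lam: "0 < lam" and eta: "0 < \<eta>" and m: "1 \<le> m"
    and z: "z = x + \<theta> *\<^sub>R d" and th: "0 \<le> \<theta>"
    and x': "x' = proximal \<eta> g (x - \<eta> *\<^sub>R (u + a + e - e'))"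
  shows "(1 / (2 * \<eta>) + lam / 4) * (norm (x' - \<eta> *\<^sub>R e' - xs))\<^sup>2 + (g x' - g xs + us \<bullet> (x' - xs))
      + (u + (1 / m) *\<^sub>R a - us) \<bullet> (x' - x) + 1 / (8 * \<eta>) * (norm (x' - x))\<^sup>2
    \<le> 1 / (2 * \<eta>) * (norm (x - \<eta> *\<^sub>R e - xs))\<^sup>2 + \<theta> * ((u - us) \<bullet> d) + \<theta>\<^sup>2 / (8 * \<eta>) * (norm d)\<^sup>2
      + 4 * \<eta> * (norm a)\<^sup>2 - (u + a - us) \<bullet> (z - xs)
      + (\<eta> + lam * \<eta>\<^sup>2) / 2 * (norm e')\<^sup>2 + \<eta> / 2 * (norm e)\<^sup>2"
proof -
  define G where "G = u + a"
  define q where "q = x - \<eta> *\<^sub>R (G + e - e')"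
  define d' where "d' = x' - x"
  define t t' where "t = x - \<eta> *\<^sub>R e" and "t' = x' - \<eta> *\<^sub>R e'"
  define X where "X = t' - t"
  have x'q: "x' = proximal \<eta> g q" by (simp add: x' q_def G_def)
  have "g x' + 1 / (2 * \<eta>) * (norm (x' - q))\<^sup>2 + (lam / 2 + 1 / (2 * \<eta>)) * (norm (xs - x'))\<^sup>2
    \<le> g xs + 1 / (2 * \<eta>) * (norm (xs - q))\<^sup>2"
    unfolding x'q using sc lam eta by (intro proximal_growth) auto
  then have "g x' - g xs + lam / 2 * (norm (xs - x'))\<^sup>2
    \<le> 1 / (2 * \<eta>) * ((norm (xs - q))\<^sup>2 - (norm (x' - q))\<^sup>2 - (norm (xs - x'))\<^sup>2)"
    by (simp add: algebra_simps)
  also have "(norm (xs - q))\<^sup>2 - (norm (x' - q))\<^sup>2 - (norm (xs - x'))\<^sup>2 = 2 * ((xs - x') \<bullet> (x' - q))"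
    unfolding power2_norm_eq_inner by (simp add: inner_simps inner_commute)
  \<comment> \<open>Error feedback: \<open>e\<close> and \<open>e'\<close> are absorbed by the
    virtual points and only the uncompressed direction \<open>G\<close> remains.\<close>
  also have "x' - q = X + \<eta> *\<^sub>R G" by (simp add: q_def X_def t_def t'_def algebra_simps)
  also have "1 / (2 * \<eta>) * (2 * ((xs - x') \<bullet> (X + \<eta> *\<^sub>R G)))
    = - (1 / \<eta> * ((x' - xs) \<bullet> X)) - (x' - xs) \<bullet> G"
    using eta by (simp add: inner_simps field_simps)
  also have "1 / \<eta> * ((x' - xs) \<bullet> X) = 1 / \<eta> * ((t' - xs) \<bullet> X) + e' \<bullet> X"
    using eta by (simp add: t'_def inner_simps field_simps)
  also have "(t' - xs) \<bullet> X = ((norm (t' - xs))\<^sup>2 + (norm X)\<^sup>2 - (norm (t - xs))\<^sup>2) / 2"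
    unfolding power2_norm_eq_inner X_def by (simp add: inner_simps inner_commute)
  finally have 1: "g x' - g xs + lam / 2 * (norm (x' - xs))\<^sup>2 + (x' - xs) \<bullet> G
      + 1 / (2 * \<eta>) * (norm (t' - xs))\<^sup>2 + (1 / (2 * \<eta>) * (norm X)\<^sup>2 + e' \<bullet> X)
    \<le> 1 / (2 * \<eta>) * (norm (t - xs))\<^sup>2"
    by (simp add: norm_minus_commute add_divide_distrib diff_divide_distrib algebra_simps)
  \<comment> \<open>Strong convexity acts at \<open>x'\<close>; moving half of it to
    \<open>t'\<close> costs the multiple \<open>lam * \<eta>\<^sup>2 / 2\<close> of the squared
    error, which is where the weight \<open>lam / 4\<close> comes from.\<close>
  have 2: "lam / 4 * (norm (t' - xs))\<^sup>2 - lam * \<eta>\<^sup>2 / 2 * (norm e')\<^sup>2 \<le> lam / 2 * (norm (x' - xs))\<^sup>2"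
  proof -
    have "(norm (t' - xs))\<^sup>2 \<le> 2 * (norm (x' - xs))\<^sup>2 + 2 * (norm (- (\<eta> *\<^sub>R e')))\<^sup>2"
      using norm_sq_add_le[of "x' - xs" "- (\<eta> *\<^sub>R e')"] by (simp add: t'_def algebra_simps)
    then have "lam / 4 * (norm (t' - xs))\<^sup>2 \<le> lam / 4 * (2 * (norm (x' - xs))\<^sup>2 + 2 * (norm (- (\<eta> *\<^sub>R e')))\<^sup>2)"
      using lam by (intro mult_left_mono) auto
    then show ?thesis by (simp add: power_mult_distrib algebra_simps)
  qed
  \<comment> \<open>The right side is completed to the square of
    \<open>X + \<eta> *\<^sub>R e'\<close>, which equals \<open>d' + \<eta> *\<^sub>R e\<close>;
    from there the true movement is recovered.\<close>
  have 3: "1 / (4 * \<eta>) * (norm d')\<^sup>2 - \<eta> / 2 * (norm e)\<^sup>2 - \<eta> / 2 * (norm e')\<^sup>2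
    \<le> 1 / (2 * \<eta>) * (norm X)\<^sup>2 + e' \<bullet> X"
  proof -
    have "X + \<eta> *\<^sub>R e' = d' + \<eta> *\<^sub>R e" by (simp add: X_def t_def t'_def d'_def)
    then have "(norm (X + \<eta> *\<^sub>R e'))\<^sup>2 \<ge> (norm d')\<^sup>2 / 2 - (norm (\<eta> *\<^sub>R e))\<^sup>2"
      by (simp only: norm_sq_add_ge)
    moreover have "(norm (X + \<eta> *\<^sub>R e'))\<^sup>2 = (norm X)\<^sup>2 + 2 * \<eta> * (e' \<bullet> X) + \<eta>\<^sup>2 * (norm e')\<^sup>2"
      unfolding power2_norm_eq_inner by (simp add: inner_simps inner_commute power2_eq_square)
    ultimately have "1 / (2 * \<eta>) * ((norm d')\<^sup>2 / 2 - \<eta>\<^sup>2 * (norm e)\<^sup>2)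
      \<le> 1 / (2 * \<eta>) * ((norm X)\<^sup>2 + 2 * \<eta> * (e' \<bullet> X) + \<eta>\<^sup>2 * (norm e')\<^sup>2)"
      using eta by (intro mult_left_mono) (auto simp: power_mult_distrib)
    then show ?thesis using eta by (simp add: field_simps power2_eq_square)
  qed
  \<comment> \<open>Insert \<open>x' = z + d' - \<theta> *\<^sub>R d\<close>. The share
    \<open>1 / m\<close> of \<open>a\<close> is split off because
    \<open>u + (1 / m) *\<^sub>R a\<close> is the next \<open>u\<close>.\<close>
  have 4: "(x' - xs) \<bullet> G = us \<bullet> (x' - xs) + (G - us) \<bullet> (z - xs) + (u + (1 / m) *\<^sub>R a - us) \<bullet> d'
      - \<theta> * ((u - us) \<bullet> d) + a \<bullet> ((1 - 1 / m) *\<^sub>R d' - \<theta> *\<^sub>R d)"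
    unfolding G_def d'_def z
    by (simp add: inner_simps inner_commute algebra_simps)
  \<comment> \<open>Young with parameter \<open>4 * \<eta>\<close>; the doubling in
    \<open>norm_sq_add_le\<close> leaves \<open>1 / (8 * \<eta>)\<close> on each movement.\<close>
  have 5: "- (4 * \<eta> * (norm a)\<^sup>2) - 1 / (8 * \<eta>) * (norm d')\<^sup>2 - \<theta>\<^sup>2 / (8 * \<eta>) * (norm d)\<^sup>2
    \<le> a \<bullet> ((1 - 1 / m) *\<^sub>R d' - \<theta> *\<^sub>R d)"
  proof -
    have "(norm ((1 - 1 / m) *\<^sub>R d' - \<theta> *\<^sub>R d))\<^sup>2
      \<le> 2 * (norm ((1 - 1 / m) *\<^sub>R d'))\<^sup>2 + 2 * (norm (- (\<theta> *\<^sub>R d)))\<^sup>2"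
      using norm_sq_add_le[of "(1 - 1 / m) *\<^sub>R d'" "- (\<theta> *\<^sub>R d)"] by simp
    also have "\<dots> \<le> 2 * (1 * norm d')\<^sup>2 + 2 * (norm (- (\<theta> *\<^sub>R d)))\<^sup>2"
      unfolding norm_scaleR using m by (intro add_right_mono mult_left_mono power_mono mult_right_mono) auto
    finally have "1 / (4 * (4 * \<eta>)) * (norm ((1 - 1 / m) *\<^sub>R d' - \<theta> *\<^sub>R d))\<^sup>2
      \<le> 1 / (4 * (4 * \<eta>)) * (2 * (norm d')\<^sup>2 + 2 * (\<theta>\<^sup>2 * (norm d)\<^sup>2))"
      using eta by (intro mult_left_mono) (auto simp: power_mult_distrib)
    also have "\<dots> = 1 / (8 * \<eta>) * (norm d')\<^sup>2 + \<theta>\<^sup>2 / (8 * \<eta>) * (norm d)\<^sup>2"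
      using eta by (simp add: field_simps)
    finally show ?thesis
      using young_inner_ge[of "4 * \<eta>" a "(1 - 1 / m) *\<^sub>R d' - \<theta> *\<^sub>R d"] eta by linarith
  qed
  have 6: "1 / (4 * \<eta>) * (norm d')\<^sup>2 = 1 / (8 * \<eta>) * (norm d')\<^sup>2 + 1 / (8 * \<eta>) * (norm d')\<^sup>2"
    by simp
  have 7: "(1 / (2 * \<eta>) + lam / 4) * (norm (t' - xs))\<^sup>2 = 1 / (2 * \<eta>) * (norm (t' - xs))\<^sup>2 + lam / 4 * (norm (t' - xs))\<^sup>2"
    "(\<eta> + lam * \<eta>\<^sup>2) / 2 * (norm e')\<^sup>2 = \<eta> / 2 * (norm e')\<^sup>2 + lam * \<eta>\<^sup>2 / 2 * (norm e')\<^sup>2"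
    by (simp_all add: field_simps)
  show ?thesis
    unfolding G_def[symmetric] d'_def[symmetric] t'_def[symmetric] t_def[symmetric] 7
    using 1 2 3 4 5 6 by linarith
qed


section \<open>The saddle value, its solution, and one dual step\<close>

locale saddle_problem =
  fixes m n :: nat
    and A :: "nat \<Rightarrow> nat \<Rightarrow> real^'t^'d"
    and \<phi> :: "nat \<Rightarrow> nat \<Rightarrow> real^'t \<Rightarrow> real"
    and G :: "nat \<Rightarrow> nat \<Rightarrow> real^'t \<Rightarrow> real^'t"
    and g :: "real^'d \<Rightarrow> real"
    and lam \<gamma> :: real
    and xs :: "real^'d" and Ys :: "nat \<Rightarrow> nat \<Rightarrow> real^'t"
  assumes m: "1 \<le> m" and n: "1 \<le> n" and lam: "0 < lam" and gam: "0 < \<gamma>"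
    and convex_phi: "\<And>i \<tau>. i < m \<Longrightarrow> \<tau> < n \<Longrightarrow> convex_on UNIV (\<phi> i \<tau>)"
    and gderiv_phi: "\<And>i \<tau> w. i < m \<Longrightarrow> \<tau> < n \<Longrightarrow> GDERIV (\<phi> i \<tau>) w :> G i \<tau> w"
    and lipschitz_phi: "\<And>i \<tau>. i < m \<Longrightarrow> \<tau> < n \<Longrightarrow> (1 / \<gamma>)-lipschitz_on UNIV (G i \<tau>)"
    and sc_g: "strongly_convex lam g"
    and minmax: "minmax_solution (saddle_fun m n A \<phi> g) xs Ys"
begin

definition At :: "nat \<Rightarrow> nat \<Rightarrow> real^'d \<Rightarrow> real^'t" where
  "At i \<tau> x = transpose (A i \<tau>) *v x"

definition primal :: "real^'d \<Rightarrow> real" where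
  "primal x = g x + 1 / real (m * n) * (\<Sum>\<tau><n. \<Sum>i<m. \<phi> i \<tau> (At i \<tau> x))"

text \<open>The value that the averaged vector \<open>u\<close> has at \<open>Ys\<close>; by
  \<open>Ys_eq\<close> it is the gradient at \<open>xs\<close> of the smooth part of the primal
  objective.\<close>

definition us :: "real^'d" where
  "us = (1 / real (m * n)) *\<^sub>R (\<Sum>\<tau><n. \<Sum>i<m. A i \<tau> *v Ys i \<tau>)"

definition dual_finite :: "(nat \<Rightarrow> nat \<Rightarrow> real^'t) \<Rightarrow> bool" where
  "dual_finite Y \<longleftrightarrow> (\<forall>i<m. \<forall>\<tau><n. conjugate (\<phi> i \<tau>) (Y i \<tau>) \<noteq> \<infinity>)"

definition conj_real :: "nat \<Rightarrow> nat \<Rightarrow> real^'t \<Rightarrow> real" where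
  "conj_real i \<tau> y = real_of_ereal (conjugate (\<phi> i \<tau>) y)"

lemma ereal_conj: "conjugate (\<phi> i \<tau>) y \<noteq> \<infinity> \<Longrightarrow> ereal (conj_real i \<tau> y) = conjugate (\<phi> i \<tau>) y"
  unfolding conj_real_def using conjugate_not_MInfty[of "\<phi> i \<tau>" y]
  by (cases "conjugate (\<phi> i \<tau>) y") auto

lemma inner_At: "y \<bullet> At i \<tau> x = (A i \<tau> *v y) \<bullet> x"
  unfolding At_def by (rule inner_transpose_mult)

lemma At_diff: "At i \<tau> (x - y) = At i \<tau> x - At i \<tau> y"
  by (simp only: At_def matrix_vector_mult_diff_distrib)

lemma saddle_fun_finite:
  assumes "dual_finite Y"
  shows "saddle_fun m n A \<phi> g x Y
    = ereal (g x + 1 / real (m * n) * (\<Sum>\<tau><n. \<Sum>i<m. Y i \<tau> \<bullet> At i \<tau> x - conj_real i \<tau> (Y i \<tau>)))"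
proof -
  have "(\<Sum>\<tau><n. \<Sum>i<m. ereal (Y i \<tau> \<bullet> (transpose (A i \<tau>) *v x)) - conjugate (\<phi> i \<tau>) (Y i \<tau>))
    = (\<Sum>\<tau><n. \<Sum>i<m. ereal (Y i \<tau> \<bullet> At i \<tau> x - conj_real i \<tau> (Y i \<tau>)))"
    using assms by (intro sum.cong refl) (auto simp: dual_finite_def At_def ereal_conj[symmetric])
  then show ?thesis unfolding saddle_fun_def by simp
qed

text \<open>No summand is \<open>\<infinity>\<close> because conjugates are never
  \<open>- \<infinity>\<close>, so a single infinite conjugate decides both sums.\<close>

lemma saddle_fun_infinite:
  assumes "\<not> dual_finite Y"
  shows "saddle_fun m n A \<phi> g x Y = - \<infinity>"
proof -
  define f where "f = (\<lambda>\<tau> i. ereal (Y i \<tau> \<bullet> (transpose (A i \<tau>) *v x)) - conjugate (\<phi> i \<tau>) (Y i \<tau>))"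
  obtain i0 \<tau>0 where i0: "i0 < m" "\<tau>0 < n" "conjugate (\<phi> i0 \<tau>0) (Y i0 \<tau>0) = \<infinity>"
    using assms by (auto simp: dual_finite_def)
  have ninf: "f \<tau> i \<noteq> \<infinity>" for \<tau> i
    unfolding f_def using conjugate_not_MInfty[of "\<phi> i \<tau>" "Y i \<tau>"]
    by (cases "conjugate (\<phi> i \<tau>) (Y i \<tau>)") auto
  have minf: "sum h J = - \<infinity>" if "finite J" "j \<in> J" "h j = - \<infinity>" "\<And>j. h j \<noteq> \<infinity>"
    for h :: "nat \<Rightarrow> ereal" and J j
  proof -
    have "sum h (J - {j}) \<noteq> \<infinity>" using that by (simp add: sum_Pinfty)
    then show ?thesis using that by (simp add: sum.remove[OF that(1,2)])
  qed
  have "f \<tau>0 i0 = - \<infinity>" unfolding f_def i0(3) by simp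
  then have "(\<Sum>i<m. f \<tau>0 i) = - \<infinity>"
    using i0 ninf by (intro minf[of _ i0]) auto
  moreover have "(\<Sum>i<m. f \<tau> i) \<noteq> \<infinity>" for \<tau>
    using ninf by (simp add: sum_Pinfty)
  ultimately have "(\<Sum>\<tau><n. \<Sum>i<m. f \<tau> i) = - \<infinity>"
    using i0 by (intro minf[of "{..<n}" \<tau>0 "\<lambda>\<tau>. \<Sum>i<m. f \<tau> i"]) auto
  moreover have "saddle_fun m n A \<phi> g x Y = ereal (g x) + ereal (1 / real (m * n)) * (\<Sum>\<tau><n. \<Sum>i<m. f \<tau> i)"
    unfolding saddle_fun_def f_def ..
  ultimately show ?thesis using m n by simp
qed

lemma conj_gradient:
  assumes "i < m" "\<tau> < n"
  shows "conjugate (\<phi> i \<tau>) (G i \<tau> p) = ereal (G i \<tau> p \<bullet> p - \<phi> i \<tau> p)"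
  using convex_phi[OF assms] gderiv_phi[OF assms] by (rule conjugate_gradient)

lemma conj_strong_convexity:
  assumes "i < m" "\<tau> < n" "conjugate (\<phi> i \<tau>) y \<noteq> \<infinity>"
  shows "y \<bullet> p - \<phi> i \<tau> p + \<gamma> / 2 * (norm (y - G i \<tau> p))\<^sup>2 \<le> conj_real i \<tau> y"
  using conjugate_strong_convexity[OF gderiv_phi[OF assms(1,2)] lipschitz_phi[OF assms(1,2)] gam, of y p]
  by (simp add: ereal_conj[OF assms(3), symmetric])

text \<open>Weak duality, by Fenchel-Young term by term; the next lemma shows that the gradients
  attain the bound.\<close>

lemma saddle_fun_le_primal: "saddle_fun m n A \<phi> g x Y \<le> ereal (primal x)"
proof (cases "dual_finite Y")
  case True
  have "Y i \<tau> \<bullet> At i \<tau> x - conj_real i \<tau> (Y i \<tau>) \<le> \<phi> i \<tau> (At i \<tau> x)" if "i < m" "\<tau> < n" for i \<tau>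
  proof -
    have "0 \<le> \<gamma> / 2 * (norm (Y i \<tau> - G i \<tau> (At i \<tau> x)))\<^sup>2" using gam by simp
    then show ?thesis
      using conj_strong_convexity[OF that, of "Y i \<tau>" "At i \<tau> x"] True that by (auto simp: dual_finite_def)
  qed
  then have "(\<Sum>\<tau><n. \<Sum>i<m. Y i \<tau> \<bullet> At i \<tau> x - conj_real i \<tau> (Y i \<tau>)) \<le> (\<Sum>\<tau><n. \<Sum>i<m. \<phi> i \<tau> (At i \<tau> x))"
    by (intro sum_mono) auto
  then show ?thesis
    unfolding saddle_fun_finite[OF True] primal_def by (simp add: mult_left_mono divide_right_mono)
qed (simp add: saddle_fun_infinite)

lemma saddle_fun_gradient: "saddle_fun m n A \<phi> g x (\<lambda>i \<tau>. G i \<tau> (At i \<tau> x)) = ereal (primal x)"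
proof -
  have "dual_finite (\<lambda>i \<tau>. G i \<tau> (At i \<tau> x))" by (simp add: dual_finite_def conj_gradient)
  then show ?thesis
    by (simp add: saddle_fun_finite primal_def conj_real_def conj_gradient)
qed

lemma SUP_saddle_fun: "(SUP Y. saddle_fun m n A \<phi> g x Y) = ereal (primal x)"
  by (rule antisym[OF SUP_least[OF saddle_fun_le_primal]])
    (simp add: SUP_upper saddle_fun_gradient[symmetric])

lemma primal_min: "primal xs \<le> primal x"
  using minmax unfolding minmax_solution_def SUP_saddle_fun is_arg_min_linorder by simp

lemma saddle_fun_xs_Ys: "saddle_fun m n A \<phi> g xs Ys = ereal (primal xs)"
proof (rule antisym[OF saddle_fun_le_primal])
  show "ereal (primal xs) \<le> saddle_fun m n A \<phi> g xs Ys"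
    using minmax unfolding minmax_solution_def is_arg_max_def saddle_fun_gradient[symmetric]
    by (auto simp: not_less)
qed

lemma dual_finite_Ys: "dual_finite Ys"
  using saddle_fun_xs_Ys saddle_fun_infinite[of Ys xs] by auto

text \<open>At the solution the Fenchel-Young gaps \<open>D\<close> are nonnegative and sum to 0.
  Each gap dominates the squared distance of \<open>Ys\<close> to the gradient, so the dual solution
  is explicit on the index range.\<close>

lemma Ys_eq:
  assumes it: "i < m" "\<tau> < n"
  shows "Ys i \<tau> = G i \<tau> (At i \<tau> xs)"
proof -
  define D where "D = (\<lambda>\<tau> i. \<phi> i \<tau> (At i \<tau> xs) - (Ys i \<tau> \<bullet> At i \<tau> xs - conj_real i \<tau> (Ys i \<tau>)))"
  have D: "\<gamma> / 2 * (norm (Ys i \<tau> - G i \<tau> (At i \<tau> xs)))\<^sup>2 \<le> D \<tau> i" if "i < m" "\<tau> < n" for i \<tau>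
    using conj_strong_convexity[OF that, of "Ys i \<tau>" "At i \<tau> xs"] dual_finite_Ys that
    by (auto simp: dual_finite_def D_def)
  then have D0: "0 \<le> D \<tau> i" if "i < m" "\<tau> < n" for i \<tau>
    using that gam by (meson D order_trans mult_nonneg_nonneg zero_le_power2 less_imp_le half_gt_zero)
  have "(\<Sum>\<tau><n. \<Sum>i<m. Ys i \<tau> \<bullet> At i \<tau> xs - conj_real i \<tau> (Ys i \<tau>)) = (\<Sum>\<tau><n. \<Sum>i<m. \<phi> i \<tau> (At i \<tau> xs))"
    using saddle_fun_xs_Ys m n unfolding saddle_fun_finite[OF dual_finite_Ys] primal_def by simp
  then have "(\<Sum>\<tau><n. \<Sum>i<m. D \<tau> i) = 0" by (simp add: D_def sum_subtractf)
  then have "(\<Sum>i<m. D \<tau> i) = 0"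
    using it D0 by (subst (asm) sum_nonneg_eq_0_iff) (auto intro!: sum_nonneg)
  then have "D \<tau> i = 0"
    using it D0 by (subst (asm) sum_nonneg_eq_0_iff) auto
  then have "(norm (Ys i \<tau> - G i \<tau> (At i \<tau> xs)))\<^sup>2 \<le> 0"
    using D[OF it] gam by (simp add: mult_le_0_iff)
  then show ?thesis by simp
qed

lemma inner_us: "us \<bullet> v = 1 / real (m * n) * (\<Sum>\<tau><n. \<Sum>i<m. Ys i \<tau> \<bullet> At i \<tau> v)"
  unfolding us_def inner_scaleR_left inner_sum_left inner_At ..

text \<open>\<open>xs\<close> is known to minimize the primal objective, while growth is wanted for
  the saddle function at \<open>Ys\<close>. Along the segment to \<open>x\<close> the smooth part is
  at most its linearization, with slope given by \<open>us\<close>, plus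
  \<open>a\<^sup>2 * C\<close>; dividing by \<open>a\<close> and letting \<open>a = 1 - z\<close>
  tend to 0 removes \<open>C\<close>.\<close>

lemma primal_gap_growth: "lam / 2 * (norm (x - xs))\<^sup>2 \<le> g x - g xs + us \<bullet> (x - xs)"
proof -
  define h where "h = (\<lambda>x. 1 / real (m * n) * (\<Sum>\<tau><n. \<Sum>i<m. \<phi> i \<tau> (At i \<tau> x)))"
  define C where "C = 1 / real (m * n) * (\<Sum>\<tau><n. \<Sum>i<m. (1 / \<gamma>) / 2 * (norm (At i \<tau> (x - xs)))\<^sup>2)"
  have C: "0 \<le> C" unfolding C_def using gam by (intro mult_nonneg_nonneg sum_nonneg) auto
  have h: "h (xs + a *\<^sub>R (x - xs)) \<le> h xs + a * (us \<bullet> (x - xs)) + a\<^sup>2 * C" for a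
  proof -
    have "\<phi> i \<tau> (At i \<tau> (xs + a *\<^sub>R (x - xs))) \<le> \<phi> i \<tau> (At i \<tau> xs) + a * (Ys i \<tau> \<bullet> At i \<tau> (x - xs))
      + a\<^sup>2 * ((1 / \<gamma>) / 2 * (norm (At i \<tau> (x - xs)))\<^sup>2)" if "i < m" "\<tau> < n" for i \<tau>
    proof -
      have eq: "At i \<tau> (xs + a *\<^sub>R (x - xs)) - At i \<tau> xs = a *\<^sub>R At i \<tau> (x - xs)"
        unfolding At_diff[symmetric] by (simp add: At_def matrix_vector_mult_scaleR)
      show ?thesis
        using smooth_quadratic_upper_bound[OF gderiv_phi[OF that] lipschitz_phi[OF that],
            of "At i \<tau> (xs + a *\<^sub>R (x - xs))" "At i \<tau> xs"]
        unfolding eq Ys_eq[OF that, symmetric] by (simp add: power_mult_distrib mult_ac)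
    qed
    then have "h (xs + a *\<^sub>R (x - xs)) \<le> 1 / real (m * n) * (\<Sum>\<tau><n. \<Sum>i<m. \<phi> i \<tau> (At i \<tau> xs)
      + a * (Ys i \<tau> \<bullet> At i \<tau> (x - xs)) + a\<^sup>2 * ((1 / \<gamma>) / 2 * (norm (At i \<tau> (x - xs)))\<^sup>2))"
      unfolding h_def by (intro mult_left_mono sum_mono) auto
    also have "\<dots> = h xs + a * (us \<bullet> (x - xs)) + a\<^sup>2 * C"
      unfolding h_def inner_us C_def sum.distrib sum_distrib_left[symmetric] by (simp add: algebra_simps add_divide_distrib)
    finally show ?thesis .
  qed
  have *: "z * (lam / 2 * (norm (x - xs))\<^sup>2) \<le> (g x - g xs + us \<bullet> (x - xs)) + (1 - z) * C"
    if z: "0 < z" "z < 1" for z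
  proof -
    define a where "a = 1 - z"
    have a: "0 < a" "a < 1" using z by (auto simp: a_def)
    have "primal xs \<le> primal (xs + a *\<^sub>R (x - xs))" by (rule primal_min)
    then have "g xs + h xs \<le> g (xs + a *\<^sub>R (x - xs)) + h (xs + a *\<^sub>R (x - xs))"
      by (simp add: primal_def h_def)
    moreover have "xs + a *\<^sub>R (x - xs) = a *\<^sub>R x + (1 - a) *\<^sub>R xs" by (simp add: algebra_simps)
    moreover have "g (a *\<^sub>R x + (1 - a) *\<^sub>R xs) \<le> a * g x + (1 - a) * g xs - lam / 2 * a * (1 - a) * (norm (x - xs))\<^sup>2"
      using a by (intro strongly_convexD[OF sc_g]) auto
    ultimately have "a * (z * (lam / 2 * (norm (x - xs))\<^sup>2)) \<le> a * ((g x - g xs + us \<bullet> (x - xs)) + (1 - z) * C)"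
      using h[of a] by (simp add: a_def algebra_simps power2_eq_square)
    then show ?thesis using a by simp
  qed
  have "((\<lambda>z. z * (lam / 2 * (norm (x - xs))\<^sup>2)) \<longlongrightarrow> 1 * (lam / 2 * (norm (x - xs))\<^sup>2)) (at_left 1)"
    by (intro tendsto_intros)
  moreover have "((\<lambda>z. (g x - g xs + us \<bullet> (x - xs)) + (1 - z) * C) \<longlongrightarrow> (g x - g xs + us \<bullet> (x - xs)) + (1 - 1) * C) (at_left 1)"
    by (intro tendsto_intros)
  moreover have "\<forall>\<^sub>F z in at_left (1::real). z * (lam / 2 * (norm (x - xs))\<^sup>2) \<le> (g x - g xs + us \<bullet> (x - xs)) + (1 - z) * C"
    using eventually_at_left_real[OF zero_less_one] by (rule eventually_mono) (use * in auto)
  ultimately have "1 * (lam / 2 * (norm (x - xs))\<^sup>2) \<le> (g x - g xs + us \<bullet> (x - xs)) + (1 - 1) * C"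
    by (intro tendsto_le[OF trivial_limit_at_left_real])
  then show ?thesis by simp
qed

text \<open>The Bregman divergence of the conjugate from \<open>Ys\<close>, with subgradient
  \<open>At i \<tau> xs\<close>. Its sum over all coordinates, divided by \<open>n\<close>, is
  \<open>m\<close> times the dual gap in the Lyapunov functions.\<close>

definition bregman :: "nat \<Rightarrow> nat \<Rightarrow> real^'t \<Rightarrow> real" where
  "bregman i \<tau> y = conj_real i \<tau> y - conj_real i \<tau> (Ys i \<tau>) - (y - Ys i \<tau>) \<bullet> At i \<tau> xs"

lemma bregman_ge:
  assumes "i < m" "\<tau> < n" "conjugate (\<phi> i \<tau>) y \<noteq> \<infinity>"
  shows "\<gamma> / 2 * (norm (y - Ys i \<tau>))\<^sup>2 \<le> bregman i \<tau> y"
proof -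
  have "conj_real i \<tau> (Ys i \<tau>) = Ys i \<tau> \<bullet> At i \<tau> xs - \<phi> i \<tau> (At i \<tau> xs)"
    using assms by (simp add: Ys_eq conj_real_def conj_gradient)
  then show ?thesis
    using conj_strong_convexity[OF assms, of "At i \<tau> xs"] assms
    by (simp add: bregman_def Ys_eq inner_diff_left)
qed

lemma bregman_nonneg:
  assumes "i < m" "\<tau> < n" "conjugate (\<phi> i \<tau>) y \<noteq> \<infinity>"
  shows "0 \<le> bregman i \<tau> y"
  using bregman_ge[OF assms] gam by (meson order_trans mult_nonneg_nonneg zero_le_power2 less_imp_le half_gt_zero)

text \<open>The dual update in closed form: for valid indices a Lipschitz function of
  \<open>z\<close> and \<open>y\<close> with values in the domain of the conjugate.\<close>

definition dual_prox :: "real \<Rightarrow> real^'d \<Rightarrow> nat \<Rightarrow> nat \<Rightarrow> real^'t \<Rightarrow> real^'t" where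
  "dual_prox \<sigma> z i \<tau> y = G i \<tau> (proximal (1 / \<sigma>) (\<phi> i \<tau>) (At i \<tau> z + (1 / \<sigma>) *\<^sub>R y))"

lemma conjugate_dual_prox_finite:
  "i < m \<Longrightarrow> \<tau> < n \<Longrightarrow> conjugate (\<phi> i \<tau>) (dual_prox \<sigma> z i \<tau> y) \<noteq> \<infinity>"
  unfolding dual_prox_def by (simp add: conj_gradient)

lemma arg_max_dual_step:
  assumes "i < m" "\<tau> < n" "0 < \<sigma>"
  shows "arg_max (\<lambda>v. ereal (v \<bullet> (transpose (A i \<tau>) *v z)) - conjugate (\<phi> i \<tau>) v
      - ereal (1 / (2 * \<sigma>) * (norm (v - y))\<^sup>2)) (\<lambda>_. True) = dual_prox \<sigma> z i \<tau> y"
  unfolding dual_prox_def At_def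
  by (rule arg_max_eq_dual_prox[OF convex_phi[OF assms(1,2)] gderiv_phi[OF assms(1,2)]
        lipschitz_phi[OF assms(1,2)] gam assms(3)])

text \<open>The growth of the dual objective tested at \<open>Ys\<close>; subtracting the affine
  part at \<open>xs\<close> turns conjugate differences into Bregman terms and leaves the inner
  product with \<open>z - xs\<close>.\<close>

lemma dual_step_inequality:
  fixes y :: "real^'t" and z :: "real^'d"
  assumes it: "i < m" "\<tau> < n" and sig: "0 < \<sigma>"
  defines "y' \<equiv> dual_prox \<sigma> z i \<tau> y"
  shows "(1 / (2 * \<sigma>) + \<gamma> / 2) * (norm (y' - Ys i \<tau>))\<^sup>2 + bregman i \<tau> y'
    \<le> 1 / (2 * \<sigma>) * (norm (y - Ys i \<tau>))\<^sup>2 - 1 / (2 * \<sigma>) * (norm (y' - y))\<^sup>2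
      + (A i \<tau> *v (y' - Ys i \<tau>)) \<bullet> (z - xs)"
proof -
  define p where "p = proximal (1 / \<sigma>) (\<phi> i \<tau>) (At i \<tau> z + (1 / \<sigma>) *\<^sub>R y)"
  have y': "y' = G i \<tau> p" by (simp add: y'_def dual_prox_def p_def)
  have c: "conj_real i \<tau> y' = y' \<bullet> p - \<phi> i \<tau> p" unfolding y' conj_real_def conj_gradient[OF it] by simp
  have fin: "conjugate (\<phi> i \<tau>) (Ys i \<tau>) \<noteq> \<infinity>" using dual_finite_Ys it by (auto simp: dual_finite_def)
  have "ereal (Ys i \<tau> \<bullet> At i \<tau> z) - conjugate (\<phi> i \<tau>) (Ys i \<tau>) - ereal (1 / (2 * \<sigma>) * (norm (Ys i \<tau> - y))\<^sup>2)
    \<le> ereal (y' \<bullet> At i \<tau> z - conj_real i \<tau> y' - 1 / (2 * \<sigma>) * (norm (y' - y))\<^sup>2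
        - (\<gamma> / 2 + 1 / (2 * \<sigma>)) * (norm (Ys i \<tau> - y'))\<^sup>2)"
    unfolding c unfolding y' p_def
    by (rule dual_prox_growth[OF convex_phi[OF it] gderiv_phi[OF it] lipschitz_phi[OF it] gam sig])
  then have "Ys i \<tau> \<bullet> At i \<tau> z - conj_real i \<tau> (Ys i \<tau>) - 1 / (2 * \<sigma>) * (norm (Ys i \<tau> - y))\<^sup>2
    \<le> y' \<bullet> At i \<tau> z - conj_real i \<tau> y' - 1 / (2 * \<sigma>) * (norm (y' - y))\<^sup>2
        - (\<gamma> / 2 + 1 / (2 * \<sigma>)) * (norm (Ys i \<tau> - y'))\<^sup>2"
    unfolding ereal_conj[OF fin, symmetric] by simp
  moreover have "(A i \<tau> *v (y' - Ys i \<tau>)) \<bullet> (z - xs) = (y' - Ys i \<tau>) \<bullet> At i \<tau> z - (y' - Ys i \<tau>) \<bullet> At i \<tau> xs"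
    by (simp add: inner_At inner_diff_right)
  ultimately show ?thesis
    unfolding bregman_def by (simp add: norm_minus_commute inner_diff_left algebra_simps)
qed

end


section \<open>Second moments of the compression errors\<close>

text \<open>Young's inequality with \<open>c\<close> such that
  \<open>(1 - \<delta>) * (1 + c) = 1 - \<delta> / 2\<close>: half of the contraction survives the
  perturbation \<open>y\<close>. For \<open>\<delta> = 1\<close> no such \<open>c\<close> exists,
  but then the left side vanishes.\<close>

lemma contraction_split:
  fixes x y :: "'a::real_inner"
  assumes d: "0 < \<delta>" "\<delta> \<le> 1"
  shows "(1 - \<delta>) * (norm (x + y))\<^sup>2 \<le> (1 - \<delta> / 2) * (norm x)\<^sup>2 + 2 * (1 - \<delta>) / \<delta> * (norm y)\<^sup>2"
proof (cases "\<delta> = 1")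
  case True then show ?thesis by simp
next
  case False
  define c where "c = \<delta> / (2 * (1 - \<delta>))"
  have c: "0 < c" using d False by (simp add: c_def)
  have "(norm (x + y))\<^sup>2 = (norm x)\<^sup>2 + 2 * (x \<bullet> y) + (norm y)\<^sup>2"
    unfolding power2_norm_eq_inner by (simp add: inner_simps inner_commute)
  moreover have "2 * (x \<bullet> y) \<le> c * (norm x)\<^sup>2 + 1 / c * (norm y)\<^sup>2"
    using young_inner_ge[of "c / 2" "- x" y] c by simp
  ultimately have "(1 - \<delta>) * (norm (x + y))\<^sup>2 \<le> (1 - \<delta>) * ((norm x)\<^sup>2 + (c * (norm x)\<^sup>2 + 1 / c * (norm y)\<^sup>2) + (norm y)\<^sup>2)"
    using d by (intro mult_left_mono) auto
  also have "\<dots> = ((1 - \<delta>) + (1 - \<delta>) * c) * (norm x)\<^sup>2 + ((1 - \<delta>) * (1 / c) + (1 - \<delta>)) * (norm y)\<^sup>2"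
    by (simp add: algebra_simps)
  also have "(1 - \<delta>) + (1 - \<delta>) * c = 1 - \<delta> / 2" using False by (simp add: c_def field_simps)
  also have "(1 - \<delta>) * (1 / c) + (1 - \<delta>) = (1 - \<delta>) * (2 - \<delta>) / \<delta>"
    using d False by (simp add: c_def field_simps)
  also have "(1 - \<delta>) * (2 - \<delta>) / \<delta> * (norm y)\<^sup>2 \<le> 2 * (1 - \<delta>) / \<delta> * (norm y)\<^sup>2"
    using d mult_left_mono[of "2 - \<delta>" 2 "1 - \<delta>"]
    by (intro mult_right_mono divide_right_mono) (auto simp: mult.commute)
  finally show ?thesis by simp
qed

text \<open>Convexity of the squared norm, with \<open>y\<close> written as \<open>\<delta>\<close>
  times \<open>(1 / \<delta>) *\<^sub>R y\<close>. Because the contraction acts on the vector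
  itself, the full factor \<open>1 - \<delta>\<close> is kept.\<close>

lemma norm_convex_combination_sq:
  fixes x y :: "'a::real_inner"
  assumes d: "0 < \<delta>" "\<delta> \<le> 1"
  shows "(norm ((1 - \<delta>) *\<^sub>R x + y))\<^sup>2 \<le> (1 - \<delta>) * (norm x)\<^sup>2 + 1 / \<delta> * (norm y)\<^sup>2"
proof -
  have "(norm ((1 - \<delta>) *\<^sub>R x + (1 - (1 - \<delta>)) *\<^sub>R ((1 / \<delta>) *\<^sub>R y) - 0))\<^sup>2
    = (1 - \<delta>) * (norm (x - 0))\<^sup>2 + (1 - (1 - \<delta>)) * (norm ((1 / \<delta>) *\<^sub>R y - 0))\<^sup>2
      - (1 - \<delta>) * (1 - (1 - \<delta>)) * (norm (x - (1 / \<delta>) *\<^sub>R y))\<^sup>2"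
    by (rule norm_sq_combination)
  moreover have "0 \<le> (1 - \<delta>) * (1 - (1 - \<delta>)) * (norm (x - (1 / \<delta>) *\<^sub>R y))\<^sup>2"
    using d by simp
  moreover have "(1 - (1 - \<delta>)) * (norm ((1 / \<delta>) *\<^sub>R y - 0))\<^sup>2 = 1 / \<delta> * (norm y)\<^sup>2"
    using d by (simp add: power_divide field_simps power2_eq_square)
  ultimately show ?thesis using d by simp
qed

text \<open>Bias-variance decomposition: shifting changes the mean but not the variance.\<close>

lemma mean_norm_sq_shift:
  fixes v :: "nat \<Rightarrow> 'a::real_inner"
  assumes "0 < m"
  defines "a \<equiv> (1 / real m) *\<^sub>R (\<Sum>i<m. v i)"
  shows "1 / real m * (\<Sum>i<m. (norm (v i + b))\<^sup>2)
    = (norm (a + b))\<^sup>2 + (1 / real m * (\<Sum>i<m. (norm (v i))\<^sup>2) - (norm a)\<^sup>2)"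
proof -
  have "1 / real m * (\<Sum>i<m. (norm (v i + b))\<^sup>2)
    = 1 / real m * (\<Sum>i<m. (norm (v i))\<^sup>2 + 2 * (v i \<bullet> b) + (norm b)\<^sup>2)"
    unfolding power2_norm_eq_inner by (simp add: inner_simps inner_commute algebra_simps)
  also have "\<dots> = 1 / real m * (\<Sum>i<m. (norm (v i))\<^sup>2) + 2 * (a \<bullet> b) + (norm b)\<^sup>2"
    unfolding a_def inner_scaleR_left inner_sum_left sum.distrib sum_distrib_left[symmetric]
    using assms(1) by (simp add: field_simps)
  also have "\<dots> = (norm (a + b))\<^sup>2 + (1 / real m * (\<Sum>i<m. (norm (v i))\<^sup>2) - (norm a)\<^sup>2)"
    unfolding power2_norm_eq_inner by (simp add: inner_simps inner_commute)
  finally show ?thesis .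
qed

lemma mean_norm_sq_ge:
  fixes v :: "nat \<Rightarrow> 'a::real_inner"
  assumes "0 < m"
  shows "(norm ((1 / real m) *\<^sub>R (\<Sum>i<m. v i)))\<^sup>2 \<le> 1 / real m * (\<Sum>i<m. (norm (v i))\<^sup>2)"
proof -
  have "0 \<le> 1 / real m * (\<Sum>i<m. (norm (v i + - ((1 / real m) *\<^sub>R (\<Sum>i<m. v i))))\<^sup>2)"
    by (simp add: sum_nonneg)
  then show ?thesis unfolding mean_norm_sq_shift[OF assms] by simp
qed

lemma norm_node_mean_sq_le:
  assumes "0 < n"
  shows "(norm (node_mean n e))\<^sup>2 \<le> 1 / real n * (\<Sum>\<tau><n. (norm (e \<tau> :: 'a::real_inner))\<^sup>2)"
  unfolding node_mean_def by (rule mean_norm_sq_ge[OF assms])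

section \<open>Moments of the next compression error and of the next shift\<close>

locale compressor_pair =
  fixes m n :: nat and S :: "'s measure" and S1 :: "'s1 measure"
    and Q :: "'s \<Rightarrow> real^'d \<Rightarrow> real^'d" and Q1 :: "'s1 \<Rightarrow> real^'d \<Rightarrow> real^'d" and \<delta> \<delta>1 :: real
  assumes m_pos: "0 < m" and n_pos: "0 < n"
    and d: "0 < \<delta>" "\<delta> \<le> 1" and d1: "0 < \<delta>1" "\<delta>1 \<le> 1"
    and Q: "contraction_compressor S Q \<delta>" and Q1: "contraction_compressor S1 Q1 \<delta>1"
begin

definition law :: "(nat \<Rightarrow> nat \<times> 's \<times> 's1) measure" where
  "law = PiM {..<n} (\<lambda>_. node_law m S S1)"

text \<open>The error of one node after the step, as a function of its index and seeds:
  \<open>v i\<close> is the dual increment if \<open>i\<close> is sampled, and \<open>b\<close> will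
  be \<open>u - h + e\<close>.\<close>

definition err_next :: "(nat \<Rightarrow> real^'d) \<Rightarrow> real^'d \<Rightarrow> nat \<times> 's \<times> 's1 \<Rightarrow> real^'d" where
  "err_next v b = (\<lambda>(i, s, s1). v i + b - Q s (v i + b))"

text \<open>The next \<open>u - h\<close> of one node, with \<open>p\<close> the current
  one.\<close>

definition shift_next :: "(nat \<Rightarrow> real^'d) \<Rightarrow> real^'d \<Rightarrow> nat \<times> 's \<times> 's1 \<Rightarrow> real^'d" where
  "shift_next v p = (\<lambda>(i, s, s1). p - Q1 s1 p + (1 / real m) *\<^sub>R v i)"

definition avg :: "(nat \<Rightarrow> 'b) \<Rightarrow> 'b::real_vector" where
  "avg v = (1 / real m) *\<^sub>R (\<Sum>i<m. v i)"

definition avg_sq :: "(nat \<Rightarrow> real^'d) \<Rightarrow> real" where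
  "avg_sq v = 1 / real m * (\<Sum>i<m. (norm (v i))\<^sup>2)"

lemma S: "prob_space S" and S1: "prob_space S1"
  using Q Q1 by (auto simp: contraction_compressor_def)

lemma prob_space_node: "prob_space (node_law m S S1)"
  by (rule prob_space_node_law[OF S S1 m_pos])

lemma prob_space_law: "prob_space law"
  unfolding law_def by (rule prob_space_PiM) (rule prob_space_node)

lemma law_component:
  fixes f :: "_ \<Rightarrow> 'b::{banach,second_countable_topology}"
  assumes "\<tau> < n" "has_bochner_integral (node_law m S S1) f v"
  shows "has_bochner_integral law (\<lambda>r. f (r \<tau>)) v"
  unfolding law_def
  by (rule has_bochner_integral_PiM_component[where \<nu> = "\<lambda>_. node_law m S S1", OF _ _ assms(2)])
    (use assms(1) prob_space_node in auto)

lemma law_index_sum: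
  fixes F :: "nat \<Rightarrow> nat \<Rightarrow> real"
  shows "has_bochner_integral law (\<lambda>r. \<Sum>\<tau><n. F \<tau> (fst (r \<tau>))) (\<Sum>\<tau><n. 1 / real m * (\<Sum>i<m. F \<tau> i))"
proof (rule has_bochner_integral_sum)
  fix \<tau> assume "\<tau> \<in> {..<n}"
  then show "has_bochner_integral law (\<lambda>r. F \<tau> (fst (r \<tau>))) (1 / real m * (\<Sum>i<m. F \<tau> i))"
    using node_law_integral_index[OF S S1 m_pos, of "F \<tau>"]
    by (intro law_component[where f = "\<lambda>x. F \<tau> (fst x)"]) (auto simp: case_prod_unfold)
qed

lemma law_node_mean_sq:
  fixes X :: "nat \<Rightarrow> nat \<times> 's \<times> 's1 \<Rightarrow> real^'d"
  assumes "\<And>\<tau>. \<tau> < n \<Longrightarrow> has_bochner_integral (node_law m S S1) (X \<tau>) (\<mu> \<tau>)"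
    and "\<And>\<tau>. \<tau> < n \<Longrightarrow> has_bochner_integral (node_law m S S1) (\<lambda>x. (norm (X \<tau> x))\<^sup>2) (q \<tau>)"
  shows "has_bochner_integral law (\<lambda>r. (norm (node_mean n (\<lambda>\<tau>. X \<tau> (r \<tau>))))\<^sup>2)
    ((norm (node_mean n \<mu>))\<^sup>2 + 1 / (real n)\<^sup>2 * (\<Sum>\<tau><n. q \<tau> - (norm (\<mu> \<tau>))\<^sup>2))"
proof -
  have "has_bochner_integral law (\<lambda>r. (1 / real n)\<^sup>2 * (norm (\<Sum>\<tau><n. X \<tau> (r \<tau>)))\<^sup>2)
    ((1 / real n)\<^sup>2 * ((norm (\<Sum>\<tau><n. \<mu> \<tau>))\<^sup>2 + (\<Sum>\<tau><n. q \<tau> - (norm (\<mu> \<tau>))\<^sup>2)))"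
    unfolding law_def using assms prob_space_node
    by (intro has_bochner_integral_mult_right has_bochner_integral_PiM_norm_sum_sq) auto
  then show ?thesis
    unfolding node_mean_def norm_scaleR power_mult_distrib
    by (simp add: distrib_left power_divide)
qed

lemma index_moments:
  shows "has_bochner_integral (node_law m S S1) (\<lambda>x. v (fst x)) (avg v)"
    and "has_bochner_integral (node_law m S S1) (\<lambda>x. (norm (v (fst x)))\<^sup>2) (avg_sq v)"
  using node_law_integral_index[OF S S1 m_pos, of v]
    node_law_integral_index[OF S S1 m_pos, of "\<lambda>i. (norm (v i))\<^sup>2"]
  by (simp_all add: case_prod_unfold avg_def avg_sq_def)

lemma update_mean_moment:
  "has_bochner_integral law (\<lambda>r. (norm (node_mean n (\<lambda>\<tau>. v \<tau> (fst (r \<tau>)))))\<^sup>2)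
    ((norm (node_mean n (\<lambda>\<tau>. avg (v \<tau>))))\<^sup>2 + 1 / (real n)\<^sup>2 * (\<Sum>\<tau><n. avg_sq (v \<tau>) - (norm (avg (v \<tau>)))\<^sup>2))"
  using law_node_mean_sq[where X = "\<lambda>\<tau> x. v \<tau> (fst x)", OF index_moments] .

lemma avg_sq_ge: "(norm (avg v))\<^sup>2 \<le> avg_sq v"
  unfolding avg_def avg_sq_def by (rule mean_norm_sq_ge[OF m_pos])

lemma avg_sq_shift: "1 / real m * (\<Sum>i<m. (norm (v i + b))\<^sup>2) = (norm (avg v + b))\<^sup>2 + (avg_sq v - (norm (avg v))\<^sup>2)"
  unfolding avg_def avg_sq_def by (rule mean_norm_sq_shift[OF m_pos])

lemma err_next_moment:
  "\<exists>q. has_bochner_integral (node_law m S S1) (\<lambda>x. (norm (err_next v b x))\<^sup>2) q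
    \<and> q \<le> (1 - \<delta>) * ((norm (avg v + b))\<^sup>2 + (avg_sq v - (norm (avg v))\<^sup>2))"
  using compressed_error_second_moment[OF Q S1 m_pos, where v = "\<lambda>i. v i + b"]
  unfolding avg_sq_shift by (simp add: err_next_def case_prod_unfold)

text \<open>Bias-variance over the index: only the mean increment perturbs \<open>e\<close> under
  \<open>contraction_split\<close>, while the variance is multiplied by \<open>1 - \<delta>\<close>
  without a factor \<open>1 / \<delta>\<close>. This is why \<open>Rm\<close> enters the leading
  terms of the constants with one power of \<open>\<delta>\<close> less than
  \<open>Rbar\<close>.\<close>

lemma err_next_sum_moment:
  "\<exists>q. has_bochner_integral law (\<lambda>r. \<Sum>\<tau><n. (norm (err_next (v \<tau>) (p \<tau> + e \<tau>) (r \<tau>)))\<^sup>2) q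
    \<and> q \<le> (\<Sum>\<tau><n. (1 - \<delta> / 2) * (norm (e \<tau>))\<^sup>2
          + 4 * (1 - \<delta>) / \<delta> * ((norm (avg (v \<tau>)))\<^sup>2 + (norm (p \<tau>))\<^sup>2) + (1 - \<delta>) * avg_sq (v \<tau>))"
proof -
  have "\<forall>\<tau>. \<exists>q. has_bochner_integral (node_law m S S1) (\<lambda>x. (norm (err_next (v \<tau>) (p \<tau> + e \<tau>) x))\<^sup>2) q
    \<and> q \<le> (1 - \<delta>) * ((norm (avg (v \<tau>) + (p \<tau> + e \<tau>)))\<^sup>2 + (avg_sq (v \<tau>) - (norm (avg (v \<tau>)))\<^sup>2))"
    by (intro allI err_next_moment)
  from choice[OF this] obtain q where q:
    "\<And>\<tau>. has_bochner_integral (node_law m S S1) (\<lambda>x. (norm (err_next (v \<tau>) (p \<tau> + e \<tau>) x))\<^sup>2) (q \<tau>)"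
    "\<And>\<tau>. q \<tau> \<le> (1 - \<delta>) * ((norm (avg (v \<tau>) + (p \<tau> + e \<tau>)))\<^sup>2 + (avg_sq (v \<tau>) - (norm (avg (v \<tau>)))\<^sup>2))"
    by auto
  have "has_bochner_integral law (\<lambda>r. \<Sum>\<tau><n. (norm (err_next (v \<tau>) (p \<tau> + e \<tau>) (r \<tau>)))\<^sup>2) (\<Sum>\<tau><n. q \<tau>)"
    using law_component[OF _ q(1)] by (intro has_bochner_integral_sum) simp
  moreover have "q \<tau> \<le> (1 - \<delta> / 2) * (norm (e \<tau>))\<^sup>2
          + 4 * (1 - \<delta>) / \<delta> * ((norm (avg (v \<tau>)))\<^sup>2 + (norm (p \<tau>))\<^sup>2) + (1 - \<delta>) * avg_sq (v \<tau>)" for \<tau>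
  proof -
    have "q \<tau> \<le> (1 - \<delta>) * (norm (e \<tau> + (avg (v \<tau>) + p \<tau>)))\<^sup>2 + (1 - \<delta>) * (avg_sq (v \<tau>) - (norm (avg (v \<tau>)))\<^sup>2)"
      using q(2)[of \<tau>] by (simp add: distrib_left add_ac)
    also have "(1 - \<delta>) * (avg_sq (v \<tau>) - (norm (avg (v \<tau>)))\<^sup>2) \<le> (1 - \<delta>) * avg_sq (v \<tau>)"
      using d by (intro mult_left_mono) auto
    also have "(1 - \<delta>) * (norm (e \<tau> + (avg (v \<tau>) + p \<tau>)))\<^sup>2
      \<le> (1 - \<delta> / 2) * (norm (e \<tau>))\<^sup>2 + 2 * (1 - \<delta>) / \<delta> * (norm (avg (v \<tau>) + p \<tau>))\<^sup>2"
      by (rule contraction_split[OF d])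
    also have "2 * (1 - \<delta>) / \<delta> * (norm (avg (v \<tau>) + p \<tau>))\<^sup>2
      \<le> 2 * (1 - \<delta>) / \<delta> * (2 * (norm (avg (v \<tau>)))\<^sup>2 + 2 * (norm (p \<tau>))\<^sup>2)"
      using d by (intro mult_left_mono norm_sq_add_le) auto
    finally show ?thesis by (simp add: algebra_simps)
  qed
  ultimately show ?thesis by (intro exI[of _ "\<Sum>\<tau><n. q \<tau>"] conjI sum_mono)
qed

definition shift_mean :: "real^'d \<Rightarrow> real^'d" where
  "shift_mean p = (\<integral>s. p - Q1 s p \<partial>S1)"

definition shift_sq :: "real^'d \<Rightarrow> real" where
  "shift_sq p = (\<integral>s. (norm (p - Q1 s p))\<^sup>2 \<partial>S1)"

lemma shift_next_moments:
  shows "has_bochner_integral (node_law m S S1) (shift_next v p) (shift_mean p + (1 / real m) *\<^sub>R avg v)"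
    and "has_bochner_integral (node_law m S S1) (\<lambda>x. (norm (shift_next v p x))\<^sup>2)
      (shift_sq p + 2 / real m * (shift_mean p \<bullet> avg v) + 1 / (real m)\<^sup>2 * avg_sq v)"
    and "shift_sq p \<le> (1 - \<delta>1) * (norm p)\<^sup>2" and "(norm (shift_mean p))\<^sup>2 \<le> shift_sq p"
    and "(\<And>x. (\<integral>s. Q1 s x \<partial>S1) = \<delta>1 *\<^sub>R x) \<Longrightarrow> shift_mean p = (1 - \<delta>1) *\<^sub>R p"
  using shift_error_moments(1,2)[OF S Q1 m_pos, of p v] shift_error_moments(3-5)[OF S Q1 m_pos, of p]
  unfolding shift_next_def avg_def avg_sq_def shift_mean_def shift_sq_def
  by (simp_all add: case_prod_unfold)

text \<open>The cross term sees the mean residual only, whose square is at most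
  \<open>(1 - \<delta>1) * (norm p)\<^sup>2\<close> by Jensen; Young then gives up half of the
  contraction. The case \<open>\<delta>1 = 1\<close> is separate because the parameter
  \<open>c\<close> would divide by 0; there the residual has second moment 0.\<close>

lemma shift_next_sum_moment:
  "\<exists>q. has_bochner_integral law (\<lambda>r. \<Sum>\<tau><n. (norm (shift_next (v \<tau>) (p \<tau>) (r \<tau>)))\<^sup>2) q
    \<and> q \<le> (\<Sum>\<tau><n. (1 - \<delta>1 / 2) * (norm (p \<tau>))\<^sup>2
          + 2 * (1 - \<delta>1) / (\<delta>1 * (real m)\<^sup>2) * (norm (avg (v \<tau>)))\<^sup>2 + 1 / (real m)\<^sup>2 * avg_sq (v \<tau>))"
proof -
  define \<mu> where "\<mu> = (\<lambda>\<tau>. shift_mean (p \<tau>))"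
  define q where "q = (\<lambda>\<tau>. shift_sq (p \<tau>))"
  have q: "\<And>\<tau>. has_bochner_integral (node_law m S S1) (\<lambda>x. (norm (shift_next (v \<tau>) (p \<tau>) x))\<^sup>2)
        (q \<tau> + 2 / real m * (\<mu> \<tau> \<bullet> avg (v \<tau>)) + 1 / (real m)\<^sup>2 * avg_sq (v \<tau>))"
    "\<And>\<tau>. q \<tau> \<le> (1 - \<delta>1) * (norm (p \<tau>))\<^sup>2" "\<And>\<tau>. (norm (\<mu> \<tau>))\<^sup>2 \<le> q \<tau>"
    unfolding \<mu>_def q_def by (rule shift_next_moments)+
  define q' where "q' = (\<lambda>\<tau>. q \<tau> + 2 / real m * (\<mu> \<tau> \<bullet> avg (v \<tau>)) + 1 / (real m)\<^sup>2 * avg_sq (v \<tau>))"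
  have "has_bochner_integral law (\<lambda>r. \<Sum>\<tau><n. (norm (shift_next (v \<tau>) (p \<tau>) (r \<tau>)))\<^sup>2) (\<Sum>\<tau><n. q' \<tau>)"
    using law_component[OF _ q(1)] unfolding q'_def by (intro has_bochner_integral_sum) simp
  moreover have "q' \<tau> \<le> (1 - \<delta>1 / 2) * (norm (p \<tau>))\<^sup>2
          + 2 * (1 - \<delta>1) / (\<delta>1 * (real m)\<^sup>2) * (norm (avg (v \<tau>)))\<^sup>2 + 1 / (real m)\<^sup>2 * avg_sq (v \<tau>)" for \<tau>
  proof (cases "\<delta>1 = 1")
    case True
    have q0: "q \<tau> \<le> 0" using q(2)[of \<tau>] True by simp
    then have "(norm (\<mu> \<tau>))\<^sup>2 \<le> 0" using q(3)[of \<tau>] by linarith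
    moreover have "q \<tau> * 2 \<le> (norm (p \<tau>))\<^sup>2"
      using q0 zero_le_power2[of "norm (p \<tau>)"] by linarith
    ultimately show ?thesis using True by (simp add: q'_def)
  next
    case False
    define c where "c = \<delta>1 / (2 * (1 - \<delta>1))"
    define w where "w = (1 / real m) *\<^sub>R avg (v \<tau>)"
    have c: "0 < c" using d1 False by (simp add: c_def)
    have "2 * (\<mu> \<tau> \<bullet> w) \<le> c * (norm (\<mu> \<tau>))\<^sup>2 + 1 / c * (norm w)\<^sup>2"
      using young_inner_ge[of "c / 2" "- \<mu> \<tau>" w] c by simp
    also have "c * (norm (\<mu> \<tau>))\<^sup>2 \<le> c * ((1 - \<delta>1) * (norm (p \<tau>))\<^sup>2)"
      using q(2,3)[of \<tau>] c by (intro mult_left_mono) auto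
    also have "\<dots> = \<delta>1 / 2 * (norm (p \<tau>))\<^sup>2" using False by (simp add: c_def field_simps)
    also have "1 / c * (norm w)\<^sup>2 = 2 * (1 - \<delta>1) / (\<delta>1 * (real m)\<^sup>2) * (norm (avg (v \<tau>)))\<^sup>2"
      by (simp add: c_def w_def power_mult_distrib power_divide)
    finally show ?thesis using q(2)[of \<tau>] unfolding q'_def w_def by (simp add: algebra_simps)
  qed
  ultimately show ?thesis by (intro exI[of _ "\<Sum>\<tau><n. q' \<tau>"] conjI sum_mono)
qed

text \<open>Unbiasedness gives every node the mean \<open>1 - \<delta>\<close> times its input, so
  the node average contracts on its own; independence adds the node variances with weight
  \<open>1 / (real n)\<^sup>2\<close>.\<close>

lemma err_next_mean_moment:
  assumes unb: "\<And>x. (\<integral>s. Q s x \<partial>S) = \<delta> *\<^sub>R x"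
  shows "\<exists>q. has_bochner_integral law (\<lambda>r. (norm (node_mean n (\<lambda>\<tau>. err_next (v \<tau>) (p \<tau> + e \<tau>) (r \<tau>))))\<^sup>2) q
    \<and> q \<le> (1 - \<delta> / 2) * (norm (node_mean n e))\<^sup>2
          + 4 * (1 - \<delta>) / \<delta> * ((norm (node_mean n (\<lambda>\<tau>. avg (v \<tau>))))\<^sup>2 + (norm (node_mean n p))\<^sup>2)
          + 1 / (real n)\<^sup>2 * (\<Sum>\<tau><n. (1 - \<delta>) * avg_sq (v \<tau>)
              + \<delta> * (1 - \<delta>) * (2 * (norm (e \<tau>))\<^sup>2 + 4 * avg_sq (v \<tau>) + 4 * (norm (p \<tau>))\<^sup>2))"
proof -
  have "\<forall>\<tau>. \<exists>q. has_bochner_integral (node_law m S S1) (\<lambda>x. (norm (err_next (v \<tau>) (p \<tau> + e \<tau>) x))\<^sup>2) q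
    \<and> q \<le> (1 - \<delta>) * ((norm (avg (v \<tau>) + (p \<tau> + e \<tau>)))\<^sup>2 + (avg_sq (v \<tau>) - (norm (avg (v \<tau>)))\<^sup>2))"
    by (intro allI err_next_moment)
  from choice[OF this] obtain q where q:
    "\<And>\<tau>. has_bochner_integral (node_law m S S1) (\<lambda>x. (norm (err_next (v \<tau>) (p \<tau> + e \<tau>) x))\<^sup>2) (q \<tau>)"
    "\<And>\<tau>. q \<tau> \<le> (1 - \<delta>) * ((norm (avg (v \<tau>) + (p \<tau> + e \<tau>)))\<^sup>2 + (avg_sq (v \<tau>) - (norm (avg (v \<tau>)))\<^sup>2))"
    by auto
  define \<mu> where "\<mu> = (\<lambda>\<tau>. (1 - \<delta>) *\<^sub>R (avg (v \<tau>) + (p \<tau> + e \<tau>)))"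
  have "(1 / real m) *\<^sub>R (\<Sum>i<m. v \<tau> i + (p \<tau> + e \<tau>)) = avg (v \<tau>) + (p \<tau> + e \<tau>)" for \<tau>
    unfolding avg_def sum.distrib scaleR_add_right sum_constant_scaleR using m_pos by simp
  then have mu: "has_bochner_integral (node_law m S S1) (err_next (v \<tau>) (p \<tau> + e \<tau>)) (\<mu> \<tau>)" for \<tau>
    using compressed_error_mean[OF Q S1 m_pos unb, where v = "\<lambda>i. v \<tau> i + (p \<tau> + e \<tau>)"]
    by (simp add: \<mu>_def err_next_def case_prod_unfold)
  define a where "a = node_mean n (\<lambda>\<tau>. avg (v \<tau>))"
  have "node_mean n \<mu> = (1 - \<delta>) *\<^sub>R (node_mean n e + (a + node_mean n p))"
    unfolding node_mean_def \<mu>_def a_def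
    by (simp add: sum.distrib scaleR_add_right scaleR_sum_right[symmetric] scaleR_left_commute add_ac)
  then have "(norm (node_mean n \<mu>))\<^sup>2 = (1 - \<delta>) * ((1 - \<delta>) * (norm (node_mean n e + (a + node_mean n p)))\<^sup>2)"
    by (simp add: power_mult_distrib power2_eq_square)
  \<comment> \<open>One of the two factors \<open>1 - \<delta>\<close> is given away so that
    \<open>contraction_split\<close> applies.\<close>
  also have "\<dots> \<le> 1 * ((1 - \<delta>) * (norm (node_mean n e + (a + node_mean n p)))\<^sup>2)"
    using d by (intro mult_right_mono) auto
  also have "1 * ((1 - \<delta>) * (norm (node_mean n e + (a + node_mean n p)))\<^sup>2)
    \<le> (1 - \<delta> / 2) * (norm (node_mean n e))\<^sup>2 + 2 * (1 - \<delta>) / \<delta> * (norm (a + node_mean n p))\<^sup>2"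
    using contraction_split[OF d] by simp
  also have "2 * (1 - \<delta>) / \<delta> * (norm (a + node_mean n p))\<^sup>2
      \<le> 2 * (1 - \<delta>) / \<delta> * (2 * (norm a)\<^sup>2 + 2 * (norm (node_mean n p))\<^sup>2)"
    using d by (intro mult_left_mono norm_sq_add_le) auto
  finally have 1: "(norm (node_mean n \<mu>))\<^sup>2 \<le> (1 - \<delta> / 2) * (norm (node_mean n e))\<^sup>2
    + 4 * (1 - \<delta>) / \<delta> * ((norm a)\<^sup>2 + (norm (node_mean n p))\<^sup>2)"
    by (simp add: algebra_simps)
  have 2: "q \<tau> - (norm (\<mu> \<tau>))\<^sup>2 \<le> (1 - \<delta>) * avg_sq (v \<tau>)
      + \<delta> * (1 - \<delta>) * (2 * (norm (e \<tau>))\<^sup>2 + 4 * avg_sq (v \<tau>) + 4 * (norm (p \<tau>))\<^sup>2)" for \<tau>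
  proof -
    define W where "W = (norm (avg (v \<tau>) + (p \<tau> + e \<tau>)))\<^sup>2"
    define V where "V = avg_sq (v \<tau>) - (norm (avg (v \<tau>)))\<^sup>2"
    have "(norm (\<mu> \<tau>))\<^sup>2 = (1 - \<delta>)\<^sup>2 * W" using d by (simp add: \<mu>_def W_def power_mult_distrib)
    \<comment> \<open>The bias part keeps the weight \<open>(1 - \<delta>) - (1 - \<delta>)\<^sup>2
      = \<delta> * (1 - \<delta>)\<close> after the squared mean is subtracted.\<close>
    then have "q \<tau> - (norm (\<mu> \<tau>))\<^sup>2 \<le> (1 - \<delta>) * V + \<delta> * (1 - \<delta>) * W"
      using q(2)[of \<tau>] unfolding W_def[symmetric] V_def[symmetric]
      by (simp add: power2_eq_square[of "1 - \<delta>"] algebra_simps)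
    also have "(1 - \<delta>) * V \<le> (1 - \<delta>) * avg_sq (v \<tau>)"
      using d by (intro mult_left_mono) (auto simp: V_def)
    also have "\<delta> * (1 - \<delta>) * W \<le> \<delta> * (1 - \<delta>) * (2 * (norm (e \<tau>))\<^sup>2 + 4 * avg_sq (v \<tau>) + 4 * (norm (p \<tau>))\<^sup>2)"
    proof (rule mult_left_mono)
      have "W \<le> 2 * (norm (e \<tau>))\<^sup>2 + 2 * (norm (avg (v \<tau>) + p \<tau>))\<^sup>2"
        using norm_sq_add_le[of "e \<tau>" "avg (v \<tau>) + p \<tau>"] by (simp add: W_def add_ac)
      also have "(norm (avg (v \<tau>) + p \<tau>))\<^sup>2 \<le> 2 * (norm (avg (v \<tau>)))\<^sup>2 + 2 * (norm (p \<tau>))\<^sup>2"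
        by (rule norm_sq_add_le)
      also have "(norm (avg (v \<tau>)))\<^sup>2 \<le> avg_sq (v \<tau>)" by (rule avg_sq_ge)
      finally show "W \<le> 2 * (norm (e \<tau>))\<^sup>2 + 4 * avg_sq (v \<tau>) + 4 * (norm (p \<tau>))\<^sup>2" by simp
    qed (use d in auto)
    finally show ?thesis by simp
  qed
  show ?thesis
    using law_node_mean_sq[of "\<lambda>\<tau>. err_next (v \<tau>) (p \<tau> + e \<tau>)" \<mu> q, OF mu q(1)]
    unfolding a_def[symmetric]
    by (intro exI[of _ "(norm (node_mean n \<mu>))\<^sup>2 + 1 / (real n)\<^sup>2 * (\<Sum>\<tau><n. q \<tau> - (norm (\<mu> \<tau>))\<^sup>2)"] conjI
        add_mono 1 mult_left_mono sum_mono 2) auto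
qed

text \<open>Here the averaged recursion keeps the full factor \<open>1 - \<delta>1\<close>, since
  the mean residual is an exact multiple of \<open>p\<close>.\<close>

lemma shift_next_mean_moment:
  assumes unb: "\<And>x. (\<integral>s. Q1 s x \<partial>S1) = \<delta>1 *\<^sub>R x"
  shows "\<exists>q. has_bochner_integral law (\<lambda>r. (norm (node_mean n (\<lambda>\<tau>. shift_next (v \<tau>) (p \<tau>) (r \<tau>))))\<^sup>2) q
    \<and> q \<le> (1 - \<delta>1) * (norm (node_mean n p))\<^sup>2
          + 1 / (\<delta>1 * (real m)\<^sup>2) * (norm (node_mean n (\<lambda>\<tau>. avg (v \<tau>))))\<^sup>2
          + 1 / (real n)\<^sup>2 * (\<Sum>\<tau><n. \<delta>1 * (1 - \<delta>1) * (norm (p \<tau>))\<^sup>2 + 1 / (real m)\<^sup>2 * avg_sq (v \<tau>))"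
proof -
  define q where "q = (\<lambda>\<tau>. shift_sq (p \<tau>))"
  have q: "\<And>\<tau>. has_bochner_integral (node_law m S S1) (shift_next (v \<tau>) (p \<tau>))
        ((1 - \<delta>1) *\<^sub>R p \<tau> + (1 / real m) *\<^sub>R avg (v \<tau>))"
    "\<And>\<tau>. has_bochner_integral (node_law m S S1) (\<lambda>x. (norm (shift_next (v \<tau>) (p \<tau>) x))\<^sup>2)
        (q \<tau> + 2 / real m * (((1 - \<delta>1) *\<^sub>R p \<tau>) \<bullet> avg (v \<tau>)) + 1 / (real m)\<^sup>2 * avg_sq (v \<tau>))"
    "\<And>\<tau>. q \<tau> \<le> (1 - \<delta>1) * (norm (p \<tau>))\<^sup>2"
    unfolding q_def shift_next_moments(5)[OF unb, symmetric] by (rule shift_next_moments)+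
  define \<mu> where "\<mu> = (\<lambda>\<tau>. (1 - \<delta>1) *\<^sub>R p \<tau> + (1 / real m) *\<^sub>R avg (v \<tau>))"
  define q' where "q' = (\<lambda>\<tau>. q \<tau> + 2 / real m * (((1 - \<delta>1) *\<^sub>R p \<tau>) \<bullet> avg (v \<tau>)) + 1 / (real m)\<^sup>2 * avg_sq (v \<tau>))"
  define a where "a = node_mean n (\<lambda>\<tau>. avg (v \<tau>))"
  have "node_mean n \<mu> = (1 - \<delta>1) *\<^sub>R node_mean n p + (1 / real m) *\<^sub>R a"
    unfolding node_mean_def \<mu>_def a_def
    by (simp add: sum.distrib scaleR_add_right scaleR_sum_right[symmetric] scaleR_left_commute add_ac mult.commute)
  then have "(norm (node_mean n \<mu>))\<^sup>2 \<le> (1 - \<delta>1) * (norm (node_mean n p))\<^sup>2 + 1 / \<delta>1 * (norm ((1 / real m) *\<^sub>R a))\<^sup>2"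
    by (simp only: norm_convex_combination_sq[OF d1])
  then have 1: "(norm (node_mean n \<mu>))\<^sup>2 \<le> (1 - \<delta>1) * (norm (node_mean n p))\<^sup>2 + 1 / (\<delta>1 * (real m)\<^sup>2) * (norm a)\<^sup>2"
    by (simp add: power_mult_distrib power_divide)
  have 2: "q' \<tau> - (norm (\<mu> \<tau>))\<^sup>2 \<le> \<delta>1 * (1 - \<delta>1) * (norm (p \<tau>))\<^sup>2 + 1 / (real m)\<^sup>2 * avg_sq (v \<tau>)" for \<tau>
  proof -
    \<comment> \<open>The inner product of \<open>p\<close> with the mean increment occurs both in
      the second moment and in the squared mean, and cancels.\<close>
    have "(norm (\<mu> \<tau>))\<^sup>2 = (1 - \<delta>1)\<^sup>2 * (norm (p \<tau>))\<^sup>2 + 2 / real m * (((1 - \<delta>1) *\<^sub>R p \<tau>) \<bullet> avg (v \<tau>))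
      + 1 / (real m)\<^sup>2 * (norm (avg (v \<tau>)))\<^sup>2"
      unfolding \<mu>_def power2_norm_eq_inner
      by (simp add: inner_add_left inner_add_right inner_commute power2_eq_square)
    then have "q' \<tau> - (norm (\<mu> \<tau>))\<^sup>2 \<le> (1 - \<delta>1) * (norm (p \<tau>))\<^sup>2 - (1 - \<delta>1)\<^sup>2 * (norm (p \<tau>))\<^sup>2
      + 1 / (real m)\<^sup>2 * avg_sq (v \<tau>)"
      using q(3)[of \<tau>] unfolding q'_def
      by (smt (verit) divide_nonneg_nonneg mult_nonneg_nonneg zero_le_power2)
    then show ?thesis by (simp add: power2_eq_square algebra_simps)
  qed
  have "has_bochner_integral (node_law m S S1) (shift_next (v \<tau>) (p \<tau>)) (\<mu> \<tau>)"
    "has_bochner_integral (node_law m S S1) (\<lambda>x. (norm (shift_next (v \<tau>) (p \<tau>) x))\<^sup>2) (q' \<tau>)" for \<tau>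
    unfolding \<mu>_def q'_def by (rule q)+
  then show ?thesis
    using law_node_mean_sq[of "\<lambda>\<tau>. shift_next (v \<tau>) (p \<tau>)" \<mu> q']
    unfolding a_def[symmetric]
    by (intro exI[of _ "(norm (node_mean n \<mu>))\<^sup>2 + 1 / (real n)\<^sup>2 * (\<Sum>\<tau><n. q' \<tau> - (norm (\<mu> \<tau>))\<^sup>2)"] conjI
        add_mono 1 mult_left_mono sum_mono 2) auto
qed

end


section \<open>One step of the iteration\<close>

lemma node_mean_add: "node_mean n (\<lambda>\<tau>. a \<tau> + b \<tau>) = node_mean n a + node_mean n b"
  and node_mean_diff: "node_mean n (\<lambda>\<tau>. a \<tau> - b \<tau>) = node_mean n a - node_mean n b"
  and node_mean_scaleR: "node_mean n (\<lambda>\<tau>. c *\<^sub>R a \<tau>) = c *\<^sub>R node_mean n a"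
  by (simp_all add: node_mean_def sum.distrib sum_subtractf scaleR_add_right scaleR_diff_right
      scaleR_sum_right[symmetric] scaleR_left_commute mult.commute)

lemma node_mean_cong: "(\<And>\<tau>. \<tau> < n \<Longrightarrow> a \<tau> = b \<tau>) \<Longrightarrow> node_mean n a = node_mean n b"
  by (simp add: node_mean_def)

lemma inner_node_mean: "node_mean n a \<bullet> x = 1 / real n * (\<Sum>\<tau><n. a \<tau> \<bullet> x)"
  by (simp add: node_mean_def inner_sum_left)

locale ecspdc_parameters = saddle_problem m n A \<phi> G g lam \<gamma> xs Ys
  for m n :: nat
    and A :: "nat \<Rightarrow> nat \<Rightarrow> real^'t^'d"
    and \<phi> :: "nat \<Rightarrow> nat \<Rightarrow> real^'t \<Rightarrow> real"
    and G :: "nat \<Rightarrow> nat \<Rightarrow> real^'t \<Rightarrow> real^'t"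
    and g :: "real^'d \<Rightarrow> real"
    and lam \<gamma> :: real
    and xs :: "real^'d" and Ys :: "nat \<Rightarrow> nat \<Rightarrow> real^'t" +
  fixes \<sigma> \<eta> \<theta> :: real
  assumes sig: "0 < \<sigma>" and eta: "0 < \<eta>" and theta: "0 < \<theta>"
begin

abbreviation step where
  "step \<equiv> ecspdc_step m n A \<phi> g \<sigma> \<eta> \<theta>"

text \<open>The invariants that the analysis reads off the state. Finiteness of the conjugates is
  among them because the Lyapunov functions are real only there.\<close>

definition consistent :: "(real^'d, real^'t) ecspdc_state \<Rightarrow> bool" where
  "consistent s \<longleftrightarrow> st_hs s = node_mean n (st_h s)
    \<and> (\<forall>\<tau><n. st_u s \<tau> = (1 / real m) *\<^sub>R (\<Sum>i<m. A i \<tau> *v st_y s i \<tau>)) \<and> dual_finite (st_y s)"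

text \<open>The dual update of every coordinate at once, of which the algorithm performs one per
  node. It does not depend on the sampling, so expectations reduce to averages over
  \<open>j\<close>.\<close>

definition yh :: "(real^'d, real^'t) ecspdc_state \<Rightarrow> nat \<Rightarrow> nat \<Rightarrow> real^'t" where
  "yh s j \<tau> = dual_prox \<sigma> (st_z s) j \<tau> (st_y s j \<tau>)"

definition dv :: "(real^'d, real^'t) ecspdc_state \<Rightarrow> nat \<Rightarrow> nat \<Rightarrow> real^'d" where
  "dv s \<tau> j = A j \<tau> *v (yh s j \<tau> - st_y s j \<tau>)"

definition pv :: "(real^'d, real^'t) ecspdc_state \<Rightarrow> nat \<Rightarrow> real^'d" where
  "pv s \<tau> = st_u s \<tau> - st_h s \<tau>"

text \<open>The last movement of \<open>x\<close>, recovered from the extrapolation so that the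
  Lyapunov function is a function of the state alone; it is 0 at the start because
  \<open>z = x\<close>.\<close>

definition xd :: "(real^'d, real^'t) ecspdc_state \<Rightarrow> real^'d" where
  "xd s = (1 / \<theta>) *\<^sub>R (st_z s - st_x s)"

text \<open>Carries \<open>1 / (2 * \<sigma>)\<close> where the stated Lyapunov functions have
  \<open>1 / (4 * \<sigma>)\<close>; the surplus belongs to \<open>cross\<close>.\<close>

definition dual_term :: "nat \<Rightarrow> nat \<Rightarrow> real^'t \<Rightarrow> real" where
  "dual_term j \<tau> y = 1 / real n * ((1 / (2 * \<sigma>) + \<gamma> / 2) * (norm (y - Ys j \<tau>))\<^sup>2 + bregman j \<tau> y)"

text \<open>
  The cross term and \<open>\<parallel>x\<^sup>k - x\<^sup>k\<^sup>-\<^sup>1\<parallel>\<^sup>2 / (8 \<eta>)\<close> keep the sum nonnegative while letting the dual step,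
  taken at the extrapolated point \<open>z\<close>, telescope against the primal step.
\<close>
definition lyap :: "(real^'d, real^'t) ecspdc_state \<Rightarrow> real" where
  "lyap s = (1 / (2 * \<eta>) + lam / 4) * (norm (st_x s - \<eta> *\<^sub>R node_mean n (st_e s) - xs))\<^sup>2
    + (g (st_x s) - g xs + us \<bullet> (st_x s - xs))
    + (node_mean n (st_u s) - us) \<bullet> xd s + 1 / (8 * \<eta>) * (norm (xd s))\<^sup>2
    + (\<Sum>\<tau><n. \<Sum>j<m. dual_term j \<tau> (st_y s j \<tau>))"

definition dual_move :: "(real^'d, real^'t) ecspdc_state \<Rightarrow> nat \<Rightarrow> real" where
  "dual_move s \<tau> = 1 / real m * (\<Sum>j<m. (norm (yh s j \<tau> - st_y s j \<tau>))\<^sup>2)"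

context
  fixes s :: "(real^'d, real^'t) ecspdc_state" and i :: "nat \<Rightarrow> nat"
    and q q1 :: "nat \<Rightarrow> real^'d \<Rightarrow> real^'d" and s' :: "(real^'d, real^'t) ecspdc_state"
  assumes i: "\<And>\<tau>. \<tau> < n \<Longrightarrow> i \<tau> < m"
    and s': "s' = step i q q1 s"
begin

lemma st_y_step:
  assumes "\<tau> < n" "j < m"
  shows "st_y s' j \<tau> = (if j = i \<tau> then yh s j \<tau> else st_y s j \<tau>)"
  unfolding s' ecspdc_step_def Let_def ecspdc_state.simps yh_def
    arg_max_dual_step[OF assms(2,1) sig] ..

text \<open>For use after unfolding \<open>ecspdc_step\<close>, where the sampled update still
  appears as an \<open>arg_max\<close>.\<close>

lemma sampled_update_step:
  assumes "\<tau> < n"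
  shows "A (i \<tau>) \<tau> *v (arg_max (\<lambda>v. ereal (v \<bullet> (transpose (A (i \<tau>) \<tau>) *v st_z s)) - conjugate (\<phi> (i \<tau>) \<tau>) v
      - ereal (1 / (2 * \<sigma>) * (norm (v - st_y s (i \<tau>) \<tau>))\<^sup>2)) (\<lambda>_. True) - st_y s (i \<tau>) \<tau>) = dv s \<tau> (i \<tau>)"
  unfolding dv_def yh_def arg_max_dual_step[OF i[OF assms] assms sig] ..

lemma st_e_step:
  assumes "\<tau> < n"
  shows "st_e s' \<tau> = dv s \<tau> (i \<tau>) + (pv s \<tau> + st_e s \<tau>) - q \<tau> (dv s \<tau> (i \<tau>) + (pv s \<tau> + st_e s \<tau>))"
  unfolding s' ecspdc_step_def Let_def ecspdc_state.simps if_P[OF refl] sampled_update_step[OF assms] pv_def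
  by (simp add: algebra_simps)

lemma st_u_step:
  assumes "\<tau> < n"
  shows "st_u s' \<tau> = st_u s \<tau> + (1 / real m) *\<^sub>R dv s \<tau> (i \<tau>)"
  unfolding s' ecspdc_step_def Let_def ecspdc_state.simps if_P[OF refl] sampled_update_step[OF assms] ..

lemma st_h_step: "st_h s' \<tau> = st_h s \<tau> + q1 \<tau> (pv s \<tau>)"
  unfolding s' ecspdc_step_def Let_def pv_def by simp

lemma st_hs_step: "st_hs s' = st_hs s + node_mean n (\<lambda>\<tau>. q1 \<tau> (pv s \<tau>))"
  unfolding s' ecspdc_step_def Let_def pv_def by simp

lemma pv_step:
  assumes "\<tau> < n"
  shows "pv s' \<tau> = pv s \<tau> - q1 \<tau> (pv s \<tau>) + (1 / real m) *\<^sub>R dv s \<tau> (i \<tau>)"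
  unfolding pv_def[of s'] st_u_step[OF assms] st_h_step by (simp add: pv_def)

lemma st_x_step_eq:
  "st_x s' = proximal \<eta> g (st_x s - \<eta> *\<^sub>R (st_hs s
    + node_mean n (\<lambda>\<tau>. q \<tau> (dv s \<tau> (i \<tau>) + (pv s \<tau> + st_e s \<tau>)))))"
proof -
  have "node_mean n (\<lambda>\<tau>. q \<tau> (A (i \<tau>) \<tau> *v (arg_max (\<lambda>v. ereal (v \<bullet> (transpose (A (i \<tau>) \<tau>) *v st_z s)) - conjugate (\<phi> (i \<tau>) \<tau>) v
      - ereal (1 / (2 * \<sigma>) * (norm (v - st_y s (i \<tau>) \<tau>))\<^sup>2)) (\<lambda>_. True) - st_y s (i \<tau>) \<tau>) + st_u s \<tau> - st_h s \<tau> + st_e s \<tau>))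
    = node_mean n (\<lambda>\<tau>. q \<tau> (dv s \<tau> (i \<tau>) + (pv s \<tau> + st_e s \<tau>)))"
    by (intro node_mean_cong) (simp only: sampled_update_step, simp add: pv_def algebra_simps)
  moreover have "st_x s' = arg_min (\<lambda>v. g v + (st_hs s + node_mean n (\<lambda>\<tau>. q \<tau> (A (i \<tau>) \<tau> *v (arg_max (\<lambda>v. ereal (v \<bullet> (transpose (A (i \<tau>) \<tau>) *v st_z s)) - conjugate (\<phi> (i \<tau>) \<tau>) v
      - ereal (1 / (2 * \<sigma>) * (norm (v - st_y s (i \<tau>) \<tau>))\<^sup>2)) (\<lambda>_. True) - st_y s (i \<tau>) \<tau>) + st_u s \<tau> - st_h s \<tau> + st_e s \<tau>))) \<bullet> v
      + 1 / (2 * \<eta>) * (norm (v - st_x s))\<^sup>2) (\<lambda>_. True)"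
    unfolding s' ecspdc_step_def Let_def ecspdc_state.simps if_P[OF refl] ..
  ultimately show ?thesis
    using arg_min_eq_proximal[OF sc_g _ eta] lam by simp
qed

text \<open>Averaging the error recursion over the nodes, the server vector plus the mean compressed
  message equals the mean uncompressed direction plus the old minus the new mean error; this uses
  that the server vector is the mean of the node vectors.\<close>

lemma st_x_step:
  assumes "consistent s"
  shows "st_x s' = proximal \<eta> g (st_x s - \<eta> *\<^sub>R (node_mean n (st_u s)
    + node_mean n (\<lambda>\<tau>. dv s \<tau> (i \<tau>)) + node_mean n (st_e s) - node_mean n (st_e s')))"
proof -
  have "node_mean n (st_e s') = node_mean n (\<lambda>\<tau>. dv s \<tau> (i \<tau>)) + (node_mean n (pv s) + node_mean n (st_e s))
    - node_mean n (\<lambda>\<tau>. q \<tau> (dv s \<tau> (i \<tau>) + (pv s \<tau> + st_e s \<tau>)))"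
    unfolding node_mean_add[symmetric] node_mean_diff[symmetric] by (intro node_mean_cong st_e_step)
  moreover have "node_mean n (pv s) = node_mean n (st_u s) - node_mean n (st_h s)"
    unfolding node_mean_diff[symmetric] by (intro node_mean_cong) (simp add: pv_def)
  ultimately have "st_hs s + node_mean n (\<lambda>\<tau>. q \<tau> (dv s \<tau> (i \<tau>) + (pv s \<tau> + st_e s \<tau>)))
    = node_mean n (st_u s) + node_mean n (\<lambda>\<tau>. dv s \<tau> (i \<tau>)) + node_mean n (st_e s) - node_mean n (st_e s')"
    using assms by (simp add: consistent_def)
  then show ?thesis unfolding st_x_step_eq by simp
qed

lemma st_z_step: "st_z s' = st_x s' + \<theta> *\<^sub>R (st_x s' - st_x s)"
  unfolding s' ecspdc_step_def Let_def by simp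

lemma xd_step: "xd s' = st_x s' - st_x s"
  using theta unfolding xd_def st_z_step by simp

lemma sum_st_y_step:
  assumes "\<tau> < n"
  shows "(\<Sum>j<m. F j (st_y s' j \<tau>)) = (\<Sum>j<m. F j (st_y s j \<tau>)) + (F (i \<tau>) (yh s (i \<tau>) \<tau>) - F (i \<tau>) (st_y s (i \<tau>) \<tau>) :: 'z::real_vector)"
proof -
  have "(\<Sum>j<m. F j (st_y s' j \<tau>)) = (\<Sum>j<m. F j (st_y s j \<tau>)
      + (if j = i \<tau> then F j (yh s j \<tau>) - F j (st_y s j \<tau>) else 0))"
    using assms by (intro sum.cong) (auto simp: st_y_step)
  then show ?thesis using i[OF assms] by (simp add: sum.distrib)
qed

lemma consistent_step:
  assumes "consistent s"
  shows "consistent s'"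
  unfolding consistent_def
proof (intro conjI allI impI)
  show "st_hs s' = node_mean n (st_h s')"
    using assms unfolding st_hs_step by (simp add: consistent_def node_mean_add[symmetric] st_h_step[abs_def] fun_eq_iff)
  show "st_u s' \<tau> = (1 / real m) *\<^sub>R (\<Sum>i<m. A i \<tau> *v st_y s' i \<tau>)" if "\<tau> < n" for \<tau>
    using assms that sum_st_y_step[OF that, of "\<lambda>j y. A j \<tau> *v y"]
    by (simp add: consistent_def st_u_step dv_def matrix_vector_mult_diff_distrib scaleR_add_right scaleR_diff_right)
  show "dual_finite (st_y s')"
    using assms by (auto simp: dual_finite_def consistent_def st_y_step yh_def conjugate_dual_prox_finite)
qed

text \<open>A pathwise estimate sorted by its dependence on the randomness: constants of
  \<open>s\<close>, a sum over nodes of functions of the sampled index, the square of the averaged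
  increment, and the new error. Each group has an accessible expectation.\<close>

lemma lyap_step_le:
  assumes "consistent s"
  shows "lyap s' \<le> 1 / (2 * \<eta>) * (norm (st_x s - \<eta> *\<^sub>R node_mean n (st_e s) - xs))\<^sup>2
      + \<theta> * ((node_mean n (st_u s) - us) \<bullet> xd s) + \<theta>\<^sup>2 / (8 * \<eta>) * (norm (xd s))\<^sup>2
      - (node_mean n (st_u s) - us) \<bullet> (st_z s - xs) + \<eta> / 2 * (norm (node_mean n (st_e s)))\<^sup>2
      + (\<Sum>\<tau><n. \<Sum>j<m. dual_term j \<tau> (st_y s j \<tau>))
      + (\<Sum>\<tau><n. dual_term (i \<tau>) \<tau> (yh s (i \<tau>) \<tau>) - dual_term (i \<tau>) \<tau> (st_y s (i \<tau>) \<tau>)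
          - 1 / real n * (dv s \<tau> (i \<tau>) \<bullet> (st_z s - xs)))
      + 4 * \<eta> * (norm (node_mean n (\<lambda>\<tau>. dv s \<tau> (i \<tau>))))\<^sup>2
      + (\<eta> + lam * \<eta>\<^sup>2) / 2 * (norm (node_mean n (st_e s')))\<^sup>2"
proof -
  define a where "a = node_mean n (\<lambda>\<tau>. dv s \<tau> (i \<tau>))"
  have u': "node_mean n (st_u s') = node_mean n (st_u s) + (1 / real m) *\<^sub>R a"
    unfolding a_def node_mean_scaleR[symmetric] node_mean_add[symmetric] by (intro node_mean_cong st_u_step)
  have z: "st_z s = st_x s + \<theta> *\<^sub>R xd s" using theta by (simp add: xd_def)
  have pr: "(1 / (2 * \<eta>) + lam / 4) * (norm (st_x s' - \<eta> *\<^sub>R node_mean n (st_e s') - xs))\<^sup>2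
      + (g (st_x s') - g xs + us \<bullet> (st_x s' - xs))
      + (node_mean n (st_u s) + (1 / real m) *\<^sub>R a - us) \<bullet> (st_x s' - st_x s) + 1 / (8 * \<eta>) * (norm (st_x s' - st_x s))\<^sup>2
    \<le> 1 / (2 * \<eta>) * (norm (st_x s - \<eta> *\<^sub>R node_mean n (st_e s) - xs))\<^sup>2
      + \<theta> * ((node_mean n (st_u s) - us) \<bullet> xd s) + \<theta>\<^sup>2 / (8 * \<eta>) * (norm (xd s))\<^sup>2
      + 4 * \<eta> * (norm a)\<^sup>2 - (node_mean n (st_u s) + a - us) \<bullet> (st_z s - xs)
      + (\<eta> + lam * \<eta>\<^sup>2) / 2 * (norm (node_mean n (st_e s')))\<^sup>2 + \<eta> / 2 * (norm (node_mean n (st_e s)))\<^sup>2"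
    using m theta
    by (intro primal_step_inequality[OF sc_g lam eta _ z _ st_x_step[OF assms, folded a_def]]) auto
  have du: "(\<Sum>\<tau><n. \<Sum>j<m. dual_term j \<tau> (st_y s' j \<tau>)) = (\<Sum>\<tau><n. \<Sum>j<m. dual_term j \<tau> (st_y s j \<tau>))
    + (\<Sum>\<tau><n. dual_term (i \<tau>) \<tau> (yh s (i \<tau>) \<tau>) - dual_term (i \<tau>) \<tau> (st_y s (i \<tau>) \<tau>))"
    unfolding sum.distrib[symmetric] by (intro sum.cong sum_st_y_step[where F = "\<lambda>j. dual_term j _"]) auto
  have in_a: "(\<Sum>\<tau><n. 1 / real n * (dv s \<tau> (i \<tau>) \<bullet> (st_z s - xs))) = a \<bullet> (st_z s - xs)"
    unfolding a_def inner_node_mean sum_distrib_left ..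
  have sp: "(node_mean n (st_u s) + a - us) \<bullet> (st_z s - xs)
    = (node_mean n (st_u s) - us) \<bullet> (st_z s - xs) + a \<bullet> (st_z s - xs)"
    by (simp add: inner_simps)
  show ?thesis
    using pr unfolding lyap_def[of s'] xd_step u' du sp in_a[symmetric] a_def[symmetric] sum_subtractf
    by linarith
qed

end

text \<open>The mean of the increment over the index is governed by \<open>Rbar\<close>, its second
  moment by \<open>Rm\<close>; averaging over the nodes as well brings in \<open>R\<close> in the
  next lemma.\<close>

lemma dv_bounds:
  assumes tau: "\<tau> < n"
  shows "(norm ((1 / real m) *\<^sub>R (\<Sum>j<m. dv s \<tau> j)))\<^sup>2 \<le> (Rbar_const m n A)\<^sup>2 * dual_move s \<tau>" (is ?bar)
    and "1 / real m * (\<Sum>j<m. (norm (dv s \<tau> j))\<^sup>2) \<le> (Rm_const m n A)\<^sup>2 * dual_move s \<tau>" (is ?max)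
proof -
  have m0: "0 < m" and n0: "0 < n" using m n by auto
  have "(norm (\<Sum>j<m. dv s \<tau> j))\<^sup>2 \<le> real m * (Rbar_const m n A)\<^sup>2 * (\<Sum>j<m. (norm (yh s j \<tau> - st_y s j \<tau>))\<^sup>2)"
    unfolding dv_def by (rule Rbar_const_bound[OF m0 tau])
  then have "(1 / real m)\<^sup>2 * (norm (\<Sum>j<m. dv s \<tau> j))\<^sup>2
    \<le> (1 / real m)\<^sup>2 * (real m * (Rbar_const m n A)\<^sup>2 * (\<Sum>j<m. (norm (yh s j \<tau> - st_y s j \<tau>))\<^sup>2))"
    by (intro mult_left_mono) auto
  then show ?bar using m0 by (simp add: dual_move_def power_mult_distrib power_divide power2_eq_square)
  have "(norm (dv s \<tau> j))\<^sup>2 \<le> (Rm_const m n A)\<^sup>2 * (norm (yh s j \<tau> - st_y s j \<tau>))\<^sup>2" if "j < m" for j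
    using power_mono[OF Rm_const_bound[OF that tau, of A "yh s j \<tau> - st_y s j \<tau>"], of 2]
    by (simp add: dv_def power_mult_distrib)
  then have "(\<Sum>j<m. (norm (dv s \<tau> j))\<^sup>2) \<le> (\<Sum>j<m. (Rm_const m n A)\<^sup>2 * (norm (yh s j \<tau> - st_y s j \<tau>))\<^sup>2)"
    by (intro sum_mono) auto
  then have "1 / real m * (\<Sum>j<m. (norm (dv s \<tau> j))\<^sup>2)
    \<le> 1 / real m * (\<Sum>j<m. (Rm_const m n A)\<^sup>2 * (norm (yh s j \<tau> - st_y s j \<tau>))\<^sup>2)"
    by (intro mult_left_mono) auto
  then show ?max by (simp add: dual_move_def sum_distrib_left[symmetric])
qed

lemma dv_mean_bound:
  "(norm (node_mean n (\<lambda>\<tau>. (1 / real m) *\<^sub>R (\<Sum>j<m. dv s \<tau> j))))\<^sup>2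
    \<le> (R_const m n A)\<^sup>2 * (1 / real n * (\<Sum>\<tau><n. dual_move s \<tau>))"
proof -
  have m0: "0 < m" and n0: "0 < n" using m n by auto
  have "(norm (\<Sum>\<tau><n. \<Sum>j<m. dv s \<tau> j))\<^sup>2
    \<le> real (m * n) * (R_const m n A)\<^sup>2 * (\<Sum>\<tau><n. \<Sum>j<m. (norm (yh s j \<tau> - st_y s j \<tau>))\<^sup>2)"
    unfolding dv_def by (rule R_const_bound[OF m0 n0])
  then have "(1 / real (m * n))\<^sup>2 * (norm (\<Sum>\<tau><n. \<Sum>j<m. dv s \<tau> j))\<^sup>2
    \<le> (1 / real (m * n))\<^sup>2 * (real (m * n) * (R_const m n A)\<^sup>2 * (\<Sum>\<tau><n. \<Sum>j<m. (norm (yh s j \<tau> - st_y s j \<tau>))\<^sup>2))"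
    by (intro mult_left_mono) auto
  also have "\<dots> = (R_const m n A)\<^sup>2 * (1 / real n * (\<Sum>\<tau><n. dual_move s \<tau>))"
    using m0 n0 unfolding dual_move_def sum_distrib_left[symmetric] by (simp add: field_simps power2_eq_square)
  finally show ?thesis
    unfolding node_mean_def scaleR_sum_right[symmetric] norm_scaleR power_mult_distrib
    using m0 n0 by (simp add: power_divide power_mult_distrib mult.commute)
qed

text \<open>The dual inequality averaged over all \<open>j\<close>. Since \<open>yh - Ys\<close>
  splits into \<open>yh - y\<close> and \<open>y - Ys\<close>, the second part averages to the inner
  product with \<open>node_mean n (st_u s) - us\<close>, which the primal estimate contains with the
  opposite sign. The last sum carries \<open>1 / m\<close> because a coordinate is refreshed with
  that probability.\<close>

lemma mean_dual_step_le:
  assumes "consistent s"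
  shows "(\<Sum>\<tau><n. 1 / real m * (\<Sum>j<m. dual_term j \<tau> (yh s j \<tau>) - dual_term j \<tau> (st_y s j \<tau>)
          - 1 / real n * (dv s \<tau> j \<bullet> (st_z s - xs))))
    \<le> (node_mean n (st_u s) - us) \<bullet> (st_z s - xs) - 1 / (2 * \<sigma>) * (1 / real n * (\<Sum>\<tau><n. dual_move s \<tau>))
      - 1 / real m * (\<Sum>\<tau><n. \<Sum>j<m. 1 / real n * (\<gamma> / 2 * (norm (st_y s j \<tau> - Ys j \<tau>))\<^sup>2 + bregman j \<tau> (st_y s j \<tau>)))"
proof -
  define w where "w = st_z s - xs"
  have m0: "0 < m" and n0: "0 < n" using m n by auto
  have "dual_term j \<tau> (yh s j \<tau>) - dual_term j \<tau> (st_y s j \<tau>) - 1 / real n * (dv s \<tau> j \<bullet> w)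
    \<le> 1 / real n * ((A j \<tau> *v (st_y s j \<tau> - Ys j \<tau>)) \<bullet> w)
      - 1 / (2 * \<sigma>) * (1 / real n) * (norm (yh s j \<tau> - st_y s j \<tau>))\<^sup>2
      - 1 / real n * (\<gamma> / 2 * (norm (st_y s j \<tau> - Ys j \<tau>))\<^sup>2 + bregman j \<tau> (st_y s j \<tau>))"
    if "j < m" "\<tau> < n" for j \<tau>
  proof -
    have "(1 / (2 * \<sigma>) + \<gamma> / 2) * (norm (yh s j \<tau> - Ys j \<tau>))\<^sup>2 + bregman j \<tau> (yh s j \<tau>)
      \<le> 1 / (2 * \<sigma>) * (norm (st_y s j \<tau> - Ys j \<tau>))\<^sup>2 - 1 / (2 * \<sigma>) * (norm (yh s j \<tau> - st_y s j \<tau>))\<^sup>2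
        + (A j \<tau> *v (yh s j \<tau> - Ys j \<tau>)) \<bullet> w"
      unfolding yh_def w_def by (rule dual_step_inequality[OF that sig])
    then have "1 / real n * ((1 / (2 * \<sigma>) + \<gamma> / 2) * (norm (yh s j \<tau> - Ys j \<tau>))\<^sup>2 + bregman j \<tau> (yh s j \<tau>))
      \<le> 1 / real n * (1 / (2 * \<sigma>) * (norm (st_y s j \<tau> - Ys j \<tau>))\<^sup>2 - 1 / (2 * \<sigma>) * (norm (yh s j \<tau> - st_y s j \<tau>))\<^sup>2
        + (A j \<tau> *v (yh s j \<tau> - Ys j \<tau>)) \<bullet> w)"
      by (intro mult_left_mono) auto
    moreover have "(A j \<tau> *v (yh s j \<tau> - Ys j \<tau>)) \<bullet> w = dv s \<tau> j \<bullet> w + (A j \<tau> *v (st_y s j \<tau> - Ys j \<tau>)) \<bullet> w"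
      by (simp add: dv_def matrix_vector_mult_diff_distrib inner_diff_left)
    ultimately show ?thesis unfolding dual_term_def by (simp add: add_divide_distrib algebra_simps)
  qed
  then have "(\<Sum>\<tau><n. 1 / real m * (\<Sum>j<m. dual_term j \<tau> (yh s j \<tau>) - dual_term j \<tau> (st_y s j \<tau>)
          - 1 / real n * (dv s \<tau> j \<bullet> w)))
    \<le> (\<Sum>\<tau><n. 1 / real m * (\<Sum>j<m. 1 / real n * ((A j \<tau> *v (st_y s j \<tau> - Ys j \<tau>)) \<bullet> w)
      - 1 / (2 * \<sigma>) * (1 / real n) * (norm (yh s j \<tau> - st_y s j \<tau>))\<^sup>2
      - 1 / real n * (\<gamma> / 2 * (norm (st_y s j \<tau> - Ys j \<tau>))\<^sup>2 + bregman j \<tau> (st_y s j \<tau>))))"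
    by (intro sum_mono mult_left_mono) auto
  also have "\<dots> = (\<Sum>\<tau><n. 1 / real m * (\<Sum>j<m. 1 / real n * ((A j \<tau> *v (st_y s j \<tau> - Ys j \<tau>)) \<bullet> w)))
      - 1 / (2 * \<sigma>) * (1 / real n * (\<Sum>\<tau><n. dual_move s \<tau>))
      - 1 / real m * (\<Sum>\<tau><n. \<Sum>j<m. 1 / real n * (\<gamma> / 2 * (norm (st_y s j \<tau> - Ys j \<tau>))\<^sup>2 + bregman j \<tau> (st_y s j \<tau>)))"
    unfolding sum_subtractf right_diff_distrib dual_move_def sum_distrib_left[symmetric] by (simp add: mult_ac)
  also have "(\<Sum>\<tau><n. 1 / real m * (\<Sum>j<m. 1 / real n * ((A j \<tau> *v (st_y s j \<tau> - Ys j \<tau>)) \<bullet> w)))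
    = (node_mean n (st_u s) - us) \<bullet> w"
  proof -
    have "node_mean n (st_u s) = (1 / real (m * n)) *\<^sub>R (\<Sum>\<tau><n. \<Sum>j<m. A j \<tau> *v st_y s j \<tau>)"
      using assms unfolding node_mean_def consistent_def
      by (simp add: scaleR_sum_right[symmetric] mult.commute)
    then have "(node_mean n (st_u s) - us) = (1 / real (m * n)) *\<^sub>R (\<Sum>\<tau><n. \<Sum>j<m. A j \<tau> *v (st_y s j \<tau> - Ys j \<tau>))"
      unfolding us_def by (simp add: matrix_vector_mult_diff_distrib sum_subtractf scaleR_diff_right)
    then show ?thesis
      by (simp add: inner_sum_left sum_distrib_left mult_ac)
  qed
  finally show ?thesis unfolding w_def .
qed

end


section \<open>One-step contraction in expectation\<close>

lemma linear_combination_le: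
  fixes a b c x y z :: real
  assumes "a \<le> a'" "b \<le> b'" "c \<le> c'" "0 \<le> x" "0 \<le> y" "0 \<le> z"
  shows "a * x + b * y + c * z \<le> a' * x + b' * y + c' * z"
  using assms by (intro add_mono mult_right_mono)

text \<open>A comparison of the coefficients of \<open>E\<close>, \<open>H\<close> and
  \<open>S\<close>. With weight \<open>c1\<close> the two terms \<open>\<kappa> / 2\<close> use up
  \<open>\<delta> / 3\<close> of the contraction \<open>\<delta> / 2\<close>. The feed of
  \<open>H\<close> into the error is at most
  \<open>14 * (1 - \<delta>) * \<kappa> / \<delta>\<^sup>2\<close>, and \<open>c4\<close> is three
  times this over \<open>\<delta>1\<close>, so that \<open>\<delta>1 / 6\<close> is left for
  \<open>\<theta>\<close>. What multiplies \<open>S\<close> is the last part of \<open>R2\<close>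
  squared, with \<open>3 / 4\<close> from \<open>\<kappa> \<le> 3 / 2 * \<eta>\<close>.\<close>

lemma error_budget:
  fixes \<delta> \<delta>1 \<kappa> \<eta> \<theta> M :: real
  assumes d: "0 < \<delta>" "\<delta> \<le> 1" and d1: "0 < \<delta>1" "\<delta>1 \<le> 1" and k: "0 \<le> \<kappa>" "\<kappa> \<le> 3 / 2 * \<eta>"
    and th: "1 - \<delta> / 6 \<le> \<theta>" "1 - \<delta>1 / 6 \<le> \<theta>"
    and nn: "0 \<le> E" "0 \<le> H" "0 \<le> S" "0 \<le> Rb" "0 \<le> Rm" and M: "0 < M"
  defines "c1 \<equiv> 3 * \<kappa> / \<delta>" and "c4 \<equiv> 42 * (1 - \<delta>) * \<kappa> / (\<delta>\<^sup>2 * \<delta>1)"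
  shows "(c1 + \<kappa> / 2) * ((1 - \<delta> / 2) * E + 4 * (1 - \<delta>) / \<delta> * (Rb * S + H) + (1 - \<delta>) * (Rm * S)) + \<kappa> / 2 * E
      + c4 * ((1 - \<delta>1 / 2) * H + 2 * (1 - \<delta>1) / (\<delta>1 * M) * (Rb * S) + 1 / M * (Rm * S))
    \<le> \<theta> * (c1 * E) + \<theta> * (c4 * H)
      + 2 * \<eta> * (3 * (1 - \<delta>) / 4 * (14 * Rb / \<delta>\<^sup>2 + 7 * Rm / (2 * \<delta>)
          + 84 * (1 - \<delta>1) * Rb / (\<delta>\<^sup>2 * \<delta>1\<^sup>2 * M) + 42 * Rm / (\<delta>\<^sup>2 * \<delta>1 * M))) * S"
proof -
  define a where "a = c1 + \<kappa> / 2"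
  have c1: "0 \<le> c1" and c4: "0 \<le> c4" using d d1 k by (simp_all add: c1_def c4_def)
  \<comment> \<open>\<open>7 / 2\<close> is \<open>3 + 1 / 2\<close>, by
    \<open>\<delta> \<le> 1\<close>.\<close>
  have a: "a \<le> 7 * \<kappa> / (2 * \<delta>)"
  proof -
    have "\<kappa> / 2 \<le> \<kappa> / (2 * \<delta>)" using d k mult_right_mono[of \<delta> 1 \<kappa>] by (simp add: field_simps)
    then show ?thesis by (simp add: a_def c1_def)
  qed
  have E: "a * (1 - \<delta> / 2) + \<kappa> / 2 \<le> \<theta> * c1"
  proof -
    have "a * (1 - \<delta> / 2) + \<kappa> / 2 = (1 - \<delta> / 6) * c1 - \<kappa> * \<delta> / 4"
      using d by (simp add: a_def c1_def field_simps power2_eq_square)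
    also have "\<dots> \<le> (1 - \<delta> / 6) * c1" using d k by simp
    also have "\<dots> \<le> \<theta> * c1" using th c1 by (intro mult_right_mono)
    finally show ?thesis .
  qed
  have H: "a * (4 * (1 - \<delta>) / \<delta>) + c4 * (1 - \<delta>1 / 2) \<le> \<theta> * c4"
  proof -
    have "a * (4 * (1 - \<delta>) / \<delta>) \<le> 7 * \<kappa> / (2 * \<delta>) * (4 * (1 - \<delta>) / \<delta>)"
      using a d by (intro mult_right_mono) auto
    also have "\<dots> = c4 * (\<delta>1 / 3)" using d d1 by (simp add: c4_def field_simps power2_eq_square)
    finally have "a * (4 * (1 - \<delta>) / \<delta>) + c4 * (1 - \<delta>1 / 2) \<le> c4 * (\<delta>1 / 3) + c4 * (1 - \<delta>1 / 2)" by simp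
    also have "\<dots> = (1 - \<delta>1 / 6) * c4" by (simp add: algebra_simps)
    also have "\<dots> \<le> \<theta> * c4" using th c4 by (intro mult_right_mono)
    finally show ?thesis .
  qed
  have S: "a * (4 * (1 - \<delta>) / \<delta> * Rb + (1 - \<delta>) * Rm) + c4 * (2 * (1 - \<delta>1) / (\<delta>1 * M) * Rb + 1 / M * Rm)
    \<le> 2 * \<eta> * (3 * (1 - \<delta>) / 4 * (14 * Rb / \<delta>\<^sup>2 + 7 * Rm / (2 * \<delta>)
          + 84 * (1 - \<delta>1) * Rb / (\<delta>\<^sup>2 * \<delta>1\<^sup>2 * M) + 42 * Rm / (\<delta>\<^sup>2 * \<delta>1 * M)))"
  proof -
    define P where "P = (1 - \<delta>) * (14 * Rb / \<delta>\<^sup>2 + 7 * Rm / (2 * \<delta>)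
          + 84 * (1 - \<delta>1) * Rb / (\<delta>\<^sup>2 * \<delta>1\<^sup>2 * M) + 42 * Rm / (\<delta>\<^sup>2 * \<delta>1 * M))"
    have P: "0 \<le> P" unfolding P_def using d d1 nn M by (intro mult_nonneg_nonneg add_nonneg_nonneg) auto
    have "a * (4 * (1 - \<delta>) / \<delta> * Rb + (1 - \<delta>) * Rm) \<le> 7 * \<kappa> / (2 * \<delta>) * (4 * (1 - \<delta>) / \<delta> * Rb + (1 - \<delta>) * Rm)"
      using a d nn by (intro mult_right_mono) auto
    also have "\<dots> + c4 * (2 * (1 - \<delta>1) / (\<delta>1 * M) * Rb + 1 / M * Rm) = \<kappa> * P"
    proof -
      have "7 * \<kappa> / (2 * \<delta>) * (4 * (1 - \<delta>) / \<delta> * Rb + (1 - \<delta>) * Rm) = \<kappa> * ((1 - \<delta>) * (14 * Rb / \<delta>\<^sup>2 + 7 * Rm / (2 * \<delta>)))"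
        using d by (simp add: field_simps power2_eq_square)
      moreover have "c4 * (2 * (1 - \<delta>1) / (\<delta>1 * M) * Rb + 1 / M * Rm)
        = \<kappa> * ((1 - \<delta>) * (84 * (1 - \<delta>1) * Rb / (\<delta>\<^sup>2 * \<delta>1\<^sup>2 * M) + 42 * Rm / (\<delta>\<^sup>2 * \<delta>1 * M)))"
        using d d1 M by (simp add: c4_def field_simps power2_eq_square)
      ultimately show ?thesis unfolding P_def by (simp add: algebra_simps)
    qed
    also have "\<kappa> * P \<le> 3 / 2 * \<eta> * P" using k P by (intro mult_right_mono)
    also have "\<dots> = 2 * \<eta> * (3 * (1 - \<delta>) / 4 * (14 * Rb / \<delta>\<^sup>2 + 7 * Rm / (2 * \<delta>)
          + 84 * (1 - \<delta>1) * Rb / (\<delta>\<^sup>2 * \<delta>1\<^sup>2 * M) + 42 * Rm / (\<delta>\<^sup>2 * \<delta>1 * M)))"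
      by (simp add: P_def)
    finally show ?thesis by simp
  qed
  show ?thesis
    using linear_combination_le[OF E H S nn(1-3)] unfolding a_def[symmetric]
    by (simp only: distrib_left distrib_right mult.assoc[symmetric] add_ac)
qed

text \<open>The weights are solved backwards along the influences: \<open>E\<close> and
  \<open>p0\<close> feed \<open>e0\<close>, and \<open>H\<close> feeds all three. As
  \<open>p0\<close> contracts by the full \<open>\<delta>1\<close>, five sixths of it may be spent,
  which gives \<open>84 / 5\<close>; for \<open>H\<close> the three feeds sum to
  \<open>84 + 84 / 5 = 504 / 5\<close>, a third of \<open>1512 / 5\<close>.\<close>

lemma unbiased_error_budget:
  fixes \<delta> \<delta>1 \<kappa> \<eta> \<theta> M n :: real
  assumes d: "0 < \<delta>" "\<delta> \<le> 1" and d1: "0 < \<delta>1" "\<delta>1 \<le> 1" and k: "0 \<le> \<kappa>" "\<kappa> \<le> 3 / 2 * \<eta>"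
    and th: "1 - \<delta> / 6 \<le> \<theta>" "1 - \<delta>1 / 6 \<le> \<theta>"
    and nn: "0 \<le> e0" "0 \<le> E" "0 \<le> p0" "0 \<le> H" "0 \<le> S" "0 \<le> R" "0 \<le> Rb" "0 \<le> Rm" and M: "0 < M" and n: "0 < n"
  defines "c1 \<equiv> 3 * \<kappa> / \<delta>" and "c2 \<equiv> 21 * (1 - \<delta>) * \<kappa> / (\<delta> * n)"
    and "c3 \<equiv> 84 * (1 - \<delta>) * \<kappa> / (5 * \<delta>\<^sup>2 * \<delta>1)" and "c5 \<equiv> 1512 * (1 - \<delta>) * \<kappa> / (5 * \<delta>\<^sup>2 * \<delta>1 * n)"
  shows "(c1 + \<kappa> / 2) * ((1 - \<delta> / 2) * e0 + 4 * (1 - \<delta>) / \<delta> * (R * S + p0)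
        + 1 / n * ((1 - \<delta>) * (Rm * S) + \<delta> * (1 - \<delta>) * (2 * E + 4 * (Rm * S) + 4 * H))) + \<kappa> / 2 * e0
      + c2 * ((1 - \<delta> / 2) * E + 4 * (1 - \<delta>) / \<delta> * (Rb * S + H) + (1 - \<delta>) * (Rm * S))
      + c3 * ((1 - \<delta>1) * p0 + 1 / (\<delta>1 * M) * (R * S) + 1 / n * (\<delta>1 * (1 - \<delta>1) * H + 1 / M * (Rm * S)))
      + c5 * ((1 - \<delta>1 / 2) * H + 2 * (1 - \<delta>1) / (\<delta>1 * M) * (Rb * S) + 1 / M * (Rm * S))
    \<le> \<theta> * (c1 * e0) + \<theta> * (c2 * E) + \<theta> * (c3 * p0) + \<theta> * (c5 * H)
      + 2 * \<eta> * (21 * (1 - \<delta>) / 4 * (2 * R / \<delta>\<^sup>2 + 11 * Rm / (2 * \<delta> * n) + 12 * (1 - \<delta>) * Rb / (\<delta>\<^sup>2 * n)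
           + 12 * R / (5 * \<delta>\<^sup>2 * \<delta>1\<^sup>2 * M) + 228 * Rm / (5 * \<delta>\<^sup>2 * \<delta>1 * M * n)
           + 432 * (1 - \<delta>1) * Rb / (5 * \<delta>\<^sup>2 * \<delta>1\<^sup>2 * M * n))) * S"
proof -
  define a where "a = c1 + \<kappa> / 2"
  have c: "0 \<le> c1" "0 \<le> c2" "0 \<le> c3" "0 \<le> c5" using d d1 k n by (simp_all add: c1_def c2_def c3_def c5_def)
  have a: "a \<le> 7 * \<kappa> / (2 * \<delta>)"
  proof -
    have "\<kappa> / 2 \<le> \<kappa> / (2 * \<delta>)" using d k mult_right_mono[of \<delta> 1 \<kappa>] by (simp add: field_simps)
    then show ?thesis by (simp add: a_def c1_def)
  qed
  have a_le: "a * X \<le> 7 * \<kappa> / (2 * \<delta>) * X" if "0 \<le> X" for X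
    using a that by (rule mult_right_mono)
  have e0: "a * (1 - \<delta> / 2) + \<kappa> / 2 \<le> \<theta> * c1"
  proof -
    have "a * (1 - \<delta> / 2) + \<kappa> / 2 = (1 - \<delta> / 6) * c1 - \<kappa> * \<delta> / 4"
      using d by (simp add: a_def c1_def field_simps power2_eq_square)
    also have "\<dots> \<le> (1 - \<delta> / 6) * c1" using d k by simp
    also have "\<dots> \<le> \<theta> * c1" using th c by (intro mult_right_mono)
    finally show ?thesis .
  qed
  have E: "a * (1 / n * (\<delta> * (1 - \<delta>) * 2)) + c2 * (1 - \<delta> / 2) \<le> \<theta> * c2"
  proof -
    have "a * (1 / n * (\<delta> * (1 - \<delta>) * 2)) \<le> 7 * \<kappa> / (2 * \<delta>) * (1 / n * (\<delta> * (1 - \<delta>) * 2))"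
      using d n by (intro a_le) auto
    also have "\<dots> = c2 * (\<delta> / 3)" using d n by (simp add: c2_def field_simps)
    finally have "a * (1 / n * (\<delta> * (1 - \<delta>) * 2)) + c2 * (1 - \<delta> / 2) \<le> c2 * (\<delta> / 3) + c2 * (1 - \<delta> / 2)" by simp
    also have "\<dots> = (1 - \<delta> / 6) * c2" by (simp add: algebra_simps)
    also have "\<dots> \<le> \<theta> * c2" using th c by (intro mult_right_mono)
    finally show ?thesis .
  qed
  have p0: "a * (4 * (1 - \<delta>) / \<delta>) + c3 * (1 - \<delta>1) \<le> \<theta> * c3"
  proof -
    have "a * (4 * (1 - \<delta>) / \<delta>) \<le> 7 * \<kappa> / (2 * \<delta>) * (4 * (1 - \<delta>) / \<delta>)"
      using d by (intro a_le) auto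
    also have "\<dots> = c3 * (5 * \<delta>1 / 6)" using d d1 by (simp add: c3_def field_simps power2_eq_square)
    finally have "a * (4 * (1 - \<delta>) / \<delta>) + c3 * (1 - \<delta>1) \<le> c3 * (5 * \<delta>1 / 6) + c3 * (1 - \<delta>1)" by simp
    also have "\<dots> = (1 - \<delta>1 / 6) * c3" by (simp add: algebra_simps)
    also have "\<dots> \<le> \<theta> * c3" using th c by (intro mult_right_mono)
    finally show ?thesis .
  qed
  have H: "a * (1 / n * (\<delta> * (1 - \<delta>) * 4)) + c2 * (4 * (1 - \<delta>) / \<delta>) + c3 * (1 / n * (\<delta>1 * (1 - \<delta>1)))
      + c5 * (1 - \<delta>1 / 2) \<le> \<theta> * c5"
  proof -
    define U where "U = (1 - \<delta>) * \<kappa> / (\<delta>\<^sup>2 * n)"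
    have U: "0 \<le> U" using d k n by (simp add: U_def)
    have "a * (1 / n * (\<delta> * (1 - \<delta>) * 4)) \<le> 7 * \<kappa> / (2 * \<delta>) * (1 / n * (\<delta> * (1 - \<delta>) * 4))"
      using d n by (intro a_le) auto
    also have "\<dots> = 14 * \<delta>\<^sup>2 * U" using d n by (simp add: U_def field_simps)
    \<comment> \<open>Rounded up generously so that it merges with
      \<open>84 * (1 - \<delta>) * U\<close> below into \<open>84 * U\<close>.\<close>
    also have "\<dots> \<le> 84 * \<delta> * U"
      using d U by (intro mult_right_mono) (auto simp: power2_eq_square)
    finally have 1: "a * (1 / n * (\<delta> * (1 - \<delta>) * 4)) \<le> 84 * \<delta> * U" .
    have 2: "c2 * (4 * (1 - \<delta>) / \<delta>) = 84 * (1 - \<delta>) * U"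
      using d n by (simp add: c2_def U_def field_simps power2_eq_square)
    have "c3 * (1 / n * (\<delta>1 * (1 - \<delta>1))) = 84 / 5 * U * (1 - \<delta>1)"
      using d n d1 by (simp add: c3_def U_def field_simps power2_eq_square)
    also have "\<dots> \<le> 84 / 5 * U * 1" using U d1 by (intro mult_left_mono) auto
    finally have 3: "c3 * (1 / n * (\<delta>1 * (1 - \<delta>1))) \<le> 84 / 5 * U" by simp
    have 4: "c5 * (\<delta>1 / 3) = 504 / 5 * U" using d n d1 by (simp add: c5_def U_def field_simps)
    have "a * (1 / n * (\<delta> * (1 - \<delta>) * 4)) + c2 * (4 * (1 - \<delta>) / \<delta>) + c3 * (1 / n * (\<delta>1 * (1 - \<delta>1)))
      + c5 * (1 - \<delta>1 / 2) \<le> c5 * (\<delta>1 / 3) + c5 * (1 - \<delta>1 / 2)"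
      using 1 2 3 4 by (simp add: algebra_simps)
    also have "\<dots> = (1 - \<delta>1 / 6) * c5" by (simp add: algebra_simps)
    also have "\<dots> \<le> \<theta> * c5" using th c by (intro mult_right_mono)
    finally show ?thesis .
  qed
  have S: "a * (4 * (1 - \<delta>) / \<delta> * R + 1 / n * ((1 - \<delta>) * Rm + \<delta> * (1 - \<delta>) * (4 * Rm)))
      + c2 * (4 * (1 - \<delta>) / \<delta> * Rb + (1 - \<delta>) * Rm)
      + c3 * (1 / (\<delta>1 * M) * R + 1 / n * (1 / M * Rm))
      + c5 * (2 * (1 - \<delta>1) / (\<delta>1 * M) * Rb + 1 / M * Rm)
    \<le> 2 * \<eta> * (21 * (1 - \<delta>) / 4 * (2 * R / \<delta>\<^sup>2 + 11 * Rm / (2 * \<delta> * n) + 12 * (1 - \<delta>) * Rb / (\<delta>\<^sup>2 * n)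
           + 12 * R / (5 * \<delta>\<^sup>2 * \<delta>1\<^sup>2 * M) + 228 * Rm / (5 * \<delta>\<^sup>2 * \<delta>1 * M * n)
           + 432 * (1 - \<delta>1) * Rb / (5 * \<delta>\<^sup>2 * \<delta>1\<^sup>2 * M * n)))"
  proof -
    define P where "P = 7 * (1 - \<delta>) * (2 * R / \<delta>\<^sup>2 + 11 * Rm / (2 * \<delta> * n) + 12 * (1 - \<delta>) * Rb / (\<delta>\<^sup>2 * n)
           + 12 * R / (5 * \<delta>\<^sup>2 * \<delta>1\<^sup>2 * M) + 228 * Rm / (5 * \<delta>\<^sup>2 * \<delta>1 * M * n)
           + 432 * (1 - \<delta>1) * Rb / (5 * \<delta>\<^sup>2 * \<delta>1\<^sup>2 * M * n))"
    have P: "0 \<le> P" unfolding P_def using d d1 nn M n by (intro mult_nonneg_nonneg add_nonneg_nonneg) auto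
    define W where "W = (1 - \<delta>) * Rm / (\<delta> * n)"
    have W: "0 \<le> W" using d nn n by (simp add: W_def)
    have 1: "a * (4 * (1 - \<delta>) / \<delta> * R + 1 / n * ((1 - \<delta>) * Rm + \<delta> * (1 - \<delta>) * (4 * Rm)))
      \<le> \<kappa> * (14 * (1 - \<delta>) * R / \<delta>\<^sup>2 + 7 / 2 * (1 + 4 * \<delta>) * W)"
    proof -
      have "a * (4 * (1 - \<delta>) / \<delta> * R + 1 / n * ((1 - \<delta>) * Rm + \<delta> * (1 - \<delta>) * (4 * Rm)))
        \<le> 7 * \<kappa> / (2 * \<delta>) * (4 * (1 - \<delta>) / \<delta> * R + 1 / n * ((1 - \<delta>) * Rm + \<delta> * (1 - \<delta>) * (4 * Rm)))"
        using d nn n by (intro a_le add_nonneg_nonneg mult_nonneg_nonneg) auto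
      also have "\<dots> = \<kappa> * (14 * (1 - \<delta>) * R / \<delta>\<^sup>2 + 7 / 2 * (1 + 4 * \<delta>) * W)"
        using d n by (simp add: W_def field_simps power2_eq_square)
      finally show ?thesis .
    qed
    have 2: "c2 * (4 * (1 - \<delta>) / \<delta> * Rb + (1 - \<delta>) * Rm)
      = \<kappa> * (7 * (1 - \<delta>) * (12 * (1 - \<delta>) * Rb / (\<delta>\<^sup>2 * n)) + 21 * (1 - \<delta>) * W)"
      using d n by (simp add: c2_def W_def field_simps power2_eq_square)
    have 3: "c3 * (1 / (\<delta>1 * M) * R + 1 / n * (1 / M * Rm))
      = \<kappa> * (7 * (1 - \<delta>) * (12 * R / (5 * \<delta>\<^sup>2 * \<delta>1\<^sup>2 * M) + 12 * Rm / (5 * \<delta>\<^sup>2 * \<delta>1 * M * n)))"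
      using d n d1 M by (simp add: c3_def field_simps power2_eq_square)
    have 4: "c5 * (2 * (1 - \<delta>1) / (\<delta>1 * M) * Rb + 1 / M * Rm)
      = \<kappa> * (7 * (1 - \<delta>) * (216 * Rm / (5 * \<delta>\<^sup>2 * \<delta>1 * M * n) + 432 * (1 - \<delta>1) * Rb / (5 * \<delta>\<^sup>2 * \<delta>1\<^sup>2 * M * n)))"
      using d n d1 M by (simp add: c5_def field_simps power2_eq_square)
    have 5: "7 / 2 * (1 + 4 * \<delta>) * W + 21 * (1 - \<delta>) * W \<le> 7 * (1 - \<delta>) * (11 * Rm / (2 * \<delta> * n))"
    proof -
      have "7 / 2 * (1 + 4 * \<delta>) * W + 21 * (1 - \<delta>) * W = (49 / 2 - 7 * \<delta>) * W" by (simp add: algebra_simps)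
      \<comment> \<open>The stated coefficient \<open>11 / 2\<close> is \<open>77 / 2\<close> after
        the factor 7; it leaves room here.\<close>
      also have "\<dots> \<le> 77 / 2 * W" using d W by (intro mult_right_mono) auto
      also have "\<dots> = 7 * (1 - \<delta>) * (11 * Rm / (2 * \<delta> * n))" using d n by (simp add: W_def field_simps)
      finally show ?thesis .
    qed
    have 6: "12 * Rm / (5 * \<delta>\<^sup>2 * \<delta>1 * M * n) + 216 * Rm / (5 * \<delta>\<^sup>2 * \<delta>1 * M * n) = 228 * Rm / (5 * \<delta>\<^sup>2 * \<delta>1 * M * n)"
      by (simp add: add_divide_distrib[symmetric])
    have "a * (4 * (1 - \<delta>) / \<delta> * R + 1 / n * ((1 - \<delta>) * Rm + \<delta> * (1 - \<delta>) * (4 * Rm)))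
      + c2 * (4 * (1 - \<delta>) / \<delta> * Rb + (1 - \<delta>) * Rm)
      + c3 * (1 / (\<delta>1 * M) * R + 1 / n * (1 / M * Rm))
      + c5 * (2 * (1 - \<delta>1) / (\<delta>1 * M) * Rb + 1 / M * Rm)
      \<le> \<kappa> * (14 * (1 - \<delta>) * R / \<delta>\<^sup>2 + (7 / 2 * (1 + 4 * \<delta>) * W + 21 * (1 - \<delta>) * W)
        + 7 * (1 - \<delta>) * (12 * (1 - \<delta>) * Rb / (\<delta>\<^sup>2 * n))
        + 7 * (1 - \<delta>) * (12 * R / (5 * \<delta>\<^sup>2 * \<delta>1\<^sup>2 * M))
        + 7 * (1 - \<delta>) * (12 * Rm / (5 * \<delta>\<^sup>2 * \<delta>1 * M * n) + 216 * Rm / (5 * \<delta>\<^sup>2 * \<delta>1 * M * n))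
        + 7 * (1 - \<delta>) * (432 * (1 - \<delta>1) * Rb / (5 * \<delta>\<^sup>2 * \<delta>1\<^sup>2 * M * n)))"
      unfolding 2 3 4 using 1 by (simp only: distrib_left)
    also have "\<dots> \<le> \<kappa> * P"
    proof (rule mult_left_mono[OF _ k(1)])
      have "14 * (1 - \<delta>) * R / \<delta>\<^sup>2 = 7 * (1 - \<delta>) * (2 * R / \<delta>\<^sup>2)"
        by (simp add: field_simps)
      then show "14 * (1 - \<delta>) * R / \<delta>\<^sup>2 + (7 / 2 * (1 + 4 * \<delta>) * W + 21 * (1 - \<delta>) * W)
        + 7 * (1 - \<delta>) * (12 * (1 - \<delta>) * Rb / (\<delta>\<^sup>2 * n))
        + 7 * (1 - \<delta>) * (12 * R / (5 * \<delta>\<^sup>2 * \<delta>1\<^sup>2 * M))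
        + 7 * (1 - \<delta>) * (12 * Rm / (5 * \<delta>\<^sup>2 * \<delta>1 * M * n) + 216 * Rm / (5 * \<delta>\<^sup>2 * \<delta>1 * M * n))
        + 7 * (1 - \<delta>) * (432 * (1 - \<delta>1) * Rb / (5 * \<delta>\<^sup>2 * \<delta>1\<^sup>2 * M * n)) \<le> P"
        using 5 unfolding 6 P_def distrib_left[of "7 * (1 - \<delta>)"] by linarith
    qed
    also have "\<kappa> * P \<le> 3 / 2 * \<eta> * P" using k P by (intro mult_right_mono)
    finally have fin: "a * (4 * (1 - \<delta>) / \<delta> * R + 1 / n * ((1 - \<delta>) * Rm + \<delta> * (1 - \<delta>) * (4 * Rm)))
      + c2 * (4 * (1 - \<delta>) / \<delta> * Rb + (1 - \<delta>) * Rm)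
      + c3 * (1 / (\<delta>1 * M) * R + 1 / n * (1 / M * Rm))
      + c5 * (2 * (1 - \<delta>1) / (\<delta>1 * M) * Rb + 1 / M * Rm) \<le> 3 / 2 * \<eta> * P" .
    have eq: "3 / 2 * \<eta> * (7 * (1 - \<delta>) * X) = 2 * \<eta> * (21 * (1 - \<delta>) / 4 * X)" for X
      by (simp add: field_simps)
    show ?thesis using fin unfolding P_def eq .
  qed
  have "((a * (1 - \<delta> / 2) + \<kappa> / 2) * e0 + (a * (1 / n * (\<delta> * (1 - \<delta>) * 2)) + c2 * (1 - \<delta> / 2)) * E
      + (a * (4 * (1 - \<delta>) / \<delta>) + c3 * (1 - \<delta>1)) * p0)
    + ((a * (1 / n * (\<delta> * (1 - \<delta>) * 4)) + c2 * (4 * (1 - \<delta>) / \<delta>) + c3 * (1 / n * (\<delta>1 * (1 - \<delta>1)))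
      + c5 * (1 - \<delta>1 / 2)) * H + (a * (4 * (1 - \<delta>) / \<delta> * R + 1 / n * ((1 - \<delta>) * Rm + \<delta> * (1 - \<delta>) * (4 * Rm)))
      + c2 * (4 * (1 - \<delta>) / \<delta> * Rb + (1 - \<delta>) * Rm)
      + c3 * (1 / (\<delta>1 * M) * R + 1 / n * (1 / M * Rm))
      + c5 * (2 * (1 - \<delta>1) / (\<delta>1 * M) * Rb + 1 / M * Rm)) * S)
    \<le> (\<theta> * c1 * e0 + \<theta> * c2 * E + \<theta> * c3 * p0) + (\<theta> * c5 * H
      + 2 * \<eta> * (21 * (1 - \<delta>) / 4 * (2 * R / \<delta>\<^sup>2 + 11 * Rm / (2 * \<delta> * n) + 12 * (1 - \<delta>) * Rb / (\<delta>\<^sup>2 * n)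
           + 12 * R / (5 * \<delta>\<^sup>2 * \<delta>1\<^sup>2 * M) + 228 * Rm / (5 * \<delta>\<^sup>2 * \<delta>1 * M * n)
           + 432 * (1 - \<delta>1) * Rb / (5 * \<delta>\<^sup>2 * \<delta>1\<^sup>2 * M * n))) * S)"
    by (intro add_mono mult_right_mono e0 E p0 H S nn(1-5))
  then show ?thesis
    unfolding a_def[symmetric]
    by (simp only: distrib_left distrib_right mult.assoc[symmetric] add_ac)
qed

text \<open>The inequalities on \<open>\<theta>\<close> are collected as assumptions, according to
  the summands of the Lyapunov function that they serve; \<open>stepsize_properties\<close> derives
  them from the stated stepsizes.\<close>

locale ecspdc_analysis = ecspdc_parameters m n A \<phi> G g lam \<gamma> xs Ys \<sigma> \<eta> \<theta>
    + compressor_pair m n S S1 Q Q1 \<delta> \<delta>1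
  for m n :: nat
    and A :: "nat \<Rightarrow> nat \<Rightarrow> real^'t^'d"
    and \<phi> :: "nat \<Rightarrow> nat \<Rightarrow> real^'t \<Rightarrow> real"
    and G :: "nat \<Rightarrow> nat \<Rightarrow> real^'t \<Rightarrow> real^'t"
    and g :: "real^'d \<Rightarrow> real"
    and lam \<gamma> :: real
    and xs :: "real^'d" and Ys :: "nat \<Rightarrow> nat \<Rightarrow> real^'t"
    and \<sigma> \<eta> \<theta> :: real
    and S :: "'s measure" and S1 :: "'s1 measure"
    and Q :: "'s \<Rightarrow> real^'d \<Rightarrow> real^'d" and Q1 :: "'s1 \<Rightarrow> real^'d \<Rightarrow> real^'d" and \<delta> \<delta>1 :: real +
  assumes theta_le: "\<theta> \<le> 1"
    and theta_primal: "1 / (2 * \<eta>) \<le> \<theta> * (1 / (2 * \<eta>) + lam / 4)"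
    and theta_dual: "1 / (2 * \<sigma>) + \<gamma> / 2 * (1 - 1 / real m) \<le> \<theta> * (1 / (2 * \<sigma>) + \<gamma> / 2)"
    and theta_m: "1 - 1 / real m \<le> \<theta>"
    and theta_d: "1 - \<delta> / 6 \<le> \<theta>" and theta_d1: "1 - \<delta>1 / 6 \<le> \<theta>"
    and lam_eta: "lam * \<eta> \<le> 1 / 2"
begin

definition stepr where
  "stepr s r = step (\<lambda>\<tau>. fst (r \<tau>)) (\<lambda>\<tau>. Q (fst (snd (r \<tau>)))) (\<lambda>\<tau>. Q1 (snd (snd (r \<tau>)))) s"

text \<open>Twice the coefficient of the squared new error in \<open>primal_step_inequality\<close>,
  and the common factor of all error weights in the Lyapunov functions.\<close>

definition \<kappa> :: real where "\<kappa> = \<eta> + lam * \<eta>\<^sup>2"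

definition move :: "(real^'d, real^'t) ecspdc_state \<Rightarrow> real" where
  "move s = 1 / real n * (\<Sum>\<tau><n. dual_move s \<tau>)"

lemma kappa: "0 \<le> \<kappa>" "\<eta> \<le> \<kappa>" "\<kappa> \<le> 3 / 2 * \<eta>"
proof -
  show "0 \<le> \<kappa>" "\<eta> \<le> \<kappa>" using lam eta by (simp_all add: \<kappa>_def)
  have "lam * \<eta> * \<eta> \<le> 1 / 2 * \<eta>" using lam_eta eta by (intro mult_right_mono) auto
  then show "\<kappa> \<le> 3 / 2 * \<eta>" by (simp add: \<kappa>_def power2_eq_square mult_ac)
qed

lemma fst_less_of_space_law:
  assumes "r \<in> space law" "\<tau> < n"
  shows "fst (r \<tau>) < m"
proof -
  have "r \<tau> \<in> space (node_law m S S1)"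
    using assms by (auto simp: law_def space_PiM PiE_iff)
  then show ?thesis by (auto simp: node_law_def space_pair_measure space_uniform_count_measure)
qed

lemma stepr_errors:
  assumes "r \<in> space law" "\<tau> < n"
  shows "st_e (stepr s r) \<tau> = err_next (dv s \<tau>) (pv s \<tau> + st_e s \<tau>) (r \<tau>)"
    and "pv (stepr s r) \<tau> = shift_next (dv s \<tau>) (pv s \<tau>) (r \<tau>)"
  using assms fst_less_of_space_law[OF assms(1)]
  by (simp_all add: stepr_def st_e_step[OF _ refl] pv_step[OF _ refl] err_next_def shift_next_def case_prod_unfold)

lemma consistent_stepr: "r \<in> space law \<Longrightarrow> consistent s \<Longrightarrow> consistent (stepr s r)"
  unfolding stepr_def by (rule consistent_step[OF fst_less_of_space_law refl])

lemma avg_dv_bounds: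
  assumes "\<tau> < n"
  shows "(norm (avg (dv s \<tau>)))\<^sup>2 \<le> (Rbar_const m n A)\<^sup>2 * dual_move s \<tau>"
    and "avg_sq (dv s \<tau>) \<le> (Rm_const m n A)\<^sup>2 * dual_move s \<tau>"
  unfolding avg_def avg_sq_def by (rule dv_bounds[OF assms])+

lemma node_mean_avg_dv_bound:
  "(norm (node_mean n (\<lambda>\<tau>. avg (dv s \<tau>))))\<^sup>2 \<le> (R_const m n A)\<^sup>2 * move s"
  unfolding avg_def move_def by (rule dv_mean_bound)

text \<open>The new error stays outside \<open>B\<close> because its expectation is estimated
  differently in the two cases. The averaged increment has second moment at most
  \<open>R\<^sup>2 + Rm\<^sup>2 / n\<close> times \<open>move s\<close>; with the factor
  \<open>4 * \<eta>\<close> this explains the first two summands of \<open>R2\<close> and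
  \<open>R3\<close> squared.\<close>

lemma lyap_step_mean:
  assumes cons: "consistent s"
  shows "\<exists>B q. (\<forall>r\<in>space law. lyap (stepr s r) \<le> B r + \<kappa> / 2 * (norm (node_mean n (st_e (stepr s r))))\<^sup>2)
    \<and> has_bochner_integral law B q
    \<and> q \<le> \<theta> * lyap s + \<kappa> / 2 * (norm (node_mean n (st_e s)))\<^sup>2
        - (1 / (2 * \<sigma>) - 4 * \<eta> * ((R_const m n A)\<^sup>2 + (Rm_const m n A)\<^sup>2 / real n)) * move s"
proof -
  interpret L: prob_space law by (rule prob_space_law)
  have m0: "0 < m" and n0: "0 < n" using m n by auto
  define u where "u = node_mean n (st_u s) - us"
  define x where "x = st_x s - \<eta> *\<^sub>R node_mean n (st_e s) - xs"
  define C where "C = 1 / (2 * \<eta>) * (norm x)\<^sup>2 + \<theta> * (u \<bullet> xd s) + \<theta>\<^sup>2 / (8 * \<eta>) * (norm (xd s))\<^sup>2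
      - u \<bullet> (st_z s - xs) + \<eta> / 2 * (norm (node_mean n (st_e s)))\<^sup>2
      + (\<Sum>\<tau><n. \<Sum>j<m. dual_term j \<tau> (st_y s j \<tau>))"
  define F where "F = (\<lambda>\<tau> j. dual_term j \<tau> (yh s j \<tau>) - dual_term j \<tau> (st_y s j \<tau>)
          - 1 / real n * (dv s \<tau> j \<bullet> (st_z s - xs)))"
  define B where "B = (\<lambda>r :: nat \<Rightarrow> nat \<times> 's \<times> 's1. C + (\<Sum>\<tau><n. F \<tau> (fst (r \<tau>)))
    + 4 * \<eta> * (norm (node_mean n (\<lambda>\<tau>. dv s \<tau> (fst (r \<tau>)))))\<^sup>2)"
  define qa where "qa = (norm (node_mean n (\<lambda>\<tau>. avg (dv s \<tau>))))\<^sup>2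
    + 1 / (real n)\<^sup>2 * (\<Sum>\<tau><n. avg_sq (dv s \<tau>) - (norm (avg (dv s \<tau>)))\<^sup>2)"
  define q where "q = C + (\<Sum>\<tau><n. 1 / real m * (\<Sum>j<m. F \<tau> j)) + 4 * \<eta> * qa"
  have "lyap (stepr s r) \<le> B r + \<kappa> / 2 * (norm (node_mean n (st_e (stepr s r))))\<^sup>2" if r: "r \<in> space law" for r
    using lyap_step_le[OF fst_less_of_space_law[OF r] refl cons]
    unfolding stepr_def B_def C_def F_def \<kappa>_def u_def x_def by simp
  moreover have "has_bochner_integral law B q"
  proof -
    have "has_bochner_integral law (\<lambda>r. C) C" by (simp add: has_bochner_integral_iff L.prob_space)
    then show ?thesis unfolding B_def q_def qa_def
      by (intro has_bochner_integral_add law_index_sum has_bochner_integral_mult_right update_mean_moment)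
  qed
  moreover have "q \<le> \<theta> * lyap s + \<kappa> / 2 * (norm (node_mean n (st_e s)))\<^sup>2
        - (1 / (2 * \<sigma>) - 4 * \<eta> * ((R_const m n A)\<^sup>2 + (Rm_const m n A)\<^sup>2 / real n)) * move s"
  proof -
    have fin: "conjugate (\<phi> j \<tau>) (st_y s j \<tau>) \<noteq> \<infinity>" if "j < m" "\<tau> < n" for j \<tau>
      using cons that by (auto simp: consistent_def dual_finite_def)
    have "qa \<le> (R_const m n A)\<^sup>2 * move s + (Rm_const m n A)\<^sup>2 / real n * move s"
      unfolding qa_def
    proof (rule add_mono[OF node_mean_avg_dv_bound])
      have "(\<Sum>\<tau><n. avg_sq (dv s \<tau>) - (norm (avg (dv s \<tau>)))\<^sup>2) \<le> (\<Sum>\<tau><n. (Rm_const m n A)\<^sup>2 * dual_move s \<tau>)"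
      proof (rule sum_mono)
        fix \<tau> assume "\<tau> \<in> {..<n}"
        then show "avg_sq (dv s \<tau>) - (norm (avg (dv s \<tau>)))\<^sup>2 \<le> (Rm_const m n A)\<^sup>2 * dual_move s \<tau>"
          using avg_dv_bounds(2)[of \<tau> s] by (simp add: add_increasing2 diff_le_eq)
      qed
      then have "1 / (real n)\<^sup>2 * (\<Sum>\<tau><n. avg_sq (dv s \<tau>) - (norm (avg (dv s \<tau>)))\<^sup>2)
        \<le> 1 / (real n)\<^sup>2 * (\<Sum>\<tau><n. (Rm_const m n A)\<^sup>2 * dual_move s \<tau>)"
        by (intro mult_left_mono) auto
      also have "\<dots> = (Rm_const m n A)\<^sup>2 / real n * move s"
        unfolding sum_distrib_left[symmetric] move_def by (simp add: power2_eq_square)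
      finally show "1 / (real n)\<^sup>2 * (\<Sum>\<tau><n. avg_sq (dv s \<tau>) - (norm (avg (dv s \<tau>)))\<^sup>2)
        \<le> (Rm_const m n A)\<^sup>2 / real n * move s" .
    qed
    then have "4 * \<eta> * qa \<le> 4 * \<eta> * ((R_const m n A)\<^sup>2 * move s + (Rm_const m n A)\<^sup>2 / real n * move s)"
      using eta by (intro mult_left_mono) auto
    then have 1: "4 * \<eta> * qa \<le> 4 * \<eta> * ((R_const m n A)\<^sup>2 + (Rm_const m n A)\<^sup>2 / real n) * move s"
      by (simp only: distrib_right mult.assoc)
    have 2: "(\<Sum>\<tau><n. 1 / real m * (\<Sum>j<m. F \<tau> j)) \<le> u \<bullet> (st_z s - xs) - 1 / (2 * \<sigma>) * move s
      - 1 / real m * (\<Sum>\<tau><n. \<Sum>j<m. 1 / real n * (\<gamma> / 2 * (norm (st_y s j \<tau> - Ys j \<tau>))\<^sup>2 + bregman j \<tau> (st_y s j \<tau>)))"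
      unfolding F_def u_def move_def by (rule mean_dual_step_le[OF cons])
    have 3: "1 / (2 * \<eta>) * (norm x)\<^sup>2 \<le> \<theta> * ((1 / (2 * \<eta>) + lam / 4) * (norm x)\<^sup>2)"
      using mult_right_mono[OF theta_primal, of "(norm x)\<^sup>2"] by (simp add: mult.assoc)
    have 4: "\<theta>\<^sup>2 / (8 * \<eta>) * (norm (xd s))\<^sup>2 \<le> \<theta> * (1 / (8 * \<eta>) * (norm (xd s))\<^sup>2)"
    proof -
      have "\<theta>\<^sup>2 \<le> \<theta>" using theta theta_le by (simp add: power2_eq_square mult_left_le)
      then have "\<theta>\<^sup>2 * (1 / (8 * \<eta>) * (norm (xd s))\<^sup>2) \<le> \<theta> * (1 / (8 * \<eta>) * (norm (xd s))\<^sup>2)"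
        using eta by (intro mult_right_mono) auto
      then show ?thesis by simp
    qed
    \<comment> \<open>The primal gap of the old iterate is absent from the one-step bound, so
      nonnegativity suffices to insert it with factor \<open>\<theta>\<close>.\<close>
    have 5: "0 \<le> \<theta> * (g (st_x s) - g xs + us \<bullet> (st_x s - xs))"
    proof -
      have "0 \<le> lam / 2 * (norm (st_x s - xs))\<^sup>2" using lam by simp
      also note primal_gap_growth
      finally show ?thesis using theta by simp
    qed
    \<comment> \<open>The share \<open>1 / m\<close> of strong convexity and Bregman terms is what
      shrinks the dual part: \<open>theta_dual\<close> compares the coefficients of the distance,
      \<open>theta_m\<close> those of the Bregman term.\<close>
    have 6: "(\<Sum>\<tau><n. \<Sum>j<m. dual_term j \<tau> (st_y s j \<tau>))
      - 1 / real m * (\<Sum>\<tau><n. \<Sum>j<m. 1 / real n * (\<gamma> / 2 * (norm (st_y s j \<tau> - Ys j \<tau>))\<^sup>2 + bregman j \<tau> (st_y s j \<tau>)))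
      \<le> \<theta> * (\<Sum>\<tau><n. \<Sum>j<m. dual_term j \<tau> (st_y s j \<tau>))"
      unfolding sum_distrib_left sum_subtractf[symmetric]
    proof (intro sum_mono)
      fix \<tau> j assume "\<tau> \<in> {..<n}" "j \<in> {..<m}"
      then have jt: "j < m" "\<tau> < n" by auto
      define D where "D = (norm (st_y s j \<tau> - Ys j \<tau>))\<^sup>2"
      define b where "b = bregman j \<tau> (st_y s j \<tau>)"
      have b: "0 \<le> b" unfolding b_def by (rule bregman_nonneg[OF jt fin[OF jt]])
      have "(1 / (2 * \<sigma>) + \<gamma> / 2 * (1 - 1 / real m)) * D + (1 - 1 / real m) * b
        \<le> \<theta> * (1 / (2 * \<sigma>) + \<gamma> / 2) * D + \<theta> * b"
        using theta_dual theta_m b by (intro add_mono mult_right_mono) (auto simp: D_def)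
      then have "1 / real n * ((1 / (2 * \<sigma>) + \<gamma> / 2 * (1 - 1 / real m)) * D + (1 - 1 / real m) * b)
        \<le> 1 / real n * (\<theta> * (1 / (2 * \<sigma>) + \<gamma> / 2) * D + \<theta> * b)"
        by (intro mult_left_mono) auto
      then show "dual_term j \<tau> (st_y s j \<tau>)
        - 1 / real m * (1 / real n * (\<gamma> / 2 * (norm (st_y s j \<tau> - Ys j \<tau>))\<^sup>2 + bregman j \<tau> (st_y s j \<tau>)))
        \<le> \<theta> * dual_term j \<tau> (st_y s j \<tau>)"
        unfolding dual_term_def D_def[symmetric] b_def[symmetric]
        by (simp add: algebra_simps add_divide_distrib diff_divide_distrib)
    qed
    have 7: "\<eta> / 2 * (norm (node_mean n (st_e s)))\<^sup>2 \<le> \<kappa> / 2 * (norm (node_mean n (st_e s)))\<^sup>2"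
      using kappa by (intro mult_right_mono) auto
    have 8: "\<theta> * lyap s = \<theta> * ((1 / (2 * \<eta>) + lam / 4) * (norm x)\<^sup>2)
      + \<theta> * (g (st_x s) - g xs + us \<bullet> (st_x s - xs)) + \<theta> * (u \<bullet> xd s)
      + \<theta> * (1 / (8 * \<eta>) * (norm (xd s))\<^sup>2) + \<theta> * (\<Sum>\<tau><n. \<Sum>j<m. dual_term j \<tau> (st_y s j \<tau>))"
      unfolding lyap_def x_def u_def by (simp only: distrib_left)
    show ?thesis
      using 1 2 3 4 5 6 7 unfolding q_def C_def 8 left_diff_distrib by linarith
  qed
  ultimately show ?thesis by blast
qed

section \<open>Expected growth of the error and shift quantities in one step\<close>

definition err_mean :: "(real^'d, real^'t) ecspdc_state \<Rightarrow> real" where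
  "err_mean s = 1 / real n * (\<Sum>\<tau><n. (norm (st_e s \<tau>))\<^sup>2)"

definition shift_sq_mean :: "(real^'d, real^'t) ecspdc_state \<Rightarrow> real" where
  "shift_sq_mean s = 1 / real n * (\<Sum>\<tau><n. (norm (pv s \<tau>))\<^sup>2)"

lemma move_nonneg: "0 \<le> move s"
  unfolding move_def dual_move_def by (intro mult_nonneg_nonneg sum_nonneg) auto

lemma err_mean_step:
  "\<exists>q. has_bochner_integral law (\<lambda>r. 1 / real n * (\<Sum>\<tau><n. (norm (err_next (dv s \<tau>) (pv s \<tau> + st_e s \<tau>) (r \<tau>)))\<^sup>2)) q
    \<and> q \<le> (1 - \<delta> / 2) * err_mean s + 4 * (1 - \<delta>) / \<delta> * ((Rbar_const m n A)\<^sup>2 * move s + shift_sq_mean s)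
        + (1 - \<delta>) * ((Rm_const m n A)\<^sup>2 * move s)"
proof -
  obtain q where q: "has_bochner_integral law (\<lambda>r. \<Sum>\<tau><n. (norm (err_next (dv s \<tau>) (pv s \<tau> + st_e s \<tau>) (r \<tau>)))\<^sup>2) q"
    "q \<le> (\<Sum>\<tau><n. (1 - \<delta> / 2) * (norm (st_e s \<tau>))\<^sup>2
          + 4 * (1 - \<delta>) / \<delta> * ((norm (avg (dv s \<tau>)))\<^sup>2 + (norm (pv s \<tau>))\<^sup>2) + (1 - \<delta>) * avg_sq (dv s \<tau>))"
    using err_next_sum_moment[of "dv s" "pv s" "st_e s"] by blast
  have "q \<le> (\<Sum>\<tau><n. (1 - \<delta> / 2) * (norm (st_e s \<tau>))\<^sup>2
          + 4 * (1 - \<delta>) / \<delta> * ((Rbar_const m n A)\<^sup>2 * dual_move s \<tau> + (norm (pv s \<tau>))\<^sup>2)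
          + (1 - \<delta>) * ((Rm_const m n A)\<^sup>2 * dual_move s \<tau>))"
    using d by (intro order_trans[OF q(2)] sum_mono add_mono mult_left_mono order_refl avg_dv_bounds) auto
  then have "1 / real n * q \<le> 1 / real n * (\<Sum>\<tau><n. (1 - \<delta> / 2) * (norm (st_e s \<tau>))\<^sup>2
          + 4 * (1 - \<delta>) / \<delta> * ((Rbar_const m n A)\<^sup>2 * dual_move s \<tau> + (norm (pv s \<tau>))\<^sup>2)
          + (1 - \<delta>) * ((Rm_const m n A)\<^sup>2 * dual_move s \<tau>))"
    by (intro mult_left_mono) auto
  also have "\<dots> = (1 - \<delta> / 2) * err_mean s + 4 * (1 - \<delta>) / \<delta> * ((Rbar_const m n A)\<^sup>2 * move s + shift_sq_mean s)
        + (1 - \<delta>) * ((Rm_const m n A)\<^sup>2 * move s)"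
    unfolding err_mean_def move_def shift_sq_mean_def sum.distrib sum_distrib_left[symmetric]
    by (simp only: distrib_left mult.left_commute)
  finally show ?thesis using has_bochner_integral_mult_right[OF q(1)] by blast
qed

lemma shift_sq_mean_step:
  "\<exists>q. has_bochner_integral law (\<lambda>r. 1 / real n * (\<Sum>\<tau><n. (norm (shift_next (dv s \<tau>) (pv s \<tau>) (r \<tau>)))\<^sup>2)) q
    \<and> q \<le> (1 - \<delta>1 / 2) * shift_sq_mean s
        + 2 * (1 - \<delta>1) / (\<delta>1 * (real m)\<^sup>2) * ((Rbar_const m n A)\<^sup>2 * move s)
        + 1 / (real m)\<^sup>2 * ((Rm_const m n A)\<^sup>2 * move s)"
proof -
  obtain q where q: "has_bochner_integral law (\<lambda>r. \<Sum>\<tau><n. (norm (shift_next (dv s \<tau>) (pv s \<tau>) (r \<tau>)))\<^sup>2) q"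
    "q \<le> (\<Sum>\<tau><n. (1 - \<delta>1 / 2) * (norm (pv s \<tau>))\<^sup>2
          + 2 * (1 - \<delta>1) / (\<delta>1 * (real m)\<^sup>2) * (norm (avg (dv s \<tau>)))\<^sup>2 + 1 / (real m)\<^sup>2 * avg_sq (dv s \<tau>))"
    using shift_next_sum_moment[of "dv s" "pv s"] by blast
  have "q \<le> (\<Sum>\<tau><n. (1 - \<delta>1 / 2) * (norm (pv s \<tau>))\<^sup>2
          + 2 * (1 - \<delta>1) / (\<delta>1 * (real m)\<^sup>2) * ((Rbar_const m n A)\<^sup>2 * dual_move s \<tau>)
          + 1 / (real m)\<^sup>2 * ((Rm_const m n A)\<^sup>2 * dual_move s \<tau>))"
    using d1 by (intro order_trans[OF q(2)] sum_mono add_mono mult_left_mono order_refl avg_dv_bounds) auto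
  then have "1 / real n * q \<le> 1 / real n * (\<Sum>\<tau><n. (1 - \<delta>1 / 2) * (norm (pv s \<tau>))\<^sup>2
          + 2 * (1 - \<delta>1) / (\<delta>1 * (real m)\<^sup>2) * ((Rbar_const m n A)\<^sup>2 * dual_move s \<tau>)
          + 1 / (real m)\<^sup>2 * ((Rm_const m n A)\<^sup>2 * dual_move s \<tau>))"
    by (intro mult_left_mono) auto
  also have "\<dots> = (1 - \<delta>1 / 2) * shift_sq_mean s
        + 2 * (1 - \<delta>1) / (\<delta>1 * (real m)\<^sup>2) * ((Rbar_const m n A)\<^sup>2 * move s)
        + 1 / (real m)\<^sup>2 * ((Rm_const m n A)\<^sup>2 * move s)"
    unfolding move_def shift_sq_mean_def sum.distrib sum_distrib_left[symmetric]
    by (simp only: distrib_left mult.left_commute)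
  finally show ?thesis using has_bochner_integral_mult_right[OF q(1)] by blast
qed

lemma err_node_mean_step:
  assumes unb: "\<And>x. (\<integral>s. Q s x \<partial>S) = \<delta> *\<^sub>R x"
  shows "\<exists>q. has_bochner_integral law (\<lambda>r. (norm (node_mean n (\<lambda>\<tau>. err_next (dv s \<tau>) (pv s \<tau> + st_e s \<tau>) (r \<tau>))))\<^sup>2) q
    \<and> q \<le> (1 - \<delta> / 2) * (norm (node_mean n (st_e s)))\<^sup>2
        + 4 * (1 - \<delta>) / \<delta> * ((R_const m n A)\<^sup>2 * move s + (norm (node_mean n (pv s)))\<^sup>2)
        + 1 / real n * ((1 - \<delta>) * ((Rm_const m n A)\<^sup>2 * move s)
            + \<delta> * (1 - \<delta>) * (2 * err_mean s + 4 * ((Rm_const m n A)\<^sup>2 * move s) + 4 * shift_sq_mean s))"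
proof -
  obtain q where q: "has_bochner_integral law (\<lambda>r. (norm (node_mean n (\<lambda>\<tau>. err_next (dv s \<tau>) (pv s \<tau> + st_e s \<tau>) (r \<tau>))))\<^sup>2) q"
    "q \<le> (1 - \<delta> / 2) * (norm (node_mean n (st_e s)))\<^sup>2
          + 4 * (1 - \<delta>) / \<delta> * ((norm (node_mean n (\<lambda>\<tau>. avg (dv s \<tau>))))\<^sup>2 + (norm (node_mean n (pv s)))\<^sup>2)
          + 1 / (real n)\<^sup>2 * (\<Sum>\<tau><n. (1 - \<delta>) * avg_sq (dv s \<tau>)
              + \<delta> * (1 - \<delta>) * (2 * (norm (st_e s \<tau>))\<^sup>2 + 4 * avg_sq (dv s \<tau>) + 4 * (norm (pv s \<tau>))\<^sup>2))"
    using err_next_mean_moment[OF unb, of "dv s" "pv s" "st_e s"] by blast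
  have "(\<Sum>\<tau><n. (1 - \<delta>) * avg_sq (dv s \<tau>)
              + \<delta> * (1 - \<delta>) * (2 * (norm (st_e s \<tau>))\<^sup>2 + 4 * avg_sq (dv s \<tau>) + 4 * (norm (pv s \<tau>))\<^sup>2))
    \<le> (\<Sum>\<tau><n. (1 - \<delta>) * ((Rm_const m n A)\<^sup>2 * dual_move s \<tau>)
              + \<delta> * (1 - \<delta>) * (2 * (norm (st_e s \<tau>))\<^sup>2 + 4 * ((Rm_const m n A)\<^sup>2 * dual_move s \<tau>) + 4 * (norm (pv s \<tau>))\<^sup>2))"
    using d by (intro sum_mono add_mono mult_left_mono order_refl avg_dv_bounds) auto
  then have "1 / (real n)\<^sup>2 * (\<Sum>\<tau><n. (1 - \<delta>) * avg_sq (dv s \<tau>)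
              + \<delta> * (1 - \<delta>) * (2 * (norm (st_e s \<tau>))\<^sup>2 + 4 * avg_sq (dv s \<tau>) + 4 * (norm (pv s \<tau>))\<^sup>2))
    \<le> 1 / (real n)\<^sup>2 * (\<Sum>\<tau><n. (1 - \<delta>) * ((Rm_const m n A)\<^sup>2 * dual_move s \<tau>)
              + \<delta> * (1 - \<delta>) * (2 * (norm (st_e s \<tau>))\<^sup>2 + 4 * ((Rm_const m n A)\<^sup>2 * dual_move s \<tau>) + 4 * (norm (pv s \<tau>))\<^sup>2))"
    by (intro mult_left_mono) auto
  also have "\<dots> = 1 / real n * ((1 - \<delta>) * ((Rm_const m n A)\<^sup>2 * move s)
            + \<delta> * (1 - \<delta>) * (2 * err_mean s + 4 * ((Rm_const m n A)\<^sup>2 * move s) + 4 * shift_sq_mean s))"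
    unfolding err_mean_def move_def shift_sq_mean_def sum.distrib sum_distrib_left[symmetric] power2_eq_square[of "real n"]
    by (simp add: algebra_simps add_divide_distrib diff_divide_distrib)
  finally have 1: "1 / (real n)\<^sup>2 * (\<Sum>\<tau><n. (1 - \<delta>) * avg_sq (dv s \<tau>)
              + \<delta> * (1 - \<delta>) * (2 * (norm (st_e s \<tau>))\<^sup>2 + 4 * avg_sq (dv s \<tau>) + 4 * (norm (pv s \<tau>))\<^sup>2))
    \<le> 1 / real n * ((1 - \<delta>) * ((Rm_const m n A)\<^sup>2 * move s)
            + \<delta> * (1 - \<delta>) * (2 * err_mean s + 4 * ((Rm_const m n A)\<^sup>2 * move s) + 4 * shift_sq_mean s))" .
  have "4 * (1 - \<delta>) / \<delta> * ((norm (node_mean n (\<lambda>\<tau>. avg (dv s \<tau>))))\<^sup>2 + (norm (node_mean n (pv s)))\<^sup>2)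
    \<le> 4 * (1 - \<delta>) / \<delta> * ((R_const m n A)\<^sup>2 * move s + (norm (node_mean n (pv s)))\<^sup>2)"
    using d by (intro mult_left_mono add_mono node_mean_avg_dv_bound order_refl) auto
  then show ?thesis using q 1 by (intro exI[of _ q]) simp
qed

lemma shift_node_mean_step:
  assumes unb: "\<And>x. (\<integral>s. Q1 s x \<partial>S1) = \<delta>1 *\<^sub>R x"
  shows "\<exists>q. has_bochner_integral law (\<lambda>r. (norm (node_mean n (\<lambda>\<tau>. shift_next (dv s \<tau>) (pv s \<tau>) (r \<tau>))))\<^sup>2) q
    \<and> q \<le> (1 - \<delta>1) * (norm (node_mean n (pv s)))\<^sup>2
        + 1 / (\<delta>1 * (real m)\<^sup>2) * ((R_const m n A)\<^sup>2 * move s)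
        + 1 / real n * (\<delta>1 * (1 - \<delta>1) * shift_sq_mean s + 1 / (real m)\<^sup>2 * ((Rm_const m n A)\<^sup>2 * move s))"
proof -
  obtain q where q: "has_bochner_integral law (\<lambda>r. (norm (node_mean n (\<lambda>\<tau>. shift_next (dv s \<tau>) (pv s \<tau>) (r \<tau>))))\<^sup>2) q"
    "q \<le> (1 - \<delta>1) * (norm (node_mean n (pv s)))\<^sup>2
          + 1 / (\<delta>1 * (real m)\<^sup>2) * (norm (node_mean n (\<lambda>\<tau>. avg (dv s \<tau>))))\<^sup>2
          + 1 / (real n)\<^sup>2 * (\<Sum>\<tau><n. \<delta>1 * (1 - \<delta>1) * (norm (pv s \<tau>))\<^sup>2 + 1 / (real m)\<^sup>2 * avg_sq (dv s \<tau>))"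
    using shift_next_mean_moment[OF unb, of "dv s" "pv s"] by blast
  have "(\<Sum>\<tau><n. \<delta>1 * (1 - \<delta>1) * (norm (pv s \<tau>))\<^sup>2 + 1 / (real m)\<^sup>2 * avg_sq (dv s \<tau>))
    \<le> (\<Sum>\<tau><n. \<delta>1 * (1 - \<delta>1) * (norm (pv s \<tau>))\<^sup>2 + 1 / (real m)\<^sup>2 * ((Rm_const m n A)\<^sup>2 * dual_move s \<tau>))"
    by (intro sum_mono add_mono mult_left_mono order_refl avg_dv_bounds) auto
  then have "1 / (real n)\<^sup>2 * (\<Sum>\<tau><n. \<delta>1 * (1 - \<delta>1) * (norm (pv s \<tau>))\<^sup>2 + 1 / (real m)\<^sup>2 * avg_sq (dv s \<tau>))
    \<le> 1 / (real n)\<^sup>2 * (\<Sum>\<tau><n. \<delta>1 * (1 - \<delta>1) * (norm (pv s \<tau>))\<^sup>2 + 1 / (real m)\<^sup>2 * ((Rm_const m n A)\<^sup>2 * dual_move s \<tau>))"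
    by (intro mult_left_mono) auto
  also have "\<dots> = 1 / real n * (\<delta>1 * (1 - \<delta>1) * shift_sq_mean s + 1 / (real m)\<^sup>2 * ((Rm_const m n A)\<^sup>2 * move s))"
    unfolding move_def shift_sq_mean_def sum.distrib sum_distrib_left[symmetric] power2_eq_square[of "real n"]
    by (simp add: algebra_simps add_divide_distrib diff_divide_distrib)
  finally have 1: "1 / (real n)\<^sup>2 * (\<Sum>\<tau><n. \<delta>1 * (1 - \<delta>1) * (norm (pv s \<tau>))\<^sup>2 + 1 / (real m)\<^sup>2 * avg_sq (dv s \<tau>))
    \<le> 1 / real n * (\<delta>1 * (1 - \<delta>1) * shift_sq_mean s + 1 / (real m)\<^sup>2 * ((Rm_const m n A)\<^sup>2 * move s))" .
  have "1 / (\<delta>1 * (real m)\<^sup>2) * (norm (node_mean n (\<lambda>\<tau>. avg (dv s \<tau>))))\<^sup>2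
    \<le> 1 / (\<delta>1 * (real m)\<^sup>2) * ((R_const m n A)\<^sup>2 * move s)"
    using d1 by (intro mult_left_mono node_mean_avg_dv_bound) auto
  then show ?thesis using q 1 by (intro exI[of _ q]) simp
qed

text \<open>On consistent states the first stated Lyapunov function plus \<open>cross\<close>;
  likewise \<open>lyap_ii\<close> for the second.\<close>

definition lyap_i :: "(real^'d, real^'t) ecspdc_state \<Rightarrow> real" where
  "lyap_i s = lyap s + 3 * \<kappa> / \<delta> * err_mean s + 42 * (1 - \<delta>) * \<kappa> / (\<delta>\<^sup>2 * \<delta>1) * shift_sq_mean s"

definition lyap_ii :: "(real^'d, real^'t) ecspdc_state \<Rightarrow> real" where
  "lyap_ii s = lyap s + 3 * \<kappa> / \<delta> * (norm (node_mean n (st_e s)))\<^sup>2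
    + 21 * (1 - \<delta>) * \<kappa> / (\<delta> * real n) * err_mean s
    + 84 * (1 - \<delta>) * \<kappa> / (5 * \<delta>\<^sup>2 * \<delta>1) * (norm (node_mean n (pv s)))\<^sup>2
    + 1512 * (1 - \<delta>) * \<kappa> / (5 * \<delta>\<^sup>2 * \<delta>1 * real n) * shift_sq_mean s"

lemma err_mean_nonneg: "0 \<le> err_mean s" and shift_sq_mean_nonneg: "0 \<le> shift_sq_mean s"
  by (simp_all add: err_mean_def shift_sq_mean_def sum_nonneg)

lemma err_mean_stepr:
  assumes "r \<in> space law"
  shows "err_mean (stepr s r) = 1 / real n * (\<Sum>\<tau><n. (norm (err_next (dv s \<tau>) (pv s \<tau> + st_e s \<tau>) (r \<tau>)))\<^sup>2)"
    and "shift_sq_mean (stepr s r) = 1 / real n * (\<Sum>\<tau><n. (norm (shift_next (dv s \<tau>) (pv s \<tau>) (r \<tau>)))\<^sup>2)"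
    and "node_mean n (st_e (stepr s r)) = node_mean n (\<lambda>\<tau>. err_next (dv s \<tau>) (pv s \<tau> + st_e s \<tau>) (r \<tau>))"
    and "node_mean n (pv (stepr s r)) = node_mean n (\<lambda>\<tau>. shift_next (dv s \<tau>) (pv s \<tau>) (r \<tau>))"
  unfolding err_mean_def shift_sq_mean_def using stepr_errors[OF assms]
  by (auto intro!: node_mean_cong)

text \<open>Asking for a pathwise majorant \<open>B\<close> with known integral keeps the
  measurability of \<open>lyap_i\<close> out of the algebra. In this case the squared mean error is
  replaced by the mean squared error, both before and after the step.\<close>

theorem lyap_i_step:
  assumes cons: "consistent s" and sig: "1 / (2 * \<sigma>) = 2 * \<eta> * R1\<^sup>2"
    and R1: "R1\<^sup>2 = 2 * (R_const m n A)\<^sup>2 + 2 * (Rm_const m n A)\<^sup>2 / n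
        + 3 * (1 - \<delta>) / 4 *
          (14 * (Rbar_const m n A)\<^sup>2 / \<delta>\<^sup>2 + 7 * (Rm_const m n A)\<^sup>2 / (2 * \<delta>)
           + 84 * (1 - \<delta>1) * (Rbar_const m n A)\<^sup>2 / (\<delta>\<^sup>2 * \<delta>1\<^sup>2 * (real m)\<^sup>2)
           + 42 * (Rm_const m n A)\<^sup>2 / (\<delta>\<^sup>2 * \<delta>1 * (real m)\<^sup>2))"
  shows "\<exists>B q. (\<forall>r\<in>space law. lyap_i (stepr s r) \<le> B r) \<and> has_bochner_integral law B q \<and> q \<le> \<theta> * lyap_i s"
proof -
  define c1 where "c1 = 3 * \<kappa> / \<delta>"
  define c4 where "c4 = 42 * (1 - \<delta>) * \<kappa> / (\<delta>\<^sup>2 * \<delta>1)"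
  have c: "0 \<le> c1" "0 \<le> c4" using d d1 kappa by (simp_all add: c1_def c4_def)
  obtain B0 q0 where 0: "\<And>r. r \<in> space law \<Longrightarrow> lyap (stepr s r) \<le> B0 r + \<kappa> / 2 * (norm (node_mean n (st_e (stepr s r))))\<^sup>2"
    "has_bochner_integral law B0 q0"
    "q0 \<le> \<theta> * lyap s + \<kappa> / 2 * (norm (node_mean n (st_e s)))\<^sup>2
        - (1 / (2 * \<sigma>) - 4 * \<eta> * ((R_const m n A)\<^sup>2 + (Rm_const m n A)\<^sup>2 / real n)) * move s"
    using lyap_step_mean[OF cons] by blast
  define BE where "BE = (\<lambda>r. 1 / real n * (\<Sum>\<tau><n. (norm (err_next (dv s \<tau>) (pv s \<tau> + st_e s \<tau>) (r \<tau>)))\<^sup>2))"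
  define BH where "BH = (\<lambda>r. 1 / real n * (\<Sum>\<tau><n. (norm (shift_next (dv s \<tau>) (pv s \<tau>) (r \<tau>)))\<^sup>2))"
  obtain qE where E: "has_bochner_integral law BE qE"
    "qE \<le> (1 - \<delta> / 2) * err_mean s + 4 * (1 - \<delta>) / \<delta> * ((Rbar_const m n A)\<^sup>2 * move s + shift_sq_mean s)
        + (1 - \<delta>) * ((Rm_const m n A)\<^sup>2 * move s)"
    unfolding BE_def using err_mean_step[of s] by blast
  obtain qH where H: "has_bochner_integral law BH qH"
    "qH \<le> (1 - \<delta>1 / 2) * shift_sq_mean s
        + 2 * (1 - \<delta>1) / (\<delta>1 * (real m)\<^sup>2) * ((Rbar_const m n A)\<^sup>2 * move s)
        + 1 / (real m)\<^sup>2 * ((Rm_const m n A)\<^sup>2 * move s)"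
    unfolding BH_def using shift_sq_mean_step[of s] by blast
  define B where "B = (\<lambda>r. B0 r + (c1 + \<kappa> / 2) * BE r + c4 * BH r)"
  define q where "q = q0 + (c1 + \<kappa> / 2) * qE + c4 * qH"
  have "lyap_i (stepr s r) \<le> B r" if r: "r \<in> space law" for r
  proof -
    have "\<kappa> / 2 * (norm (node_mean n (st_e (stepr s r))))\<^sup>2 \<le> \<kappa> / 2 * err_mean (stepr s r)"
      unfolding err_mean_def using kappa n by (intro mult_left_mono norm_node_mean_sq_le) auto
    moreover have "B r = B0 r + (c1 + \<kappa> / 2) * err_mean (stepr s r) + c4 * shift_sq_mean (stepr s r)"
      by (simp add: B_def BE_def BH_def err_mean_stepr[OF r])
    ultimately show ?thesis
      using 0(1)[OF r] unfolding lyap_i_def c1_def[symmetric] c4_def[symmetric] distrib_right by linarith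
  qed
  moreover have "has_bochner_integral law B q"
    unfolding B_def q_def by (intro has_bochner_integral_add has_bochner_integral_mult_right 0 E H)
  moreover have "q \<le> \<theta> * lyap_i s"
  proof -
    have "\<kappa> / 2 * (norm (node_mean n (st_e s)))\<^sup>2 \<le> \<kappa> / 2 * err_mean s"
      unfolding err_mean_def using kappa n by (intro mult_left_mono norm_node_mean_sq_le) auto
    moreover have "(c1 + \<kappa> / 2) * qE \<le> (c1 + \<kappa> / 2) * ((1 - \<delta> / 2) * err_mean s
        + 4 * (1 - \<delta>) / \<delta> * ((Rbar_const m n A)\<^sup>2 * move s + shift_sq_mean s)
        + (1 - \<delta>) * ((Rm_const m n A)\<^sup>2 * move s))"
      using c kappa by (intro mult_left_mono E) auto
    moreover have "c4 * qH \<le> c4 * ((1 - \<delta>1 / 2) * shift_sq_mean s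
        + 2 * (1 - \<delta>1) / (\<delta>1 * (real m)\<^sup>2) * ((Rbar_const m n A)\<^sup>2 * move s)
        + 1 / (real m)\<^sup>2 * ((Rm_const m n A)\<^sup>2 * move s))"
      using c by (intro mult_left_mono H) auto
    moreover have "0 < (real m)\<^sup>2" using m by simp
    note error_budget[OF d d1 kappa(1,3) theta_d theta_d1 err_mean_nonneg[of s] shift_sq_mean_nonneg[of s]
        move_nonneg[of s] zero_le_power2[of "Rbar_const m n A"] zero_le_power2[of "Rm_const m n A"] this,
        folded c1_def c4_def]
    moreover have "(1 / (2 * \<sigma>) - 4 * \<eta> * ((R_const m n A)\<^sup>2 + (Rm_const m n A)\<^sup>2 / real n)) * move s
      = 2 * \<eta> * (3 * (1 - \<delta>) / 4 *
          (14 * (Rbar_const m n A)\<^sup>2 / \<delta>\<^sup>2 + 7 * (Rm_const m n A)\<^sup>2 / (2 * \<delta>)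
           + 84 * (1 - \<delta>1) * (Rbar_const m n A)\<^sup>2 / (\<delta>\<^sup>2 * \<delta>1\<^sup>2 * (real m)\<^sup>2)
           + 42 * (Rm_const m n A)\<^sup>2 / (\<delta>\<^sup>2 * \<delta>1 * (real m)\<^sup>2))) * move s"
      unfolding sig R1 by (simp only: distrib_left distrib_right) (simp add: algebra_simps)
    moreover have "\<theta> * lyap_i s = \<theta> * lyap s + \<theta> * (c1 * err_mean s) + \<theta> * (c4 * shift_sq_mean s)"
      by (simp add: lyap_i_def c1_def c4_def distrib_left)
    ultimately show ?thesis
      using 0(3) unfolding q_def by linarith
  qed
  ultimately show ?thesis by blast
qed

text \<open>Here the squared mean error is a summand of its own, so its new value is taken over
  directly by the weight \<open>c1 + \<kappa> / 2\<close>.\<close>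

theorem lyap_ii_step:
  assumes cons: "consistent s" and sig: "1 / (2 * \<sigma>) = 2 * \<eta> * R1\<^sup>2"
    and unb: "\<And>x. (\<integral>s. Q s x \<partial>S) = \<delta> *\<^sub>R x" and unb1: "\<And>x. (\<integral>s. Q1 s x \<partial>S1) = \<delta>1 *\<^sub>R x"
    and R1: "R1\<^sup>2 = 2 * (R_const m n A)\<^sup>2 + 2 * (Rm_const m n A)\<^sup>2 / n
        + 21 * (1 - \<delta>) / 4 *
          (2 * (R_const m n A)\<^sup>2 / \<delta>\<^sup>2 + 11 * (Rm_const m n A)\<^sup>2 / (2 * \<delta> * n) + 12 * (1 - \<delta>) * (Rbar_const m n A)\<^sup>2 / (\<delta>\<^sup>2 * n)
           + 12 * (R_const m n A)\<^sup>2 / (5 * \<delta>\<^sup>2 * \<delta>1\<^sup>2 * (real m)\<^sup>2)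
           + 228 * (Rm_const m n A)\<^sup>2 / (5 * \<delta>\<^sup>2 * \<delta>1 * (real m)\<^sup>2 * n)
           + 432 * (1 - \<delta>1) * (Rbar_const m n A)\<^sup>2 / (5 * \<delta>\<^sup>2 * \<delta>1\<^sup>2 * (real m)\<^sup>2 * n))"
  shows "\<exists>B q. (\<forall>r\<in>space law. lyap_ii (stepr s r) \<le> B r) \<and> has_bochner_integral law B q \<and> q \<le> \<theta> * lyap_ii s"
proof -
  define c1 where "c1 = 3 * \<kappa> / \<delta>"
  define c2 where "c2 = 21 * (1 - \<delta>) * \<kappa> / (\<delta> * real n)"
  define c3 where "c3 = 84 * (1 - \<delta>) * \<kappa> / (5 * \<delta>\<^sup>2 * \<delta>1)"
  define c5 where "c5 = 1512 * (1 - \<delta>) * \<kappa> / (5 * \<delta>\<^sup>2 * \<delta>1 * real n)"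
  have c: "0 \<le> c1" "0 \<le> c2" "0 \<le> c3" "0 \<le> c5" using d d1 kappa by (simp_all add: c1_def c2_def c3_def c5_def)
  define V where "V = (Rm_const m n A)\<^sup>2 * move s"
  obtain B0 q0 where 0: "\<And>r. r \<in> space law \<Longrightarrow> lyap (stepr s r) \<le> B0 r + \<kappa> / 2 * (norm (node_mean n (st_e (stepr s r))))\<^sup>2"
    "has_bochner_integral law B0 q0"
    "q0 \<le> \<theta> * lyap s + \<kappa> / 2 * (norm (node_mean n (st_e s)))\<^sup>2
        - (1 / (2 * \<sigma>) - 4 * \<eta> * ((R_const m n A)\<^sup>2 + (Rm_const m n A)\<^sup>2 / real n)) * move s"
    using lyap_step_mean[OF cons] by blast
  define BE where "BE = (\<lambda>r. 1 / real n * (\<Sum>\<tau><n. (norm (err_next (dv s \<tau>) (pv s \<tau> + st_e s \<tau>) (r \<tau>)))\<^sup>2))"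
  define BH where "BH = (\<lambda>r. 1 / real n * (\<Sum>\<tau><n. (norm (shift_next (dv s \<tau>) (pv s \<tau>) (r \<tau>)))\<^sup>2))"
  define Be where "Be = (\<lambda>r. (norm (node_mean n (\<lambda>\<tau>. err_next (dv s \<tau>) (pv s \<tau> + st_e s \<tau>) (r \<tau>))))\<^sup>2)"
  define Bp where "Bp = (\<lambda>r. (norm (node_mean n (\<lambda>\<tau>. shift_next (dv s \<tau>) (pv s \<tau>) (r \<tau>))))\<^sup>2)"
  obtain qE where E: "has_bochner_integral law BE qE"
    "qE \<le> (1 - \<delta> / 2) * err_mean s + 4 * (1 - \<delta>) / \<delta> * ((Rbar_const m n A)\<^sup>2 * move s + shift_sq_mean s)
        + (1 - \<delta>) * V"
    unfolding BE_def V_def using err_mean_step[of s] by blast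
  obtain qH where H: "has_bochner_integral law BH qH"
    "qH \<le> (1 - \<delta>1 / 2) * shift_sq_mean s
        + 2 * (1 - \<delta>1) / (\<delta>1 * (real m)\<^sup>2) * ((Rbar_const m n A)\<^sup>2 * move s) + 1 / (real m)\<^sup>2 * V"
    unfolding BH_def V_def using shift_sq_mean_step[of s] by blast
  obtain qe where e: "has_bochner_integral law Be qe"
    "qe \<le> (1 - \<delta> / 2) * (norm (node_mean n (st_e s)))\<^sup>2
        + 4 * (1 - \<delta>) / \<delta> * ((R_const m n A)\<^sup>2 * move s + (norm (node_mean n (pv s)))\<^sup>2)
        + 1 / real n * ((1 - \<delta>) * V + \<delta> * (1 - \<delta>) * (2 * err_mean s + 4 * V + 4 * shift_sq_mean s))"
    unfolding Be_def V_def using err_node_mean_step[OF unb, of s] by blast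
  obtain qp where p: "has_bochner_integral law Bp qp"
    "qp \<le> (1 - \<delta>1) * (norm (node_mean n (pv s)))\<^sup>2
        + 1 / (\<delta>1 * (real m)\<^sup>2) * ((R_const m n A)\<^sup>2 * move s)
        + 1 / real n * (\<delta>1 * (1 - \<delta>1) * shift_sq_mean s + 1 / (real m)\<^sup>2 * V)"
    unfolding Bp_def V_def using shift_node_mean_step[OF unb1, of s] by blast
  define B where "B = (\<lambda>r. B0 r + (c1 + \<kappa> / 2) * Be r + c2 * BE r + c3 * Bp r + c5 * BH r)"
  define q where "q = q0 + (c1 + \<kappa> / 2) * qe + c2 * qE + c3 * qp + c5 * qH"
  have "lyap_ii (stepr s r) \<le> B r" if r: "r \<in> space law" for r
  proof -
    have "B r = B0 r + (c1 + \<kappa> / 2) * (norm (node_mean n (st_e (stepr s r))))\<^sup>2 + c2 * err_mean (stepr s r)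
      + c3 * (norm (node_mean n (pv (stepr s r))))\<^sup>2 + c5 * shift_sq_mean (stepr s r)"
      by (simp add: B_def BE_def BH_def Be_def Bp_def err_mean_stepr[OF r])
    then show ?thesis
      using 0(1)[OF r] unfolding lyap_ii_def c1_def[symmetric] c2_def[symmetric] c3_def[symmetric]
        c5_def[symmetric] distrib_right by linarith
  qed
  moreover have "has_bochner_integral law B q"
    unfolding B_def q_def by (intro has_bochner_integral_add has_bochner_integral_mult_right 0 E H e p)
  moreover have "q \<le> \<theta> * lyap_ii s"
  proof -
    have "(c1 + \<kappa> / 2) * qe \<le> (c1 + \<kappa> / 2) * ((1 - \<delta> / 2) * (norm (node_mean n (st_e s)))\<^sup>2
        + 4 * (1 - \<delta>) / \<delta> * ((R_const m n A)\<^sup>2 * move s + (norm (node_mean n (pv s)))\<^sup>2)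
        + 1 / real n * ((1 - \<delta>) * V + \<delta> * (1 - \<delta>) * (2 * err_mean s + 4 * V + 4 * shift_sq_mean s)))"
      using c kappa by (intro mult_left_mono e) auto
    moreover have "c2 * qE \<le> c2 * ((1 - \<delta> / 2) * err_mean s
        + 4 * (1 - \<delta>) / \<delta> * ((Rbar_const m n A)\<^sup>2 * move s + shift_sq_mean s) + (1 - \<delta>) * V)"
      using c by (intro mult_left_mono E) auto
    moreover have "c3 * qp \<le> c3 * ((1 - \<delta>1) * (norm (node_mean n (pv s)))\<^sup>2
        + 1 / (\<delta>1 * (real m)\<^sup>2) * ((R_const m n A)\<^sup>2 * move s)
        + 1 / real n * (\<delta>1 * (1 - \<delta>1) * shift_sq_mean s + 1 / (real m)\<^sup>2 * V))"
      using c by (intro mult_left_mono p) auto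
    moreover have "c5 * qH \<le> c5 * ((1 - \<delta>1 / 2) * shift_sq_mean s
        + 2 * (1 - \<delta>1) / (\<delta>1 * (real m)\<^sup>2) * ((Rbar_const m n A)\<^sup>2 * move s) + 1 / (real m)\<^sup>2 * V)"
      using c by (intro mult_left_mono H) auto
    moreover have "0 < (real m)\<^sup>2" "0 < real n" using m n by simp_all
    note unbiased_error_budget[OF d d1 kappa(1,3) theta_d theta_d1
        zero_le_power2[of "norm (node_mean n (st_e s))"] err_mean_nonneg[of s]
        zero_le_power2[of "norm (node_mean n (pv s))"] shift_sq_mean_nonneg[of s] move_nonneg[of s]
        zero_le_power2[of "R_const m n A"] zero_le_power2[of "Rbar_const m n A"] zero_le_power2[of "Rm_const m n A"]
        this, folded c1_def c2_def c3_def c5_def V_def]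
    moreover have "(1 / (2 * \<sigma>) - 4 * \<eta> * ((R_const m n A)\<^sup>2 + (Rm_const m n A)\<^sup>2 / real n)) * move s
      = 2 * \<eta> * (21 * (1 - \<delta>) / 4 *
          (2 * (R_const m n A)\<^sup>2 / \<delta>\<^sup>2 + 11 * (Rm_const m n A)\<^sup>2 / (2 * \<delta> * n) + 12 * (1 - \<delta>) * (Rbar_const m n A)\<^sup>2 / (\<delta>\<^sup>2 * n)
           + 12 * (R_const m n A)\<^sup>2 / (5 * \<delta>\<^sup>2 * \<delta>1\<^sup>2 * (real m)\<^sup>2)
           + 228 * (Rm_const m n A)\<^sup>2 / (5 * \<delta>\<^sup>2 * \<delta>1 * (real m)\<^sup>2 * n)
           + 432 * (1 - \<delta>1) * (Rbar_const m n A)\<^sup>2 / (5 * \<delta>\<^sup>2 * \<delta>1\<^sup>2 * (real m)\<^sup>2 * n))) * move s"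
      unfolding sig R1 by (simp only: distrib_left distrib_right) (simp add: algebra_simps)
    moreover have "\<theta> * lyap_ii s = \<theta> * lyap s + \<theta> * (c1 * (norm (node_mean n (st_e s)))\<^sup>2) + \<theta> * (c2 * err_mean s)
      + \<theta> * (c3 * (norm (node_mean n (pv s)))\<^sup>2) + \<theta> * (c5 * shift_sq_mean s)"
      by (simp add: lyap_ii_def c1_def c2_def c3_def c5_def distrib_left)
    ultimately show ?thesis
      using 0(3) unfolding q_def by linarith
  qed
  ultimately show ?thesis by blast
qed

end


section \<open>Measurability of the iterates and the Lyapunov functions\<close>

text \<open>A supremum of continuous functions is lower semicontinuous; the union over
  \<open>u\<close> is uncountable, but of open sets.\<close>

lemma borel_measurable_conjugate:
  fixes f :: "'a::euclidean_space \<Rightarrow> real"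
  shows "conjugate f \<in> borel_measurable borel"
proof (rule borel_measurableI_greater)
  fix c :: ereal
  have "{y. c < conjugate f y} = (\<Union>u. {y. c < ereal (y \<bullet> u - f u)})"
    unfolding conjugate_def less_SUP_iff by auto
  moreover have "open {y. c < ereal (y \<bullet> u - f u)}" for u
    by (intro open_Collect_less continuous_intros)
  ultimately have "open {y. c < conjugate f y}" by (auto intro!: open_UN)
  then show "{y \<in> space borel. c < conjugate f y} \<in> sets borel" by simp
qed

context ecspdc_analysis
begin

text \<open>Restricted to the coordinates below \<open>n\<close> and \<open>m\<close>: outside this
  range the step may involve an \<open>arg_max\<close> about which nothing is known.\<close>

definition state_measurable :: "'z measure \<Rightarrow> ('z \<Rightarrow> (real^'d, real^'t) ecspdc_state) \<Rightarrow> bool" where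
  "state_measurable N st \<longleftrightarrow>
    (\<lambda>w. st_x (st w)) \<in> borel_measurable N \<and> (\<lambda>w. st_z (st w)) \<in> borel_measurable N
    \<and> (\<lambda>w. st_hs (st w)) \<in> borel_measurable N
    \<and> (\<forall>\<tau><n. (\<lambda>w. st_e (st w) \<tau>) \<in> borel_measurable N \<and> (\<lambda>w. st_u (st w) \<tau>) \<in> borel_measurable N
        \<and> (\<lambda>w. st_h (st w) \<tau>) \<in> borel_measurable N)
    \<and> (\<forall>\<tau><n. \<forall>j<m. (\<lambda>w. st_y (st w) j \<tau>) \<in> borel_measurable N)"

lemma state_measurableD:
  assumes "state_measurable N st"
  shows "(\<lambda>w. st_x (st w)) \<in> borel_measurable N" "(\<lambda>w. st_z (st w)) \<in> borel_measurable N"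
    "(\<lambda>w. st_hs (st w)) \<in> borel_measurable N"
    "\<tau> < n \<Longrightarrow> (\<lambda>w. st_e (st w) \<tau>) \<in> borel_measurable N"
    "\<tau> < n \<Longrightarrow> (\<lambda>w. st_u (st w) \<tau>) \<in> borel_measurable N"
    "\<tau> < n \<Longrightarrow> (\<lambda>w. st_h (st w) \<tau>) \<in> borel_measurable N"
    "\<tau> < n \<Longrightarrow> j < m \<Longrightarrow> (\<lambda>w. st_y (st w) j \<tau>) \<in> borel_measurable N"
  using assms unfolding state_measurable_def by blast+

lemma state_measurable_compose:
  assumes "state_measurable N st" "f \<in> N' \<rightarrow>\<^sub>M N"
  shows "state_measurable N' (\<lambda>w. st (f w))"
  using assms(1) unfolding state_measurable_def by (auto intro: measurable_compose[OF assms(2)])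

lemma borel_measurable_node_mean:
  assumes "\<And>\<tau>. \<tau> < n \<Longrightarrow> (\<lambda>w. v w \<tau> :: real^'d) \<in> borel_measurable N"
  shows "(\<lambda>w. node_mean n (v w)) \<in> borel_measurable N"
  unfolding node_mean_def using assms by (intro borel_measurable_scaleR borel_measurable_sum) auto

lemma borel_measurable_pv:
  assumes "state_measurable N st" "\<tau> < n"
  shows "(\<lambda>w. pv (st w) \<tau>) \<in> borel_measurable N"
  unfolding pv_def using assms by (intro borel_measurable_diff state_measurableD)

lemma borel_measurable_matrix_mult:
  assumes "f \<in> borel_measurable N"
  shows "(\<lambda>w. (B :: real^'p^'r) *v f w) \<in> borel_measurable N"
  by (rule borel_measurable_continuous_on[OF _ assms])
    (intro linear_continuous_on, simp add: linear_conv_bounded_linear[symmetric])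

lemma borel_measurable_G:
  assumes "j < m" "\<tau> < n"
  shows "G j \<tau> \<in> borel_measurable borel"
  by (intro borel_measurable_continuous_onI lipschitz_on_continuous_on[OF lipschitz_phi[OF assms]])

lemma borel_measurable_yh:
  assumes "state_measurable N st" "\<tau> < n" "j < m"
  shows "(\<lambda>w. yh (st w) j \<tau>) \<in> borel_measurable N"
proof -
  have "(\<lambda>w. proximal (1 / \<sigma>) (\<phi> j \<tau>) (At j \<tau> (st_z (st w)) + (1 / \<sigma>) *\<^sub>R st_y (st w) j \<tau>)) \<in> borel_measurable N"
    unfolding At_def using assms sig
    by (intro measurable_compose[OF _ borel_measurable_proximal] borel_measurable_add
        borel_measurable_matrix_mult borel_measurable_scaleR state_measurableD convex_phi) auto
  then show ?thesis
    unfolding yh_def dual_prox_def by (rule measurable_compose[OF _ borel_measurable_G[OF assms(3,2)]])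
qed

lemma fst_node_law_measurable:
  "fst \<in> node_law m S S1 \<rightarrow>\<^sub>M count_space {..<m}"
  unfolding node_law_def
  using measurable_fst[of "uniform_count_measure {..<m}" "S \<Otimes>\<^sub>M S1"]
  by (simp add: measurable_cong_sets[OF refl sets_uniform_count_measure_count_space])

lemma borel_measurable_compressor:
  assumes "contraction_compressor S' Q' d'" "f \<in> N \<rightarrow>\<^sub>M S'" "v \<in> borel_measurable N"
  shows "(\<lambda>w. Q' (f w) (v w) :: real^'d) \<in> borel_measurable N"
proof -
  have "(\<lambda>(s, x). Q' s x) \<in> borel_measurable (S' \<Otimes>\<^sub>M borel)"
    using assms(1) by (simp add: contraction_compressor_def)
  from measurable_compose[OF measurable_Pair[OF assms(2,3)] this] show ?thesis by simp
qed

lemma space_node_lawD: "x \<in> space (node_law m S S1) \<Longrightarrow> fst x < m"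
  by (auto simp: node_law_def space_pair_measure space_uniform_count_measure)

lemma borel_measurable_convex_g: "g \<in> borel_measurable borel"
  using strongly_convex_convex_on[OF sc_g] lam
  by (intro borel_measurable_continuous_onI convex_on_continuous) auto

text \<open>Uses the closed forms of the step, which hold on \<open>space N\<close> because the
  sampled index is below \<open>m\<close> there; a function of the sampled index is glued from its
  finitely many sections.\<close>

lemma state_measurable_stepr:
  assumes st: "state_measurable N st" and r: "\<And>\<tau>. \<tau> < n \<Longrightarrow> (\<lambda>w. r w \<tau>) \<in> N \<rightarrow>\<^sub>M node_law m S S1"
  shows "state_measurable N (\<lambda>w. stepr (st w) (r w))"
proof -
  have i: "fst (r w \<tau>) < m" if "w \<in> space N" "\<tau> < n" for w \<tau>
    using measurable_space[OF r[OF that(2)] that(1)] by (rule space_node_lawD)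
  have ri: "(\<lambda>w. fst (r w \<tau>)) \<in> N \<rightarrow>\<^sub>M count_space {..<m}" if "\<tau> < n" for \<tau>
    by (rule measurable_compose[OF r[OF that] fst_node_law_measurable])
  have rs: "(\<lambda>w. fst (snd (r w \<tau>))) \<in> N \<rightarrow>\<^sub>M S" "(\<lambda>w. snd (snd (r w \<tau>))) \<in> N \<rightarrow>\<^sub>M S1" if "\<tau> < n" for \<tau>
    using r[OF that] unfolding node_law_def by measurable
  have yhm: "(\<lambda>w. yh (st w) j \<tau>) \<in> borel_measurable N" if "\<tau> < n" "j < m" for j \<tau>
    by (rule borel_measurable_yh[OF st that])
  have dvm: "(\<lambda>w. dv (st w) \<tau> (fst (r w \<tau>))) \<in> borel_measurable N" if "\<tau> < n" for \<tau>
  proof (rule measurable_compose_countable'[where f = "\<lambda>j w. dv (st w) \<tau> j" and g = "\<lambda>w. fst (r w \<tau>)" and I = "{..<m}"])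
    fix j assume "j \<in> {..<m}"
    then show "(\<lambda>w. dv (st w) \<tau> j) \<in> borel_measurable N"
      unfolding dv_def using that st
      by (intro borel_measurable_matrix_mult borel_measurable_diff yhm state_measurableD) auto
  qed (use that in \<open>auto intro: ri\<close>)
  have wm: "(\<lambda>w. dv (st w) \<tau> (fst (r w \<tau>)) + (pv (st w) \<tau> + st_e (st w) \<tau>)) \<in> borel_measurable N" if "\<tau> < n" for \<tau>
    using that by (intro borel_measurable_add dvm borel_measurable_pv[OF st] state_measurableD[OF st])
  have qm: "(\<lambda>w. Q (fst (snd (r w \<tau>))) (dv (st w) \<tau> (fst (r w \<tau>)) + (pv (st w) \<tau> + st_e (st w) \<tau>))) \<in> borel_measurable N"
    if "\<tau> < n" for \<tau>
    by (rule borel_measurable_compressor[OF Q rs(1)[OF that] wm[OF that]])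
  have q1m: "(\<lambda>w. Q1 (snd (snd (r w \<tau>))) (pv (st w) \<tau>)) \<in> borel_measurable N" if "\<tau> < n" for \<tau>
    by (rule borel_measurable_compressor[OF Q1 rs(2)[OF that] borel_measurable_pv[OF st that]])
  note c = measurable_cong[where M = N]
  have xm: "(\<lambda>w. st_x (stepr (st w) (r w))) \<in> borel_measurable N"
  proof -
    have "(\<lambda>w. proximal \<eta> g (st_x (st w) - \<eta> *\<^sub>R (st_hs (st w)
      + node_mean n (\<lambda>\<tau>. Q (fst (snd (r w \<tau>))) (dv (st w) \<tau> (fst (r w \<tau>)) + (pv (st w) \<tau> + st_e (st w) \<tau>)))))) \<in> borel_measurable N"
      using lam eta
      by (intro measurable_compose[OF _ borel_measurable_proximal] borel_measurable_diff borel_measurable_scaleR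
          borel_measurable_add borel_measurable_node_mean qm state_measurableD[OF st]
          strongly_convex_convex_on[OF sc_g]) auto
    then show ?thesis
      by (subst c) (auto simp: stepr_def st_x_step_eq[OF i refl])
  qed
  have zm: "(\<lambda>w. st_z (stepr (st w) (r w))) \<in> borel_measurable N"
  proof -
    have "(\<lambda>w. st_x (stepr (st w) (r w)) + \<theta> *\<^sub>R (st_x (stepr (st w) (r w)) - st_x (st w))) \<in> borel_measurable N"
      by (intro borel_measurable_add borel_measurable_scaleR borel_measurable_diff xm state_measurableD[OF st]) auto
    then show ?thesis
      by (subst c) (auto simp: stepr_def st_z_step[OF i refl])
  qed
  have em: "(\<lambda>w. st_e (stepr (st w) (r w)) \<tau>) \<in> borel_measurable N" if "\<tau> < n" for \<tau>
    using borel_measurable_diff[OF wm[OF that] qm[OF that]] that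
    by (subst c) (auto simp: stepr_def st_e_step[OF i refl])
  have um: "(\<lambda>w. st_u (stepr (st w) (r w)) \<tau>) \<in> borel_measurable N" if "\<tau> < n" for \<tau>
  proof -
    have "(\<lambda>w. st_u (st w) \<tau> + (1 / real m) *\<^sub>R dv (st w) \<tau> (fst (r w \<tau>))) \<in> borel_measurable N"
      using that by (intro borel_measurable_add borel_measurable_scaleR dvm state_measurableD[OF st]) auto
    then show ?thesis using that
      by (subst c) (auto simp: stepr_def st_u_step[OF i refl])
  qed
  have hm: "(\<lambda>w. st_h (stepr (st w) (r w)) \<tau>) \<in> borel_measurable N" if "\<tau> < n" for \<tau>
    using borel_measurable_add[OF state_measurableD(6)[OF st that] q1m[OF that]]
    by (subst c) (auto simp: stepr_def st_h_step[OF i refl])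
  have hsm: "(\<lambda>w. st_hs (stepr (st w) (r w))) \<in> borel_measurable N"
    using borel_measurable_add[OF state_measurableD(3)[OF st] borel_measurable_node_mean[OF q1m]]
    by (subst c) (auto simp: stepr_def st_hs_step[OF i refl])
  have ym: "(\<lambda>w. st_y (stepr (st w) (r w)) j \<tau>) \<in> borel_measurable N" if "\<tau> < n" "j < m" for j \<tau>
  proof -
    have "{w \<in> space N. j = fst (r w \<tau>)} = (\<lambda>w. fst (r w \<tau>)) -` {j} \<inter> space N" by auto
    also have "\<dots> \<in> sets N" using that by (intro measurable_sets[OF ri]) auto
    finally have "(\<lambda>w. if j = fst (r w \<tau>) then yh (st w) j \<tau> else st_y (st w) j \<tau>) \<in> borel_measurable N"
      using that by (intro measurable_If yhm state_measurableD[OF st])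
    then show ?thesis using that
      by (subst c) (auto simp: stepr_def st_y_step[OF i refl])
  qed
  show ?thesis
    unfolding state_measurable_def using xm zm em um hm hsm ym by blast
qed

text \<open>One form with four free weights covers \<open>lyap_i\<close> and \<open>lyap_ii\<close>,
  so that the probabilistic argument is carried out once.\<close>

definition energy :: "real \<Rightarrow> real \<Rightarrow> real \<Rightarrow> real \<Rightarrow> (real^'d, real^'t) ecspdc_state \<Rightarrow> real" where
  "energy a1 a2 a3 a4 s = lyap s + a1 * (norm (node_mean n (st_e s)))\<^sup>2 + a2 * err_mean s
    + a3 * (norm (node_mean n (pv s)))\<^sup>2 + a4 * shift_sq_mean s"

lemma borel_measurable_energy:
  assumes st: "state_measurable N st"
  shows "(\<lambda>w. energy a1 a2 a3 a4 (st w)) \<in> borel_measurable N"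
proof -
  note [measurable] = state_measurableD[OF st] borel_measurable_pv[OF st]
  have [measurable]: "(\<lambda>w. node_mean n (st_e (st w))) \<in> borel_measurable N"
    "(\<lambda>w. node_mean n (st_u (st w))) \<in> borel_measurable N"
    "(\<lambda>w. node_mean n (pv (st w))) \<in> borel_measurable N"
    by (intro borel_measurable_node_mean; measurable)+
  have [measurable]: "(\<lambda>w. g (st_x (st w))) \<in> borel_measurable N"
    by (rule measurable_compose[OF _ borel_measurable_convex_g]) measurable
  have [measurable]: "(\<lambda>w. dual_term j \<tau> (st_y (st w) j \<tau>)) \<in> borel_measurable N" if "\<tau> < n" "j < m" for j \<tau>
  proof -
    have [measurable]: "(\<lambda>w. st_y (st w) j \<tau>) \<in> borel_measurable N" by (rule state_measurableD(7)[OF st that])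
    have [measurable]: "(\<lambda>w. conj_real j \<tau> (st_y (st w) j \<tau>)) \<in> borel_measurable N"
      unfolding conj_real_def by (intro borel_measurable_real_of_ereal measurable_compose[OF _ borel_measurable_conjugate]) measurable
    show ?thesis unfolding dual_term_def bregman_def by measurable
  qed
  have [measurable]: "(\<lambda>w. \<Sum>\<tau><n. \<Sum>j<m. dual_term j \<tau> (st_y (st w) j \<tau>)) \<in> borel_measurable N"
    "(\<lambda>w. \<Sum>\<tau><n. (norm (st_e (st w) \<tau>))\<^sup>2) \<in> borel_measurable N"
    "(\<lambda>w. \<Sum>\<tau><n. (norm (pv (st w) \<tau>))\<^sup>2) \<in> borel_measurable N"
    by (intro borel_measurable_sum; simp)+
  show ?thesis
    unfolding energy_def lyap_def err_mean_def shift_sq_mean_def xd_def by measurable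
qed

section \<open>From the working Lyapunov functions to the stated ones\<close>

definition cross :: "(real^'d, real^'t) ecspdc_state \<Rightarrow> real" where
  "cross s = (node_mean n (st_u s) - us) \<bullet> xd s + 1 / (8 * \<eta>) * (norm (xd s))\<^sup>2
    + 1 / (4 * \<sigma> * real n) * dual_dist_sq m n (st_y s) Ys"

lemma node_mean_st_u:
  assumes "consistent s"
  shows "node_mean n (st_u s) - us = (1 / real (m * n)) *\<^sub>R (\<Sum>\<tau><n. \<Sum>j<m. A j \<tau> *v (st_y s j \<tau> - Ys j \<tau>))"
proof -
  have "node_mean n (st_u s) = (1 / real (m * n)) *\<^sub>R (\<Sum>\<tau><n. \<Sum>j<m. A j \<tau> *v st_y s j \<tau>)"
    using assms unfolding node_mean_def consistent_def
    by (simp add: scaleR_sum_right[symmetric] mult.commute)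
  then show ?thesis
    unfolding us_def by (simp add: matrix_vector_mult_diff_distrib sum_subtractf scaleR_diff_right)
qed

text \<open>Young with \<open>2 * \<eta>\<close> uses up \<open>1 / (8 * \<eta>)\<close> of the
  squared movement and leaves \<open>2 * \<eta>\<close> times the squared norm of \<open>w\<close>.
  The spectral bound and the assumption on \<open>R1\<close> bound the latter, and \<open>sg\<close>
  identifies the result with the dual distance in \<open>cross\<close>.\<close>

lemma cross_nonneg:
  assumes cons: "consistent s" and sg: "1 / (2 * \<sigma>) = 2 * \<eta> * R1\<^sup>2" and R1: "2 * (R_const m n A)\<^sup>2 \<le> R1\<^sup>2"
  shows "0 \<le> cross s"
proof -
  have m0: "0 < m" and n0: "0 < n" using m n by auto
  define w where "w = node_mean n (st_u s) - us"
  define D where "D = dual_dist_sq m n (st_y s) Ys"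
  have D: "0 \<le> D" by (simp add: D_def dual_dist_sq_def sum_nonneg)
  have "(norm (\<Sum>\<tau><n. \<Sum>j<m. A j \<tau> *v (st_y s j \<tau> - Ys j \<tau>)))\<^sup>2 \<le> real (m * n) * (R_const m n A)\<^sup>2 * D"
    unfolding D_def dual_dist_sq_def by (rule R_const_bound[OF m0 n0])
  then have "(1 / real (m * n))\<^sup>2 * (norm (\<Sum>\<tau><n. \<Sum>j<m. A j \<tau> *v (st_y s j \<tau> - Ys j \<tau>)))\<^sup>2
    \<le> (1 / real (m * n))\<^sup>2 * (real (m * n) * (R_const m n A)\<^sup>2 * D)"
    by (intro mult_left_mono) auto
  moreover have "(norm w)\<^sup>2 = (1 / real (m * n))\<^sup>2 * (norm (\<Sum>\<tau><n. \<Sum>j<m. A j \<tau> *v (st_y s j \<tau> - Ys j \<tau>)))\<^sup>2"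
    unfolding w_def node_mean_st_u[OF cons] norm_scaleR power_mult_distrib power2_abs ..
  moreover have "(1 / real (m * n))\<^sup>2 * (real (m * n) * (R_const m n A)\<^sup>2 * D) = (R_const m n A)\<^sup>2 / real m * D / real n"
    using m0 n0 by (simp add: power2_eq_square field_simps)
  ultimately have "(norm w)\<^sup>2 \<le> (R_const m n A)\<^sup>2 / real m * D / real n" by linarith
  also have "\<dots> \<le> R1\<^sup>2 / 2 * D / real n"
  proof -
    have "(R_const m n A)\<^sup>2 / real m \<le> (R_const m n A)\<^sup>2 / 1"
      using m0 by (intro divide_left_mono) auto
    then have "(R_const m n A)\<^sup>2 / real m \<le> R1\<^sup>2 / 2" using R1 unfolding div_by_1 by linarith
    then show ?thesis using D by (intro divide_right_mono mult_right_mono) auto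
  qed
  finally have "2 * \<eta> * (norm w)\<^sup>2 \<le> 2 * \<eta> * (R1\<^sup>2 / 2 * D / real n)"
    using eta by (intro mult_left_mono) auto
  also have "\<dots> = 1 / 2 * (2 * \<eta> * R1\<^sup>2) / real n * D" by simp
  also have "\<dots> = 1 / (4 * \<sigma> * real n) * D" unfolding sg[symmetric] by simp
  finally show ?thesis
    using young_inner_ge[of "2 * \<eta>" w "xd s"] eta
    unfolding cross_def w_def[symmetric] D_def[symmetric] by simp
qed

text \<open>The saddle values are finite for consistent states, so the \<open>ereal\<close>
  expression collapses to a real one. The parameters \<open>a\<close> and \<open>b\<close> stand
  where the two Lyapunov functions put their error terms, before and after the gaps.\<close>

lemma lyap_eq_saddle:
  assumes cons: "consistent s"
  defines "F \<equiv> saddle_fun m n A \<phi> g"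
  shows "ereal (a + lyap s - cross s + b) =
    ereal ((1 / (2 * \<eta>) + lam / 4) * (norm (st_x s - \<eta> *\<^sub>R node_mean n (st_e s) - xs))\<^sup>2
        + (1 / (4 * \<sigma>) + \<gamma> / 2) * (1 / real n) * dual_dist_sq m n (st_y s) Ys + a)
      + (F (st_x s) Ys - F xs Ys) + ereal (real m) * (F xs Ys - F xs (st_y s)) + ereal b"
proof -
  have m0: "0 < m" and n0: "0 < n" using m n by auto
  have fin: "dual_finite (st_y s)" using cons by (simp add: consistent_def)
  have 1: "F (st_x s) Ys - F xs Ys = ereal (g (st_x s) - g xs + us \<bullet> (st_x s - xs))"
    unfolding F_def saddle_fun_finite[OF dual_finite_Ys] inner_us
    by (simp add: At_diff inner_diff_right sum_subtractf algebra_simps diff_divide_distrib add_divide_distrib)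
  have 2: "ereal (real m) * (F xs Ys - F xs (st_y s)) = ereal (1 / real n * (\<Sum>\<tau><n. \<Sum>j<m. bregman j \<tau> (st_y s j \<tau>)))"
  proof -
    have "F xs Ys - F xs (st_y s) = ereal (1 / real (m * n) * (\<Sum>\<tau><n. \<Sum>j<m. bregman j \<tau> (st_y s j \<tau>)))"
      unfolding F_def saddle_fun_finite[OF dual_finite_Ys] saddle_fun_finite[OF fin] bregman_def
      by (simp add: inner_diff_left sum_subtractf sum.distrib algebra_simps diff_divide_distrib add_divide_distrib)
    then show ?thesis using m0 by simp
  qed
  have "(\<Sum>\<tau><n. \<Sum>j<m. dual_term j \<tau> (st_y s j \<tau>)) =
    (1 / (2 * \<sigma>) + \<gamma> / 2) * (1 / real n) * dual_dist_sq m n (st_y s) Ys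
      + 1 / real n * (\<Sum>\<tau><n. \<Sum>j<m. bregman j \<tau> (st_y s j \<tau>))"
    unfolding dual_term_def dual_dist_sq_def distrib_left sum.distrib sum_distrib_left by (simp add: mult_ac)
  moreover have "(1 / (2 * \<sigma>) + \<gamma> / 2) * (1 / real n) * dual_dist_sq m n (st_y s) Ys
    = (1 / (4 * \<sigma>) + \<gamma> / 2) * (1 / real n) * dual_dist_sq m n (st_y s) Ys + 1 / (4 * \<sigma> * real n) * dual_dist_sq m n (st_y s) Ys"
  proof -
    have "1 / (2 * \<sigma>) = 1 / (4 * \<sigma>) + 1 / (4 * \<sigma>)" by simp
    then show ?thesis by (simp add: algebra_simps)
  qed
  ultimately show ?thesis
    unfolding 1 2 lyap_def cross_def by simp
qed

lemma Phi2_eq: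
  assumes "consistent s"
  shows "Phi2 m n A \<phi> g lam \<gamma> \<delta> \<delta>1 \<sigma> \<eta> xs Ys s = ereal (lyap_i s - cross s)"
proof -
  define a where "a = 3 * (\<eta> + lam * \<eta>\<^sup>2) / (\<delta> * real n) * (\<Sum>\<tau><n. (norm (st_e s \<tau>))\<^sup>2)"
  define b where "b = 42 * (1 - \<delta>) * (\<eta> + lam * \<eta>\<^sup>2) / (\<delta>\<^sup>2 * \<delta>1 * real n) * (\<Sum>\<tau><n. (norm (st_h s \<tau> - st_u s \<tau>))\<^sup>2)"
  have "lyap_i s - cross s = a + lyap s - cross s + b"
    unfolding lyap_i_def a_def b_def err_mean_def shift_sq_mean_def \<kappa>_def pv_def by (simp add: norm_minus_commute)
  then show ?thesis
    unfolding Phi2_def Let_def a_def[symmetric] b_def[symmetric]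
    by (simp only: lyap_eq_saddle[OF assms, of a b])
qed

lemma Psi2_eq:
  assumes "consistent s"
  shows "Psi2 m n A \<phi> g lam \<gamma> \<delta> \<delta>1 \<sigma> \<eta> xs Ys s = ereal (lyap_ii s - cross s)"
proof -
  have hs: "norm (st_hs s - node_mean n (st_u s)) = norm (node_mean n (pv s))"
    using assms unfolding pv_def[abs_def] node_mean_diff consistent_def by (simp add: norm_minus_commute)
  define b where "b = 3 * (\<eta> + lam * \<eta>\<^sup>2) / \<delta> * (norm (node_mean n (st_e s)))\<^sup>2
               + 21 * (1 - \<delta>) * (\<eta> + lam * \<eta>\<^sup>2) / (\<delta> * (real n)\<^sup>2) * (\<Sum>\<tau><n. (norm (st_e s \<tau>))\<^sup>2)
               + 84 * (1 - \<delta>) * (\<eta> + lam * \<eta>\<^sup>2) / (5 * \<delta>\<^sup>2 * \<delta>1) * (norm (st_hs s - node_mean n (st_u s)))\<^sup>2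
               + 1512 * (1 - \<delta>) * (\<eta> + lam * \<eta>\<^sup>2) / (5 * \<delta>\<^sup>2 * \<delta>1 * (real n)\<^sup>2)
                 * (\<Sum>\<tau><n. (norm (st_h s \<tau> - st_u s \<tau>))\<^sup>2)"
  have "lyap_ii s - cross s = 0 + lyap s - cross s + b"
    unfolding lyap_ii_def b_def err_mean_def shift_sq_mean_def \<kappa>_def hs
    by (simp add: pv_def norm_minus_commute power2_eq_square[of "real n"])
  then show ?thesis
    unfolding Psi2_def Let_def b_def[symmetric]
    by (simp only: lyap_eq_saddle[OF assms, of 0 b] add_0_right)
qed

text \<open>After \<open>cross\<close> is removed the dual part still has at least
  \<open>1 / (4 * \<sigma>)\<close> times the distance, and every other summand is nonnegative by
  itself.\<close>

lemma lyap_minus_cross_nonneg: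
  assumes "consistent s"
  shows "0 \<le> lyap s - cross s"
proof -
  have fin: "conjugate (\<phi> j \<tau>) (st_y s j \<tau>) \<noteq> \<infinity>" if "j < m" "\<tau> < n" for j \<tau>
    using assms that by (auto simp: consistent_def dual_finite_def)
  have D: "dual_dist_sq m n (st_y s) Ys = (\<Sum>\<tau><n. \<Sum>j<m. (norm (st_y s j \<tau> - Ys j \<tau>))\<^sup>2)"
    by (simp add: dual_dist_sq_def)
  have "1 / (4 * \<sigma> * real n) * dual_dist_sq m n (st_y s) Ys \<le> (\<Sum>\<tau><n. \<Sum>j<m. dual_term j \<tau> (st_y s j \<tau>))"
    unfolding D sum_distrib_left
  proof (intro sum_mono)
    fix \<tau> j assume "\<tau> \<in> {..<n}" "j \<in> {..<m}"
    then have jt: "j < m" "\<tau> < n" by auto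
    define N where "N = (norm (st_y s j \<tau> - Ys j \<tau>))\<^sup>2"
    have "0 \<le> bregman j \<tau> (st_y s j \<tau>)" by (rule bregman_nonneg[OF jt fin[OF jt]])
    moreover have "1 / (4 * \<sigma>) * N \<le> (1 / (2 * \<sigma>) + \<gamma> / 2) * N"
    proof (rule mult_right_mono)
      have "1 / (2 * \<sigma>) = 1 / (4 * \<sigma>) + 1 / (4 * \<sigma>)" "0 < 1 / (4 * \<sigma>)" using sig by auto
      then show "1 / (4 * \<sigma>) \<le> 1 / (2 * \<sigma>) + \<gamma> / 2" using gam by linarith
    qed (simp add: N_def)
    ultimately have "1 / (4 * \<sigma>) * N \<le> (1 / (2 * \<sigma>) + \<gamma> / 2) * N + bregman j \<tau> (st_y s j \<tau>)" by linarith
    then have "1 / real n * (1 / (4 * \<sigma>) * N) \<le> dual_term j \<tau> (st_y s j \<tau>)"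
      unfolding dual_term_def N_def by (intro mult_left_mono) auto
    then show "1 / (4 * \<sigma> * real n) * (norm (st_y s j \<tau> - Ys j \<tau>))\<^sup>2 \<le> dual_term j \<tau> (st_y s j \<tau>)"
      by (simp add: N_def mult_ac)
  qed
  moreover have "0 \<le> g (st_x s) - g xs + us \<bullet> (st_x s - xs)"
  proof -
    have "0 \<le> lam / 2 * (norm (st_x s - xs))\<^sup>2" using lam by simp
    also note primal_gap_growth
    finally show ?thesis .
  qed
  moreover have "0 \<le> (1 / (2 * \<eta>) + lam / 4) * (norm (st_x s - \<eta> *\<^sub>R node_mean n (st_e s) - xs))\<^sup>2"
    using eta lam by (intro mult_nonneg_nonneg) auto
  ultimately show ?thesis unfolding lyap_def cross_def by linarith
qed

lemma lyap_full_minus_cross_nonneg: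
  assumes "consistent s"
  shows "0 \<le> lyap_i s - cross s" "0 \<le> lyap_ii s - cross s"
proof -
  note nn = lyap_minus_cross_nonneg[OF assms] err_mean_nonneg[of s] shift_sq_mean_nonneg[of s] kappa d d1
  have "0 \<le> 3 * \<kappa> / \<delta> * err_mean s + 42 * (1 - \<delta>) * \<kappa> / (\<delta>\<^sup>2 * \<delta>1) * shift_sq_mean s"
    using nn by (intro add_nonneg_nonneg mult_nonneg_nonneg) auto
  then show "0 \<le> lyap_i s - cross s" using nn(1) unfolding lyap_i_def by linarith
  have "0 \<le> 3 * \<kappa> / \<delta> * (norm (node_mean n (st_e s)))\<^sup>2
    + 21 * (1 - \<delta>) * \<kappa> / (\<delta> * real n) * err_mean s
    + 84 * (1 - \<delta>) * \<kappa> / (5 * \<delta>\<^sup>2 * \<delta>1) * (norm (node_mean n (pv s)))\<^sup>2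
    + 1512 * (1 - \<delta>) * \<kappa> / (5 * \<delta>\<^sup>2 * \<delta>1 * real n) * shift_sq_mean s"
    using nn by (intro add_nonneg_nonneg mult_nonneg_nonneg divide_nonneg_nonneg) auto
  then show "0 \<le> lyap_ii s - cross s" using nn(1) unfolding lyap_ii_def by linarith
qed

end


section \<open>The random process\<close>

locale ecspdc_process = ecspdc_analysis m n A \<phi> G g lam \<gamma> xs Ys \<sigma> \<eta> \<theta> S S1 Q Q1 \<delta> \<delta>1
  for m n :: nat
    and A :: "nat \<Rightarrow> nat \<Rightarrow> real^'t^'d"
    and \<phi> :: "nat \<Rightarrow> nat \<Rightarrow> real^'t \<Rightarrow> real"
    and G :: "nat \<Rightarrow> nat \<Rightarrow> real^'t \<Rightarrow> real^'t"
    and g :: "real^'d \<Rightarrow> real"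
    and lam \<gamma> :: real
    and xs :: "real^'d" and Ys :: "nat \<Rightarrow> nat \<Rightarrow> real^'t"
    and \<sigma> \<eta> \<theta> :: real
    and S :: "'s measure" and S1 :: "'s1 measure"
    and Q :: "'s \<Rightarrow> real^'d \<Rightarrow> real^'d" and Q1 :: "'s1 \<Rightarrow> real^'d \<Rightarrow> real^'d" and \<delta> \<delta>1 :: real +
  fixes M :: "'w measure"
    and I :: "nat \<Rightarrow> nat \<Rightarrow> 'w \<Rightarrow> nat"
    and \<xi> :: "nat \<Rightarrow> nat \<Rightarrow> 'w \<Rightarrow> 's" and \<xi>1 :: "nat \<Rightarrow> nat \<Rightarrow> 'w \<Rightarrow> 's1"
    and s0 :: "(real^'d, real^'t) ecspdc_state"
  assumes randomness: "ecspdc_randomness M m n S S1 I \<xi> \<xi>1"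
    and consistent_s0: "consistent s0"
begin

abbreviation "node \<equiv> node_law m S S1"

definition X :: "nat \<Rightarrow> nat \<Rightarrow> 'w \<Rightarrow> nat \<times> 's \<times> 's1" where
  "X k \<tau> \<omega> = (I k \<tau> \<omega>, \<xi> k \<tau> \<omega>, \<xi>1 k \<tau> \<omega>)"

text \<open>
  The random inputs of nodes \<open>\<tau> \<ge> n\<close> are unconstrained, so they are masked by \<open>undefined\<close>; this does
  not change the coordinates of the state that the Lyapunov functions read.
\<close>
definition draw :: "nat \<Rightarrow> 'w \<Rightarrow> nat \<Rightarrow> nat \<times> 's \<times> 's1" where
  "draw k \<omega> = (\<lambda>\<tau>\<in>{..<n}. X k \<tau> \<omega>)"

definition proc :: "nat \<Rightarrow> 'w \<Rightarrow> (real^'d, real^'t) ecspdc_state" where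
  "proc k \<omega> = ecspdc m n A \<phi> g \<sigma> \<eta> \<theta> Q Q1 I \<xi> \<xi>1 s0 k \<omega>"

definition past :: "nat \<Rightarrow> 'w \<Rightarrow> nat \<times> nat \<Rightarrow> nat \<times> 's \<times> 's1" where
  "past k \<omega> = (\<lambda>p\<in>{..<k} \<times> {..<n}. X (fst p) (snd p) \<omega>)"

text \<open>The sigma-algebra generated by the draws of the first \<open>k\<close> iterations; as a
  vimage algebra its sets are exactly the preimages under \<open>past k\<close>, which
  \<open>distr_history_draw\<close> exploits.\<close>

definition history :: "nat \<Rightarrow> 'w measure" where
  "history k = vimage_algebra (space M) (past k) (PiM ({..<k} \<times> {..<n}) (\<lambda>_. node))"

lemma prob_space_M: "prob_space M"
  using randomness unfolding ecspdc_randomness_def Let_def by blast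

lemma indep_X: "prob_space.indep_vars M (\<lambda>_. node) (\<lambda>p. X (fst p) (snd p)) (UNIV \<times> {..<n})"
proof -
  have "prob_space.indep_vars M (\<lambda>_. node) (\<lambda>(k, \<tau>) \<omega>. (I k \<tau> \<omega>, \<xi> k \<tau> \<omega>, \<xi>1 k \<tau> \<omega>)) (UNIV \<times> {..<n})"
    using randomness unfolding ecspdc_randomness_def Let_def node_law_def by blast
  also have "(\<lambda>(k, \<tau>) \<omega>. (I k \<tau> \<omega>, \<xi> k \<tau> \<omega>, \<xi>1 k \<tau> \<omega>)) = (\<lambda>p. X (fst p) (snd p))"
    by (auto simp: fun_eq_iff X_def)
  finally show ?thesis .
qed

lemma distr_X:
  assumes "\<tau> < n"
  shows "distr M node (X k \<tau>) = node"
proof -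
  have "distr M node (\<lambda>\<omega>. (I k \<tau> \<omega>, \<xi> k \<tau> \<omega>, \<xi>1 k \<tau> \<omega>)) = node"
    using randomness assms unfolding ecspdc_randomness_def Let_def node_law_def by blast
  then show ?thesis by (simp only: X_def[abs_def])
qed

lemma proc_Suc: "proc (Suc k) \<omega> = stepr (proc k \<omega>) (\<lambda>\<tau>. X k \<tau> \<omega>)"
  by (simp add: proc_def stepr_def X_def)

lemma measurable_X:
  assumes "\<tau> < n"
  shows "X k \<tau> \<in> M \<rightarrow>\<^sub>M node"
proof -
  interpret M: prob_space M by (rule prob_space_M)
  have "\<forall>p\<in>UNIV \<times> {..<n}. M.random_variable node (X (fst p) (snd p))"
    using indep_X unfolding M.indep_vars_def by blast
  then have "M.random_variable node (X (fst (k, \<tau>)) (snd (k, \<tau>)))"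
    by (rule bspec) (use assms in simp)
  then show ?thesis by simp
qed

lemma X_less:
  assumes "\<omega> \<in> space M" "\<tau> < n"
  shows "fst (X k \<tau> \<omega>) < m"
  using measurable_space[OF measurable_X[OF assms(2)] assms(1)] by (rule space_node_lawD)

lemma consistent_proc: "\<omega> \<in> space M \<Longrightarrow> consistent (proc k \<omega>)"
proof (induction k)
  case 0
  then show ?case using consistent_s0 by (simp add: proc_def)
next
  case (Suc k)
  then show ?case
    unfolding proc_Suc stepr_def by (intro consistent_step[OF X_less refl]) auto
qed

lemma measurable_past: "past k \<in> M \<rightarrow>\<^sub>M PiM ({..<k} \<times> {..<n}) (\<lambda>_. node)"
  unfolding past_def[abs_def] by (intro measurable_restrict measurable_X) auto

lemma space_history [simp]: "space (history k) = space M"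
  by (simp add: history_def)

lemma measurable_X_history:
  assumes "j < k" "\<tau> < n"
  shows "X j \<tau> \<in> history k \<rightarrow>\<^sub>M node"
proof -
  have "past k \<in> history k \<rightarrow>\<^sub>M PiM ({..<k} \<times> {..<n}) (\<lambda>_. node)"
    unfolding history_def using measurable_space[OF measurable_past] by (intro measurable_vimage_algebra1) auto
  then have "(\<lambda>\<omega>. past k \<omega> (j, \<tau>)) \<in> history k \<rightarrow>\<^sub>M node"
    by (rule measurable_compose[OF _ measurable_component_singleton]) (use assms in auto)
  then show ?thesis using assms by (simp add: past_def)
qed

lemma history_Suc: "(\<lambda>\<omega>. \<omega>) \<in> history (Suc k) \<rightarrow>\<^sub>M history k"
  unfolding history_def[of k]
proof (rule measurable_vimage_algebra2)
  show "(\<lambda>\<omega>. past k \<omega>) \<in> history (Suc k) \<rightarrow>\<^sub>M PiM ({..<k} \<times> {..<n}) (\<lambda>_. node)"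
    unfolding past_def by (intro measurable_restrict measurable_X_history) auto
qed simp

lemma history_M: "(\<lambda>\<omega>. \<omega>) \<in> M \<rightarrow>\<^sub>M history k"
  unfolding history_def by (rule measurable_vimage_algebra2) (use measurable_past in auto)

text \<open>Measurability with respect to the history, and not just to \<open>M\<close>, is what
  allows the current draw to be integrated out with the state frozen.\<close>

lemma state_measurable_proc: "state_measurable (history k) (proc k)"
proof (induction k)
  case 0
  show ?case by (simp add: proc_def[abs_def] state_measurable_def)
next
  case (Suc k)
  have "state_measurable (history (Suc k)) (\<lambda>\<omega>. proc k \<omega>)"
    using state_measurable_compose[OF Suc.IH history_Suc] .
  then show ?case
    unfolding proc_Suc[abs_def] by (rule state_measurable_stepr) (intro measurable_X_history, auto)
qed

lemma measurable_draw: "draw k \<in> M \<rightarrow>\<^sub>M law"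
  unfolding draw_def[abs_def] law_def by (intro measurable_restrict measurable_X) auto

text \<open>Independence on the index set \<open>{k} \<times> {..<n}\<close> gives a product law
  there; projecting the pairs to their node index yields \<open>law\<close>.\<close>

lemma distr_draw: "distr M law (draw k) = law"
proof -
  interpret M: prob_space M by (rule prob_space_M)
  interpret node: prob_space node by (rule prob_space_node)
  interpret P: product_prob_space "\<lambda>_. node" "UNIV :: (nat \<times> nat) set" ..
  define K where "K = {k} \<times> {..<n}"
  have K: "K \<noteq> {}" using n by (auto simp: K_def lessThan_empty_iff bot_nat_def)
  have "M.indep_vars (\<lambda>_. node) (\<lambda>p. X (fst p) (snd p)) K"
    by (rule M.indep_vars_subset[OF indep_X]) (auto simp: K_def)
  then have "distr M (PiM K (\<lambda>_. node)) (\<lambda>\<omega>. \<lambda>p\<in>K. X (fst p) (snd p) \<omega>)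
    = PiM K (\<lambda>p. distr M node (X (fst p) (snd p)))"
    by (subst (asm) M.indep_vars_iff_distr_eq_PiM'[OF K]) (auto simp: K_def measurable_X)
  also have "\<dots> = PiM K (\<lambda>_. node)" by (intro PiM_cong) (auto simp: distr_X K_def)
  finally have 1: "distr M (PiM K (\<lambda>_. node)) (\<lambda>\<omega>. \<lambda>p\<in>K. X (fst p) (snd p) \<omega>) = PiM K (\<lambda>_. node)" .
  have "distr M law (draw k)
    = distr (distr M (PiM K (\<lambda>_. node)) (\<lambda>\<omega>. \<lambda>p\<in>K. X (fst p) (snd p) \<omega>)) law (\<lambda>r. \<lambda>\<tau>\<in>{..<n}. r (k, \<tau>))"
    by (subst distr_distr)
      (auto simp: K_def law_def draw_def comp_def intro!: distr_cong measurable_restrict measurable_component_singleton measurable_X)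
  also have "\<dots> = law"
    unfolding 1 law_def
    using P.distr_reorder[of "Pair k" "{..<n}" K] by (auto simp: K_def inj_on_def)
  finally show ?thesis .
qed

text \<open>Independence of the current draw from the past, in the form of a product measure. It is
  enough to compare rectangles, and the two factors come from disjoint index blocks of one
  independent family.\<close>

lemma distr_history_draw:
  "distr M (history k) (\<lambda>\<omega>. \<omega>) \<Otimes>\<^sub>M law = distr M (history k \<Otimes>\<^sub>M law) (\<lambda>\<omega>. (\<omega>, draw k \<omega>))"
proof (rule pair_measure_eqI)
  interpret M: prob_space M by (rule prob_space_M)
  interpret L: prob_space law by (rule prob_space_law)
  interpret H: prob_space "distr M (history k) (\<lambda>\<omega>. \<omega>)" by (rule M.prob_space_distr[OF history_M])
  show "sigma_finite_measure (distr M (history k) (\<lambda>\<omega>. \<omega>))" by unfold_locales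
  show "sigma_finite_measure law" by unfold_locales
  show "sets (distr M (history k) (\<lambda>\<omega>. \<omega>) \<Otimes>\<^sub>M law) = sets (distr M (history k \<Otimes>\<^sub>M law) (\<lambda>\<omega>. (\<omega>, draw k \<omega>)))"
    by (simp cong: sets_pair_measure_cong)
  fix B C assume "B \<in> sets (distr M (history k) (\<lambda>\<omega>. \<omega>))" and C: "C \<in> sets law"
  then have B: "B \<in> sets (history k)" by simp
  define PA where "PA = PiM ({..<k} \<times> {..<n}) (\<lambda>_. node)"
  define PB where "PB = PiM ({k} \<times> {..<n}) (\<lambda>_. node)"
  define present where "present = (\<lambda>\<omega>. \<lambda>p\<in>{k} \<times> {..<n}. X (fst p) (snd p) \<omega>)"
  define pick where "pick = (\<lambda>r :: nat \<times> nat \<Rightarrow> nat \<times> 's \<times> 's1. \<lambda>\<tau>\<in>{..<n}. r (k, \<tau>))"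
  have ind: "M.indep_var PA (past k) PB present"
    unfolding past_def[abs_def] PA_def PB_def present_def by (rule M.indep_var_restrict[OF indep_X]) auto
  have pick: "pick \<in> PB \<rightarrow>\<^sub>M law"
    unfolding pick_def law_def PB_def by (auto intro!: measurable_restrict measurable_component_singleton)
  have draw: "draw k \<omega> = pick (present \<omega>)" for \<omega>
    by (auto simp: draw_def pick_def present_def fun_eq_iff)
  have present: "present \<omega> \<in> space PB" if "\<omega> \<in> space M" for \<omega>
    using measurable_space[OF M.indep_var_rv2[OF ind] that] .
  have "sets (history k) = {past k -` B \<inter> space M |B. B \<in> sets PA}"
    unfolding history_def PA_def using measurable_space[OF measurable_past] by (intro sets_vimage_algebra2) auto
  then obtain B' where B': "B' \<in> sets PA" "B = past k -` B' \<inter> space M" using B by blast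
  have C': "pick -` C \<inter> space PB \<in> sets PB" by (rule measurable_sets[OF pick C])
  have eqC: "draw k -` C \<inter> space M = present -` (pick -` C \<inter> space PB) \<inter> space M"
    using present by (auto simp: draw)
  have eqB: "(\<lambda>\<omega>. \<omega>) -` B \<inter> space M = past k -` B' \<inter> space M" using B' by auto
  have "emeasure law C = emeasure M (draw k -` C \<inter> space M)"
    using C measurable_draw by (subst distr_draw[symmetric, of k]) (simp add: emeasure_distr)
  moreover have "emeasure (distr M (history k) (\<lambda>\<omega>. \<omega>)) B = emeasure M (past k -` B' \<inter> space M)"
    using B history_M eqB by (simp add: emeasure_distr)
  moreover have "emeasure (distr M (history k \<Otimes>\<^sub>M law) (\<lambda>\<omega>. (\<omega>, draw k \<omega>))) (B \<times> C)
    = emeasure M ((\<lambda>\<omega>. (past k \<omega>, present \<omega>)) -` (B' \<times> (pick -` C \<inter> space PB)) \<inter> space M)"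
  proof -
    have "(\<lambda>\<omega>. (\<omega>, draw k \<omega>)) -` (B \<times> C) \<inter> space M
      = (\<lambda>\<omega>. (past k \<omega>, present \<omega>)) -` (B' \<times> (pick -` C \<inter> space PB)) \<inter> space M"
      using B'(2) present by (auto simp: draw)
    then show ?thesis
      using B C by (subst emeasure_distr) (auto intro!: measurable_Pair history_M measurable_draw)
  qed
  ultimately show "emeasure (distr M (history k) (\<lambda>\<omega>. \<omega>)) B * emeasure law C
    = emeasure (distr M (history k \<Otimes>\<^sub>M law) (\<lambda>\<omega>. (\<omega>, draw k \<omega>))) (B \<times> C)"
    using M.indep_varD[OF ind B'(1) C'] unfolding eqC
    by (simp add: M.emeasure_eq_measure ennreal_mult)
qed

text \<open>The tower property as an iterated integral: the draw is integrated first, for a fixed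
  past.\<close>

lemma nn_integral_draw:
  assumes f: "f \<in> borel_measurable (history k \<Otimes>\<^sub>M law)"
  shows "(\<integral>\<^sup>+\<omega>. f (\<omega>, draw k \<omega>) \<partial>M) = (\<integral>\<^sup>+\<omega>. (\<integral>\<^sup>+r. f (\<omega>, r) \<partial>law) \<partial>M)"
proof -
  interpret M: prob_space M by (rule prob_space_M)
  interpret L: prob_space law by (rule prob_space_law)
  have meas: "(\<lambda>\<omega>. (\<omega>, draw k \<omega>)) \<in> M \<rightarrow>\<^sub>M history k \<Otimes>\<^sub>M law"
    by (intro measurable_Pair history_M measurable_draw)
  have "(\<integral>\<^sup>+\<omega>. f (\<omega>, draw k \<omega>) \<partial>M) = (\<integral>\<^sup>+x. f x \<partial>distr M (history k \<Otimes>\<^sub>M law) (\<lambda>\<omega>. (\<omega>, draw k \<omega>)))"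
    by (subst nn_integral_distr[OF meas]) (use f in simp_all)
  also have "distr M (history k \<Otimes>\<^sub>M law) (\<lambda>\<omega>. (\<omega>, draw k \<omega>)) = distr M (history k) (\<lambda>\<omega>. \<omega>) \<Otimes>\<^sub>M law"
    by (rule distr_history_draw[symmetric])
  also have "(\<integral>\<^sup>+x. f x \<partial>(distr M (history k) (\<lambda>\<omega>. \<omega>) \<Otimes>\<^sub>M law))
    = (\<integral>\<^sup>+\<omega>. (\<integral>\<^sup>+r. f (\<omega>, r) \<partial>law) \<partial>distr M (history k) (\<lambda>\<omega>. \<omega>))"
  proof (rule L.nn_integral_fst[symmetric])
    show "f \<in> borel_measurable (distr M (history k) (\<lambda>\<omega>. \<omega>) \<Otimes>\<^sub>M law)"
      using f by (simp cong: measurable_cong_sets sets_pair_measure_cong)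
  qed
  also have "\<dots> = (\<integral>\<^sup>+\<omega>. (\<integral>\<^sup>+r. f (\<omega>, r) \<partial>law) \<partial>M)"
    by (subst nn_integral_distr[OF history_M]) (use L.borel_measurable_nn_integral_fst[OF f] in simp_all)
  finally show ?thesis .
qed

lemma energy_cong:
  assumes "st_x s = st_x s'" "st_z s = st_z s'"
    and "\<And>\<tau>. \<tau> < n \<Longrightarrow> st_e s \<tau> = st_e s' \<tau> \<and> st_u s \<tau> = st_u s' \<tau> \<and> st_h s \<tau> = st_h s' \<tau>"
    and "\<And>\<tau> j. \<tau> < n \<Longrightarrow> j < m \<Longrightarrow> st_y s j \<tau> = st_y s' j \<tau>"
  shows "energy a1 a2 a3 a4 s = energy a1 a2 a3 a4 s'"
proof -
  have "node_mean n (st_e s) = node_mean n (st_e s')" "node_mean n (st_u s) = node_mean n (st_u s')"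
    "node_mean n (pv s) = node_mean n (pv s')"
    using assms(3) by (auto intro!: node_mean_cong simp: pv_def)
  then show ?thesis
    unfolding energy_def lyap_def err_mean_def shift_sq_mean_def xd_def pv_def using assms by simp
qed

lemma energy_stepr_draw:
  assumes "\<omega> \<in> space M"
  shows "energy a1 a2 a3 a4 (stepr s (\<lambda>\<tau>. X k \<tau> \<omega>)) = energy a1 a2 a3 a4 (stepr s (draw k \<omega>))"
proof -
  have i: "fst (X k \<tau> \<omega>) < m" "fst (draw k \<omega> \<tau>) < m" if "\<tau> < n" for \<tau>
    using X_less[OF assms that] that by (auto simp: draw_def)
  have x1: "st_x (stepr s (\<lambda>\<tau>. X k \<tau> \<omega>)) = proximal \<eta> g (st_x s - \<eta> *\<^sub>R (st_hs s
      + node_mean n (\<lambda>\<tau>. Q (fst (snd (X k \<tau> \<omega>))) (dv s \<tau> (fst (X k \<tau> \<omega>)) + (pv s \<tau> + st_e s \<tau>)))))"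
    unfolding stepr_def by (rule st_x_step_eq[OF _ refl]) (rule i(1))
  have x2: "st_x (stepr s (draw k \<omega>)) = proximal \<eta> g (st_x s - \<eta> *\<^sub>R (st_hs s
      + node_mean n (\<lambda>\<tau>. Q (fst (snd (draw k \<omega> \<tau>))) (dv s \<tau> (fst (draw k \<omega> \<tau>)) + (pv s \<tau> + st_e s \<tau>)))))"
    unfolding stepr_def by (rule st_x_step_eq[OF _ refl]) (rule i(2))
  have x: "st_x (stepr s (\<lambda>\<tau>. X k \<tau> \<omega>)) = st_x (stepr s (draw k \<omega>))"
    unfolding x1 x2
    by (intro arg_cong[where f = "\<lambda>v. proximal \<eta> g (st_x s - \<eta> *\<^sub>R (st_hs s + v))"] node_mean_cong)
      (simp add: draw_def)
  show ?thesis
  proof (rule energy_cong[OF x])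
    show "st_z (stepr s (\<lambda>\<tau>. X k \<tau> \<omega>)) = st_z (stepr s (draw k \<omega>))"
      using x by (simp add: stepr_def st_z_step[OF i(1) refl] st_z_step[OF i(2) refl])
  qed (simp_all add: stepr_def st_e_step[OF i(1) refl] st_e_step[OF i(2) refl] st_u_step[OF i(1) refl]
      st_u_step[OF i(2) refl] st_h_step[OF i(1) refl] st_h_step[OF i(2) refl]
      st_y_step[OF i(1) refl] st_y_step[OF i(2) refl], simp_all add: draw_def)
qed

text \<open>Nonnegative integrals make the induction self-contained: finiteness at each step comes
  out of the bound. The inner integral over the draw is controlled, for a frozen state, by the
  majorant from \<open>step\<close>.\<close>

theorem energy_decay:
  assumes step: "\<And>s. consistent s \<Longrightarrow> \<exists>B q. (\<forall>r\<in>space law. energy a1 a2 a3 a4 (stepr s r) \<le> B r)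
      \<and> has_bochner_integral law B q \<and> q \<le> \<theta> * energy a1 a2 a3 a4 s"
    and nonneg: "\<And>s. consistent s \<Longrightarrow> 0 \<le> energy a1 a2 a3 a4 s"
  shows "(\<integral>\<^sup>+\<omega>. ennreal (energy a1 a2 a3 a4 (proc k \<omega>)) \<partial>M) \<le> ennreal (\<theta> ^ k * energy a1 a2 a3 a4 s0)"
proof (induction k)
  case 0
  interpret M: prob_space M by (rule prob_space_M)
  show ?case by (simp add: proc_def M.emeasure_space_1)
next
  case (Suc k)
  let ?e = "energy a1 a2 a3 a4"
  have one: "(\<integral>\<^sup>+r. ennreal (?e (stepr s r)) \<partial>law) \<le> ennreal (\<theta> * ?e s)" if cons: "consistent s" for s
  proof -
    obtain B q where B: "\<And>r. r \<in> space law \<Longrightarrow> ?e (stepr s r) \<le> B r" "has_bochner_integral law B q" "q \<le> \<theta> * ?e s"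
      using step[OF cons] by blast
    \<comment> \<open>The majorant inherits nonnegativity from the energy, as required to pass
      between its Bochner and its nonnegative integral.\<close>
    have B0: "0 \<le> B r" if "r \<in> space law" for r
      using nonneg[OF consistent_stepr[OF that cons]] B(1)[OF that] by linarith
    have "(\<integral>\<^sup>+r. ennreal (?e (stepr s r)) \<partial>law) \<le> (\<integral>\<^sup>+r. ennreal (B r) \<partial>law)"
      using B(1) by (intro nn_integral_mono ennreal_leI)
    also have "\<dots> = ennreal (integral\<^sup>L law B)"
      using B(2) B0 by (intro nn_integral_eq_integral) (auto simp: has_bochner_integral_iff)
    also have "\<dots> \<le> ennreal (\<theta> * ?e s)"
      using B(2,3) by (intro ennreal_leI) (auto simp: has_bochner_integral_iff)
    finally show ?thesis .
  qed
  have joint: "(\<lambda>p. ennreal (?e (stepr (proc k (fst p)) (snd p)))) \<in> borel_measurable (history k \<Otimes>\<^sub>M law)"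
  proof -
    have "state_measurable (history k \<Otimes>\<^sub>M law) (\<lambda>p. stepr (proc k (fst p)) (snd p))"
    proof (rule state_measurable_stepr)
      show "state_measurable (history k \<Otimes>\<^sub>M law) (\<lambda>p. proc k (fst p))"
        by (rule state_measurable_compose[OF state_measurable_proc measurable_fst])
      show "(\<lambda>w. snd w \<tau>) \<in> history k \<Otimes>\<^sub>M law \<rightarrow>\<^sub>M node" if "\<tau> < n" for \<tau>
        unfolding law_def using that
        by (intro measurable_compose[OF measurable_snd measurable_component_singleton]) auto
    qed
    from borel_measurable_energy[OF this] show ?thesis by measurable
  qed
  have "(\<integral>\<^sup>+\<omega>. ennreal (?e (proc (Suc k) \<omega>)) \<partial>M) = (\<integral>\<^sup>+\<omega>. ennreal (?e (stepr (proc k \<omega>) (draw k \<omega>))) \<partial>M)"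
    by (intro nn_integral_cong) (simp add: proc_Suc energy_stepr_draw)
  also have "\<dots> = (\<integral>\<^sup>+\<omega>. (\<integral>\<^sup>+r. ennreal (?e (stepr (proc k \<omega>) r)) \<partial>law) \<partial>M)"
    using nn_integral_draw[OF joint] by simp
  also have "\<dots> \<le> (\<integral>\<^sup>+\<omega>. ennreal \<theta> * ennreal (?e (proc k \<omega>)) \<partial>M)"
    using theta by (intro nn_integral_mono) (simp add: one consistent_proc ennreal_mult' [symmetric] nonneg)
  also have "\<dots> = ennreal \<theta> * (\<integral>\<^sup>+\<omega>. ennreal (?e (proc k \<omega>)) \<partial>M)"
  proof (rule nn_integral_cmult)
    have "(\<lambda>\<omega>. ?e (proc k \<omega>)) \<in> borel_measurable M"
      by (rule borel_measurable_energy[OF state_measurable_compose[OF state_measurable_proc history_M]])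
    then show "(\<lambda>\<omega>. ennreal (?e (proc k \<omega>))) \<in> borel_measurable M" by measurable
  qed
  also have "\<dots> \<le> ennreal \<theta> * ennreal (\<theta> ^ k * ?e s0)"
    using Suc.IH by (rule mult_left_mono) simp
  also have "\<dots> = ennreal (\<theta> ^ Suc k * ?e s0)"
    using theta by (simp add: ennreal_mult'[symmetric] mult.assoc)
  finally show ?case .
qed

text \<open>Since \<open>cross\<close> is nonnegative it may be dropped at time \<open>k\<close>; at
  time 0 its value \<open>D0\<close> appears on the right. The negative part of the expectation
  vanishes because \<open>\<Phi>\<close> is nonnegative on consistent states.\<close>

lemma ereal_expectation_decay:
  assumes Phi: "\<And>s. consistent s \<Longrightarrow> \<Phi> s = ereal (energy a1 a2 a3 a4 s - cross s)"
    and nn: "\<And>s. consistent s \<Longrightarrow> 0 \<le> energy a1 a2 a3 a4 s - cross s"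
    and cr: "\<And>s. consistent s \<Longrightarrow> 0 \<le> cross s"
    and step: "\<And>s. consistent s \<Longrightarrow> \<exists>B q. (\<forall>r\<in>space law. energy a1 a2 a3 a4 (stepr s r) \<le> B r)
      \<and> has_bochner_integral law B q \<and> q \<le> \<theta> * energy a1 a2 a3 a4 s"
    and D0: "cross s0 = D0" and eps: "\<theta> ^ k \<le> \<epsilon>"
  shows "ereal_expectation M (\<lambda>\<omega>. \<Phi> (proc k \<omega>)) \<le> ereal \<epsilon> * (\<Phi> s0 + ereal D0)"
proof -
  let ?e = "energy a1 a2 a3 a4"
  have e: "0 \<le> ?e s" if "consistent s" for s using nn[OF that] cr[OF that] by linarith
  have "(\<integral>\<^sup>+\<omega>. e2ennreal (\<Phi> (proc k \<omega>)) \<partial>M) \<le> (\<integral>\<^sup>+\<omega>. ennreal (?e (proc k \<omega>)) \<partial>M)"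
    by (intro nn_integral_mono) (simp add: Phi cr consistent_proc ennreal_leI)
  also have "\<dots> \<le> ennreal (\<theta> ^ k * ?e s0)" by (rule energy_decay[OF step e])
  also have "\<dots> \<le> ennreal (\<epsilon> * ?e s0)"
    using eps e[OF consistent_s0] by (intro ennreal_leI mult_right_mono)
  finally have 1: "(\<integral>\<^sup>+\<omega>. e2ennreal (\<Phi> (proc k \<omega>)) \<partial>M) \<le> ennreal (\<epsilon> * ?e s0)" .
  have "(\<integral>\<^sup>+\<omega>. e2ennreal (- \<Phi> (proc k \<omega>)) \<partial>M) = (\<integral>\<^sup>+\<omega>. 0 \<partial>M)"
    using nn by (intro nn_integral_cong) (simp add: Phi consistent_proc ennreal_neg)
  then have 2: "(\<integral>\<^sup>+\<omega>. e2ennreal (- \<Phi> (proc k \<omega>)) \<partial>M) = 0" by simp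
  have eps0: "0 \<le> \<epsilon>" using eps theta by (meson order_trans zero_le_power less_imp_le)
  have "ereal_expectation M (\<lambda>\<omega>. \<Phi> (proc k \<omega>)) \<le> enn2ereal (ennreal (\<epsilon> * ?e s0))"
    unfolding ereal_expectation_def 2 using 1 by (simp add: less_eq_ennreal.rep_eq zero_ennreal.rep_eq)
  also have "\<dots> = ereal (\<epsilon> * ?e s0)"
    using eps0 e[OF consistent_s0] by simp
  also have "\<dots> = ereal \<epsilon> * (\<Phi> s0 + ereal D0)"
    using Phi[OF consistent_s0] D0 by simp
  finally show ?thesis .
qed

end

text \<open>Rests on \<open>1 - 1 / K \<le> exp (- (1 / K))\<close>.\<close>

lemma rate_power_le:
  fixes \<theta> K \<epsilon> :: real
  assumes "0 \<le> \<theta>" "0 < K" "\<theta> \<le> 1 - 1 / K" "0 < \<epsilon>" "K * ln (1 / \<epsilon>) \<le> real k"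
  shows "\<theta> ^ k \<le> \<epsilon>"
proof -
  have "\<theta> \<le> exp (- (1 / K))" using assms(3) exp_ge_add_one_self[of "- (1 / K)"] by linarith
  then have "\<theta> ^ k \<le> exp (- (1 / K)) ^ k" using assms(1) by (intro power_mono)
  also have "\<dots> = exp (- (real k / K))" by (simp add: exp_of_nat_mult[symmetric])
  also have "\<dots> \<le> exp (- ln (1 / \<epsilon>))" using assms(2,5) by (simp add: field_simps)
  also have "\<dots> = \<epsilon>" using assms(4) by (simp add: ln_div exp_minus)
  finally show ?thesis .
qed


section \<open>Stepsizes and rates\<close>

text \<open>Everything is expressed through \<open>c = R1 * T\<close>, for then
  \<open>\<eta> = 1 / (2 * c * lam)\<close>, \<open>\<sigma> = m / (2 * c * \<gamma>)\<close>, and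
  the first candidate in the minimum is the reciprocal of \<open>K = m + 4 * c\<close>.\<close>

lemma stepsize_properties:
  fixes m :: nat and lam \<gamma> R1 \<delta> \<delta>1 \<sigma> \<eta> \<theta> :: real
  assumes m: "1 \<le> m" and lam: "0 < lam" and gam: "0 < \<gamma>" and R1: "0 < R1"
    and d: "0 < \<delta>" "\<delta> \<le> 1" and d1: "0 < \<delta>1" "\<delta>1 \<le> 1"
    and cond: "1 \<le> R1\<^sup>2 / (lam * \<gamma>)"
    and sig: "\<sigma> = 1 / (2 * R1) * sqrt (m * lam / \<gamma>)"
    and eta: "\<eta> = 1 / (2 * R1) * sqrt (\<gamma> / (m * lam))"
    and theta: "\<theta> = 1 - Min {1 / (m + 4 * R1 * sqrt (m / (lam * \<gamma>))), \<delta> / 6, \<delta>1 / 6}"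
  shows "0 < \<sigma>" "0 < \<eta>" "0 < \<theta>" "\<theta> \<le> 1"
    and "1 / (2 * \<eta>) \<le> \<theta> * (1 / (2 * \<eta>) + lam / 4)"
    and "1 / (2 * \<sigma>) + \<gamma> / 2 * (1 - 1 / real m) \<le> \<theta> * (1 / (2 * \<sigma>) + \<gamma> / 2)"
    and "1 - 1 / real m \<le> \<theta>" and "1 - \<delta> / 6 \<le> \<theta>" and "1 - \<delta>1 / 6 \<le> \<theta>"
    and "lam * \<eta> \<le> 1 / 2" and "1 / (2 * \<sigma>) = 2 * \<eta> * R1\<^sup>2"
    and "\<theta> \<le> 1 - 1 / (m + 4 * R1 * sqrt (m / (lam * \<gamma>)) + 6 / \<delta> + 6 / \<delta>1)"
proof -
  define T where "T = sqrt (m / (lam * \<gamma>))"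
  define c where "c = R1 * T"
  define K where "K = m + 4 * c"
  have m0: "0 < real m" "1 \<le> real m" using m by auto
  have T: "0 < T" using m0 lam gam by (simp add: T_def)
  have c0: "0 < c" using R1 T by (simp add: c_def)
  have K0: "0 < K" and Km: "m \<le> K" using m0 c0 by (auto simp: K_def)
  have T2: "T\<^sup>2 = m / (lam * \<gamma>)" using m0 lam gam by (simp add: T_def)
  have e: "\<eta> = 1 / (2 * c * lam)"
  proof -
    have "sqrt (\<gamma> / (m * lam)) = 1 / (T * lam)"
    proof (rule real_sqrt_unique)
      show "(1 / (T * lam))\<^sup>2 = \<gamma> / (m * lam)"
        unfolding power_divide power_mult_distrib T2 using m0 lam gam by (simp add: power2_eq_square)
    qed (use T lam in simp)
    then show ?thesis by (simp add: eta c_def)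
  qed
  have s: "\<sigma> = m / (2 * c * \<gamma>)"
  proof -
    have "sqrt (m * lam / \<gamma>) = m / (T * \<gamma>)"
    proof (rule real_sqrt_unique)
      show "(m / (T * \<gamma>))\<^sup>2 = m * lam / \<gamma>"
        unfolding power_divide power_mult_distrib T2 using m0 lam gam by (simp add: power2_eq_square)
    qed (use T gam in simp)
    then show ?thesis by (simp add: sig c_def)
  qed
  \<comment> \<open>This is what \<open>cond\<close> is for: \<open>c \<ge> 1\<close> amounts to
    \<open>lam * \<eta> \<le> 1 / 2\<close>.\<close>
  have c1: "1 \<le> c"
  proof -
    have "1 * 1 \<le> real m * (R1\<^sup>2 / (lam * \<gamma>))"
      using m0 cond by (intro mult_mono) auto
    then have "1 \<le> c\<^sup>2" by (simp add: c_def power_mult_distrib T2 mult.commute)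
    then show ?thesis using c0 power2_le_imp_le[of 1 c] by simp
  qed
  define \<rho> where "\<rho> = Min {1 / K, \<delta> / 6, \<delta>1 / 6}"
  have th: "\<theta> = 1 - \<rho>" by (simp add: theta \<rho>_def K_def c_def T_def mult.assoc)
  have rho: "\<rho> \<le> 1 / K" "\<rho> \<le> \<delta> / 6" "\<rho> \<le> \<delta>1 / 6" "0 < \<rho>"
    using K0 d d1 by (auto simp: \<rho>_def)
  show "0 < \<sigma>" using m0 c0 gam by (simp add: s)
  show "0 < \<eta>" using c0 lam by (simp add: e)
  show "0 < \<theta>" "\<theta> \<le> 1" using rho d by (auto simp: th)
  show "1 - \<delta> / 6 \<le> \<theta>" "1 - \<delta>1 / 6 \<le> \<theta>" using rho by (auto simp: th)
  have thK: "1 - 1 / K \<le> \<theta>" using rho by (simp add: th)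
  have "1 / K \<le> 1 / m" using Km m0 by (intro divide_left_mono) auto
  then show "1 - 1 / real m \<le> \<theta>" using thK by simp
  show "lam * \<eta> \<le> 1 / 2" using c1 lam by (simp add: e)
  show "1 / (2 * \<sigma>) = 2 * \<eta> * R1\<^sup>2"
  proof -
    have "c\<^sup>2 = R1\<^sup>2 * m / (lam * \<gamma>)" by (simp add: c_def power_mult_distrib T2)
    then have "R1\<^sup>2 = c\<^sup>2 * lam * \<gamma> / m" using m0 lam gam by (simp add: field_simps)
    then show ?thesis using m0 lam gam c0 by (simp add: e s power2_eq_square)
  qed
  show "1 / (2 * \<eta>) \<le> \<theta> * (1 / (2 * \<eta>) + lam / 4)"
  proof -
    \<comment> \<open>The 4 in \<open>K\<close> matches the \<open>lam / 4\<close> of the primal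
      weight, so that only \<open>lam * (real m - 1) / 4\<close> is left of the difference.\<close>
    have "c * lam * K \<le> (K - 1) * (c * lam + lam / 4)"
    proof -
      have "(K - 1) * (c * lam + lam / 4) - c * lam * K = lam * (real m - 1) / 4"
        by (simp add: K_def algebra_simps)
      moreover have "0 \<le> lam * (real m - 1) / 4" using lam m0 by simp
      ultimately show ?thesis by linarith
    qed
    then have "c * lam \<le> (1 - 1 / K) * (c * lam + lam / 4)" using K0 by (simp add: field_simps)
    also have "\<dots> \<le> \<theta> * (c * lam + lam / 4)"
      using thK c0 lam by (intro mult_right_mono) auto
    finally show ?thesis using c0 lam by (simp add: e)
  qed
  show "1 / (2 * \<sigma>) + \<gamma> / 2 * (1 - 1 / real m) \<le> \<theta> * (1 / (2 * \<sigma>) + \<gamma> / 2)"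
  proof -
    have s2: "1 / (2 * \<sigma>) = c * \<gamma> / m" using m0 c0 gam by (simp add: s)
    \<comment> \<open>Amounts to \<open>2 * c + m \<le> K\<close>.\<close>
    have "1 / K * (c * \<gamma> / m + \<gamma> / 2) \<le> \<gamma> / (2 * m)"
    proof -
      have "(2 * c + m) * \<gamma> \<le> K * \<gamma>" using c0 gam by (intro mult_right_mono) (auto simp: K_def)
      then have "(2 * c + m) * \<gamma> / (2 * m * K) \<le> K * \<gamma> / (2 * m * K)"
        using K0 by (intro divide_right_mono) auto
      then show ?thesis using K0 m0 by (simp add: field_simps)
    qed
    moreover have "\<gamma> / 2 * (1 - 1 / real m) = \<gamma> / 2 - \<gamma> / (2 * m)"
      by (simp add: right_diff_distrib)
    ultimately have "c * \<gamma> / m + \<gamma> / 2 * (1 - 1 / real m) \<le> (1 - 1 / K) * (c * \<gamma> / m + \<gamma> / 2)"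
      unfolding left_diff_distrib mult_1_left by linarith
    also have "\<dots> \<le> \<theta> * (c * \<gamma> / m + \<gamma> / 2)"
      using thK c0 gam m0 by (intro mult_right_mono) auto
    finally show ?thesis unfolding s2 .
  qed
  \<comment> \<open>The minimum of positive numbers is at least the reciprocal of the sum of their
    reciprocals.\<close>
  show "\<theta> \<le> 1 - 1 / (m + 4 * R1 * sqrt (m / (lam * \<gamma>)) + 6 / \<delta> + 6 / \<delta>1)"
  proof -
    define L where "L = K + 6 / \<delta> + 6 / \<delta>1"
    have "1 / L \<le> 1 / K" using K0 d d1 by (intro divide_left_mono) (auto simp: L_def add_pos_pos)
    moreover have "1 / L \<le> 1 / (6 / \<delta>)" using K0 d d1 by (intro divide_left_mono) (auto simp: L_def add_pos_pos)
    moreover have "1 / L \<le> 1 / (6 / \<delta>1)" using K0 d d1 by (intro divide_left_mono) (auto simp: L_def add_pos_pos)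
    ultimately have "1 / L \<le> \<rho>" by (simp add: \<rho>_def)
    then show ?thesis by (simp add: th L_def K_def c_def T_def mult.assoc)
  qed
qed

section \<open>Bounds of the constants R2 and R3 when 1/m is at most a multiple of the parameter of
  \<open>Q1\<close>\<close>

lemma sqrt_four_sum_le:
  assumes "x \<le> a\<^sup>2 + b\<^sup>2 + c\<^sup>2 + d\<^sup>2" "0 \<le> a" "0 \<le> b" "0 \<le> c" "0 \<le> d"
  shows "sqrt x \<le> a + b + c + (d :: real)"
proof -
  have "(a + b + c + d)\<^sup>2 = a\<^sup>2 + b\<^sup>2 + c\<^sup>2 + d\<^sup>2 + 2 * (a * b + a * c + a * d + b * c + b * d + c * d)"
    by (simp add: power2_eq_square algebra_simps)
  moreover have "0 \<le> a * b + a * c + a * d + b * c + b * d + c * d" using assms by simp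
  moreover note assms(1)
  ultimately have "x \<le> (a + b + c + d)\<^sup>2" by simp
  then have "sqrt x \<le> sqrt ((a + b + c + d)\<^sup>2)" by (rule real_sqrt_le_mono)
  then show ?thesis using assms by simp
qed

text \<open>By hypothesis \<open>w = 1 / (\<delta>1 * m)\<close> is at most \<open>c\<close>, so the
  terms containing \<open>\<delta>1\<close> are absorbed into \<open>U\<close>, the one with
  \<open>Rm\<close> after \<open>Rm_const_sq_le\<close>. The factor 8 is large enough because
  \<open>84 \<le> 4 / 3 * 64\<close>.\<close>

lemma R2_const_le:
  fixes A :: "nat \<Rightarrow> nat \<Rightarrow> real^'t^'d" and c :: real
  assumes m: "1 \<le> m" and n: "1 \<le> n" and d: "0 < \<delta>" "\<delta> \<le> 1" and d1: "0 < \<delta>1" "\<delta>1 \<le> 1"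
    and c: "0 < c" "1 / m \<le> c * \<delta>1"
  defines "R \<equiv> R_const m n A" and "Rb \<equiv> Rbar_const m n A" and "Rm \<equiv> Rm_const m n A"
  shows "R2_const m n A \<delta> \<delta>1 \<le> 8 * (1 + c) * (R + Rm / sqrt n + sqrt (1 - \<delta>) * Rb / \<delta> + sqrt (1 - \<delta>) * Rm / sqrt \<delta>)"
proof -
  have m0: "0 < m" and n0: "0 < n" using m n by auto
  have nn: "0 \<le> R" "0 \<le> Rb" "0 \<le> Rm"
    unfolding R_def Rb_def Rm_def using R_const_nonneg Rbar_const_nonneg[OF n0] Rm_const_nonneg[OF m0 n0] by auto
  define U where "U = Rb\<^sup>2 / \<delta>\<^sup>2"
  have U: "0 \<le> U" by (simp add: U_def)
  define w where "w = 1 / (\<delta>1 * m)"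
  have w: "0 \<le> w" "w \<le> c"
    using c d1 m0 by (simp_all add: w_def field_simps)
  have t3: "84 * (1 - \<delta>1) * Rb\<^sup>2 / (\<delta>\<^sup>2 * \<delta>1\<^sup>2 * (real m)\<^sup>2) \<le> 84 * c\<^sup>2 * U"
  proof -
    have "84 * (1 - \<delta>1) * Rb\<^sup>2 / (\<delta>\<^sup>2 * \<delta>1\<^sup>2 * (real m)\<^sup>2) = 84 * (1 - \<delta>1) * w\<^sup>2 * U"
      by (simp add: w_def U_def power_divide power_mult_distrib)
    also have "\<dots> \<le> 84 * 1 * c\<^sup>2 * U"
      using w d1 U c by (intro mult_right_mono mult_mono power_mono) auto
    finally show ?thesis by simp
  qed
  have t4: "42 * Rm\<^sup>2 / (\<delta>\<^sup>2 * \<delta>1 * (real m)\<^sup>2) \<le> 42 * c * U"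
  proof -
    have "42 * Rm\<^sup>2 / (\<delta>\<^sup>2 * \<delta>1 * (real m)\<^sup>2) = 42 * w * (Rm\<^sup>2 / m) / \<delta>\<^sup>2"
      by (simp add: w_def power2_eq_square)
    also have "\<dots> \<le> 42 * w * Rb\<^sup>2 / \<delta>\<^sup>2"
      using Rm_const_sq_le[OF m0 n0, of A] m0 w
      by (intro divide_right_mono mult_left_mono) (auto simp: Rm_def Rb_def field_simps)
    also have "\<dots> = 42 * w * U" by (simp add: U_def)
    also have "\<dots> \<le> 42 * c * U" using w U by (intro mult_right_mono) auto
    finally show ?thesis .
  qed
  have "R2_const m n A \<delta> \<delta>1 = sqrt (2 * R\<^sup>2 + 2 * Rm\<^sup>2 / n + 3 * (1 - \<delta>) / 4 *
      (14 * Rb\<^sup>2 / \<delta>\<^sup>2 + 7 * Rm\<^sup>2 / (2 * \<delta>) + 84 * (1 - \<delta>1) * Rb\<^sup>2 / (\<delta>\<^sup>2 * \<delta>1\<^sup>2 * (real m)\<^sup>2)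
           + 42 * Rm\<^sup>2 / (\<delta>\<^sup>2 * \<delta>1 * (real m)\<^sup>2)))"
    by (simp add: R2_const_def Let_def R_def Rb_def Rm_def)
  also have "\<dots> \<le> 8 * (1 + c) * R + 8 * (1 + c) * (Rm / sqrt n) + 8 * (1 + c) * (sqrt (1 - \<delta>) * Rb / \<delta>)
    + 8 * (1 + c) * (sqrt (1 - \<delta>) * Rm / sqrt \<delta>)"
  proof (rule sqrt_four_sum_le)
    have big: "2 \<le> (8 * (1 + c))\<^sup>2" "21 / 8 \<le> (8 * (1 + c))\<^sup>2"
      using power_mono[of 8 "8 * (1 + c)" 2] c by auto
    have k1: "2 * R\<^sup>2 \<le> (8 * (1 + c))\<^sup>2 * R\<^sup>2" using big by (intro mult_right_mono) auto
    have k2: "2 * Rm\<^sup>2 / n \<le> (8 * (1 + c))\<^sup>2 * (Rm\<^sup>2 / n)"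
      using mult_right_mono[OF big(1), of "Rm\<^sup>2 / n"] by simp
    have k4: "3 * (1 - \<delta>) / 4 * (7 * Rm\<^sup>2 / (2 * \<delta>)) \<le> (8 * (1 + c))\<^sup>2 * ((1 - \<delta>) * Rm\<^sup>2 / \<delta>)"
    proof -
      have "3 * (1 - \<delta>) / 4 * (7 * Rm\<^sup>2 / (2 * \<delta>)) = 21 / 8 * ((1 - \<delta>) * Rm\<^sup>2 / \<delta>)" by simp
      also have "\<dots> \<le> (8 * (1 + c))\<^sup>2 * ((1 - \<delta>) * Rm\<^sup>2 / \<delta>)"
        using d by (intro mult_right_mono big) auto
      finally show ?thesis .
    qed
    have k3: "3 * (1 - \<delta>) / 4 * (14 * Rb\<^sup>2 / \<delta>\<^sup>2 + 84 * (1 - \<delta>1) * Rb\<^sup>2 / (\<delta>\<^sup>2 * \<delta>1\<^sup>2 * (real m)\<^sup>2)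
           + 42 * Rm\<^sup>2 / (\<delta>\<^sup>2 * \<delta>1 * (real m)\<^sup>2)) \<le> (8 * (1 + c))\<^sup>2 * ((1 - \<delta>) * U)"
    proof -
      have "14 * Rb\<^sup>2 / \<delta>\<^sup>2 + 84 * (1 - \<delta>1) * Rb\<^sup>2 / (\<delta>\<^sup>2 * \<delta>1\<^sup>2 * (real m)\<^sup>2) + 42 * Rm\<^sup>2 / (\<delta>\<^sup>2 * \<delta>1 * (real m)\<^sup>2)
        \<le> (14 + 84 * c\<^sup>2 + 42 * c) * U"
        using t3 t4 by (simp add: U_def algebra_simps)
      also have "\<dots> \<le> 4 / 3 * (8 * (1 + c))\<^sup>2 * U"
      proof (rule mult_right_mono[OF _ U])
        have "4 / 3 * (8 * (1 + c))\<^sup>2 = 256 / 3 + 512 / 3 * c + 256 / 3 * c\<^sup>2"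
          by (simp add: power2_eq_square algebra_simps)
        moreover have "84 * c\<^sup>2 \<le> 256 / 3 * c\<^sup>2" by simp
        ultimately show "14 + 84 * c\<^sup>2 + 42 * c \<le> 4 / 3 * (8 * (1 + c))\<^sup>2" using c by linarith
      qed
      finally have "3 * (1 - \<delta>) / 4 * (14 * Rb\<^sup>2 / \<delta>\<^sup>2 + 84 * (1 - \<delta>1) * Rb\<^sup>2 / (\<delta>\<^sup>2 * \<delta>1\<^sup>2 * (real m)\<^sup>2)
           + 42 * Rm\<^sup>2 / (\<delta>\<^sup>2 * \<delta>1 * (real m)\<^sup>2)) \<le> 3 * (1 - \<delta>) / 4 * (4 / 3 * (8 * (1 + c))\<^sup>2 * U)"
        using d by (intro mult_left_mono) auto
      moreover have "3 * (1 - \<delta>) / 4 * (4 / 3 * Y * U) = Y * ((1 - \<delta>) * U)" for Y :: real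
        by (simp add: field_simps)
      ultimately show ?thesis by (simp only:)
    qed
    have e: "(8 * (1 + c) * (Rm / sqrt n))\<^sup>2 = (8 * (1 + c))\<^sup>2 * (Rm\<^sup>2 / n)"
      "(8 * (1 + c) * (sqrt (1 - \<delta>) * Rb / \<delta>))\<^sup>2 = (8 * (1 + c))\<^sup>2 * ((1 - \<delta>) * U)"
      "(8 * (1 + c) * (sqrt (1 - \<delta>) * Rm / sqrt \<delta>))\<^sup>2 = (8 * (1 + c))\<^sup>2 * ((1 - \<delta>) * Rm\<^sup>2 / \<delta>)"
      using d by (simp_all only: power_mult_distrib power_divide real_sqrt_pow2 U_def of_nat_0_le_iff diff_ge_0_iff_ge less_imp_le)
        simp_all
    show "2 * R\<^sup>2 + 2 * Rm\<^sup>2 / n + 3 * (1 - \<delta>) / 4 *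
      (14 * Rb\<^sup>2 / \<delta>\<^sup>2 + 7 * Rm\<^sup>2 / (2 * \<delta>) + 84 * (1 - \<delta>1) * Rb\<^sup>2 / (\<delta>\<^sup>2 * \<delta>1\<^sup>2 * (real m)\<^sup>2)
           + 42 * Rm\<^sup>2 / (\<delta>\<^sup>2 * \<delta>1 * (real m)\<^sup>2))
      \<le> (8 * (1 + c) * R)\<^sup>2 + (8 * (1 + c) * (Rm / sqrt n))\<^sup>2 + (8 * (1 + c) * (sqrt (1 - \<delta>) * Rb / \<delta>))\<^sup>2
        + (8 * (1 + c) * (sqrt (1 - \<delta>) * Rm / sqrt \<delta>))\<^sup>2"
      using k1 k2 k3 k4 unfolding e power_mult_distrib[of "8 * (1 + c)" R] distrib_left[of "3 * (1 - \<delta>) / 4"] by linarith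
  qed (use nn c d in simp_all)
  also have "\<dots> = 8 * (1 + c) * (R + Rm / sqrt n + sqrt (1 - \<delta>) * Rb / \<delta> + sqrt (1 - \<delta>) * Rm / sqrt \<delta>)"
    by (simp only: distrib_left)
  finally show ?thesis .
qed

text \<open>The terms in \<open>Rbar\<close>, and the one in \<open>Rm\<close> that contains
  \<open>\<delta>1\<close>, are reduced to \<open>R\<close> by \<open>Rb_n\<close> and
  \<open>Rm_mn\<close>. The constants \<open>14 = 2 + 12\<close> and
  \<open>444 / 5 = 12 / 5 + 432 / 5\<close> collect them.\<close>

lemma R3_const_le:
  fixes A :: "nat \<Rightarrow> nat \<Rightarrow> real^'t^'d" and c :: real
  assumes m: "1 \<le> m" and n: "1 \<le> n" and d: "0 < \<delta>" "\<delta> \<le> 1" and d1: "0 < \<delta>1" "\<delta>1 \<le> 1"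
    and c: "0 < c" "1 / m \<le> c * \<delta>1"
  defines "R \<equiv> R_const m n A" and "Rb \<equiv> Rbar_const m n A" and "Rm \<equiv> Rm_const m n A"
  shows "R3_const m n A \<delta> \<delta>1 \<le> 24 * (1 + c) * (R + Rm / sqrt n + sqrt (1 - \<delta>) * R / \<delta> + sqrt (1 - \<delta>) * Rm / sqrt (\<delta> * n))"
proof -
  have m0: "0 < m" and n0: "0 < n" using m n by auto
  have nn: "0 \<le> R" "0 \<le> Rb" "0 \<le> Rm"
    unfolding R_def Rb_def Rm_def using R_const_nonneg Rbar_const_nonneg[OF n0] Rm_const_nonneg[OF m0 n0] by auto
  have Rb_n: "Rb\<^sup>2 / n \<le> R\<^sup>2"
    using Rbar_const_sq_le[OF m0 n0, of A] n0 by (simp add: Rb_def R_def field_simps)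
  have Rm_mn: "Rm\<^sup>2 / (m * n) \<le> R\<^sup>2"
  proof -
    have "Rm\<^sup>2 \<le> m * Rb\<^sup>2" using Rm_const_sq_le[OF m0 n0, of A] by (simp add: Rm_def Rb_def)
    also have "\<dots> \<le> m * (n * R\<^sup>2)"
      using Rbar_const_sq_le[OF m0 n0, of A] by (intro mult_left_mono) (auto simp: Rb_def R_def)
    finally show ?thesis using m0 n0 by (simp add: field_simps)
  qed
  define U where "U = R\<^sup>2 / \<delta>\<^sup>2"
  have U: "0 \<le> U" by (simp add: U_def)
  define w where "w = 1 / (\<delta>1 * m)"
  have w: "0 \<le> w" "w \<le> c"
    using c d1 m0 by (simp_all add: w_def field_simps)
  have w2: "w\<^sup>2 \<le> c\<^sup>2" using w by (intro power_mono) auto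
  have t1: "12 * (1 - \<delta>) * Rb\<^sup>2 / (\<delta>\<^sup>2 * n) \<le> 12 * U"
  proof -
    have "12 * (1 - \<delta>) * Rb\<^sup>2 / (\<delta>\<^sup>2 * n) = 12 * (1 - \<delta>) * (Rb\<^sup>2 / n) / \<delta>\<^sup>2" by simp
    also have "\<dots> \<le> 12 * 1 * R\<^sup>2 / \<delta>\<^sup>2"
      using d Rb_n by (intro divide_right_mono mult_mono) auto
    finally show ?thesis by (simp add: U_def)
  qed
  have t2: "12 * R\<^sup>2 / (5 * \<delta>\<^sup>2 * \<delta>1\<^sup>2 * (real m)\<^sup>2) \<le> 12 / 5 * c\<^sup>2 * U"
  proof -
    have "12 * R\<^sup>2 / (5 * \<delta>\<^sup>2 * \<delta>1\<^sup>2 * (real m)\<^sup>2) = 12 / 5 * w\<^sup>2 * U"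
      by (simp add: w_def U_def power_divide power_mult_distrib)
    also have "\<dots> \<le> 12 / 5 * c\<^sup>2 * U" using w2 U by (intro mult_right_mono) auto
    finally show ?thesis .
  qed
  have t3: "228 * Rm\<^sup>2 / (5 * \<delta>\<^sup>2 * \<delta>1 * (real m)\<^sup>2 * n) \<le> 228 / 5 * c * U"
  proof -
    have "228 * Rm\<^sup>2 / (5 * \<delta>\<^sup>2 * \<delta>1 * (real m)\<^sup>2 * n) = 228 / 5 * w * (Rm\<^sup>2 / (m * n)) / \<delta>\<^sup>2"
      by (simp add: w_def power2_eq_square)
    also have "\<dots> \<le> 228 / 5 * c * R\<^sup>2 / \<delta>\<^sup>2"
      using w Rm_mn by (intro divide_right_mono mult_mono) auto
    finally show ?thesis by (simp add: U_def)
  qed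
  have t4: "432 * (1 - \<delta>1) * Rb\<^sup>2 / (5 * \<delta>\<^sup>2 * \<delta>1\<^sup>2 * (real m)\<^sup>2 * n) \<le> 432 / 5 * c\<^sup>2 * U"
  proof -
    have "432 * (1 - \<delta>1) * Rb\<^sup>2 / (5 * \<delta>\<^sup>2 * \<delta>1\<^sup>2 * (real m)\<^sup>2 * n) = 432 / 5 * (1 - \<delta>1) * w\<^sup>2 * (Rb\<^sup>2 / n) / \<delta>\<^sup>2"
      by (simp add: w_def power_divide power_mult_distrib)
    also have "\<dots> \<le> 432 / 5 * 1 * c\<^sup>2 * R\<^sup>2 / \<delta>\<^sup>2"
      using w2 d1 Rb_n by (intro divide_right_mono mult_mono) auto
    finally show ?thesis by (simp add: U_def)
  qed
  have "R3_const m n A \<delta> \<delta>1 = sqrt (2 * R\<^sup>2 + 2 * Rm\<^sup>2 / n + 21 * (1 - \<delta>) / 4 *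
      (2 * R\<^sup>2 / \<delta>\<^sup>2 + 11 * Rm\<^sup>2 / (2 * \<delta> * n) + 12 * (1 - \<delta>) * Rb\<^sup>2 / (\<delta>\<^sup>2 * n)
           + 12 * R\<^sup>2 / (5 * \<delta>\<^sup>2 * \<delta>1\<^sup>2 * (real m)\<^sup>2)
           + 228 * Rm\<^sup>2 / (5 * \<delta>\<^sup>2 * \<delta>1 * (real m)\<^sup>2 * n)
           + 432 * (1 - \<delta>1) * Rb\<^sup>2 / (5 * \<delta>\<^sup>2 * \<delta>1\<^sup>2 * (real m)\<^sup>2 * n)))"
    by (simp add: R3_const_def Let_def R_def Rb_def Rm_def)
  also have "\<dots> \<le> 24 * (1 + c) * R + 24 * (1 + c) * (Rm / sqrt n) + 24 * (1 + c) * (sqrt (1 - \<delta>) * R / \<delta>)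
    + 24 * (1 + c) * (sqrt (1 - \<delta>) * Rm / sqrt (\<delta> * n))"
  proof (rule sqrt_four_sum_le)
    have big: "2 \<le> (24 * (1 + c))\<^sup>2" "231 / 8 \<le> (24 * (1 + c))\<^sup>2"
      using power_mono[of 24 "24 * (1 + c)" 2] c by auto
    have k1: "2 * R\<^sup>2 \<le> (24 * (1 + c))\<^sup>2 * R\<^sup>2" using big by (intro mult_right_mono) auto
    have k2: "2 * Rm\<^sup>2 / n \<le> (24 * (1 + c))\<^sup>2 * (Rm\<^sup>2 / n)"
      using mult_right_mono[OF big(1), of "Rm\<^sup>2 / n"] by simp
    have k4: "21 * (1 - \<delta>) / 4 * (11 * Rm\<^sup>2 / (2 * \<delta> * n)) \<le> (24 * (1 + c))\<^sup>2 * ((1 - \<delta>) * Rm\<^sup>2 / (\<delta> * n))"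
    proof -
      have "21 * (1 - \<delta>) / 4 * (11 * Rm\<^sup>2 / (2 * \<delta> * n)) = 231 / 8 * ((1 - \<delta>) * Rm\<^sup>2 / (\<delta> * n))" by simp
      also have "\<dots> \<le> (24 * (1 + c))\<^sup>2 * ((1 - \<delta>) * Rm\<^sup>2 / (\<delta> * n))"
        using d by (intro mult_right_mono big) auto
      finally show ?thesis .
    qed
    define P where "P = 2 * R\<^sup>2 / \<delta>\<^sup>2 + 12 * (1 - \<delta>) * Rb\<^sup>2 / (\<delta>\<^sup>2 * n)
           + 12 * R\<^sup>2 / (5 * \<delta>\<^sup>2 * \<delta>1\<^sup>2 * (real m)\<^sup>2)
           + 228 * Rm\<^sup>2 / (5 * \<delta>\<^sup>2 * \<delta>1 * (real m)\<^sup>2 * n)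
           + 432 * (1 - \<delta>1) * Rb\<^sup>2 / (5 * \<delta>\<^sup>2 * \<delta>1\<^sup>2 * (real m)\<^sup>2 * n)"
    have k3: "21 * (1 - \<delta>) / 4 * P \<le> (24 * (1 + c))\<^sup>2 * ((1 - \<delta>) * U)"
    proof -
      have "P \<le> (14 + 444 / 5 * c\<^sup>2 + 228 / 5 * c) * U"
        using t1 t2 t3 t4 unfolding P_def by (simp add: U_def algebra_simps)
      also have "\<dots> \<le> 4 / 21 * (24 * (1 + c))\<^sup>2 * U"
      proof (rule mult_right_mono[OF _ U])
        have "4 / 21 * (24 * (1 + c))\<^sup>2 = 768 / 7 + 1536 / 7 * c + 768 / 7 * c\<^sup>2"
          by (simp add: power2_eq_square algebra_simps)
        moreover have "444 / 5 * c\<^sup>2 \<le> 768 / 7 * c\<^sup>2" by simp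
        ultimately show "14 + 444 / 5 * c\<^sup>2 + 228 / 5 * c \<le> 4 / 21 * (24 * (1 + c))\<^sup>2" using c by linarith
      qed
      finally have "21 * (1 - \<delta>) / 4 * P \<le> 21 * (1 - \<delta>) / 4 * (4 / 21 * (24 * (1 + c))\<^sup>2 * U)"
        using d by (intro mult_left_mono) auto
      moreover have "21 * (1 - \<delta>) / 4 * (4 / 21 * Y * U) = Y * ((1 - \<delta>) * U)" for Y :: real
        by (simp add: field_simps)
      ultimately show ?thesis by (simp only:)
    qed
    have e: "(24 * (1 + c) * (Rm / sqrt n))\<^sup>2 = (24 * (1 + c))\<^sup>2 * (Rm\<^sup>2 / n)"
      "(24 * (1 + c) * (sqrt (1 - \<delta>) * R / \<delta>))\<^sup>2 = (24 * (1 + c))\<^sup>2 * ((1 - \<delta>) * U)"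
      "(24 * (1 + c) * (sqrt (1 - \<delta>) * Rm / sqrt (\<delta> * n)))\<^sup>2 = (24 * (1 + c))\<^sup>2 * ((1 - \<delta>) * Rm\<^sup>2 / (\<delta> * n))"
      using d by (simp_all add: power_mult_distrib power_divide U_def)
    have "2 * R\<^sup>2 + 2 * Rm\<^sup>2 / n + 21 * (1 - \<delta>) / 4 * (P + 11 * Rm\<^sup>2 / (2 * \<delta> * n))
      \<le> (24 * (1 + c) * R)\<^sup>2 + (24 * (1 + c) * (Rm / sqrt n))\<^sup>2 + (24 * (1 + c) * (sqrt (1 - \<delta>) * R / \<delta>))\<^sup>2
        + (24 * (1 + c) * (sqrt (1 - \<delta>) * Rm / sqrt (\<delta> * n)))\<^sup>2"
      using k1 k2 k3 k4 unfolding e power_mult_distrib[of "24 * (1 + c)" R] distrib_left[of "21 * (1 - \<delta>) / 4"] by linarith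
    then show "2 * R\<^sup>2 + 2 * Rm\<^sup>2 / n + 21 * (1 - \<delta>) / 4 *
      (2 * R\<^sup>2 / \<delta>\<^sup>2 + 11 * Rm\<^sup>2 / (2 * \<delta> * n) + 12 * (1 - \<delta>) * Rb\<^sup>2 / (\<delta>\<^sup>2 * n)
           + 12 * R\<^sup>2 / (5 * \<delta>\<^sup>2 * \<delta>1\<^sup>2 * (real m)\<^sup>2)
           + 228 * Rm\<^sup>2 / (5 * \<delta>\<^sup>2 * \<delta>1 * (real m)\<^sup>2 * n)
           + 432 * (1 - \<delta>1) * Rb\<^sup>2 / (5 * \<delta>\<^sup>2 * \<delta>1\<^sup>2 * (real m)\<^sup>2 * n))
      \<le> (24 * (1 + c) * R)\<^sup>2 + (24 * (1 + c) * (Rm / sqrt n))\<^sup>2 + (24 * (1 + c) * (sqrt (1 - \<delta>) * R / \<delta>))\<^sup>2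
        + (24 * (1 + c) * (sqrt (1 - \<delta>) * Rm / sqrt (\<delta> * n)))\<^sup>2"
      unfolding P_def by (simp only: add_ac)
  qed (use nn c d in simp_all)
  also have "\<dots> = 24 * (1 + c) * (R + Rm / sqrt n + sqrt (1 - \<delta>) * R / \<delta> + sqrt (1 - \<delta>) * Rm / sqrt (\<delta> * n))"
    by (simp only: distrib_left)
  finally show ?thesis .
qed

section \<open>The decay bounds and the complexity statements\<close>

context saddle_problem
begin

text \<open>Applied to a starting point outside the domain of a conjugate: the dual gap is infinite
  there, and with it the right side of the claimed bound.\<close>

lemma lyapunov_infinite:
  assumes "\<not> dual_finite (st_y s)"
  shows "Phi2 m n A \<phi> g lam \<gamma> \<delta> \<delta>1 \<sigma> \<eta> xs Ys s = \<infinity>"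
    and "Psi2 m n A \<phi> g lam \<gamma> \<delta> \<delta>1 \<sigma> \<eta> xs Ys s = \<infinity>"
proof -
  have "ereal (real m) * (saddle_fun m n A \<phi> g xs Ys - saddle_fun m n A \<phi> g xs (st_y s)) = \<infinity>"
    using m unfolding saddle_fun_infinite[OF assms] saddle_fun_xs_Ys by simp
  moreover obtain c where "saddle_fun m n A \<phi> g (st_x s) Ys - saddle_fun m n A \<phi> g xs Ys = ereal c"
    unfolding saddle_fun_finite[OF dual_finite_Ys] by simp
  ultimately show "Phi2 m n A \<phi> g lam \<gamma> \<delta> \<delta>1 \<sigma> \<eta> xs Ys s = \<infinity>"
    "Psi2 m n A \<phi> g lam \<gamma> \<delta> \<delta>1 \<sigma> \<eta> xs Ys s = \<infinity>"
    by (simp_all add: Phi2_def Psi2_def Let_def)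
qed

end

context ecspdc_process
begin

lemma R_const_le_of_budget:
  assumes "R1\<^sup>2 = 2 * (R_const m n A)\<^sup>2 + 2 * (Rm_const m n A)\<^sup>2 / n + c" "0 \<le> c"
  shows "2 * (R_const m n A)\<^sup>2 \<le> R1\<^sup>2"
  unfolding assms(1) using assms(2) by simp

lemma Phi2_decay:
  assumes sg: "1 / (2 * \<sigma>) = 2 * \<eta> * R1\<^sup>2" and R1: "R1 = R2_const m n A \<delta> \<delta>1" "0 < R1"
    and D0: "cross s0 = D0" and eps: "\<theta> ^ k \<le> \<epsilon>"
  shows "ereal_expectation M (\<lambda>\<omega>. Phi2 m n A \<phi> g lam \<gamma> \<delta> \<delta>1 \<sigma> \<eta> xs Ys (proc k \<omega>))
    \<le> ereal \<epsilon> * (Phi2 m n A \<phi> g lam \<gamma> \<delta> \<delta>1 \<sigma> \<eta> xs Ys s0 + ereal D0)"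
proof -
  define c where "c = 3 * (1 - \<delta>) / 4 *
          (14 * (Rbar_const m n A)\<^sup>2 / \<delta>\<^sup>2 + 7 * (Rm_const m n A)\<^sup>2 / (2 * \<delta>)
           + 84 * (1 - \<delta>1) * (Rbar_const m n A)\<^sup>2 / (\<delta>\<^sup>2 * \<delta>1\<^sup>2 * (real m)\<^sup>2)
           + 42 * (Rm_const m n A)\<^sup>2 / (\<delta>\<^sup>2 * \<delta>1 * (real m)\<^sup>2))"
  have c0: "0 \<le> c" unfolding c_def using d d1 by (intro mult_nonneg_nonneg add_nonneg_nonneg divide_nonneg_nonneg) auto
  then have R1sq: "R1\<^sup>2 = 2 * (R_const m n A)\<^sup>2 + 2 * (Rm_const m n A)\<^sup>2 / n + c"
    unfolding R1 R2_const_def Let_def c_def by (subst real_sqrt_pow2) auto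
  have en: "lyap_i s = energy 0 (3 * \<kappa> / \<delta>) 0 (42 * (1 - \<delta>) * \<kappa> / (\<delta>\<^sup>2 * \<delta>1)) s" for s
    by (simp add: lyap_i_def energy_def)
  show ?thesis
  proof (rule ereal_expectation_decay[OF _ _ _ _ D0 eps])
    fix s assume "consistent s"
    then show "Phi2 m n A \<phi> g lam \<gamma> \<delta> \<delta>1 \<sigma> \<eta> xs Ys s
        = ereal (energy 0 (3 * \<kappa> / \<delta>) 0 (42 * (1 - \<delta>) * \<kappa> / (\<delta>\<^sup>2 * \<delta>1)) s - cross s)"
      "0 \<le> energy 0 (3 * \<kappa> / \<delta>) 0 (42 * (1 - \<delta>) * \<kappa> / (\<delta>\<^sup>2 * \<delta>1)) s - cross s"
      "0 \<le> cross s"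
      unfolding en[symmetric]
      by (rule Phi2_eq lyap_full_minus_cross_nonneg(1) cross_nonneg[OF _ sg R_const_le_of_budget[OF R1sq c0]])+
    show "\<exists>B q. (\<forall>r\<in>space law. energy 0 (3 * \<kappa> / \<delta>) 0 (42 * (1 - \<delta>) * \<kappa> / (\<delta>\<^sup>2 * \<delta>1)) (stepr s r) \<le> B r)
      \<and> has_bochner_integral law B q \<and> q \<le> \<theta> * energy 0 (3 * \<kappa> / \<delta>) 0 (42 * (1 - \<delta>) * \<kappa> / (\<delta>\<^sup>2 * \<delta>1)) s"
      unfolding en[symmetric] by (rule lyap_i_step[OF \<open>consistent s\<close> sg R1sq[unfolded c_def]])
  qed
qed

lemma Psi2_decay:
  assumes sg: "1 / (2 * \<sigma>) = 2 * \<eta> * R1\<^sup>2" and R1: "R1 = R3_const m n A \<delta> \<delta>1" "0 < R1"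
    and unb: "\<And>x. (\<integral>s. Q s x \<partial>S) = \<delta> *\<^sub>R x" and unb1: "\<And>x. (\<integral>s. Q1 s x \<partial>S1) = \<delta>1 *\<^sub>R x"
    and D0: "cross s0 = D0" and eps: "\<theta> ^ k \<le> \<epsilon>"
  shows "ereal_expectation M (\<lambda>\<omega>. Psi2 m n A \<phi> g lam \<gamma> \<delta> \<delta>1 \<sigma> \<eta> xs Ys (proc k \<omega>))
    \<le> ereal \<epsilon> * (Psi2 m n A \<phi> g lam \<gamma> \<delta> \<delta>1 \<sigma> \<eta> xs Ys s0 + ereal D0)"
proof -
  define c where "c = 21 * (1 - \<delta>) / 4 *
          (2 * (R_const m n A)\<^sup>2 / \<delta>\<^sup>2 + 11 * (Rm_const m n A)\<^sup>2 / (2 * \<delta> * n) + 12 * (1 - \<delta>) * (Rbar_const m n A)\<^sup>2 / (\<delta>\<^sup>2 * n)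
           + 12 * (R_const m n A)\<^sup>2 / (5 * \<delta>\<^sup>2 * \<delta>1\<^sup>2 * (real m)\<^sup>2)
           + 228 * (Rm_const m n A)\<^sup>2 / (5 * \<delta>\<^sup>2 * \<delta>1 * (real m)\<^sup>2 * n)
           + 432 * (1 - \<delta>1) * (Rbar_const m n A)\<^sup>2 / (5 * \<delta>\<^sup>2 * \<delta>1\<^sup>2 * (real m)\<^sup>2 * n))"
  have c0: "0 \<le> c" unfolding c_def using d d1 by (intro mult_nonneg_nonneg add_nonneg_nonneg divide_nonneg_nonneg) auto
  then have R1sq: "R1\<^sup>2 = 2 * (R_const m n A)\<^sup>2 + 2 * (Rm_const m n A)\<^sup>2 / n + c"
    unfolding R1 R3_const_def Let_def c_def by (subst real_sqrt_pow2) auto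
  define E where "E = energy (3 * \<kappa> / \<delta>) (21 * (1 - \<delta>) * \<kappa> / (\<delta> * real n))
    (84 * (1 - \<delta>) * \<kappa> / (5 * \<delta>\<^sup>2 * \<delta>1)) (1512 * (1 - \<delta>) * \<kappa> / (5 * \<delta>\<^sup>2 * \<delta>1 * real n))"
  have en: "lyap_ii s = E s" for s
    by (simp add: lyap_ii_def energy_def E_def)
  show ?thesis
  proof (rule ereal_expectation_decay[where ?a1.0 = "3 * \<kappa> / \<delta>"
        and ?a2.0 = "21 * (1 - \<delta>) * \<kappa> / (\<delta> * real n)"
        and ?a3.0 = "84 * (1 - \<delta>) * \<kappa> / (5 * \<delta>\<^sup>2 * \<delta>1)"
        and ?a4.0 = "1512 * (1 - \<delta>) * \<kappa> / (5 * \<delta>\<^sup>2 * \<delta>1 * real n)",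
        folded E_def, OF _ _ _ _ D0 eps])
    fix s assume "consistent s"
    then show "Psi2 m n A \<phi> g lam \<gamma> \<delta> \<delta>1 \<sigma> \<eta> xs Ys s = ereal (E s - cross s)"
      "0 \<le> E s - cross s" "0 \<le> cross s"
      unfolding en[symmetric]
      by (rule Psi2_eq lyap_full_minus_cross_nonneg(2) cross_nonneg[OF _ sg R_const_le_of_budget[OF R1sq c0]])+
    show "\<exists>B q. (\<forall>r\<in>space law. E (stepr s r) \<le> B r) \<and> has_bochner_integral law B q \<and> q \<le> \<theta> * E s"
      unfolding en[symmetric] by (rule lyap_ii_step[OF \<open>consistent s\<close> sg unb unb1 R1sq[unfolded c_def]])
  qed
qed

end

theorem theoremC7:
  fixes m n :: nat
    and A :: "nat \<Rightarrow> nat \<Rightarrow> real^'t^'d"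
    and \<phi> :: "nat \<Rightarrow> nat \<Rightarrow> real^'t \<Rightarrow> real"
    and g :: "real^'d \<Rightarrow> real"
    and lam \<gamma> \<delta> \<delta>1 R1 \<sigma> \<eta> \<theta> R Rb Rm R2 R3 :: real
    and S :: "'s measure" and S1 :: "'s1 measure"
    and Q :: "'s \<Rightarrow> real^'d \<Rightarrow> real^'d" and Q1 :: "'s1 \<Rightarrow> real^'d \<Rightarrow> real^'d"
    and M :: "'w measure"
    and I :: "nat \<Rightarrow> nat \<Rightarrow> 'w \<Rightarrow> nat"
    and \<xi> :: "nat \<Rightarrow> nat \<Rightarrow> 'w \<Rightarrow> 's" and \<xi>1 :: "nat \<Rightarrow> nat \<Rightarrow> 'w \<Rightarrow> 's1"
    and x0 xs :: "real^'d" and y0 Ys :: "nat \<Rightarrow> nat \<Rightarrow> real^'t" and h0 :: "nat \<Rightarrow> real^'d"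
    and s0 :: "(real^'d, real^'t) ecspdc_state"
    and s :: "nat \<Rightarrow> 'w \<Rightarrow> (real^'d, real^'t) ecspdc_state"
    and \<Phi> \<Psi> :: "(real^'d, real^'t) ecspdc_state \<Rightarrow> ereal"
    and D0 :: real
  assumes "m \<ge> 1" and "n \<ge> 1" and "lam > 0" and "\<gamma> > 0"
    and "\<And>i \<tau>. i < m \<Longrightarrow> \<tau> < n \<Longrightarrow> convex_on UNIV (\<phi> i \<tau>)"
    and "\<And>i \<tau>. i < m \<Longrightarrow> \<tau> < n \<Longrightarrow> L_smooth (1 / \<gamma>) (\<phi> i \<tau>)"
    and "strongly_convex lam g"
    and "minmax_solution (saddle_fun m n A \<phi> g) xs Ys"
    and "0 < \<delta>" and "\<delta> \<le> 1" and "0 < \<delta>1" and "\<delta>1 \<le> 1"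
    and "contraction_compressor S Q \<delta>"
    and "contraction_compressor S1 Q1 \<delta>1"
    and "ecspdc_randomness M m n S S1 I \<xi> \<xi>1"
    and "R = R_const m n A" and "Rb = Rbar_const m n A" and "Rm = Rm_const m n A"
    and "R2 = R2_const m n A \<delta> \<delta>1" and "R3 = R3_const m n A \<delta> \<delta>1"
    and "R1 > 0"
    and "\<sigma> = 1 / (2 * R1) * sqrt (m * lam / \<gamma>)"
    and "\<eta> = 1 / (2 * R1) * sqrt (\<gamma> / (m * lam))"
    and "\<theta> = 1 - Min {1 / (m + 4 * R1 * sqrt (m / (lam * \<gamma>))), \<delta> / 6, \<delta>1 / 6}"
    and "s0 = ecspdc_init m n A x0 y0 h0"
    and "s = ecspdc m n A \<phi> g \<sigma> \<eta> \<theta> Q Q1 I \<xi> \<xi>1 s0"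
    and "\<Phi> = Phi2 m n A \<phi> g lam \<gamma> \<delta> \<delta>1 \<sigma> \<eta> xs Ys"
    and "\<Psi> = Psi2 m n A \<phi> g lam \<gamma> \<delta> \<delta>1 \<sigma> \<eta> xs Ys"
    and "D0 = 1 / (4 * \<sigma> * n) * dual_dist_sq m n y0 Ys"
  shows
    "(R1 = R2 \<and> R2\<^sup>2 / (lam * \<gamma>) \<ge> 1 \<longrightarrow>
        (\<forall>\<epsilon> k. 0 < \<epsilon> \<and> \<epsilon> < 1 \<and>
           real k \<ge> bigO_const * ((1 / \<delta> + 1 / \<delta>1 + m + R2 * sqrt (m / (lam * \<gamma>))) * ln (1 / \<epsilon>))
           \<longrightarrow> ereal_expectation M (\<lambda>\<omega>. \<Phi> (s k \<omega>)) \<le> ereal \<epsilon> * (\<Phi> s0 + ereal D0)) \<and>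
        (\<forall>c \<epsilon> k. 0 < c \<and> 1 / m \<le> c * \<delta>1 \<and> 0 < \<epsilon> \<and> \<epsilon> < 1 \<and>
           real k \<ge> bigO_const_given c *
             (((R + Rm / sqrt n + sqrt (1 - \<delta>) * Rb / \<delta> + sqrt (1 - \<delta>) * Rm / sqrt \<delta>)
                 * sqrt (m / (lam * \<gamma>)) + 1 / \<delta> + m) * ln (1 / \<epsilon>))
           \<longrightarrow> ereal_expectation M (\<lambda>\<omega>. \<Phi> (s k \<omega>)) \<le> ereal \<epsilon> * (\<Phi> s0 + ereal D0)))
     \<and>
     (R1 = R3 \<and> R3\<^sup>2 / (lam * \<gamma>) \<ge> 1 \<and>
      (\<forall>x. (\<integral>r. Q r x \<partial>S) = \<delta> *\<^sub>R x) \<and> (\<forall>x. (\<integral>r. Q1 r x \<partial>S1) = \<delta>1 *\<^sub>R x) \<longrightarrow>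
        (\<forall>\<epsilon> k. 0 < \<epsilon> \<and> \<epsilon> < 1 \<and>
           real k \<ge> bigO_const * ((1 / \<delta> + 1 / \<delta>1 + m + R3 * sqrt (m / (lam * \<gamma>))) * ln (1 / \<epsilon>))
           \<longrightarrow> ereal_expectation M (\<lambda>\<omega>. \<Psi> (s k \<omega>)) \<le> ereal \<epsilon> * (\<Psi> s0 + ereal D0)) \<and>
        (\<forall>c \<epsilon> k. 0 < c \<and> 1 / m \<le> c * \<delta>1 \<and> 0 < \<epsilon> \<and> \<epsilon> < 1 \<and>
           real k \<ge> bigO_const_given c *
             (((R + Rm / sqrt n + sqrt (1 - \<delta>) * R / \<delta> + sqrt (1 - \<delta>) * Rm / sqrt (\<delta> * n))
                 * sqrt (m / (lam * \<gamma>)) + 1 / \<delta> + m) * ln (1 / \<epsilon>))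
           \<longrightarrow> ereal_expectation M (\<lambda>\<omega>. \<Psi> (s k \<omega>)) \<le> ereal \<epsilon> * (\<Psi> s0 + ereal D0)))"
proof -
  have m0: "0 < m" and n0: "0 < n" using assms(1,2) by auto
  define T where "T = sqrt (m / (lam * \<gamma>))"
  have T: "0 \<le> T" using assms(3,4) by (simp add: T_def)
  \<comment> \<open>\<open>L_smooth\<close> provides a gradient for each function separately; one
    family \<open>G\<close> is chosen, constrained on the index range only.\<close>
  have "\<exists>G. i < m \<and> \<tau> < n \<longrightarrow> (\<forall>w. GDERIV (\<phi> i \<tau>) w :> G w) \<and> (1 / \<gamma>)-lipschitz_on UNIV G" for i \<tau>
    using assms(6)[of i \<tau>] unfolding L_smooth_def by blast
  then obtain G where G: "\<And>i \<tau>. i < m \<and> \<tau> < n \<longrightarrow> (\<forall>w. GDERIV (\<phi> i \<tau>) w :> G i \<tau> w) \<and> (1 / \<gamma>)-lipschitz_on UNIV (G i \<tau>)"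
    by metis
  interpret P: saddle_problem m n A \<phi> G g lam \<gamma> xs Ys
    using assms(1-8) G by unfold_locales auto
  have y0: "st_y s0 = y0" by (simp add: assms(25) ecspdc_init_def)
  \<comment> \<open>Conditional on finite conjugates at \<open>y0\<close>, without which the initial
    state is not consistent.\<close>
  have process: "ecspdc_process m n A \<phi> G g lam \<gamma> xs Ys \<sigma> \<eta> \<theta> S S1 Q Q1 \<delta> \<delta>1 M I \<xi> \<xi>1 s0"
    and balance: "1 / (2 * \<sigma>) = 2 * \<eta> * R1\<^sup>2"
    and theta: "0 < \<theta>" "\<theta> \<le> 1 - 1 / (m + 4 * R1 * T + 6 / \<delta> + 6 / \<delta>1)"
    if cond: "1 \<le> R1\<^sup>2 / (lam * \<gamma>)" and fin: "P.dual_finite y0"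
  proof -
    note st = stepsize_properties[OF assms(1,3,4,21,9-12) cond assms(22-24)]
    show "1 / (2 * \<sigma>) = 2 * \<eta> * R1\<^sup>2" "0 < \<theta>" "\<theta> \<le> 1 - 1 / (m + 4 * R1 * T + 6 / \<delta> + 6 / \<delta>1)"
      using st unfolding T_def by blast+
    interpret E: ecspdc_parameters m n A \<phi> G g lam \<gamma> xs Ys \<sigma> \<eta> \<theta>
      using st by unfold_locales auto
    have "E.consistent s0"
      using fin by (simp add: E.consistent_def assms(25) ecspdc_init_def)
    then show "ecspdc_process m n A \<phi> G g lam \<gamma> xs Ys \<sigma> \<eta> \<theta> S S1 Q Q1 \<delta> \<delta>1 M I \<xi> \<xi>1 s0"
      using st m0 n0 assms(9-15) by unfold_locales auto
  qed
  have power: "\<theta> ^ k \<le> \<epsilon>"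
    if "1 \<le> R1\<^sup>2 / (lam * \<gamma>)" "P.dual_finite y0" "0 < \<epsilon>"
      "(m + 4 * R1 * T + 6 / \<delta> + 6 / \<delta>1) * ln (1 / \<epsilon>) \<le> real k" for \<epsilon> k
  proof (rule rate_power_le)
    show "0 < real m + 4 * R1 * T + 6 / \<delta> + 6 / \<delta>1"
      using m0 T assms(9,11,21) by (intro add_pos_nonneg) auto
  qed (use theta[OF that(1,2)] that(3,4) in auto)
  have main_i: "ereal_expectation M (\<lambda>\<omega>. \<Phi> (s k \<omega>)) \<le> ereal \<epsilon> * (\<Phi> s0 + ereal D0)"
    if hyp: "R1 = R2" "R2\<^sup>2 / (lam * \<gamma>) \<ge> 1" and eps: "0 < \<epsilon>"
      and k: "(m + 4 * R1 * T + 6 / \<delta> + 6 / \<delta>1) * ln (1 / \<epsilon>) \<le> real k" for \<epsilon> k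
  proof (cases "P.dual_finite y0")
    case False
    \<comment> \<open>The factor \<open>\<epsilon>\<close> is positive, so the right side is
      \<open>\<infinity>\<close>.\<close>
    then show ?thesis using eps P.lyapunov_infinite(1)[of s0] by (simp add: y0 assms(27))
  next
    case True
    have cond: "1 \<le> R1\<^sup>2 / (lam * \<gamma>)" using hyp by simp
    interpret E: ecspdc_process m n A \<phi> G g lam \<gamma> xs Ys \<sigma> \<eta> \<theta> S S1 Q Q1 \<delta> \<delta>1 M I \<xi> \<xi>1 s0
      by (rule process[OF cond True])
    \<comment> \<open>At the start \<open>z = x\<close>, so \<open>xd\<close> vanishes and only the
      dual distance of \<open>cross\<close> is left.\<close>
    have D0: "E.cross s0 = D0"
      by (simp add: E.cross_def E.xd_def y0 assms(29), simp add: assms(25) ecspdc_init_def)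
    have sk: "s k = E.proc k" by (simp add: fun_eq_iff E.proc_def assms(26))
    have "R1 = R2_const m n A \<delta> \<delta>1" using hyp(1) assms(19) by simp
    from E.Phi2_decay[OF balance[OF cond True] this assms(21) D0 power[OF cond True eps k]]
    show ?thesis unfolding sk assms(27) .
  qed
  have main_ii: "ereal_expectation M (\<lambda>\<omega>. \<Psi> (s k \<omega>)) \<le> ereal \<epsilon> * (\<Psi> s0 + ereal D0)"
    if hyp: "R1 = R3" "R3\<^sup>2 / (lam * \<gamma>) \<ge> 1" and eps: "0 < \<epsilon>"
      and unb: "\<forall>x. (\<integral>r. Q r x \<partial>S) = \<delta> *\<^sub>R x" "\<forall>x. (\<integral>r. Q1 r x \<partial>S1) = \<delta>1 *\<^sub>R x"
      and k: "(m + 4 * R1 * T + 6 / \<delta> + 6 / \<delta>1) * ln (1 / \<epsilon>) \<le> real k" for \<epsilon> k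
  proof (cases "P.dual_finite y0")
    case False
    then show ?thesis using eps P.lyapunov_infinite(2)[of s0] by (simp add: y0 assms(28))
  next
    case True
    have cond: "1 \<le> R1\<^sup>2 / (lam * \<gamma>)" using hyp by simp
    interpret E: ecspdc_process m n A \<phi> G g lam \<gamma> xs Ys \<sigma> \<eta> \<theta> S S1 Q Q1 \<delta> \<delta>1 M I \<xi> \<xi>1 s0
      by (rule process[OF cond True])
    have D0: "E.cross s0 = D0"
      by (simp add: E.cross_def E.xd_def y0 assms(29), simp add: assms(25) ecspdc_init_def)
    have sk: "s k = E.proc k" by (simp add: fun_eq_iff E.proc_def assms(26))
    have "R1 = R3_const m n A \<delta> \<delta>1" using hyp(1) assms(20) by simp
    from E.Psi2_decay[OF balance[OF cond True] this assms(21) unb[rule_format] D0 power[OF cond True eps k]]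
    show ?thesis unfolding sk assms(28) .
  qed
  have rate: "(m + 4 * R1 * T + 6 / \<delta> + 6 / \<delta>1) * ln (1 / \<epsilon>) \<le> real k"
    if "0 < \<epsilon>" "\<epsilon> < 1" "real k \<ge> bigO_const * ((1 / \<delta> + 1 / \<delta>1 + m + R1 * T) * ln (1 / \<epsilon>))" for \<epsilon> k
  proof -
    have L: "0 \<le> ln (1 / \<epsilon>)" using that by simp
    \<comment> \<open>The largest coefficient to be covered by 100 is 6.\<close>
    have "M + 4 * x + 6 * a + 6 * b \<le> 100 * (a + b + M + x)"
      if "0 \<le> a" "0 \<le> b" "0 \<le> x" "0 \<le> M" for a b x M :: real
      using that by (simp add: algebra_simps)
    from this[of "1 / \<delta>" "1 / \<delta>1" "R1 * T" "real m"]
    have "m + 4 * R1 * T + 6 / \<delta> + 6 / \<delta>1 \<le> 100 * (1 / \<delta> + 1 / \<delta>1 + m + R1 * T)"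
      using assms(9,11,21) T by simp
    from order_trans[OF mult_right_mono[OF this L] that(3)[unfolded bigO_const_def mult.assoc[symmetric]]]
    show ?thesis .
  qed
  have rate': "(m + 4 * R1 * T + 6 / \<delta> + 6 / \<delta>1) * ln (1 / \<epsilon>) \<le> real k"
    if c: "0 < c" "1 / m \<le> c * \<delta>1" and eps: "0 < \<epsilon>" "\<epsilon> < 1" and Z: "R1 \<le> 24 * (1 + c) * Z"
      and k: "real k \<ge> bigO_const_given c * ((Z * T + 1 / \<delta> + m) * ln (1 / \<epsilon>))" for \<epsilon> k c Z
  proof -
    have L: "0 \<le> ln (1 / \<epsilon>)" using eps by simp
    have "0 \<le> Z" using Z assms(21) c by (smt (verit) mult_nonneg_nonpos)
    then have ZT: "0 \<le> Z * T" using T by simp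
    \<comment> \<open>\<open>y\<close> stands for \<open>R1 * T\<close> and contributes at most
      \<open>96 * (1 + c) * x\<close>; \<open>b\<close> stands for \<open>1 / \<delta>1\<close>,
      which is absorbed into \<open>c * M\<close>.\<close>
    have lin: "M + 4 * y + 6 * a + 6 * b \<le> 1000 * (1 + c) * (x + a + M)"
      if "0 \<le> a" "0 \<le> x" "0 \<le> M" "b \<le> c * M" "y \<le> 24 * (1 + c) * x" for a b x y M :: real
    proof -
      have "0 \<le> c * a" "0 \<le> c * x" "0 \<le> c * M" using that c by auto
      then show ?thesis using that by (simp add: algebra_simps)
    qed
    have "R1 * T \<le> 24 * (1 + c) * (Z * T)" using mult_right_mono[OF Z T] by (simp only: mult.assoc)
    moreover have "1 / \<delta>1 \<le> c * m" using c assms(11) m0 by (simp add: field_simps)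
    ultimately have "m + 4 * R1 * T + 6 / \<delta> + 6 / \<delta>1 \<le> 1000 * (1 + c) * (Z * T + 1 / \<delta> + m)"
      using lin[of "1 / \<delta>" "Z * T" "real m" "1 / \<delta>1" "R1 * T"] ZT assms(9) by simp
    from order_trans[OF mult_right_mono[OF this L] k[unfolded bigO_const_given_def mult.assoc[symmetric]]]
    show ?thesis .
  qed
  show ?thesis
  proof (intro conjI impI allI; elim conjE)
    fix \<epsilon> k assume "R1 = R2" "1 \<le> R2\<^sup>2 / (lam * \<gamma>)" "0 < \<epsilon>" "\<epsilon> < 1"
      "bigO_const * ((1 / \<delta> + 1 / \<delta>1 + m + R2 * sqrt (m / (lam * \<gamma>))) * ln (1 / \<epsilon>)) \<le> real k"
    then show "ereal_expectation M (\<lambda>\<omega>. \<Phi> (s k \<omega>)) \<le> ereal \<epsilon> * (\<Phi> s0 + ereal D0)"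
      by (intro main_i rate) (simp_all add: T_def)
  next
    fix c \<epsilon> k assume A: "R1 = R2" "1 \<le> R2\<^sup>2 / (lam * \<gamma>)" "0 < c" "1 / real m \<le> c * \<delta>1" "0 < \<epsilon>" "\<epsilon> < 1"
      "bigO_const_given c * (((R + Rm / sqrt n + sqrt (1 - \<delta>) * Rb / \<delta> + sqrt (1 - \<delta>) * Rm / sqrt \<delta>)
                 * sqrt (m / (lam * \<gamma>)) + 1 / \<delta> + m) * ln (1 / \<epsilon>)) \<le> real k"
    define Z where "Z = R + Rm / sqrt n + sqrt (1 - \<delta>) * Rb / \<delta> + sqrt (1 - \<delta>) * Rm / sqrt \<delta>"
    have "0 < R1" by fact
    have le: "R1 \<le> 8 * (1 + c) * Z"
      unfolding A(1) Z_def assms(16-19) by (rule R2_const_le[OF assms(1,2,9-12) A(3,4)])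
    then have "0 \<le> Z" using \<open>0 < R1\<close> A(3) by (smt (verit) mult_nonneg_nonpos)
    \<comment> \<open>Weakened to the constant of \<open>R3_const_le\<close>, so that
      \<open>rate'\<close> serves both cases.\<close>
    then have "8 * (1 + c) * Z \<le> 24 * (1 + c) * Z" using A(3) by (intro mult_right_mono) auto
    with le have "R1 \<le> 24 * (1 + c) * Z" by linarith
    from main_i[OF A(1,2,5) rate'[OF A(3-6) this]] A(7)
    show "ereal_expectation M (\<lambda>\<omega>. \<Phi> (s k \<omega>)) \<le> ereal \<epsilon> * (\<Phi> s0 + ereal D0)"
      by (simp add: Z_def T_def)
  next
    fix \<epsilon> k assume "R1 = R3" "1 \<le> R3\<^sup>2 / (lam * \<gamma>)" "0 < \<epsilon>" "\<epsilon> < 1"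
      "\<forall>x. (\<integral>r. Q r x \<partial>S) = \<delta> *\<^sub>R x" "\<forall>x. (\<integral>r. Q1 r x \<partial>S1) = \<delta>1 *\<^sub>R x"
      "bigO_const * ((1 / \<delta> + 1 / \<delta>1 + m + R3 * sqrt (m / (lam * \<gamma>))) * ln (1 / \<epsilon>)) \<le> real k"
    then show "ereal_expectation M (\<lambda>\<omega>. \<Psi> (s k \<omega>)) \<le> ereal \<epsilon> * (\<Psi> s0 + ereal D0)"
      by (intro main_ii rate) (simp_all add: T_def)
  next
    fix c \<epsilon> k assume A: "R1 = R3" "1 \<le> R3\<^sup>2 / (lam * \<gamma>)" "0 < c" "1 / real m \<le> c * \<delta>1" "0 < \<epsilon>" "\<epsilon> < 1"
      "\<forall>x. (\<integral>r. Q r x \<partial>S) = \<delta> *\<^sub>R x" "\<forall>x. (\<integral>r. Q1 r x \<partial>S1) = \<delta>1 *\<^sub>R x"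
      "bigO_const_given c * (((R + Rm / sqrt n + sqrt (1 - \<delta>) * R / \<delta> + sqrt (1 - \<delta>) * Rm / sqrt (\<delta> * n))
                 * sqrt (m / (lam * \<gamma>)) + 1 / \<delta> + m) * ln (1 / \<epsilon>)) \<le> real k"
    define Z where "Z = R + Rm / sqrt n + sqrt (1 - \<delta>) * R / \<delta> + sqrt (1 - \<delta>) * Rm / sqrt (\<delta> * n)"
    have le: "R1 \<le> 24 * (1 + c) * Z"
      unfolding A(1) Z_def assms(16,18,20) by (rule R3_const_le[OF assms(1,2,9-12) A(3,4)])
    from main_ii[OF A(1,2,5,7,8) rate'[OF A(3-6) le]] A(9)
    show "ereal_expectation M (\<lambda>\<omega>. \<Psi> (s k \<omega>)) \<le> ereal \<epsilon> * (\<Psi> s0 + ereal D0)"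
      by (simp add: Z_def T_def)
  qed
qed


end
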